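(* Let $H_1,\dots,H_q$ be hyperplanes in general position in $\mathbb{P}^n$ with $q>2n$, let $m_i\in\mathbb{Z}_{\ge1}\cup\{\infty\}$ and $\Delta=\sum_{i=1}^q(1-\frac1{m_i})H_i$, with $$\deg\Delta:=\sum_{i=1}^q\Big(1-\frac1{m_i}\Big)>q-\frac qn+1+\frac1n .$$ Then $(\mathbb{P}^n/\Delta)$ is hyperbolic and hyperbolically imbedded in $\mathbb{P}^n$.
   Context: General position: any $n+1$ of the defining linear forms are linearly independent. $\Delta_1$ is the union of the $H_i$ with $m_i=\infty$. With $D$ the unit disc, a holomorphic $h:D\to\mathbb{P}^n$ is an orbifold morphism to $(\mathbb{P}^n/\Delta)$ if $h(D)\not\subset\bigcup H_i$ and the multiplicity of $h^*H_i$ at each point over $H_i$ is $\ge m_i$ (with $h(D)\cap H_i=\emptyset$ if $m_i=\infty$). The orbifold Kobayashi pseudo-distance $d_{(\mathbb{P}^n/\Delta)}$ is the largest pseudo-distance on $\mathbb{P}^n\setminus\Delta_1$ such that $g^*d\le d_P$ for all orbifold morphisms $g:D\to(\mathbb{P}^n/\Delta)$, $d_P$ the Poincaré distance. Hyperbolic: $d_{(\mathbb{P}^n/\Delta)}$ is a distance. Hyperbolically imbedded in $\mathbb{P}^n$: whenever $p_k\to p$, $q_k\to q$ in $\mathbb{P}^n$ with $p_k,q_k\in\mathbb{P}^n\setminus\Delta_1$ and $d_{(\mathbb{P}^n/\Delta)}(p_k,q_k)\to0$, then $p=q$. *)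

theory Defs
  imports "HOL-Analysis.Analysis" "HOL-Library.Extended_Nat"
begin

text \<open>Points of P^n are represented by nonzero vectors of complex^'n, where
  CARD('n) = n+1. A hyperplane H_i is the zero set of the linear form
  v |-> sum_j L_i$j * v$j.\<close>

definition lform :: "complex ^ 'n \<Rightarrow> complex ^ 'n \<Rightarrow> complex" where
  "lform a v = (\<Sum>j\<in>UNIV. a $ j * v $ j)"

definition proj_eq :: "complex ^ 'n \<Rightarrow> complex ^ 'n \<Rightarrow> bool" where
  "proj_eq v w \<longleftrightarrow> v \<noteq> 0 \<and> w \<noteq> 0 \<and> (\<exists>c. c \<noteq> 0 \<and> w = c *s v)"

text \<open>Chordal (Fubini--Study) distance; it induces the standard topology of P^n.\<close>
definition chordal :: "complex ^ 'n \<Rightarrow> complex ^ 'n \<Rightarrow> real" where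
  "chordal v w = sqrt (1 - (cmod (\<Sum>j\<in>UNIV. v $ j * cnj (w $ j)))\<^sup>2 / ((norm v)\<^sup>2 * (norm w)\<^sup>2))"

definition general_position :: "(nat \<Rightarrow> complex ^ 'n) \<Rightarrow> nat \<Rightarrow> bool" where
  "general_position L q \<longleftrightarrow>
     (\<forall>\<sigma> :: 'n \<Rightarrow> nat. inj \<sigma> \<and> range \<sigma> \<subseteq> {..<q} \<longrightarrow> det (\<chi> j. L (\<sigma> j)) \<noteq> 0)"

abbreviation unit_disc :: "complex set" where "unit_disc \<equiv> ball 0 1"

definition poincare_dist :: "complex \<Rightarrow> complex \<Rightarrow> real" where
  "poincare_dist z w =
     (let r = cmod (z - w) / cmod (1 - cnj w * z) in ln ((1 + r) / (1 - r)))"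

definition orb_coeff :: "enat \<Rightarrow> real" where
  "orb_coeff m = (case m of enat k \<Rightarrow> 1 - 1 / real k | \<infinity> \<Rightarrow> 1)"

definition orb_space :: "(nat \<Rightarrow> complex ^ 'n) \<Rightarrow> (nat \<Rightarrow> enat) \<Rightarrow> nat \<Rightarrow> (complex ^ 'n) set" where
  "orb_space L m q = {v. v \<noteq> 0 \<and> (\<forall>i<q. m i = \<infinity> \<longrightarrow> lform (L i) v \<noteq> 0)}"

text \<open>A holomorphic map h : D -> P^n given by a reduced representation F
  (holomorphic, nowhere vanishing), which always exists on the disc.
  Orbifold morphism: h(D) not contained in the union of the H_i; the
  multiplicity of h^*H_i (order of vanishing of L_i o F) is >= m_i at every
  point mapped into H_i; and h(D) misses H_i if m_i = \<infinity>.\<close>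
definition orb_morphism ::
  "(nat \<Rightarrow> complex ^ 'n) \<Rightarrow> (nat \<Rightarrow> enat) \<Rightarrow> nat \<Rightarrow> (complex \<Rightarrow> complex ^ 'n) \<Rightarrow> bool" where
  "orb_morphism L m q F \<longleftrightarrow>
     (\<forall>j. (\<lambda>z. F z $ j) holomorphic_on unit_disc) \<and>
     (\<forall>z\<in>unit_disc. F z \<noteq> 0) \<and>
     (\<exists>z\<in>unit_disc. \<forall>i<q. lform (L i) (F z) \<noteq> 0) \<and>
     (\<forall>i<q. \<forall>z\<in>unit_disc. lform (L i) (F z) = 0 \<longrightarrow>
        (case m i of
           \<infinity> \<Rightarrow> False
         | enat k \<Rightarrow> (\<forall>l<k. (deriv ^^ l) (\<lambda>w. lform (L i) (F w)) z = 0)))"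

definition proj_pseudo_dist :: "(complex ^ 'n) set \<Rightarrow> (complex ^ 'n \<Rightarrow> complex ^ 'n \<Rightarrow> ereal) \<Rightarrow> bool" where
  "proj_pseudo_dist S d \<longleftrightarrow>
     (\<forall>x\<in>S. d x x = 0) \<and>
     (\<forall>x\<in>S. \<forall>y\<in>S. 0 \<le> d x y \<and> d x y = d y x) \<and>
     (\<forall>x\<in>S. \<forall>y\<in>S. \<forall>z\<in>S. d x z \<le> d x y + d y z) \<and>
     (\<forall>x\<in>S. \<forall>y\<in>S. \<forall>x'\<in>S. \<forall>y'\<in>S. proj_eq x x' \<and> proj_eq y y' \<longrightarrow> d x y = d x' y')"

text \<open>Orbifold Kobayashi pseudo-distance: the largest pseudo-distance d with
  g^*d <= d_P for all orbifold morphisms g (the pointwise supremum).\<close>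
definition orb_kobayashi ::
  "(nat \<Rightarrow> complex ^ 'n) \<Rightarrow> (nat \<Rightarrow> enat) \<Rightarrow> nat \<Rightarrow> complex ^ 'n \<Rightarrow> complex ^ 'n \<Rightarrow> ereal" where
  "orb_kobayashi L m q x y =
     Sup {d x y | d. proj_pseudo_dist (orb_space L m q) d \<and>
            (\<forall>F. orb_morphism L m q F \<longrightarrow>
               (\<forall>z\<in>unit_disc. \<forall>w\<in>unit_disc. d (F z) (F w) \<le> ereal (poincare_dist z w)))}"

definition orb_hyperbolic :: "(nat \<Rightarrow> complex ^ 'n) \<Rightarrow> (nat \<Rightarrow> enat) \<Rightarrow> nat \<Rightarrow> bool" where
  "orb_hyperbolic L m q \<longleftrightarrow>
     (\<forall>x\<in>orb_space L m q. \<forall>y\<in>orb_space L m q. orb_kobayashi L m q x y = 0 \<longrightarrow> proj_eq x y)"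

definition orb_hyperbolically_imbedded :: "(nat \<Rightarrow> complex ^ 'n) \<Rightarrow> (nat \<Rightarrow> enat) \<Rightarrow> nat \<Rightarrow> bool" where
  "orb_hyperbolically_imbedded L m q \<longleftrightarrow>
     (\<forall>(P :: nat \<Rightarrow> complex ^ 'n) Q p r.
        (\<forall>k. P k \<in> orb_space L m q \<and> Q k \<in> orb_space L m q) \<and> p \<noteq> 0 \<and> r \<noteq> 0 \<and>
        (\<lambda>k. chordal (P k) p) \<longlonglongrightarrow> 0 \<and> (\<lambda>k. chordal (Q k) r) \<longlonglongrightarrow> 0 \<and>
        (\<lambda>k. orb_kobayashi L m q (P k) (Q k)) \<longlonglongrightarrow> 0
        \<longrightarrow> proj_eq p r)"

end

theory Submission
  imports Defs "HOL-Complex_Analysis.Complex_Analysis" "HOL-Real_Asymp.Real_Asymp" "Jordan_Normal_Form.Determinant"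
begin

text \<open>By Brody's reparametrisation, if the Fubini--Study derivatives at \<open>0\<close> of the orbifold discs are
  unbounded, then rescaled orbifold discs of growing radius with derivative at most \<open>2\<close> converge to a
  nonconstant orbifold curve, possibly contained in some of the hyperplanes. Such curves have characteristic
  at most quadratic in the radius. Cartan's truncated second main theorem, in Nochka's form for the
  linear span of the curve, bounds a positive multiple of the characteristic by its logarithm, because
  a multiplicity \<open>m\<^sub>i\<close> cuts the truncated counting function of \<open>H\<^sub>i\<close> down to at most the fraction \<open>n / m\<^sub>i\<close> of the counting function;
  this is impossible on large discs. The resulting bound on the derivative compares the chordal
  distance with the orbifold Kobayashi pseudo-distance.\<close>

subsection \<open>Nochka weights\<close>

text \<open>Put N = n + 1. The degree hypothesis says that the sum of the 1/m_i is below (q - N)/(N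
  - 1), the condition suited to a curve spanning the whole space. A limit of discs may span only a
  linear subspace of dimension d = N - c, on which the restricted hyperplanes are no longer in
  general position. Nochka weights repair this, and their loss is covered by (N-1)(q-d-2c) -
  (d-1)(q-N) = c(q-2N+1), which is nonnegative because q > 2n. No entire curve is formed: all
  estimates are effective on finite discs. Logarithmic derivative lemmas usually have exceptional
  radii; here the representative is normalised to norm at most 1 on a larger disc, so the error is
  controlled by the characteristic at four times the radius, and quadratic growth permits using the
  estimate twice. This leaves a characteristic of order log log r, against the lower bound of about
  (log r)/2 forced by a nonzero derivative at the centre. Forms, weights and Wronskian depend on the
  span alone, so they can be fixed before the disc is enlarged.\<close>

locale rank_function =
  fixes E :: "'a set" and rk :: "'a set \<Rightarrow> nat"
  assumes finite_E: "finite E"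
    and rk_empty: "rk {} = 0"
    and rk_insert: "\<And>A x. A \<subseteq> E \<Longrightarrow> x \<in> E \<Longrightarrow> rk (insert x A) \<le> rk A + 1"
    and rk_mono: "\<And>A B. A \<subseteq> B \<Longrightarrow> B \<subseteq> E \<Longrightarrow> rk A \<le> rk B"
    and rk_submod: "\<And>A B. A \<subseteq> E \<Longrightarrow> B \<subseteq> E \<Longrightarrow> rk (A \<union> B) + rk (A \<inter> B) \<le> rk A + rk B"
begin

section \<open>Augmentation, bases and greedy bounds for a matroid rank\<close>

lemma rk_le_card: "A \<subseteq> E \<Longrightarrow> rk A \<le> card A"
proof -
  assume A: "A \<subseteq> E"
  then have "finite A" using finite_E finite_subset by blast
  then show ?thesis using A
  proof (induction A rule: finite_induct)
    case empty then show ?case by (simp add: rk_empty)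
  next
    case (insert x F)
    then show ?case using rk_insert[of F x] by auto
  qed
qed

text \<open>If no single element of \<open>A\<close> raises the rank of \<open>I\<close>,
  submodularity shows by induction that adjoining finitely many of them does not either, so
  \<open>rk A = rk I\<close>.\<close>

lemma rk_augment:
  assumes "I \<subseteq> A" "A \<subseteq> E" "rk I < rk A"
  obtains x where "x \<in> A" "x \<notin> I" "rk (insert x I) = rk I + 1"
proof -
  have "\<exists>x\<in>A. rk (insert x I) \<noteq> rk I"
  proof (rule ccontr)
    assume H: "\<not> ?thesis"
    have IE: "I \<subseteq> E" using assms by auto
    have "rk (I \<union> C) = rk I" if "finite C" "C \<subseteq> A" for C
      using that
    proof (induction C rule: finite_induct)
      case empty then show ?case by simp
    next
      case (insert x F)
      have 1: "rk (I \<union> F) = rk I" using insert by auto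
      have 2: "rk (insert x I) = rk I" using H insert by auto
      have "rk ((I \<union> F) \<union> insert x I) + rk ((I \<union> F) \<inter> insert x I) \<le> rk (I \<union> F) + rk (insert x I)"
        by (rule rk_submod) (use insert assms in auto)
      moreover have "rk I \<le> rk ((I \<union> F) \<inter> insert x I)"
        by (rule rk_mono) (use insert assms in auto)
      moreover have "rk I \<le> rk (I \<union> insert x F)"
        by (rule rk_mono) (use insert assms in auto)
      moreover have "(I \<union> F) \<union> insert x I = I \<union> insert x F" by auto
      ultimately show ?case using 1 2 by simp
    qed
    from this[of A] have "rk (I \<union> A) = rk I" using assms finite_E finite_subset by blast
    moreover have "I \<union> A = A" using assms by auto
    ultimately show False using assms by simp
  qed
  then obtain x where x: "x \<in> A" "rk (insert x I) \<noteq> rk I" by auto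
  have "x \<notin> I" using x by (auto simp: insert_absorb)
  moreover have "rk (insert x I) = rk I + 1"
  proof -
    have "rk I \<le> rk (insert x I)" by (rule rk_mono) (use x assms in auto)
    moreover have "rk (insert x I) \<le> rk I + 1" by (rule rk_insert) (use x assms in auto)
    ultimately show ?thesis using x by simp
  qed
  ultimately show ?thesis using that x by auto
qed

lemma extend_basis:
  assumes "I \<subseteq> A" "A \<subseteq> E" "rk I = card I"
  shows "\<exists>B. I \<subseteq> B \<and> B \<subseteq> A \<and> rk B = card B \<and> rk B = rk A"
  using assms
proof (induction "rk A - card I" arbitrary: I)
  case 0
  have "rk I \<le> rk A" by (rule rk_mono) (use 0 in auto)
  then show ?case using 0 by (intro exI[of _ I]) auto
next
  case (Suc n)
  have lt: "rk I < rk A" using Suc by simp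
  obtain x where x: "x \<in> A" "x \<notin> I" "rk (insert x I) = rk I + 1"
    using rk_augment[OF Suc(3,4) lt] by blast
  have "finite I" using Suc finite_E by (meson finite_subset)
  then have c: "card (insert x I) = card I + 1" using x by simp
  have "\<exists>B. insert x I \<subseteq> B \<and> B \<subseteq> A \<and> rk B = card B \<and> rk B = rk A"
    by (rule Suc(1)) (use Suc x c in auto)
  then show ?case by auto
qed

text \<open>Edmonds' greedy argument: under the rank constraints of the matroid polytope a linear
  functional with nonnegative coefficients is at most its largest value on a basis. Subtracting the
  minimum \<open>t\<close> of \<open>a\<close> removes at least one element; the basis found on the
  rest extends to \<open>A\<close>, and the constant \<open>t\<close> contributes
  \<open>t * sum w A\<close> against \<open>t * rk A\<close>. This is how the weights enter both the
  orders of zeros and the pointwise estimate on circles.\<close>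

lemma greedy_basis:
  fixes a w :: "'a \<Rightarrow> real"
  assumes A: "A \<subseteq> E" and pos: "\<And>x. x \<in> A \<Longrightarrow> a x \<ge> 0"
    and w: "\<And>R. R \<subseteq> A \<Longrightarrow> sum w R \<le> real (rk R)"
  shows "\<exists>B. B \<subseteq> A \<and> rk B = card B \<and> rk B = rk A \<and> (\<Sum>x\<in>A. w x * a x) \<le> sum a B"
proof -
  have "finite A" using A finite_E finite_subset by blast
  then show ?thesis using assms
  proof (induction "card A" arbitrary: A a rule: less_induct)
    case less
    show ?case
    proof (cases "A = {}")
      case True
      then show ?thesis by (intro exI[of _ "{}"]) (auto simp: rk_empty)
    next
      case False
      define t where "t = Min (a ` A)"
      have tin: "t \<in> a ` A" unfolding t_def by (rule Min_in) (use False less in auto)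
      then obtain y where y: "y \<in> A" "a y = t" by auto
      have tle: "t \<le> a x" if "x \<in> A" for x unfolding t_def using that less by auto
      have t0: "0 \<le> t" using y less by auto
      define A' where "A' = {x\<in>A. a x > t}"
      have A'A: "A' \<subseteq> A" "A' \<noteq> A" using y unfolding A'_def by auto
      have "card A' < card A" using A'A less by (meson psubset_card_mono psubsetI)
      then have "\<exists>B. B \<subseteq> A' \<and> rk B = card B \<and> rk B = rk A' \<and> (\<Sum>x\<in>A'. w x * (a x - t)) \<le> sum (\<lambda>x. a x - t) B"
      proof (rule less(1))
        show "sum w R \<le> real (rk R)" if "R \<subseteq> A'" for R
          using less.prems(4)[of R] that A'A by auto
      qed (use less A'A in \<open>auto simp: A'_def\<close>)
      then obtain B' where B': "B' \<subseteq> A'" "rk B' = card B'" "(\<Sum>x\<in>A'. w x * (a x - t)) \<le> sum (\<lambda>x. a x - t) B'" by blast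
      obtain B where B: "B' \<subseteq> B" "B \<subseteq> A" "rk B = card B" "rk B = rk A"
        using extend_basis[of B' A] B' A'A less by blast
      have fB: "finite B" using finite_subset[OF B(2) less.prems(1)] .
      have e1: "(\<Sum>x\<in>A'. w x * (a x - t)) = (\<Sum>x\<in>A. w x * (a x - t))"
      proof (rule sum.mono_neutral_left)
        show "\<forall>i\<in>A - A'. w i * (a i - t) = 0" unfolding A'_def using tle by force
      qed (use A'A less in auto)
      have e2: "sum (\<lambda>x. a x - t) B' \<le> sum (\<lambda>x. a x - t) B"
        by (rule sum_mono2) (use B fB tle in auto)
      have "(\<Sum>x\<in>A. w x * a x) = (\<Sum>x\<in>A. w x * (a x - t)) + t * sum w A"
        by (simp add: algebra_simps sum_subtractf sum_distrib_left)
      also have "\<dots> \<le> sum (\<lambda>x. a x - t) B + t * real (rk A)"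
        using e1 e2 B' mult_left_mono[OF less(5)[of A] t0] by auto
      also have "\<dots> = sum a B" using B by (simp add: sum_subtractf)
      finally show ?thesis using B by blast
    qed
  qed
qed

text \<open>The marginal increments along an enumeration of \<open>S\<close> form an extreme point
  of the core of a convex game. Supermodularity says that the increment of an element only grows
  with the set it is added to, which gives \<open>h T \<le> sum x T\<close> by induction on
  \<open>S\<close>.\<close>

lemma extremal_prefix_weight:
  fixes h :: "'a set \<Rightarrow> real"
  assumes fin: "finite S" and h0: "h {} = 0"
    and super: "\<And>A B. A \<subseteq> S \<Longrightarrow> B \<subseteq> S \<Longrightarrow> h A + h B \<le> h (A \<union> B) + h (A \<inter> B)"
    and inc: "\<And>A x. A \<subseteq> S \<Longrightarrow> x \<in> S \<Longrightarrow> h A \<le> h (insert x A) \<and> h (insert x A) \<le> h A + t"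
  shows "\<exists>x. (\<forall>e\<in>S. 0 \<le> x e \<and> x e \<le> t) \<and> sum x S = h S \<and> (\<forall>T\<subseteq>S. h T \<le> sum x T)"
  using assms
proof (induction S rule: finite_induct)
  case empty
  then show ?case by auto
next
  case (insert e S)
  have "\<exists>x. (\<forall>e\<in>S. 0 \<le> x e \<and> x e \<le> t) \<and> sum x S = h S \<and> (\<forall>T\<subseteq>S. h T \<le> sum x T)"
  proof (rule insert(3))
    show "h A + h B \<le> h (A \<union> B) + h (A \<inter> B)" if "A \<subseteq> S" "B \<subseteq> S" for A B
      by (rule insert.prems(2)) (use that in auto)
    show "h A \<le> h (insert x A) \<and> h (insert x A) \<le> h A + t" if "A \<subseteq> S" "x \<in> S" for A x
      by (rule insert.prems(3)) (use that in auto)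
  qed (fact insert.prems(1))
  then obtain x where x: "\<And>e. e\<in>S \<Longrightarrow> 0 \<le> x e \<and> x e \<le> t" "sum x S = h S" "\<And>T. T\<subseteq>S \<Longrightarrow> h T \<le> sum x T" by blast
  define y where "y = x(e := h (insert e S) - h S)"
  have s: "sum y T = sum x T" if "T \<subseteq> S" for T
    unfolding y_def using that insert by (intro sum.cong) auto
  show ?case
  proof (intro exI[of _ y] conjI ballI allI impI)
    fix z assume "z \<in> insert e S"
    then show "0 \<le> y z" "y z \<le> t" using x insert.prems(3)[of S e, OF subset_insertI insertI1] by (auto simp: y_def)
  next
    have "sum y (insert e S) = y e + sum x S" using s[of S] insert by simp
    then show "sum y (insert e S) = h (insert e S)" using x by (simp add: y_def)
  next
    fix T assume T: "T \<subseteq> insert e S"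
    show "h T \<le> sum y T"
    proof (cases "e \<in> T")
      case False
      then have "T \<subseteq> S" using T by auto
      then show ?thesis using s x by simp
    next
      case True
      define T' where "T' = T - {e}"
      have T': "T' \<subseteq> S" "T = insert e T'" "e \<notin> T'" using T True unfolding T'_def by auto
      have "finite T'" by (rule finite_subset[OF T'(1) insert.hyps(1)])
      then have "sum y T = y e + sum x T'" using T' s[of T'] by simp
      moreover have "h T + h S \<le> h (T \<union> S) + h (T \<inter> S)" by (rule insert.prems(2)) (use T in auto)
      moreover have "T \<union> S = insert e S" "T \<inter> S = T'" using T' insert.hyps(2) by auto
      ultimately show ?thesis using x(3)[OF T'(1)] by (simp add: y_def)
    qed
  qed
qed

text \<open>The weights are \<open>\<theta> - x\<close>, where \<open>x\<close> is an element of the core of the supermodular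
  function \<open>R \<mapsto> \<theta> |R| - rk R\<close> on the set \<open>S\<close> at which \<open>\<theta>\<close> is attained.\<close>

theorem nochka_weights:
  fixes c :: nat
  defines "d \<equiv> rk E"
  assumes d: "d \<ge> 1"
    and card: "\<And>R. R \<subseteq> E \<Longrightarrow> rk R < d \<Longrightarrow> card R \<le> rk R + c"
  shows "\<exists>w \<theta>. \<theta> > (0::real) \<and> (\<forall>e\<in>E. 0 \<le> w e \<and> w e \<le> \<theta>) \<and>
     sum w E = \<theta> * (real (card E) - real d - 2 * real c) + real d \<and>
     (\<forall>R\<subseteq>E. rk R < d \<longrightarrow> sum w R \<le> real (rk R))"
proof -
  define F where "F = {R. R \<subseteq> E \<and> rk R < d}"
  have finF: "finite F" unfolding F_def using finite_E by simp
  have emF: "{} \<in> F" using d by (auto simp: F_def rk_empty)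
  \<comment> \<open>In Nochka's diagram a set \<open>R\<close> is the point (\<open>card R\<close>,
    \<open>rk R\<close>), and \<open>sl R\<close> is the slope from it to (\<open>D\<close>,
    \<open>d\<close>). For a span of projective dimension k in P^n one has d = k + 1 and c = n - k,
    so \<open>D\<close> is the classical 2n - k + 1. The cardinality hypothesis keeps all points of
    \<open>F\<close> strictly to the left.\<close>
  define D where "D = real d + 2 * real c"
  have den: "D - real (card R) \<ge> real d + real c - real (rk R)" "D - real (card R) > 0" if "R \<in> F" for R
    using card[of R] that unfolding F_def D_def by auto
  define sl where "sl R = (real d - real (rk R)) / (D - real (card R))" for R
  define \<theta> where "\<theta> = Max (sl ` F)"
  have "\<theta> \<in> sl ` F" unfolding \<theta>_def by (rule Max_in) (use finF emF in auto)
  then obtain S where S: "S \<in> F" "\<theta> = sl S" by auto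
  have SE: "S \<subseteq> E" and rS: "rk S < d" using S by (auto simp: F_def)
  have finS: "finite S" using SE finite_E finite_subset by blast
  have sl_le: "sl R \<le> \<theta>" if "R \<in> F" for R unfolding \<theta>_def using that finF by auto
  have th0: "\<theta> > 0" using S den[of S] rS unfolding sl_def by auto
  have thS: "\<theta> * (D - real (card S)) = real d - real (rk S)" using S den[of S] by (simp add: sl_def)
  have thR: "real d - real (rk R) \<le> \<theta> * (D - real (card R))" if "R \<in> F" for R
    using sl_le[OF that] den[OF that] by (simp add: sl_def divide_simps)
  \<comment> \<open>The wanted bound \<open>sum w R \<le> rk R\<close> will amount to
    \<open>g R \<le> sum x (R \<inter> S)\<close>. Maximality of the slope at \<open>S\<close> makes
    \<open>S\<close> a maximiser of \<open>g\<close> on \<open>F\<close>.\<close>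
  define g where "g R = \<theta> * real (card R) - real (rk R)" for R :: "'a set"
  have gS: "g S = \<theta> * D - real d" using thS by (simp add: g_def algebra_simps)
  have gle: "g R \<le> g S" if "R \<in> F" for R
    using thR[OF that] gS by (simp add: g_def algebra_simps)
  have subF: "R \<in> F" if "R \<subseteq> R'" "R' \<in> F" for R R'
    using that rk_mono[of R R'] by (auto simp: F_def)
  have gsuper: "g A + g B \<le> g (A \<union> B) + g (A \<inter> B)" if "A \<subseteq> E" "B \<subseteq> E" for A B
  proof -
    have "finite A" "finite B" using that finite_E finite_subset by blast+
    then have "real (card A) + real (card B) = real (card (A \<union> B)) + real (card (A \<inter> B))"
      using card_Un_Int[of A B] by linarith
    then have "\<theta> * real (card A) + \<theta> * real (card B) = \<theta> * real (card (A \<union> B)) + \<theta> * real (card (A \<inter> B))"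
      by (metis distrib_left)
    then show ?thesis using rk_submod[OF that] unfolding g_def by linarith
  qed
  \<comment> \<open>\<open>g\<close> is supermodular but may drop when an element is added. Its
    monotone hull \<open>h\<close> is still supermodular, has increments between 0 and \<theta>, and
    agrees with \<open>g\<close> at the maximiser \<open>S\<close>.\<close>
  define h where "h T = Max (g ` Pow T)" for T :: "'a set"
  have hge: "g U \<le> h T" if "finite T" "U \<subseteq> T" for U T
    unfolding h_def by (rule Max_ge) (use that in auto)
  have hex: "\<exists>U\<subseteq>T. h T = g U" if "finite T" for T
  proof -
    have "h T \<in> g ` Pow T" unfolding h_def by (rule Max_in) (use that in auto)
    then show ?thesis by auto
  qed
  have hS: "h S = g S"
  proof (rule antisym)
    obtain U where "U \<subseteq> S" "h S = g U" using hex[OF finS] by blast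
    then show "h S \<le> g S" using gle[OF subF[of U S]] S by simp
    show "g S \<le> h S" by (rule hge) (use finS in auto)
  qed
  have "\<exists>x. (\<forall>e\<in>S. 0 \<le> x e \<and> x e \<le> \<theta>) \<and> sum x S = h S \<and> (\<forall>T\<subseteq>S. h T \<le> sum x T)"
  proof (rule extremal_prefix_weight[OF finS])
    show "h {} = 0" by (simp add: h_def g_def rk_empty)
  next
    fix A B assume AB: "A \<subseteq> S" "B \<subseteq> S"
    then have fAB: "finite A" "finite B" using finS finite_subset by blast+
    obtain U where U: "U \<subseteq> A" "h A = g U" using hex[OF fAB(1)] by blast
    obtain V where V: "V \<subseteq> B" "h B = g V" using hex[OF fAB(2)] by blast
    have "g U + g V \<le> g (U \<union> V) + g (U \<inter> V)" by (rule gsuper) (use U V AB SE in auto)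
    also have "\<dots> \<le> h (A \<union> B) + h (A \<inter> B)"
      by (intro add_mono hge) (use U V fAB in auto)
    finally show "h A + h B \<le> h (A \<union> B) + h (A \<inter> B)" using U V by simp
  next
    fix A x assume A: "A \<subseteq> S" "x \<in> S"
    then have fA: "finite A" using finS finite_subset by blast
    obtain U where U: "U \<subseteq> A" "h A = g U" using hex[OF fA] by blast
    have 1: "h A \<le> h (insert x A)" using U hge[of "insert x A" U] fA by auto
    obtain V where V: "V \<subseteq> insert x A" "h (insert x A) = g V" using hex[of "insert x A"] fA by blast
    have fV: "finite V" using finite_subset[OF V(1)] fA by simp
    have "g V \<le> h A + \<theta>"
    proof (cases "x \<in> V")
      case False
      then have "V \<subseteq> A" using V by auto
      then show ?thesis using hge[OF fA, of V] th0 by linarith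
    next
      case True
      have c: "card V = card (V - {x}) + 1" using card.remove[OF fV True] by linarith
      have "rk (V - {x}) \<le> rk V" by (rule rk_mono) (use V A SE in auto)
      then have "g V \<le> g (V - {x}) + \<theta>" unfolding g_def c of_nat_add distrib_left by linarith
      also have "g (V - {x}) \<le> h A" by (rule hge) (use V fA in auto)
      finally show ?thesis by simp
    qed
    then show "h A \<le> h (insert x A) \<and> h (insert x A) \<le> h A + \<theta>" using 1 V by simp
  qed
  then obtain x where x: "\<And>e. e\<in>S \<Longrightarrow> 0 \<le> x e \<and> x e \<le> \<theta>" "sum x S = g S" "\<And>T. T\<subseteq>S \<Longrightarrow> g T \<le> sum x T"
  proof -
    assume *: thesis if "\<And>e. e\<in>S \<Longrightarrow> 0 \<le> x e \<and> x e \<le> \<theta>" "sum x S = g S" "\<And>T. T\<subseteq>S \<Longrightarrow> g T \<le> sum x T" for x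
    assume "\<exists>x. (\<forall>e\<in>S. 0 \<le> x e \<and> x e \<le> \<theta>) \<and> sum x S = h S \<and> (\<forall>T\<subseteq>S. h T \<le> sum x T)"
    then obtain x where x: "\<forall>e\<in>S. 0 \<le> x e \<and> x e \<le> \<theta>" "sum x S = h S" "\<forall>T\<subseteq>S. h T \<le> sum x T" by blast
    show thesis
    proof (rule *[of x])
      fix T assume T: "T \<subseteq> S"
      have "g T \<le> h T" by (rule hge) (use T finS finite_subset in auto)
      then show "g T \<le> sum x T" using x T by force
    qed (use x hS in auto)
  qed
  define w where "w e = (if e \<in> S then \<theta> - x e else \<theta>)" for e
  have sw: "sum w R = \<theta> * real (card R) - sum x (R \<inter> S)" if "R \<subseteq> E" for R
  proof -
    have fR: "finite R" using that finite_E finite_subset by blast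
    have "sum w R = (\<Sum>e\<in>R. \<theta> - (if e \<in> S then x e else 0))"
      by (rule sum.cong) (auto simp: w_def)
    also have "\<dots> = \<theta> * real (card R) - (\<Sum>e\<in>R. if e \<in> S then x e else 0)" by (simp add: sum_subtractf)
    also have "(\<Sum>e\<in>R. if e \<in> S then x e else 0) = sum x (R \<inter> S)" using fR by (simp add: sum.inter_restrict)
    finally show ?thesis .
  qed
  have key: "g R \<le> sum x (R \<inter> S)" if R: "R \<in> F" for R
  proof -
    have RE: "R \<subseteq> E" and rR: "rk R < d" using R by (auto simp: F_def)
    have fR: "finite R" using RE finite_E finite_subset by blast
    have xg: "g (R \<inter> S) \<le> sum x (R \<inter> S)" by (rule x) auto
    show ?thesis
    proof (cases "R \<union> S \<in> F")
      case True
      have "g R + g S \<le> g (R \<union> S) + g (R \<inter> S)" by (rule gsuper) (use RE SE in auto)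
      then show ?thesis using gle[OF True] xg by linarith
    next
      \<comment> \<open>Now \<open>R \<union> S\<close> has rank at least \<open>d\<close>, so
        passing from \<open>R \<inter> S\<close> to \<open>R\<close> raises the rank by some
        \<open>u \<ge> d - rk S\<close>. The slope equation at \<open>S\<close> gives
        \<open>\<theta> \<le> 1\<close> and \<open>\<theta> * c \<le> (1 - \<theta>) * u\<close>;
        with \<open>card R \<le> rk R + c\<close> the gain in \<open>\<theta> * card\<close> is then
        at most the gain in rank.\<close>
      case False
      then have "rk (R \<union> S) \<ge> d" using RE SE by (auto simp: F_def)
      then have sub: "d + rk (R \<inter> S) \<le> rk R + rk S" using rk_submod[OF RE SE] by linarith
      have cR: "card R \<le> rk R + c" using card RE rR by auto
      have cS: "card S \<le> rk S + c" using card SE rS by auto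
      have cI: "rk (R \<inter> S) \<le> card (R \<inter> S)" by (rule rk_le_card) (use RE in auto)
      have t1: "\<theta> * (real d + real c - real (rk S)) \<le> real d - real (rk S)"
        using thS mult_left_mono[OF den(1)[OF S(1)], of \<theta>] th0 by linarith
      have th1: "\<theta> \<le> 1"
      proof -
        have "\<theta> * (real d - real (rk S)) \<le> \<theta> * (real d + real c - real (rk S))"
          using th0 by (intro mult_left_mono) auto
        then have "\<theta> * (real d - real (rk S)) \<le> real d - real (rk S)" by (rule order_trans[OF _ t1])
        then show ?thesis using rS by (simp add: mult_le_cancel_right1)
      qed
      define u where "u = real (rk R) - real (rk (R \<inter> S))"
      have u: "u \<ge> real d - real (rk S)" using sub unfolding u_def by linarith
      have "(1 - \<theta>) * (real d - real (rk S)) \<le> (1 - \<theta>) * u"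
        using u th1 by (intro mult_left_mono) auto
      then have A: "\<theta> * real c \<le> (1 - \<theta>) * u" using t1 by (simp add: algebra_simps)
      have "\<theta> * (real (card R) - real (card (R \<inter> S))) \<le> \<theta> * (u + real c)"
        using th0 cR cI by (intro mult_left_mono) (auto simp: u_def)
      also have "\<dots> \<le> u" using A by (simp add: algebra_simps)
      finally have "g R \<le> g (R \<inter> S)" unfolding g_def u_def by (simp add: algebra_simps)
      then show ?thesis using xg by linarith
    qed
  qed
  show ?thesis
  proof (intro exI[of _ w] exI[of _ \<theta>] conjI ballI allI impI)
    show "\<theta> > 0" by fact
    show "0 \<le> w e" "w e \<le> \<theta>" if "e \<in> E" for e using x th0 by (auto simp: w_def)
    show "sum w E = \<theta> * (real (card E) - real d - 2 * real c) + real d"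
    proof -
      have "E \<inter> S = S" using SE by auto
      then show ?thesis using sw[of E] x(2) gS by (simp add: D_def algebra_simps)
    qed
    show "sum w R \<le> real (rk R)" if "R \<subseteq> E" "rk R < d" for R
      using sw[OF that(1)] key[of R] that by (auto simp: F_def g_def)
  qed
qed

end

subsection \<open>Circular means\<close>

definition cmean :: "complex \<Rightarrow> real \<Rightarrow> (complex \<Rightarrow> real) \<Rightarrow> real" where
  "cmean z r \<phi> = integral {0..1} (\<lambda>t. \<phi> (circlepath z r t))"

lemma circlepath_in_sphere: "0 \<le> r \<Longrightarrow> circlepath z r t \<in> sphere z r"
  by (simp add: circlepath dist_norm norm_mult)

lemma continuous_circlepath: "continuous_on A (circlepath z r)"
  unfolding circlepath by (intro continuous_intros)

lemma circle_integrable: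
  fixes \<phi> :: "complex \<Rightarrow> real"
  assumes "continuous_on (sphere z r) \<phi>" "0 \<le> r"
  shows "(\<lambda>t. \<phi> (circlepath z r t)) integrable_on {0..1}"
proof (rule integrable_continuous_interval)
  show "continuous_on {0..1} (\<lambda>t. \<phi> (circlepath z r t))"
    by (rule continuous_on_compose2[OF assms(1) continuous_circlepath])
       (use circlepath_in_sphere assms in blast)
qed

lemma cmean_const [simp]: "cmean z r (\<lambda>_. c) = c"
  by (simp add: cmean_def)

lemma cmean_cong:
  assumes "\<And>w. w \<in> sphere z r \<Longrightarrow> \<phi> w = \<psi> w" "0 \<le> r"
  shows "cmean z r \<phi> = cmean z r \<psi>"
  unfolding cmean_def using assms circlepath_in_sphere by (intro integral_cong) metis

lemma cmean_mono:
  assumes "continuous_on (sphere z r) \<phi>" "continuous_on (sphere z r) \<psi>" "0 \<le> r"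
    "\<And>w. w \<in> sphere z r \<Longrightarrow> \<phi> w \<le> \<psi> w"
  shows "cmean z r \<phi> \<le> cmean z r \<psi>"
  unfolding cmean_def using assms circlepath_in_sphere
  by (intro integral_le circle_integrable) auto

lemma cmean_add:
  assumes "continuous_on (sphere z r) \<phi>" "continuous_on (sphere z r) \<psi>" "0 \<le> r"
  shows "cmean z r (\<lambda>w. \<phi> w + \<psi> w) = cmean z r \<phi> + cmean z r \<psi>"
  unfolding cmean_def by (intro integral_add circle_integrable assms)

lemma cmean_diff:
  assumes "continuous_on (sphere z r) \<phi>" "continuous_on (sphere z r) \<psi>" "0 \<le> r"
  shows "cmean z r (\<lambda>w. \<phi> w - \<psi> w) = cmean z r \<phi> - cmean z r \<psi>"
  unfolding cmean_def by (intro integral_diff circle_integrable assms)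

lemma cmean_cmult: "cmean z r (\<lambda>w. c * \<phi> w) = c * cmean z r \<phi>"
  unfolding cmean_def by simp

lemma cmean_uminus: "cmean z r (\<lambda>w. - \<phi> w) = - cmean z r \<phi>"
  unfolding cmean_def by simp

lemma cmean_sum:
  assumes "finite I" "\<And>i. i \<in> I \<Longrightarrow> continuous_on (sphere z r) (\<phi> i)" "0 \<le> r"
  shows "cmean z r (\<lambda>w. \<Sum>i\<in>I. \<phi> i w) = (\<Sum>i\<in>I. cmean z r (\<phi> i))"
  unfolding cmean_def using assms by (intro integral_sum circle_integrable) auto

lemma cmean_Re_holomorphic:
  assumes "continuous_on (cball z r) f" "f holomorphic_on ball z r" "0 < r"
  shows "cmean z r (\<lambda>w. Re (f w)) = Re (f z)"
proof -
  have "((\<lambda>u. f u / (u - z)) has_contour_integral (2 * of_real pi * \<i> * f z)) (circlepath z r)"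
    by (rule Cauchy_integral_circlepath) (use assms in auto)
  then have "((\<lambda>t. f (circlepath z r t) / (circlepath z r t - z) *
      vector_derivative (circlepath z r) (at t within {0..1})) has_integral (2 * of_real pi * \<i> * f z)) {0..1}"
    by (simp add: has_contour_integral_def)
  then have "((\<lambda>t. (2 * of_real pi * \<i>) * f (circlepath z r t)) has_integral (2 * of_real pi * \<i> * f z)) {0..1}"
  proof (rule has_integral_eq[rotated])
    fix t :: real assume t: "t \<in> {0..1}"
    have "circlepath z r t - z = r * exp (2 * of_real pi * \<i> * of_real t)" by (simp add: circlepath)
    then show "f (circlepath z r t) / (circlepath z r t - z) *
      vector_derivative (circlepath z r) (at t within {0..1}) = (2 * of_real pi * \<i>) * f (circlepath z r t)"
      using t assms(3) by (simp add: vector_derivative_circlepath01 field_simps)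
  qed
  then have "((\<lambda>t. f (circlepath z r t)) has_integral f z) {0..1}"
    using has_integral_mult_right[of _ "2 * of_real pi * \<i> * f z" _ "inverse (2 * of_real pi * \<i>)"]
    by (force simp: field_simps)
  then have "((\<lambda>t. Re (f (circlepath z r t))) has_integral Re (f z)) {0..1}"
    by (rule has_integral_Re)
  then show ?thesis unfolding cmean_def by (rule integral_unique)
qed

lemma cmean_ln_nonzero:
  assumes "h holomorphic_on S" "cball z r \<subseteq> S" "0 < r" "\<And>w. w \<in> cball z r \<Longrightarrow> h w \<noteq> 0"
  shows "cmean z r (\<lambda>w. ln (norm (h w))) = ln (norm (h z))"
proof -
  have "h holomorphic_on cball z r" using assms by (meson holomorphic_on_subset)
  then obtain g where g: "g holomorphic_on cball z r" "\<And>w. w \<in> cball z r \<Longrightarrow> h w = exp (g w)"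
    using contractible_imp_holomorphic_log[of h "cball z r"] assms convex_imp_contractible[OF convex_cball] by blast
  have e: "ln (norm (h w)) = Re (g w)" if "w \<in> cball z r" for w
    using g(2)[OF that] by simp
  have "cmean z r (\<lambda>w. ln (norm (h w))) = cmean z r (\<lambda>w. Re (g w))"
    by (rule cmean_cong) (use e assms(3) in auto)
  also have "\<dots> = Re (g z)"
    by (rule cmean_Re_holomorphic)
       (use g assms in \<open>auto intro: holomorphic_on_imp_continuous_on holomorphic_on_subset\<close>)
  also have "\<dots> = ln (norm (h z))" using e[of z] assms(3) by auto
  finally show ?thesis .
qed

text \<open>On the circle \<open>z * cnj z = r\<^sup>2\<close>, so |z - a| equals |r - cnj a * z /
  r|, the modulus of a function without zeros in the closed disc, for which the mean value property
  holds.\<close>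

lemma cmean_ln_linear:
  assumes "norm a < r"
  shows "cmean 0 r (\<lambda>z. ln (norm (z - a))) = ln r"
proof -
  have r: "r > 0" using assms norm_ge_zero by (metis le_less_trans)
  define h where "h z = of_real r - cnj a * z / of_real r" for z
  have "norm (z - a) = norm (h z)" if "z \<in> sphere 0 r" for z
  proof -
    have nz: "norm z = r" using that by simp
    then have zz: "z * cnj z = of_real (r\<^sup>2)" using complex_norm_square[of z] by simp
    have "cnj z * (z - a) * of_real r = cnj (z) * (z*r - a*r)" by (simp add: algebra_simps)
    have "of_real r * h z = of_real (r\<^sup>2) - cnj a * z"
      using r by (simp add: h_def field_simps power2_eq_square)
    also have "\<dots> = z * cnj (z - a)" using zz by (simp add: algebra_simps)
    finally have "norm (of_real r * h z) = norm (z * cnj (z - a))" by simp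
    then show ?thesis using r nz by (simp only: norm_mult complex_mod_cnj) simp
  qed
  then have "cmean 0 r (\<lambda>z. ln (norm (z - a))) = cmean 0 r (\<lambda>z. ln (norm (h z)))"
    by (intro cmean_cong) (use r in auto)
  also have "\<dots> = ln (norm (h 0))"
  proof (rule cmean_ln_nonzero[of h UNIV])
    fix w :: complex assume "w \<in> cball 0 r"
    then have "norm (cnj a * w / of_real r) \<le> norm a"
      using r by (simp add: norm_mult norm_divide divide_simps mult_left_mono)
    then have "norm (cnj a * w / of_real r) < norm (of_real r :: complex)" using assms r by simp
    then show "h w \<noteq> 0" unfolding h_def by auto
  next
    show "h holomorphic_on UNIV" unfolding h_def by (intro holomorphic_intros) (use r in auto)
  qed (use r in auto)
  finally show ?thesis using r by (simp add: h_def)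
qed

lemma continuous_on_ln_norm:
  fixes g :: "'a::topological_space \<Rightarrow> 'b::real_normed_vector"
  assumes "continuous_on S g" "\<And>w. w \<in> S \<Longrightarrow> g w \<noteq> 0"
  shows "continuous_on S (\<lambda>w. ln (norm (g w)))"
  using assms by (intro continuous_intros) auto

section \<open>Zeros of holomorphic functions and Jensen's formula\<close>

lemma ball_holomorphic_not_constant:
  assumes "g z1 = (0::complex)" "g z2 \<noteq> 0" "z1 \<in> S" "z2 \<in> S"
  shows "\<not> g constant_on S"
  using assms unfolding constant_on_def by metis

lemma finite_zeros_cball:
  assumes "g holomorphic_on ball 0 R" "r < R" "g z0 \<noteq> 0" "z0 \<in> ball 0 R"
  shows "finite {z\<in>cball 0 r. g z = 0}"
proof (cases "\<exists>z\<in>ball 0 R. g z = 0")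
  case False
  then have "{z\<in>cball 0 r. g z = 0} = {}" using assms by auto
  then show ?thesis by (simp only: finite.emptyI)
next
  case True
  then show ?thesis
    using assms ball_holomorphic_not_constant[of g _ z0 "ball 0 R"]
    by (intro holomorphic_compact_finite_zeros[of g "ball 0 R"]) auto
qed

lemma zorder_factor:
  assumes "g holomorphic_on ball 0 R" "a \<in> ball 0 R" "g z0 \<noteq> 0" "z0 \<in> ball 0 R"
  obtains s h where "s > 0" "ball a s \<subseteq> ball 0 R" "h holomorphic_on ball a s"
    "\<And>w. w \<in> ball a s \<Longrightarrow> g w = (w - a) ^ nat (zorder g a) * h w \<and> h w \<noteq> 0"
proof -
  have exz: "\<exists>w\<in>ball 0 R. g w \<noteq> 0" using assms by blast
  obtain r where r: "r>0" "cball a r \<subseteq> ball 0 R" "zor_poly g a holomorphic_on cball a r"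
    "\<forall>w\<in>cball a r. g w = zor_poly g a w * (w-a) ^ nat (zorder g a) \<and> zor_poly g a w \<noteq> 0"
    using zorder_exist_zero[OF assms(1) open_ball connected_ball assms(2) exz] by auto
  show ?thesis
    by (rule that[of r "zor_poly g a"])
       (use r ball_subset_cball[of a r] in \<open>auto intro: holomorphic_on_subset simp: mult.commute\<close>)
qed

text \<open>Peels off one zero with its full multiplicity and leaves the orders elsewhere unchanged,
  the induction step of Jensen's formula. The order of a holomorphic function that is not
  identically zero is nonnegative, so \<open>nat\<close> loses nothing.\<close>

lemma divide_zero:
  assumes g: "g holomorphic_on ball 0 R" and a: "a \<in> ball 0 R" and z0: "g z0 \<noteq> 0" "z0 \<in> ball 0 R"
  obtains h where "h holomorphic_on ball 0 R" "h a \<noteq> 0"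
    "\<And>w. w \<in> ball 0 R \<Longrightarrow> g w = (w - a) ^ nat (zorder g a) * h w"
    "\<And>b. b \<in> ball 0 R \<Longrightarrow> b \<noteq> a \<Longrightarrow> zorder h b = zorder g b"
proof -
  define n where "n = nat (zorder g a)"
  obtain s k where sk: "s > 0" "ball a s \<subseteq> ball 0 R" "k holomorphic_on ball a s"
    "\<And>w. w \<in> ball a s \<Longrightarrow> g w = (w - a) ^ n * k w \<and> k w \<noteq> 0"
    using zorder_factor[OF assms] unfolding n_def by metis
  define h where "h w = (if w = a then k a else g w / (w - a) ^ n)" for w
  have hk: "h w = k w" if "w \<in> ball a s" for w
    using sk(4)[OF that] by (auto simp: h_def)
  have "h holomorphic_on (ball a s \<union> (ball 0 R - {a}))"
  proof (rule holomorphic_on_Un)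
    show "h holomorphic_on ball a s" using sk(3) hk by (metis holomorphic_transform)
    show "h holomorphic_on (ball 0 R - {a})"
    proof (rule holomorphic_transform[of "\<lambda>w. g w / (w - a) ^ n"])
      show "(\<lambda>w. g w / (w - a) ^ n) holomorphic_on ball 0 R - {a}"
        by (intro holomorphic_intros holomorphic_on_subset[OF g]) auto
    qed (auto simp: h_def)
  qed auto
  moreover have "ball a s \<union> (ball 0 R - {a}) = ball 0 R" using sk by auto
  ultimately have hol: "h holomorphic_on ball 0 R" by simp
  have ha: "h a \<noteq> 0" using sk(4)[of a] hk[of a] sk(1) by auto
  have fac: "g w = (w - a) ^ n * h w" if "w \<in> ball 0 R" for w
    using sk(4)[of a] hk[of a] sk(1) by (cases "w = a") (auto simp: h_def)
  have "zorder h b = zorder g b" if b: "b \<in> ball 0 R" "b \<noteq> a" for b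
  proof -
    obtain s' k' where sk': "s' > 0" "ball b s' \<subseteq> ball 0 R" "k' holomorphic_on ball b s'"
      "\<And>w. w \<in> ball b s' \<Longrightarrow> g w = (w - b) ^ nat (zorder g b) * k' w \<and> k' w \<noteq> 0"
      using zorder_factor[OF g b(1) z0] by metis
    have exz: "\<exists>w\<in>ball 0 R. g w \<noteq> 0" using z0 by blast
    have nn: "zorder g b \<ge> 0"
      using zorder_exist_zero[OF g open_ball connected_ball b(1) exz] by (auto split: if_splits)
    show ?thesis
    proof (rule zorder_eqI[of "ball b s' - {a}" b "\<lambda>w. k' w / (w - a) ^ n"])
      show "(\<lambda>w. k' w / (w - a) ^ n) holomorphic_on ball b s' - {a}"
        by (intro holomorphic_intros holomorphic_on_subset[OF sk'(3)]) auto
      fix w assume w: "w \<in> ball b s' - {a}" "w \<noteq> b"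
      then have "h w = g w / (w - a) ^ n" by (auto simp: h_def)
      also have "g w = (w - b) powi zorder g b * k' w"
        using sk'(4)[of w] w nn by (simp add: power_int_def)
      finally show "h w = k' w / (w - a) ^ n * (w - b) powi zorder g b" by simp
    qed (use sk' b in auto)
  qed
  then show ?thesis using that[OF hol ha] fac unfolding n_def by blast
qed

text \<open>Induction on the number of distinct zeros in the open disc. A factor (z - a)^n
  contributes \<open>n * ln r\<close> to the mean and \<open>n * ln (norm a)\<close> at the centre,
  and the difference is the summand of \<open>a\<close>. Without zeros only the mean value property
  is left.\<close>

theorem jensen_formula:
  assumes "g holomorphic_on ball 0 R" "0 < r" "r < R" "\<And>z. z \<in> sphere 0 r \<Longrightarrow> g z \<noteq> 0" "g 0 \<noteq> 0"
  shows "cmean 0 r (\<lambda>z. ln (norm (g z))) = ln (norm (g 0)) +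
           (\<Sum>a\<in>{a\<in>ball 0 r. g a = 0}. real (nat (zorder g a)) * ln (r / norm a))"
  using assms
proof (induction "card {a\<in>ball 0 r. g a = 0}" arbitrary: g rule: less_induct)
  case (less g)
  note hol = less.prems(1) and r = less.prems(2,3) and nz = less.prems(4,5)
  let ?Z = "{a\<in>ball 0 r. g a = 0}"
  have fin: "finite ?Z"
    by (rule finite_subset[OF _ finite_zeros_cball[OF hol r(2) nz(2)]]) (use r in auto)
  show ?case
  proof (cases "?Z = {}")
    case True
    have "g w \<noteq> 0" if "w \<in> cball 0 r" for w
    proof (cases "norm w = r")
      case False
      then have "w \<in> ball 0 r" using that by auto
      then show ?thesis using True by blast
    qed (use nz(1) in auto)
    then have "cmean 0 r (\<lambda>z. ln (norm (g z))) = ln (norm (g 0))"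
      by (intro cmean_ln_nonzero[OF hol]) (use r in auto)
    then show ?thesis unfolding True by simp
  next
    case False
    then obtain a where a: "a \<in> ball 0 r" "g a = 0" by auto
    have a0: "a \<noteq> 0" using a nz by auto
    have aR: "a \<in> ball 0 R" "0 \<in> ball 0 R" using a r by auto
    obtain h where h: "h holomorphic_on ball 0 R" "h a \<noteq> 0"
      "\<And>w. w \<in> ball 0 R \<Longrightarrow> g w = (w - a) ^ nat (zorder g a) * h w"
      "\<And>b. b \<in> ball 0 R \<Longrightarrow> b \<noteq> a \<Longrightarrow> zorder h b = zorder g b"
      using divide_zero[OF hol aR(1) nz(2) aR(2)] by blast
    define n where "n = nat (zorder g a)"
    have n: "n > 0" using h(3)[OF aR(1)] a h(2) unfolding n_def by (metis gr0I mult_eq_0_iff power_0 one_neq_zero)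
    have Z: "{b\<in>ball 0 r. h b = 0} = ?Z - {a}"
    proof -
      have "h b = 0 \<longleftrightarrow> g b = 0 \<and> b \<noteq> a" if "b \<in> ball 0 r" for b
        using h(2) h(3)[of b] that r by (cases "b = a") auto
      then show ?thesis by auto
    qed
    have lt: "card {b\<in>ball 0 r. h b = 0} < card ?Z"
      unfolding Z by (rule card_Diff1_less) (use fin a in auto)
    have hnz: "h w \<noteq> 0" if "w \<in> sphere 0 r" for w
      using nz(1)[OF that] h(3)[of w] that r by auto
    have h0: "h 0 \<noteq> 0" using nz(2) h(3)[of 0] r by auto
    have IH: "cmean 0 r (\<lambda>z. ln (norm (h z))) = ln (norm (h 0)) +
           (\<Sum>a\<in>{a\<in>ball 0 r. h a = 0}. real (nat (zorder h a)) * ln (r / norm a))"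
      by (rule less.hyps[OF lt h(1) r hnz h0])
    have con: "continuous_on (sphere 0 r) (\<lambda>z. ln (norm (h z)))"
      by (rule continuous_on_ln_norm)
         (use h(1) hnz r in \<open>auto intro!: holomorphic_on_imp_continuous_on intro: holomorphic_on_subset\<close>)
    have con2: "continuous_on (sphere 0 r) (\<lambda>z. ln (norm (z - a)))"
      using a by (intro continuous_on_ln_norm continuous_intros) auto
    have "cmean 0 r (\<lambda>z. ln (norm (g z))) = cmean 0 r (\<lambda>z. real n * ln (norm (z - a)) + ln (norm (h z)))"
    proof (rule cmean_cong)
      fix w :: complex assume w: "w \<in> sphere 0 r"
      then have "w \<noteq> a" using a by auto
      then show "ln (norm (g w)) = real n * ln (norm (w - a)) + ln (norm (h w))"
        using h(3)[of w] w r hnz[OF w] by (simp add: n_def norm_mult norm_power ln_mult ln_realpow)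
    qed (use r in auto)
    also have "\<dots> = real n * ln r + cmean 0 r (\<lambda>z. ln (norm (h z)))"
      using a r con con2 by (subst cmean_add) (auto intro!: continuous_intros simp: cmean_cmult cmean_ln_linear)
    finally have 1: "cmean 0 r (\<lambda>z. ln (norm (g z))) = real n * ln r + cmean 0 r (\<lambda>z. ln (norm (h z)))" .
    have 2: "ln (norm (g 0)) = real n * ln (norm a) + ln (norm (h 0))"
      using h(3)[of 0] r h0 a0 by (simp add: n_def norm_mult norm_power ln_mult ln_realpow)
    have 3: "(\<Sum>a\<in>?Z. real (nat (zorder g a)) * ln (r / norm a)) =
       real n * ln (r / norm a) + (\<Sum>a\<in>?Z - {a}. real (nat (zorder g a)) * ln (r / norm a))"
      using sum.remove[OF fin, of a] a by (simp add: n_def)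
    have 4: "(\<Sum>b\<in>{b\<in>ball 0 r. h b = 0}. real (nat (zorder h b)) * ln (r / norm b)) =
        (\<Sum>b\<in>?Z - {a}. real (nat (zorder g b)) * ln (r / norm b))"
      unfolding Z by (rule sum.cong) (use h(4) r in auto)
    have 5: "real n * ln (r / norm a) = real n * ln r - real n * ln (norm a)"
      using r a0 by (simp add: ln_div algebra_simps)
    show ?thesis using 1 2 3 4 5 IH by linarith
  qed
qed

lemma zorder_ge_1:
  assumes "g holomorphic_on ball 0 R" "a \<in> ball 0 R" "g a = 0" "g z0 \<noteq> 0" "z0 \<in> ball 0 R"
  shows "nat (zorder g a) \<ge> 1"
proof -
  have exz: "\<exists>w\<in>ball 0 R. g w \<noteq> 0" using assms by blast
  show ?thesis
    using zorder_exist_zero[OF assms(1) open_ball connected_ball assms(2) exz] assms(3)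
    by (auto split: if_splits)
qed

lemma jensen_inequality:
  assumes "g holomorphic_on ball 0 R" "0 < r" "r < R" "\<And>z. z \<in> sphere 0 r \<Longrightarrow> g z \<noteq> 0" "g 0 \<noteq> 0"
  shows "ln (norm (g 0)) \<le> cmean 0 r (\<lambda>z. ln (norm (g z)))"
proof -
  have "0 \<le> (\<Sum>a\<in>{a\<in>ball 0 r. g a = 0}. real (nat (zorder g a)) * ln (r / norm a))"
  proof (intro sum_nonneg mult_nonneg_nonneg)
    fix a assume a: "a \<in> {a\<in>ball 0 r. g a = 0}"
    then have "a \<noteq> 0" using assms(5) by auto
    then show "0 \<le> ln (r / norm a)" using a assms(2) by (auto simp: divide_simps)
  qed auto
  then show ?thesis using jensen_formula[OF assms] by linarith
qed

text \<open>For norm at most 1 the mean in Jensen's formula is nonpositive, while each zero in the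
  smaller disc contributes at least \<open>ln (\<rho> / r)\<close>.\<close>

lemma card_zeros_bound:
  assumes "g holomorphic_on ball 0 R" "0 < \<rho>" "r < \<rho>" "\<rho> < R" "\<And>z. z \<in> sphere 0 \<rho> \<Longrightarrow> g z \<noteq> 0" "g 0 \<noteq> 0"
    "\<And>z. z \<in> ball 0 R \<Longrightarrow> norm (g z) \<le> 1" "0 < r"
  shows "real (card {a\<in>cball 0 r. g a = 0}) * ln (\<rho> / r) \<le> - ln (norm (g 0))"
proof -
  let ?Z = "{a\<in>ball 0 \<rho>. g a = 0}"
  have finr: "finite {a\<in>cball 0 r. g a = 0}"
    by (rule finite_zeros_cball[OF assms(1) _ assms(6)]) (use assms in auto)
  have fin: "finite ?Z"
    by (rule finite_subset[OF _ finite_zeros_cball[OF assms(1) assms(4) assms(6)]]) (use assms in auto)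
  have con: "continuous_on (sphere 0 \<rho>) (\<lambda>z. ln (norm (g z)))"
    by (rule continuous_on_ln_norm)
       (use assms in \<open>auto intro!: holomorphic_on_imp_continuous_on intro: holomorphic_on_subset\<close>)
  have "cmean 0 \<rho> (\<lambda>z. ln (norm (g z))) \<le> cmean 0 \<rho> (\<lambda>_. 0)"
    by (rule cmean_mono[OF con]) (use assms in auto)
  then have le: "ln (norm (g 0)) + (\<Sum>a\<in>?Z. real (nat (zorder g a)) * ln (\<rho> / norm a)) \<le> 0"
    using jensen_formula[OF assms(1,2,4,5,6)] by simp
  have a0: "a \<noteq> 0" if "g a = 0" for a using that assms by auto
  have "real (card {a\<in>cball 0 r. g a = 0}) * ln (\<rho> / r) = (\<Sum>a\<in>{a\<in>cball 0 r. g a = 0}. ln (\<rho> / r))" by simp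
  also have "\<dots> \<le> (\<Sum>a\<in>{a\<in>cball 0 r. g a = 0}. real (nat (zorder g a)) * ln (\<rho> / norm a))"
  proof (rule sum_mono)
    fix a assume "a \<in> {a\<in>cball 0 r. g a = 0}"
    then have a: "norm a \<le> r" "g a = 0" by auto
    then have n: "nat (zorder g a) \<ge> 1"
      by (intro zorder_ge_1[OF assms(1)]) (use assms in auto)
    have "ln (\<rho> / r) \<le> ln (\<rho> / norm a)" using a a0[of a] assms by (auto simp: divide_simps)
    moreover have "0 \<le> ln (\<rho> / norm a)" using a a0[of a] assms by (auto simp: divide_simps)
    then have "1 * ln (\<rho> / norm a) \<le> real (nat (zorder g a)) * ln (\<rho> / norm a)"
      using n by (intro mult_right_mono) auto
    ultimately show "ln (\<rho> / r) \<le> real (nat (zorder g a)) * ln (\<rho> / norm a)" by simp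
  qed
  also have "\<dots> \<le> (\<Sum>a\<in>?Z. real (nat (zorder g a)) * ln (\<rho> / norm a))"
  proof (rule sum_mono2[OF fin])
    fix a assume "a \<in> ?Z - {a\<in>cball 0 r. g a = 0}"
    then show "0 \<le> real (nat (zorder g a)) * ln (\<rho> / norm a)"
      using a0[of a] assms by (intro mult_nonneg_nonneg) (auto simp: divide_simps)
  qed (use assms in auto)
  finally show ?thesis using le by linarith
qed

text \<open>Jensen's formula is stated for circles free of zeros. Finitely many functions have
  finitely many zero moduli up to \<open>r2\<close>, so every interval of radii contains one that is
  good for all of them.\<close>

lemma generic_radius:
  assumes "finite G" "\<And>g. g \<in> G \<Longrightarrow> g holomorphic_on ball 0 R \<and> (\<exists>z\<in>ball 0 R. g z \<noteq> 0)"
    "0 < r1" "r1 < r2" "r2 < R"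
  obtains r where "r1 < r" "r < r2" "\<And>g z. g \<in> G \<Longrightarrow> z \<in> sphere 0 r \<Longrightarrow> g z \<noteq> (0::complex)"
proof -
  define B where "B = (\<Union>g\<in>G. norm ` {z\<in>cball 0 r2. g z = 0})"
  have "finite B" unfolding B_def
  proof (intro finite_UN_I[OF assms(1)] finite_imageI)
    fix g assume "g \<in> G"
    then obtain z where "g holomorphic_on ball 0 R" "z\<in>ball 0 R" "g z \<noteq> 0" using assms(2) by blast
    then show "finite {z\<in>cball 0 r2. g z = 0}" using finite_zeros_cball assms(5) by blast
  qed
  moreover have "infinite {r1<..<r2}" using assms by simp
  ultimately obtain r where r: "r \<in> {r1<..<r2}" "r \<notin> B"
    by (meson finite_subset subsetI)
  show ?thesis
  proof (rule that[of r])
    show "g z \<noteq> 0" if "g \<in> G" "z \<in> sphere 0 r" for g z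
    proof
      assume "g z = 0"
      then have "r \<in> B" unfolding B_def using that r by force
      then show False using r by simp
    qed
  qed (use r in auto)
qed

subsection \<open>Logarithmic derivatives\<close>

text \<open>\<open>Re (X w) < A\<close> means that \<open>X w\<close> is closer to 0 than to
  \<open>2 * A\<close>. So X / (2A - X) maps into the unit disc, and Schwarz's lemma bounds it by
  |w|.\<close>

lemma borel_caratheodory_unit:
  assumes hol: "X holomorphic_on ball 0 1" and X0: "X 0 = 0" and A: "A > 0"
    and Re: "\<And>w. w \<in> ball 0 1 \<Longrightarrow> Re (X w) < A" and w: "norm w < 1"
  shows "norm (X w) \<le> 2 * A * norm w / (1 - norm w)"
proof -
  define \<psi> where "\<psi> w = X w / (of_real (2 * A) - X w)" for w
  have ne: "of_real (2 * A) - X w \<noteq> 0" if "w \<in> ball 0 1" for w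
  proof
    assume "of_real (2 * A) - X w = 0"
    then have "Re (X w) = 2 * A" by (simp add: complex_eq_iff)
    then show False using Re[OF that] A by simp
  qed
  have lt: "norm (X w) < norm (of_real (2 * A) - X w)" if "w \<in> ball 0 1" for w
  proof -
    have "0 < 4 * A * (A - Re (X w))" using A Re[OF that] by simp
    also have "\<dots> = (norm (of_real (2 * A) - X w))\<^sup>2 - (norm (X w))\<^sup>2"
      unfolding cmod_power2 by (simp add: power2_eq_square algebra_simps)
    finally show ?thesis by (simp add: power2_less_imp_less)
  qed
  have "norm (\<psi> w) \<le> norm w"
  proof (rule Schwarz_Lemma(1))
    show "\<psi> holomorphic_on ball 0 1"
      unfolding \<psi>_def by (intro holomorphic_intros hol) (use ne in auto)
    show "\<psi> 0 = 0" by (simp add: \<psi>_def X0)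
    show "norm (\<psi> z) < 1" if "norm z < 1" for z
      using lt[of z] ne[of z] that by (simp add: \<psi>_def norm_divide divide_simps)
  qed (use w in auto)
  then have 1: "norm (X w) \<le> norm w * norm (of_real (2 * A) - X w)"
    using ne[of w] w by (simp add: \<psi>_def norm_divide divide_simps mult.commute)
  have "norm (of_real (2 * A) - X w) \<le> 2 * A + norm (X w)"
    using norm_triangle_ineq4[of "of_real (2 * A)" "X w"] A by simp
  then have "norm w * norm (of_real (2 * A) - X w) \<le> norm w * (2 * A + norm (X w))"
    by (intro mult_left_mono) auto
  then have "norm (X w) * (1 - norm w) \<le> 2 * A * norm w" using 1 by (simp add: algebra_simps)
  then show ?thesis using w by (simp add: divide_simps)
qed

text \<open>A zero-free function bounded by 1 has a holomorphic logarithm with nonpositive real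
  part. By Borel-Caratheodory this logarithm varies little on a disc of radius about \<delta> / (1 -
  ln |G z|), where \<open>G\<close> stays comparable to \<open>G z\<close>; Cauchy's inequality
  there bounds all logarithmic derivatives at once.\<close>

lemma nonvanishing_higher_deriv_bound:
  assumes hol: "G holomorphic_on ball z \<delta>" and d: "\<delta> > 0"
    and nz: "\<And>w. w \<in> ball z \<delta> \<Longrightarrow> G w \<noteq> 0" and le1: "\<And>w. w \<in> ball z \<delta> \<Longrightarrow> norm (G w) \<le> 1"
  shows "norm ((deriv ^^ j) G z) \<le> norm (G z) * (fact j * exp 1 * (4 * (1 + - ln (norm (G z))) / \<delta>) ^ j)"
proof -
  \<comment> \<open>The added 1 keeps \<open>A\<close> positive and makes the bound on the real part
    strict.\<close>
  define A where "A = 1 + - ln (norm (G z))"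
  have zb: "z \<in> ball z \<delta>" using d by simp
  have A1: "A \<ge> 1" using nz[OF zb] le1[OF zb] by (simp add: A_def)
  obtain g where g: "g holomorphic_on ball z \<delta>" "\<And>w. w \<in> ball z \<delta> \<Longrightarrow> G w = exp (g w)"
    using contractible_imp_holomorphic_log[of G "ball z \<delta>"] hol nz convex_imp_contractible[OF convex_ball] by blast
  define X where "X w = g (z + of_real \<delta> * w) - g z" for w
  have inb: "z + of_real \<delta> * w \<in> ball z \<delta>" if "w \<in> ball 0 1" for w
    using that d by (simp add: dist_norm norm_mult)
  have Xb: "norm (X w) \<le> 2 * A * norm w / (1 - norm w)" if "norm w < 1" for w
  proof (rule borel_caratheodory_unit[of X A w])
    have "(\<lambda>w. g (z + of_real \<delta> * w)) holomorphic_on ball 0 1"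
    proof (rule holomorphic_on_compose_gen[unfolded o_def, of "\<lambda>w. z + of_real \<delta> * w" "ball 0 1" g "ball z \<delta>"])
      show "(\<lambda>w. z + of_real \<delta> * w) holomorphic_on ball 0 1" by (intro holomorphic_intros)
      show "g holomorphic_on ball z \<delta>" by (rule g)
    qed (use inb in blast)
    then show "X holomorphic_on ball 0 1" unfolding X_def by (intro holomorphic_intros)
    show "Re (X w) < A" if "w \<in> ball 0 1" for w
    proof -
      have "Re (g (z + of_real \<delta> * w)) \<le> 0"
        using le1[OF inb[OF that]] g(2)[OF inb[OF that]] by simp
      moreover have "Re (g z) = ln (norm (G z))" using g(2)[OF zb] by simp
      ultimately show ?thesis by (simp add: X_def A_def)
    qed
  qed (use A1 that in \<open>auto simp: X_def\<close>)
  \<comment> \<open>On this radius \<open>norm u = 1 / (4 * A)\<close>, and Borel-Caratheodory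
    bounds \<open>X\<close> by (1/2) / (1 - 1/4), which is below 1.\<close>
  define s where "s = \<delta> / (4 * A)"
  have s: "s > 0" "s < \<delta>" using A1 d by (auto simp: s_def divide_simps)
  have bd: "norm (G w) \<le> norm (G z) * exp 1" if "norm (z - w) = s" for w
  proof -
    define u where "u = (w - z) / of_real \<delta>"
    have w: "w = z + of_real \<delta> * u" using d by (simp add: u_def)
    have nu: "norm u = 1 / (4 * A)"
      using that d by (simp add: u_def norm_divide norm_minus_commute s_def)
    then have nu1: "norm u \<le> 1/4" "norm u < 1" unfolding nu using A1 by (auto simp: divide_simps)
    have "norm (X u) \<le> 2 * A * norm u / (1 - norm u)" by (rule Xb) (rule nu1)
    also have "\<dots> \<le> (1/2) / (1 - 1/4)"
      by (rule frac_le) (use nu1 nu A1 in auto)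
    also have "\<dots> \<le> 1" by simp
    finally have X1: "norm (X u) \<le> 1" .
    have wb: "w \<in> ball z \<delta>" using that s by (simp add: dist_norm)
    have "G w = G z * exp (X u)"
      using g(2)[OF wb] g(2)[OF zb] w by (simp add: X_def exp_diff)
    then have "norm (G w) = norm (G z) * exp (Re (X u))" by (simp add: norm_mult)
    also have "\<dots> \<le> norm (G z) * exp 1"
      using X1 complex_Re_le_cmod[of "X u"] by (intro mult_left_mono) auto
    finally show ?thesis .
  qed
  have "norm ((deriv ^^ j) G z) \<le> (fact j) * (norm (G z) * exp 1) / s ^ j"
  proof (rule Cauchy_inequality)
    show "G holomorphic_on ball z s" using hol s by (auto intro: holomorphic_on_subset)
    show "continuous_on (cball z s) G"
      using hol s by (intro holomorphic_on_imp_continuous_on) (auto intro!: holomorphic_on_subset[OF hol])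
  qed (use s bd in auto)
  also have "\<dots> = norm (G z) * (fact j * exp 1 * (4 * A / \<delta>) ^ j)"
    by (simp add: s_def power_divide field_simps)
  finally show ?thesis by (simp add: A_def)
qed

text \<open>Jensen's inequality for the concave logarithm, obtained by integrating its tangent at
  the mean \<open>c\<close>.\<close>

lemma cmean_ln_le:
  assumes con: "continuous_on (sphere z r) \<phi>" and ge: "\<And>w. w \<in> sphere z r \<Longrightarrow> \<phi> w \<ge> 1" and r: "0 \<le> r"
  shows "cmean z r (\<lambda>w. ln (\<phi> w)) \<le> ln (cmean z r \<phi>)"
proof -
  define c where "c = cmean z r \<phi>"
  have "cmean z r (\<lambda>_. 1) \<le> c" unfolding c_def by (rule cmean_mono) (use assms in auto)
  then have c: "c \<ge> 1" by simp
  have "cmean z r (\<lambda>w. ln (\<phi> w)) \<le> cmean z r (\<lambda>w. (ln c - 1) + (1 / c) * \<phi> w)"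
  proof (rule cmean_mono)
    show "continuous_on (sphere z r) (\<lambda>w. ln (\<phi> w))"
      by (intro continuous_intros con) (use ge in force)
    show "continuous_on (sphere z r) (\<lambda>w. ln c - 1 + 1 / c * \<phi> w)"
      by (intro continuous_intros con)
    fix w assume w: "w \<in> sphere z r"
    have "ln (\<phi> w / c) \<le> \<phi> w / c - 1" using ge[OF w] c by (intro ln_le_minus_one) auto
    then show "ln (\<phi> w) \<le> ln c - 1 + 1 / c * \<phi> w" using ge[OF w] c by (simp add: ln_div)
  qed (use r in auto)
  also have "\<dots> = (ln c - 1) + (1 / c) * c"
    unfolding c_def using r con by (subst cmean_add) (auto intro!: continuous_intros simp: cmean_cmult simp del: times_divide_eq_left)
  also have "\<dots> = ln c" using c by simp
  finally show ?thesis by (simp add: c_def)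
qed

text \<open>The primitive \<open>G\<close> is continuous across the singularity. The range of
  \<open>c\<close> covers a point of [0,1] together with its translates by 1 and -1, and 6 is twice
  the bound 3 for the primitive.\<close>

lemma inverse_sqrt_integral:
  assumes c: "-1 \<le> c" "c \<le> 2"
  shows "\<exists>I. ((\<lambda>t. 1 / sqrt \<bar>t - c\<bar>) has_integral I) {0..1::real} \<and> I \<le> 6"
proof -
  define G where "G t = 2 * sgn (t - c) * sqrt \<bar>t - c\<bar>" for t
  have "((\<lambda>t. 1 / sqrt \<bar>t - c\<bar>) has_integral (G 1 - G 0)) {0..1}"
  proof (rule fundamental_theorem_of_calculus_strong[of "{c}"])
    fix x assume x: "x \<in> {0..1} - {c}"
    show "(G has_vector_derivative 1 / sqrt \<bar>x - c\<bar>) (at x)"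
    proof (cases "x > c")
      case True
      have "((\<lambda>t. 2 * sqrt (t - c)) has_field_derivative 1 / sqrt \<bar>x - c\<bar>) (at x)"
        using True by (auto intro!: derivative_eq_intros simp: field_simps)
      then have "(G has_field_derivative 1 / sqrt \<bar>x - c\<bar>) (at x)"
        by (rule has_field_derivative_transform_within_open[of _ _ _ "{c<..}"])
           (use True in \<open>auto simp: G_def\<close>)
      then show ?thesis by (simp add: has_real_derivative_iff_has_vector_derivative)
    next
      case False
      then have lt: "x < c" using x by auto
      have "((\<lambda>t. - 2 * sqrt (c - t)) has_field_derivative 1 / sqrt \<bar>x - c\<bar>) (at x)"
        using lt by (auto intro!: derivative_eq_intros simp: field_simps)
      then have "(G has_field_derivative 1 / sqrt \<bar>x - c\<bar>) (at x)"
        by (rule has_field_derivative_transform_within_open[of _ _ _ "{..<c}"])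
           (use lt in \<open>auto simp: G_def\<close>)
      then show ?thesis by (simp add: has_real_derivative_iff_has_vector_derivative)
    qed
  next
    have "G = (\<lambda>t. 2 * (sqrt (max (t - c) 0) - sqrt (max (c - t) 0)))"
      by (auto simp: G_def fun_eq_iff sgn_if max_def)
    then show "continuous_on {0..1} G" by (auto intro!: continuous_intros)
  qed auto
  moreover have "G 1 - G 0 \<le> 6"
  proof -
    have b: "\<bar>G t\<bar> \<le> 3" if "t \<in> {0..1}" for t
    proof -
      have "sqrt \<bar>t - c\<bar> \<le> sqrt (9/4)" using that c by (intro real_sqrt_le_mono) (auto simp: abs_if)
      also have "sqrt (9/4) = 3/2" by (rule real_sqrt_unique) (auto simp: power2_eq_square)
      finally show ?thesis by (auto simp: G_def abs_mult sgn_if)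
    qed
    show ?thesis using b[of 0] b[of 1] by auto
  qed
  ultimately show ?thesis by blast
qed

lemma sin_pi_lower:
  fixes x :: real
  assumes "\<bar>x\<bar> \<le> 1/2"
  shows "2 * \<bar>x\<bar> \<le> \<bar>sin (pi * x)\<bar>"
proof -
  have *: "2 * y \<le> sin (pi * y)" if y: "0 \<le> y" "y \<le> 1/2" for y :: real
  proof -
    have "concave_on {0..pi} sin"
    proof (rule f''_le0_imp_concave)
      show "(sin has_real_derivative cos x) (at x)" for x :: real by (rule DERIV_sin)
      show "(cos has_real_derivative - sin x) (at x)" for x :: real by (rule DERIV_cos)
      show "- sin x \<le> 0" if "x \<in> {0..pi}" for x using that by (simp add: sin_ge_zero)
    qed auto
    then have "sin ((1 - 2*y) *\<^sub>R 0 + (2*y) *\<^sub>R (pi/2)) \<ge> (1 - 2*y) * sin 0 + (2*y) * sin (pi/2)"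
      by (rule concave_onD) (use y in auto)
    then show ?thesis by (simp add: mult.commute)
  qed
  show ?thesis
  proof (cases "x \<ge> 0")
    case True
    then show ?thesis using *[of x] assms by simp
  next
    case False
    then show ?thesis using *[of "-x"] assms by simp
  qed
qed

text \<open>The radial projection \<open>r * u\<close> of \<open>a\<close> is a nearest point of the
  circle, so z is at most twice as far from it as from \<open>a\<close>. The chord from z to
  \<open>r * u\<close> is 2r times the sine, and \<open>r \<ge> 1\<close>.\<close>

lemma circle_distance_lower:
  fixes a :: complex
  assumes r: "r \<ge> 1"
  obtains \<alpha> where "0 \<le> \<alpha>" "\<alpha> \<le> 1"
    "\<And>t. t \<in> {0..1} \<Longrightarrow> norm (circlepath 0 r t - a) \<ge> \<bar>sin (pi * (t - \<alpha>))\<bar>"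
proof -
  obtain \<theta> where th: "a = norm a * exp (\<i> * of_real \<theta>)" "0 \<le> \<theta>" "\<theta> \<le> 2 * pi"
  proof -
    have "a = rcis (norm a) (Arg2pi a)" using Arg2pi_eq[of a] by (simp add: rcis_def cis_conv_exp)
    then show ?thesis using that[of "Arg2pi a"] Arg2pi[of a] by (auto simp: rcis_def cis_conv_exp)
  qed
  define \<alpha> where "\<alpha> = \<theta> / (2 * pi)"
  define u where "u = exp (\<i> * of_real \<theta>)"
  have nu: "norm u = 1" by (simp add: u_def)
  show ?thesis
  proof (rule that[of \<alpha>])
    show "0 \<le> \<alpha>" "\<alpha> \<le> 1" using th by (auto simp: \<alpha>_def)
    fix t :: real
    define z where "z = circlepath 0 r t"
    have nz: "norm z = r" using r by (simp add: z_def circlepath norm_mult)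
    have "norm (of_real r * u - a) = \<bar>r - norm a\<bar>"
    proof -
      have "of_real r * u - a = of_real (r - norm a) * u" using th(1) by (simp add: u_def algebra_simps)
      then show ?thesis using nu by (simp add: norm_mult del: of_real_diff)
    qed
    also have "\<dots> \<le> norm (z - a)" using nz norm_triangle_ineq3[of z a] by simp
    finally have 1: "norm (of_real r * u - a) \<le> norm (z - a)" .
    have 2: "norm (z - of_real r * u) \<le> norm (z - a) + norm (of_real r * u - a)"
      using norm_triangle_ineq4[of "z - a" "of_real r * u - a"] by simp
    have "z = of_real r * cis (2 * pi * t)" by (simp add: z_def circlepath cis_conv_exp mult_ac)
    moreover have "u = cis \<theta>" by (simp add: u_def cis_conv_exp)
    ultimately have "z - of_real r * u = of_real r * (cis (2 * pi * t) - cis \<theta>)" by (simp add: algebra_simps)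
    then have 3: "norm (z - of_real r * u) = r * norm (cis (2 * pi * t) - cis \<theta>)"
      using r by (simp add: norm_mult)
    have 4: "norm (cis x - cis y) = 2 * \<bar>sin ((x - y) / 2)\<bar>" for x y
    proof -
      have "(norm (cis x - cis y))\<^sup>2 = (cos x - cos y)\<^sup>2 + (sin x - sin y)\<^sup>2"
        by (simp add: cmod_power2)
      also have "\<dots> = 2 - 2 * cos (x - y)"
        using sin_cos_squared_add[of x] sin_cos_squared_add[of y]
        by (simp add: cos_diff power2_eq_square algebra_simps)
      also have "cos (x - y) = 1 - 2 * (sin ((x - y) / 2))\<^sup>2"
      proof -
        have "2 * ((x - y) / 2) = x - y" by simp
        then show ?thesis using cos_double_sin[of "(x - y) / 2"] by metis
      qed
      finally have "(norm (cis x - cis y))\<^sup>2 = (2 * \<bar>sin ((x - y) / 2)\<bar>)\<^sup>2"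
        by (simp add: power_mult_distrib)
      then show ?thesis by (rule power2_eq_imp_eq) auto
    qed
    have "(2 * pi * t - \<theta>) / 2 = pi * (t - \<alpha>)" by (simp add: \<alpha>_def field_simps)
    then have "2 * \<bar>sin (pi * (t - \<alpha>))\<bar> = norm (cis (2 * pi * t) - cis \<theta>)" using 4[of "2*pi*t" \<theta>] by simp
    also have "\<dots> \<le> norm (z - of_real r * u)" unfolding 3 using r
      by (metis mult_le_cancel_right1 norm_ge_zero not_less)
    finally show "norm (circlepath 0 r t - a) \<ge> \<bar>sin (pi * (t - \<alpha>))\<bar>"
      using 1 2 unfolding z_def by linarith
  qed
qed

text \<open>The exponent 1/2 keeps the mean bounded however close \<open>a\<close> is to the circle,
  with a bound independent of \<open>r\<close> and \<open>a\<close>. The sine is estimated at its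
  nearest zero \<alpha>, \<alpha> - 1 or \<alpha> + 1, each costing at most 6.\<close>

lemma cmean_inverse_sqrt:
  assumes r: "r \<ge> 1" and a: "norm a \<noteq> r"
  shows "cmean 0 r (\<lambda>z. 1 / sqrt (norm (z - a))) \<le> 18"
proof -
  obtain \<alpha> where al: "0 \<le> \<alpha>" "\<alpha> \<le> 1"
    "\<And>t. t \<in> {0..1} \<Longrightarrow> norm (circlepath 0 r t - a) \<ge> \<bar>sin (pi * (t - \<alpha>))\<bar>"
    using circle_distance_lower[OF r] by blast
  define f where "f t = 1 / sqrt (norm (circlepath 0 r t - a))" for t
  define h where "h c t = 1 / sqrt \<bar>t - c\<bar>" for c t :: real
  \<comment> \<open>At a singular point the function \<open>h\<close> centred there takes the value
    \<open>1 / 0 = 0\<close> and fails as a majorant, so \<open>f\<close> is used instead; finitely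
    many points do not change the integral.\<close>
  define B where "B t = (if t \<in> {\<alpha>, \<alpha> - 1, \<alpha> + 1} then f t else h \<alpha> t + h (\<alpha> - 1) t + h (\<alpha> + 1) t)" for t
  have fint: "f integrable_on {0..1}" unfolding f_def
    by (rule circle_integrable) (use r a in \<open>auto intro!: continuous_intros\<close>)
  obtain I1 I2 I3 where I: "(h \<alpha> has_integral I1) {0..1}" "(h (\<alpha> - 1) has_integral I2) {0..1}"
    "(h (\<alpha> + 1) has_integral I3) {0..1}" "I1 \<le> 6" "I2 \<le> 6" "I3 \<le> 6"
    using inverse_sqrt_integral[of \<alpha>] inverse_sqrt_integral[of "\<alpha> - 1"] inverse_sqrt_integral[of "\<alpha> + 1"] al
    unfolding h_def by auto
  have "((\<lambda>t. h \<alpha> t + h (\<alpha> - 1) t + h (\<alpha> + 1) t) has_integral (I1 + I2 + I3)) {0..1}"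
    by (intro has_integral_add I)
  then have B: "(B has_integral (I1 + I2 + I3)) {0..1}"
    by (rule has_integral_spike_finite[rotated 2, of _ _ _ "{\<alpha>, \<alpha> - 1, \<alpha> + 1}"]) (auto simp: B_def)
  have le: "f t \<le> B t" if t: "t \<in> {0..1}" for t
  proof (cases "t \<in> {\<alpha>, \<alpha> - 1, \<alpha> + 1}")
    case True
    then show ?thesis by (simp add: B_def)
  next
    case False
    have h0: "h c t \<ge> 0" for c by (simp add: h_def)
    have key: "f t \<le> h c t" if c: "\<bar>t - c\<bar> \<le> 1/2" "t \<noteq> c" "\<bar>sin (pi * (t - c))\<bar> = \<bar>sin (pi * (t - \<alpha>))\<bar>" for c
    proof -
      have "\<bar>t - c\<bar> \<le> 2 * \<bar>t - c\<bar>" by simp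
      also have "\<dots> \<le> norm (circlepath 0 r t - a)"
        using sin_pi_lower[OF c(1)] al(3)[OF t] c(3) by linarith
      finally have "sqrt \<bar>t - c\<bar> \<le> sqrt (norm (circlepath 0 r t - a))" by simp
      moreover have "sqrt \<bar>t - c\<bar> > 0" using c(2) by simp
      ultimately show ?thesis unfolding f_def h_def
        by (intro divide_left_mono mult_pos_pos) auto
    qed
    have s1: "sin (pi * (t - (\<alpha> + 1))) = - sin (pi * (t - \<alpha>))"
      using sin_minus_pi[of "pi * (t - \<alpha>)"] by (simp add: algebra_simps)
    have s2: "sin (pi * (t - (\<alpha> - 1))) = - sin (pi * (t - \<alpha>))"
      using sin_periodic_pi[of "pi * (t - \<alpha>)"] by (simp add: algebra_simps)
    have "f t \<le> h \<alpha> t \<or> f t \<le> h (\<alpha> - 1) t \<or> f t \<le> h (\<alpha> + 1) t"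
    proof -
      consider "\<bar>t - \<alpha>\<bar> \<le> 1/2" | "t - \<alpha> > 1/2" | "t - \<alpha> < - 1/2" by linarith
      then show ?thesis
      proof cases
        case 1 then show ?thesis using key[of \<alpha>] False by auto
      next
        case 2
        then have "\<bar>t - (\<alpha> + 1)\<bar> \<le> 1/2" using t al by (auto simp: abs_if)
        then show ?thesis using key[of "\<alpha> + 1"] False s1 by auto
      next
        case 3
        then have "\<bar>t - (\<alpha> - 1)\<bar> \<le> 1/2" using t al by (auto simp: abs_if)
        then show ?thesis using key[of "\<alpha> - 1"] False s2 by auto
      qed
    qed
    then have "f t \<le> h \<alpha> t + h (\<alpha> - 1) t + h (\<alpha> + 1) t" using h0[of \<alpha>] h0[of "\<alpha> - 1"] h0[of "\<alpha> + 1"] by linarith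
    then show ?thesis using False by (simp add: B_def)
  qed
  have "integral {0..1} f \<le> I1 + I2 + I3"
    by (rule has_integral_le[OF integrable_integral[OF fint] B]) (rule le)
  then show ?thesis using I unfolding cmean_def f_def by linarith
qed

text \<open>The function \<open>S\<close> takes the place of the logarithmic derivatives. No radius
  is exceptional, since norm at most 1 on the double disc bounds the number of zeros near the circle
  by a multiple of \<open>- ln (norm (G 0))\<close>. Around a point z of the circle \<open>G\<close>
  is zero-free on a disc of radius \<open>1 / (X z)\<^sup>2\<close>, where the estimate for
  zero-free functions applies, and concavity of the logarithm turns means of logarithms into
  logarithms of means.\<close>

theorem log_derivative_lemma:
  "\<exists>C>0. \<forall>r G. 2 \<le> r \<longrightarrow> G holomorphic_on ball 0 (2 * r) \<longrightarrow> (\<forall>z\<in>ball 0 (2 * r). norm (G z) \<le> 1) \<longrightarrow>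
     G 0 \<noteq> 0 \<longrightarrow> (\<forall>z\<in>sphere 0 r. G z \<noteq> 0) \<longrightarrow>
     (\<exists>S. continuous_on (sphere 0 r) S \<and>
        (\<forall>z\<in>sphere 0 r. 0 \<le> S z \<and> (\<forall>j\<le>k. norm ((deriv ^^ j) G z) \<le> exp (S z) * norm (G z))) \<and>
        cmean 0 r S \<le> C * (1 + ln (1 + - ln (norm (G 0)))))"
proof -
  define c0 where "c0 = ln (fact k) + 1 + real k * ln 4"
  \<comment> \<open>127 = 1 + 7 * 18: at most \<open>7 * A\<close> zeros, each with mean at most 18,
    for \<open>A = - ln (norm (G 0))\<close>.\<close>
  define C where "C = c0 + real k * (1 + 2 * (ln 127 + 1)) + 1"
  have c00: "c0 \<ge> 0" by (simp add: c0_def)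
  have C0: "C > 0" using c00 by (simp add: C_def add_nonneg_pos)
  show ?thesis
  proof (intro exI[of _ C] conjI C0 allI impI)
    fix r :: real and G :: "complex \<Rightarrow> complex"
    assume r: "2 \<le> r" and hol: "G holomorphic_on ball 0 (2 * r)" and le1: "\<forall>z\<in>ball 0 (2 * r). norm (G z) \<le> 1"
      and G0: "G 0 \<noteq> 0" and nz: "\<forall>z\<in>sphere 0 r. G z \<noteq> 0"
    define A where "A = - ln (norm (G 0))"
    have A0: "A \<ge> 0" using le1 G0 r by (auto simp: A_def)
    define Z where "Z = {a\<in>cball 0 (r + 1). G a = 0}"
    have finZ: "finite Z" unfolding Z_def
      by (rule finite_zeros_cball[OF hol _ G0]) (use r in auto)
    \<comment> \<open>Zeros up to \<open>r + 1\<close> matter because the discs around points of the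
      circle have radius at most 1. From \<open>r \<ge> 2\<close> one gets
      \<open>r + 1 \<le> 3 * r / 2\<close>, hence \<open>\<rho> / (r + 1) \<ge> 7/6\<close>, and ln
      (7/6) is at least 1/7.\<close>
    have cardZ: "real (card Z) \<le> 7 * A"
    proof -
      obtain \<rho> where rho: "7/4 * r < \<rho>" "\<rho> < 15/8 * r" "\<And>z. z \<in> sphere 0 \<rho> \<Longrightarrow> G z \<noteq> 0"
      proof (rule generic_radius[of "{G}" "2 * r" "7/4 * r" "15/8 * r"])
        show "g holomorphic_on ball 0 (2 * r) \<and> (\<exists>z\<in>ball 0 (2 * r). g z \<noteq> 0)" if "g \<in> {G}" for g
          using that hol G0 r by force
      qed (use r in auto)
      have "real (card {a\<in>cball 0 (r + 1). G a = 0}) * ln (\<rho> / (r + 1)) \<le> - ln (norm (G 0))"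
        by (rule card_zeros_bound[OF hol]) (use rho r G0 le1 in auto)
      then have 1: "real (card Z) * ln (\<rho> / (r + 1)) \<le> A" by (simp add: Z_def A_def)
      have "7/6 \<le> \<rho> / (r + 1)" using rho r by (simp add: divide_simps)
      then have "ln (7/6) \<le> ln (\<rho> / (r + 1))"
        using rho r by (subst ln_le_cancel_iff) auto
      moreover have "1/7 \<le> ln (7/6 :: real)"
        using ln_le_minus_one[of "6/7::real"] ln_inverse[of "7/6::real"] by simp
      ultimately have "real (card Z) * (1/7) \<le> real (card Z) * ln (\<rho> / (r + 1))"
        by (intro mult_left_mono) auto
      then show ?thesis using 1 by linarith
    qed
    \<comment> \<open>Each summand is at most \<open>X z\<close>, so
      \<open>1 / (X z)\<^sup>2\<close> is at most the distance to every zero in \<open>Z\<close>,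
      while the square root keeps the circular mean bounded.\<close>
    define X where "X z = 1 + (\<Sum>a\<in>Z. 1 / sqrt (norm (z - a)))" for z
    have nZ: "norm a \<noteq> r" if "a \<in> Z" for a using that nz by (auto simp: Z_def)
    have conX0: "continuous_on (sphere 0 r) (\<lambda>z. 1 / sqrt (norm (z - a)))" if "a \<in> Z" for a
      using nZ[OF that] by (intro continuous_intros) auto
    have conX: "continuous_on (sphere 0 r) X"
      unfolding X_def by (intro continuous_intros conX0)
    have X1: "X z \<ge> 1" for z unfolding X_def by (simp add: sum_nonneg)
    have conL: "continuous_on (sphere 0 r) (\<lambda>z. ln (norm (G z)))"
      by (rule continuous_on_ln_norm)
         (use hol nz r in \<open>auto intro!: holomorphic_on_imp_continuous_on intro: holomorphic_on_subset\<close>)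
    have Lz: "ln (norm (G z)) \<le> 0" if "z \<in> sphere 0 r" for z
      using le1 nz that r by auto
    define S where "S z = c0 + real k * ln (1 + - ln (norm (G z))) + 2 * real k * ln (X z)" for z
    have con1: "continuous_on (sphere 0 r) (\<lambda>z. 1 + - ln (norm (G z)))" by (intro continuous_intros conL)
    have con2: "continuous_on (sphere 0 r) (\<lambda>z. ln (1 + - ln (norm (G z))))"
      by (intro continuous_on_ln con1) (use Lz in force)
    have con3: "continuous_on (sphere 0 r) (\<lambda>z. ln (X z))"
      by (intro continuous_on_ln conX) (use X1 in \<open>metis not_one_le_zero\<close>)
    have conS: "continuous_on (sphere 0 r) S"
      unfolding S_def by (intro continuous_intros con2 con3)
    have m1: "cmean 0 r (\<lambda>z. ln (1 + - ln (norm (G z)))) \<le> ln (1 + A)"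
    proof -
      have "cmean 0 r (\<lambda>z. ln (1 + - ln (norm (G z)))) \<le> ln (cmean 0 r (\<lambda>z. 1 + - ln (norm (G z))))"
        by (rule cmean_ln_le[OF con1]) (use Lz r in auto)
      also have e: "cmean 0 r (\<lambda>z. 1 + - ln (norm (G z))) = 1 - cmean 0 r (\<lambda>z. ln (norm (G z)))"
        using r conL by (subst cmean_add) (auto intro!: continuous_intros simp: cmean_uminus)
      also have "ln \<dots> \<le> ln (1 + A)"
      proof -
        have "ln (norm (G 0)) \<le> cmean 0 r (\<lambda>z. ln (norm (G z)))"
          by (rule jensen_inequality[OF hol]) (use r nz G0 in auto)
        moreover have "cmean 0 r (\<lambda>z. ln (norm (G z))) \<le> cmean 0 r (\<lambda>_. 0)"
          by (rule cmean_mono[OF conL]) (use Lz r in auto)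
        ultimately show ?thesis by (subst ln_le_cancel_iff) (auto simp: A_def)
      qed
      finally show ?thesis .
    qed
    have m2: "cmean 0 r (\<lambda>z. ln (X z)) \<le> ln 127 + ln (1 + A)"
    proof -
      have "cmean 0 r (\<lambda>z. ln (X z)) \<le> ln (cmean 0 r X)"
        by (rule cmean_ln_le[OF conX]) (use X1 r in auto)
      also have "\<dots> \<le> ln (127 * (1 + A))"
      proof -
        have "cmean 0 r X = 1 + (\<Sum>a\<in>Z. cmean 0 r (\<lambda>z. 1 / sqrt (norm (z - a))))"
          unfolding X_def using r conX0 finZ
          by (subst cmean_add) (auto intro!: continuous_on_sum simp: cmean_sum)
        also have "\<dots> \<le> 1 + (\<Sum>a\<in>Z. 18)"
          by (intro add_left_mono sum_mono cmean_inverse_sqrt) (use r nZ in auto)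
        also have "\<dots> \<le> 127 * (1 + A)" using cardZ A0 by simp
        finally have "cmean 0 r X \<le> 127 * (1 + A)" .
        moreover have "cmean 0 r (\<lambda>_. 1) \<le> cmean 0 r X"
          by (rule cmean_mono) (use conX X1 r in auto)
        ultimately show ?thesis using A0 by (subst ln_le_cancel_iff) auto
      qed
      also have "\<dots> = ln 127 + ln (1 + A)" using A0 by (subst ln_mult) auto
      finally show ?thesis .
    qed
    have mS: "cmean 0 r S \<le> C * (1 + ln (1 + A))"
    proof -
      have "cmean 0 r S = c0 + real k * cmean 0 r (\<lambda>z. ln (1 + - ln (norm (G z)))) + 2 * real k * cmean 0 r (\<lambda>z. ln (X z))"
        unfolding S_def using r con2 con3
        by (subst cmean_add; (subst cmean_add)?) (auto intro!: continuous_intros simp: cmean_cmult)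
      also have "\<dots> \<le> c0 + real k * ln (1 + A) + 2 * real k * (ln 127 + ln (1 + A))"
        by (intro add_mono mult_left_mono m1 m2) auto
      also have "\<dots> \<le> C * (1 + ln (1 + A))"
      proof -
        have l: "ln (1 + A) \<ge> 0" using A0 by simp
        have "c0 * ln (1 + A) \<ge> 0" "real k * ln (1 + A) \<ge> 0" "real k * (ln 127 * ln (1 + A)) \<ge> 0"
          using l c00 by auto
        then show ?thesis using l unfolding C_def by (simp add: algebra_simps)
      qed
      finally show ?thesis .
    qed
    have bnd: "0 \<le> S z \<and> (\<forall>j\<le>k. norm ((deriv ^^ j) G z) \<le> exp (S z) * norm (G z))" if z: "z \<in> sphere 0 r" for z
    proof -
      define \<delta> where "\<delta> = 1 / (X z)\<^sup>2"
      define a where "a = 1 + - ln (norm (G z))"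
      have a1: "a \<ge> 1" using Lz[OF z] by (simp add: a_def)
      have d: "\<delta> > 0" "\<delta> \<le> 1" using X1[of z] by (auto simp: \<delta>_def)
      have sub: "ball z \<delta> \<subseteq> ball 0 (r + 1)"
      proof
        fix w assume "w \<in> ball z \<delta>"
        then have "norm (z - w) < 1" using d by (simp add: dist_norm)
        moreover have "norm w \<le> norm z + norm (z - w)" using norm_triangle_ineq4[of z "z - w"] by simp
        ultimately show "w \<in> ball 0 (r + 1)" using z by simp
      qed
      have sub2: "ball 0 (r + 1) \<subseteq> ball (0::complex) (2 * r)" using r by auto
      have nzb: "G w \<noteq> 0" if w: "w \<in> ball z \<delta>" for w
      proof
        assume "G w = 0"
        then have wZ: "w \<in> Z" using sub w by (auto simp: Z_def)
        have zw: "norm (z - w) > 0" using nZ[OF wZ] z by auto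
        have "1 / sqrt (norm (z - w)) \<le> (\<Sum>a\<in>Z. 1 / sqrt (norm (z - a)))"
          by (rule member_le_sum[OF wZ]) (use finZ in auto)
        also have "\<dots> \<le> X z" by (simp add: X_def)
        finally have "(1 / sqrt (norm (z - w)))\<^sup>2 \<le> (X z)\<^sup>2" by (rule power_mono) auto
        then have "1 / norm (z - w) \<le> (X z)\<^sup>2" by (simp add: power_divide)
        moreover have "(X z)\<^sup>2 > 0" using X1[of z] by simp
        ultimately have "\<delta> \<le> norm (z - w)" unfolding \<delta>_def using zw by (simp add: divide_simps mult.commute)
        then show False using w by (simp add: dist_norm)
      qed
      have q1: "4 * a / \<delta> \<ge> 1"
      proof -
        have "1 * 1 \<le> (4 * a) * (X z)\<^sup>2" using a1 X1[of z] by (intro mult_mono) (auto simp: one_le_power)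
        then show ?thesis by (simp add: \<delta>_def)
      qed
      have eS: "exp (S z) = fact k * exp 1 * (4 * a / \<delta>) ^ k"
      proof -
        have "exp (S z) = exp (ln (fact k)) * exp 1 * (exp (real k * ln 4) * exp (real k * ln a) * exp (real k * (2 * ln (X z))))"
          by (simp only: exp_add[symmetric]) (simp add: S_def c0_def a_def algebra_simps)
        also have "exp (2 * ln (X z)) = (X z)\<^sup>2" using X1[of z] by (simp add: exp_double)
        then have "exp (real k * (2 * ln (X z))) = ((X z)\<^sup>2) ^ k" by (simp add: exp_of_nat_mult)
        moreover have "exp (real k * ln 4) = 4 ^ k" by (simp add: exp_of_nat_mult)
        moreover have "exp (real k * ln a) = a ^ k" using a1 by (simp add: exp_of_nat_mult)
        ultimately show ?thesis by (simp add: \<delta>_def power_mult_distrib)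
      qed
      have "norm ((deriv ^^ j) G z) \<le> exp (S z) * norm (G z)" if j: "j \<le> k" for j
      proof -
        have "norm ((deriv ^^ j) G z) \<le> norm (G z) * (fact j * exp 1 * (4 * (1 + - ln (norm (G z))) / \<delta>) ^ j)"
        proof (rule nonvanishing_higher_deriv_bound)
          show "G holomorphic_on ball z \<delta>" using hol sub sub2 by (meson holomorphic_on_subset subset_trans)
          show "norm (G w) \<le> 1" if "w \<in> ball z \<delta>" for w using le1 sub sub2 that by blast
        qed (use d nzb in auto)
        also have "\<dots> = norm (G z) * (fact j * exp 1 * (4 * a / \<delta>) ^ j)" by (simp add: a_def)
        also have "\<dots> \<le> norm (G z) * (fact k * exp 1 * (4 * a / \<delta>) ^ k)"
          using q1 j by (intro mult_left_mono mult_mono power_increasing fact_mono) auto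
        finally show ?thesis by (simp add: eS mult.commute)
      qed
      moreover have "0 \<le> S z"
        unfolding S_def using c00 a1 X1[of z] by (intro add_nonneg_nonneg mult_nonneg_nonneg) (auto simp: a_def)
      ultimately show ?thesis by blast
    qed
    show "\<exists>S. continuous_on (sphere 0 r) S \<and>
        (\<forall>z\<in>sphere 0 r. 0 \<le> S z \<and> (\<forall>j\<le>k. norm ((deriv ^^ j) G z) \<le> exp (S z) * norm (G z))) \<and>
        cmean 0 r S \<le> C * (1 + ln (1 + - ln (norm (G 0))))"
      using conS bnd mS unfolding A_def by blast
  qed
qed

subsection \<open>Wronskians\<close>

text \<open>Matrices whose dimensions are values are used because the number of functions is a list
  length, which will be the dimension of the span of the curve.\<close>

definition wronskian :: "(complex \<Rightarrow> complex) list \<Rightarrow> complex \<Rightarrow> complex" where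
  "wronskian gs z = Determinant.det (Matrix.mat (length gs) (length gs) (\<lambda>(i,j). (deriv ^^ i) (gs ! j) z))"

lemma wronskian_leibniz:
  "wronskian gs z = (\<Sum>p\<in>{p. p permutes {0..<length gs}}.
     of_int (sign p) * (\<Prod>i = 0..<length gs. (deriv ^^ i) (gs ! p i) z))"
proof -
  have "wronskian gs z = (\<Sum>p\<in>{p. p permutes {0..<length gs}}. of_int (sign p) *
      (\<Prod>i = 0..<length gs. Matrix.mat (length gs) (length gs) (\<lambda>(i,j). (deriv ^^ i) (gs ! j) z) $$ (i, p i)))"
    unfolding wronskian_def by (subst det_def'[of _ "length gs"]) auto
  also have "\<dots> = (\<Sum>p\<in>{p. p permutes {0..<length gs}}.
     of_int (sign p) * (\<Prod>i = 0..<length gs. (deriv ^^ i) (gs ! p i) z))"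
  proof (intro sum.cong arg_cong2[of _ _ _ _ times] prod.cong refl)
    fix p i assume "p \<in> {p. p permutes {0..<length gs}}" "i \<in> {0..<length gs}"
    then have "p i < length gs" "i < length gs" using permutes_in_image[of p "{0..<length gs}" i] by auto
    then show "Matrix.mat (length gs) (length gs) (\<lambda>(i,j). (deriv ^^ i) (gs ! j) z) $$ (i, p i) = (deriv ^^ i) (gs ! p i) z"
      by simp
  qed
  finally show ?thesis .
qed

lemma wronskian_cong:
  assumes "open S" "z \<in> S" "length gs = length hs"
    "\<And>j. j < length gs \<Longrightarrow> (gs ! j) holomorphic_on S" "\<And>j. j < length gs \<Longrightarrow> (hs ! j) holomorphic_on S"
    "\<And>j w. j < length gs \<Longrightarrow> w \<in> S \<Longrightarrow> (gs ! j) w = (hs ! j) w"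
  shows "wronskian gs z = wronskian hs z"
proof -
  have "Matrix.mat (length gs) (length gs) (\<lambda>(i,j). (deriv ^^ i) (gs ! j) z) =
        Matrix.mat (length hs) (length hs) (\<lambda>(i,j). (deriv ^^ i) (hs ! j) z)"
    by (intro eq_matI) (use assms in \<open>auto intro!: higher_deriv_transform_within_open\<close>)
  then show ?thesis by (simp add: wronskian_def)
qed

lemma holomorphic_wronskian:
  assumes "open S" "\<And>j. j < length gs \<Longrightarrow> (gs ! j) holomorphic_on S"
  shows "wronskian gs holomorphic_on S"
proof -
  have "(\<lambda>z. \<Sum>p\<in>{p. p permutes {0..<length gs}}.
     of_int (sign p) * (\<Prod>i = 0..<length gs. (deriv ^^ i) (gs ! p i) z)) holomorphic_on S"
  proof (intro holomorphic_on_sum holomorphic_on_mult holomorphic_on_const holomorphic_on_prod)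
    fix p i assume "p \<in> {p. p permutes {0..<length gs}}" "i \<in> {0..<length gs}"
    then have "p i < length gs" using permutes_in_image[of p "{0..<length gs}" i] by auto
    then show "(\<lambda>z. (deriv ^^ i) (gs ! p i) z) holomorphic_on S"
      using assms by (intro holomorphic_higher_deriv) auto
  qed
  then show ?thesis unfolding wronskian_leibniz[abs_def] .
qed

lemma norm_wronskian_le:
  assumes "\<And>i j. i < length gs \<Longrightarrow> j < length gs \<Longrightarrow> norm ((deriv ^^ i) (gs ! j) z) \<le> B j"
    "\<And>j. j < length gs \<Longrightarrow> 0 \<le> B j"
  shows "norm (wronskian gs z) \<le> fact (length gs) * (\<Prod>j<length gs. B j)"
proof -
  let ?n = "length gs"
  have "norm (wronskian gs z) \<le> (\<Sum>p\<in>{p. p permutes {0..<?n}}. (\<Prod>j<?n. B j))"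
    unfolding wronskian_leibniz
  proof (rule sum_norm_le)
    fix p assume "p \<in> {p. p permutes {0..<?n}}"
    then have p: "p permutes {0..<?n}" by simp
    have "norm (of_int (sign p) * (\<Prod>i = 0..<?n. (deriv ^^ i) (gs ! p i) z))
       = (\<Prod>i = 0..<?n. norm ((deriv ^^ i) (gs ! p i) z))"
      by (simp add: norm_mult prod_norm sign_def)
    also have "\<dots> \<le> (\<Prod>i = 0..<?n. B (p i))"
      using assms(1) permutes_in_image[OF p] by (intro prod_mono) auto
    also have "\<dots> = (\<Prod>j = 0..<?n. B j)" by (rule prod.permute[OF p, symmetric, unfolded o_def])
    finally show "norm (of_int (sign p) * (\<Prod>i = 0..<?n. (deriv ^^ i) (gs ! p i) z)) \<le> (\<Prod>j<?n. B j)"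
      by (simp add: atLeast0LessThan)
  qed
  also have "\<dots> = fact ?n * (\<Prod>j<?n. B j)" by (simp add: card_permutations[OF refl])
  finally show ?thesis .
qed

lemma higher_deriv_lincomb:
  assumes "open S" "z \<in> S" "finite I" "\<And>l. l \<in> I \<Longrightarrow> h l holomorphic_on S"
  shows "(deriv ^^ i) (\<lambda>w. \<Sum>l\<in>I. c l * h l w) z = (\<Sum>l\<in>I. c l * (deriv ^^ i) (h l) z)"
  using assms(3,4)
proof (induction I rule: finite_induct)
  case empty
  then show ?case by simp
next
  case (insert a F)
  have "(deriv ^^ i) (\<lambda>w. \<Sum>l\<in>insert a F. c l * h l w) z = (deriv ^^ i) (\<lambda>w. c a * h a w + (\<Sum>l\<in>F. c l * h l w)) z"
    using insert.hyps by simp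
  also have "\<dots> = (deriv ^^ i) (\<lambda>w. c a * h a w) z + (deriv ^^ i) (\<lambda>w. \<Sum>l\<in>F. c l * h l w) z"
    by (rule higher_deriv_add[of _ S]) (use insert.prems assms(1,2) in \<open>auto intro!: holomorphic_intros\<close>)
  also have "(deriv ^^ i) (\<lambda>w. c a * h a w) z = c a * (deriv ^^ i) (h a) z"
    by (rule higher_deriv_cmult[of _ S]) (use insert.prems assms(1,2) in auto)
  finally show ?case using insert by simp
qed

text \<open>Constant coefficients commute with differentiation, so the derivative matrix of
  \<open>gs\<close> is that of \<open>hs\<close> times the coefficient matrix.\<close>

lemma wronskian_linear_change:
  assumes S: "open S" "z \<in> S" and len: "length gs = length hs"
    and hol: "\<And>j. j < length hs \<Longrightarrow> (hs ! j) holomorphic_on S"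
    and eq: "\<And>j w. j < length gs \<Longrightarrow> w \<in> S \<Longrightarrow> (gs ! j) w = (\<Sum>l<length hs. c j l * (hs ! l) w)"
  shows "wronskian gs z = Determinant.det (Matrix.mat (length hs) (length hs) (\<lambda>(l,j). c j l)) * wronskian hs z"
proof -
  let ?n = "length hs"
  have "(deriv ^^ i) (gs ! j) z = (\<Sum>l<?n. c j l * (deriv ^^ i) (hs ! l) z)" if "j < ?n" for i j
  proof -
    have "(deriv ^^ i) (\<lambda>w. \<Sum>l<?n. c j l * (hs ! l) w) z = (\<Sum>l<?n. c j l * (deriv ^^ i) (hs ! l) z)"
      by (rule higher_deriv_lincomb[of S]) (use S hol in auto)
    moreover have "(\<lambda>w. \<Sum>l<?n. c j l * (hs ! l) w) holomorphic_on S"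
      using hol by (intro holomorphic_intros) auto
    ultimately show ?thesis
      using higher_deriv_transform_within_open[of "gs ! j" S "\<lambda>w. \<Sum>l<?n. c j l * (hs ! l) w" z i] eq[of j] that len S
        holomorphic_transform[of "\<lambda>w. \<Sum>l<?n. c j l * (hs ! l) w" S "gs ! j"] by simp
  qed
  then have "Matrix.mat (length gs) (length gs) (\<lambda>(i,j). (deriv ^^ i) (gs ! j) z) =
     Matrix.mat ?n ?n (\<lambda>(i,j). (deriv ^^ i) (hs ! j) z) * Matrix.mat ?n ?n (\<lambda>(l,j). c j l)"
    by (intro eq_matI) (auto simp: len scalar_prod_def atLeast0LessThan mult.commute)
  then show ?thesis
    unfolding wronskian_def by (simp add: det_mult[of _ ?n] mult.commute)
qed

text \<open>By Leibniz's rule the derivative matrix of the products is that of \<open>gs\<close>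
  multiplied on the left by a lower triangular matrix with \<open>u z\<close> on the
  diagonal.\<close>

lemma wronskian_mult:
  assumes S: "open S" "z \<in> S" and u: "u holomorphic_on S"
    and hol: "\<And>j. j < length gs \<Longrightarrow> (gs ! j) holomorphic_on S"
  shows "wronskian (map (\<lambda>g w. u w * g w) gs) z = u z ^ length gs * wronskian gs z"
proof -
  let ?n = "length gs"
  define U where "U = Matrix.mat ?n ?n (\<lambda>(i,l). if l \<le> i then of_nat (i choose l) * (deriv ^^ (i - l)) u z else 0)"
  have "(deriv ^^ i) (\<lambda>w. u w * (gs ! j) w) z =
     (\<Sum>l = 0..<?n. (if l \<le> i then of_nat (i choose l) * (deriv ^^ (i - l)) u z else 0) * (deriv ^^ l) (gs ! j) z)"
    if "i < ?n" "j < ?n" for i j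
  proof -
    have "(deriv ^^ i) (\<lambda>w. (gs ! j) w * u w) z =
      (\<Sum>l = 0..i. of_nat (i choose l) * (deriv ^^ l) (gs ! j) z * (deriv ^^ (i - l)) u z)"
      by (rule higher_deriv_mult[of _ S]) (use S u hol that in auto)
    also have "\<dots> = (\<Sum>l = 0..i. (if l \<le> i then of_nat (i choose l) * (deriv ^^ (i - l)) u z else 0) * (deriv ^^ l) (gs ! j) z)"
      by (intro sum.cong) auto
    also have "\<dots> = (\<Sum>l = 0..<?n. (if l \<le> i then of_nat (i choose l) * (deriv ^^ (i - l)) u z else 0) * (deriv ^^ l) (gs ! j) z)"
      using that by (intro sum.mono_neutral_left) auto
    finally show ?thesis by (simp add: mult.commute)
  qed
  then have "Matrix.mat (length (map (\<lambda>g w. u w * g w) gs)) (length (map (\<lambda>g w. u w * g w) gs))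
       (\<lambda>(i,j). (deriv ^^ i) (map (\<lambda>g w. u w * g w) gs ! j) z) =
     U * Matrix.mat ?n ?n (\<lambda>(i,j). (deriv ^^ i) (gs ! j) z)"
    by (intro eq_matI) (auto simp: U_def scalar_prod_def)
  moreover have "Determinant.det U = u z ^ ?n"
  proof -
    have "Determinant.det U = prod_list (diag_mat U)"
      by (rule det_lower_triangular[of ?n]) (auto simp: U_def)
    also have "diag_mat U = replicate ?n (u z)"
      by (rule nth_equalityI) (auto simp: diag_mat_def U_def)
    finally show ?thesis by simp
  qed
  ultimately show ?thesis
    unfolding wronskian_def by (simp add: det_mult[of _ ?n] U_def)
qed

text \<open>The first column is a unit vector; Laplace expansion along it leaves the derivatives
  shifted by one row.\<close>

lemma wronskian_one_Cons: "wronskian ((\<lambda>_. 1) # us) z = wronskian (map deriv us) z"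
proof -
  let ?n = "length us"
  define A where "A = Matrix.mat (Suc ?n) (Suc ?n) (\<lambda>(i,j). (deriv ^^ i) (((\<lambda>_. 1) # us) ! j) z)"
  have A: "A \<in> carrier_mat (Suc ?n) (Suc ?n)" by (simp add: A_def)
  have col: "A $$ (i, 0) = (if i = 0 then 1 else 0)" if "i < Suc ?n" for i
    using that by (simp add: A_def)
  have "Determinant.det A = (\<Sum>i<Suc ?n. A $$ (i, 0) * cofactor A i 0)"
    by (rule laplace_expansion_column[OF A]) simp
  also have "\<dots> = (\<Sum>i<Suc ?n. if i = 0 then cofactor A 0 0 else 0)"
    by (intro sum.cong) (auto simp: col)
  also have "\<dots> = cofactor A 0 0" by simp
  also have "\<dots> = Determinant.det (mat_delete A 0 0)" by (simp add: cofactor_def)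
  also have "mat_delete A 0 0 = Matrix.mat ?n ?n (\<lambda>(i,j). (deriv ^^ i) (map deriv us ! j) z)"
    by (intro eq_matI) (auto simp: mat_delete_def A_def funpow_Suc_right simp del: funpow.simps)
  finally show ?thesis by (simp add: wronskian_def A_def)
qed

text \<open>Induction on the number of functions. Where the leading function \<open>g\<close> has no
  zero, dividing by it produces 1 and quotients whose derivatives again have Wronskian zero. A
  relation between these derivatives integrates to a constant, whose negative becomes the
  coefficient of \<open>g\<close>, and the identity theorem extends the relation from a ball to
  \<open>S\<close>.\<close>

theorem wronskian_zero_imp_dependent:
  assumes "open S" "connected S" "S \<noteq> {}" "\<And>j. j < length gs \<Longrightarrow> (gs ! j) holomorphic_on S"
    "\<And>z. z \<in> S \<Longrightarrow> wronskian gs z = 0"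
  shows "\<exists>c. (\<exists>j<length gs. c j \<noteq> (0::complex)) \<and> (\<forall>z\<in>S. (\<Sum>j<length gs. c j * (gs ! j) z) = 0)"
  using assms
proof (induction "length gs" arbitrary: gs S)
  case 0
  then show ?case by (auto simp: wronskian_def)
next
  case (Suc n)
  obtain g hs where gs: "gs = g # hs" using Suc.hyps(2) by (cases gs) auto
  have n: "n = length hs" using Suc.hyps(2) gs by simp
  have gh: "g holomorphic_on S" using Suc.prems(4)[of 0] gs by simp
  have hh: "(hs ! j) holomorphic_on S" if "j < n" for j using Suc.prems(4)[of "Suc j"] gs n that by simp
  show ?case
  proof (cases "\<forall>z\<in>S. g z = 0")
    case True
    have "(\<Sum>j<length gs. (if j = 0 then 1 else 0) * (gs ! j) z) = 0" if "z \<in> S" for z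
      by (rule sum.neutral) (use gs True that in auto)
    then show ?thesis using gs by (intro exI[of _ "\<lambda>j. if j = 0 then 1 else 0"]) auto
  next
    case False
    then obtain z1 where z1: "z1 \<in> S" "g z1 \<noteq> 0" by auto
    have "open (S \<inter> g -` (- {0}))"
      by (rule continuous_open_preimage[OF holomorphic_on_imp_continuous_on[OF gh] Suc.prems(1)]) auto
    then obtain e where e: "e > 0" "ball z1 e \<subseteq> S \<inter> g -` (- {0})"
      by (rule openE[of _ z1]) (use z1 in auto)
    define B where "B = ball z1 e"
    have B: "open B" "connected B" "B \<noteq> {}" "B \<subseteq> S" "\<And>z. z \<in> B \<Longrightarrow> g z \<noteq> 0"
      using e by (auto simp: B_def)
    define us where "us = map (\<lambda>h w. h w / g w) hs"
    have us: "length us = n" "\<And>j. j < n \<Longrightarrow> us ! j = (\<lambda>w. (hs ! j) w / g w)"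
      by (auto simp: us_def n)
    have ush: "(us ! j) holomorphic_on B" if "j < n" for j
      unfolding us(2)[OF that] using B hh[OF that] gh by (auto intro!: holomorphic_intros intro: holomorphic_on_subset)
    have "wronskian (map deriv us) z = 0" if z: "z \<in> B" for z
    proof -
      have "wronskian (map (\<lambda>h w. inverse (g w) * h w) gs) z = inverse (g z) ^ length gs * wronskian gs z"
        by (rule wronskian_mult[of B]) (use B z gh Suc.prems(4) in \<open>auto intro!: holomorphic_intros intro: holomorphic_on_subset\<close>)
      also have "\<dots> = 0" using Suc.prems(5) z B by auto
      finally have "wronskian (map (\<lambda>h w. inverse (g w) * h w) gs) z = 0" .
      moreover have "wronskian ((\<lambda>_. 1) # us) z = wronskian (map (\<lambda>h w. inverse (g w) * h w) gs) z"
      proof (rule wronskian_cong[of B])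
        fix j assume j: "j < length ((\<lambda>_. 1) # us)"
        show "(((\<lambda>_. 1) # us) ! j) holomorphic_on B"
          using j ush us(1) by (cases j) auto
        show "(map (\<lambda>h w. inverse (g w) * h w) gs ! j) holomorphic_on B"
          using j us(1) gs n gh hh B
          by (cases j) (auto intro!: holomorphic_intros intro: holomorphic_on_subset)
        show "(((\<lambda>_. 1) # us) ! j) w = (map (\<lambda>h w. inverse (g w) * h w) gs ! j) w" if "w \<in> B" for w
          using j us gs n B(5)[OF that] by (cases j) (auto simp: divide_inverse mult.commute)
      qed (use B z us gs n in auto)
      ultimately show ?thesis by (simp add: wronskian_one_Cons)
    qed
    moreover have "(map deriv us ! j) holomorphic_on B" if "j < length (map deriv us)" for j
      using ush us(1) that B(1) by (auto intro!: holomorphic_deriv)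
    ultimately have "\<exists>c. (\<exists>j<length (map deriv us). c j \<noteq> (0::complex)) \<and>
        (\<forall>z\<in>B. (\<Sum>j<length (map deriv us). c j * (map deriv us ! j) z) = 0)"
      by (intro Suc.hyps(1)) (use us(1) B in auto)
    then obtain c where c: "\<exists>j<n. c j \<noteq> 0" "\<And>z. z \<in> B \<Longrightarrow> (\<Sum>j<n. c j * (map deriv us ! j) z) = 0"
      using us(1) by fastforce
    have "\<exists>C. \<forall>z\<in>B. (\<Sum>j<n. c j * (us ! j) z) = C"
    proof -
      have D: "((\<lambda>z. \<Sum>j<n. c j * (us ! j) z) has_field_derivative 0) (at z)" if z: "z \<in> B" for z
      proof -
        have "((us ! j) has_field_derivative deriv (us ! j) z) (at z)" if "j < n" for j
          using ush[OF that] B(1) z by (meson holomorphic_derivI)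
        then have "((\<lambda>z. \<Sum>j<n. c j * (us ! j) z) has_field_derivative (\<Sum>j<n. c j * deriv (us ! j) z)) (at z)"
          by (intro DERIV_sum DERIV_cmult) auto
        moreover have "(\<Sum>j<n. c j * deriv (us ! j) z) = 0"
          using c(2)[OF z] us(1) by simp
        ultimately show ?thesis by simp
      qed
      show ?thesis
        by (rule has_field_derivative_zero_constant) (use D in \<open>auto simp: B_def intro: has_field_derivative_at_within\<close>)
    qed
    then obtain C where C: "\<And>z. z \<in> B \<Longrightarrow> (\<Sum>j<n. c j * (us ! j) z) = C" by blast
    define c' where "c' j = (case j of 0 \<Rightarrow> - C | Suc i \<Rightarrow> c i)" for j
    have sum': "(\<Sum>j<length gs. c' j * (gs ! j) z) = - C * g z + (\<Sum>j<n. c j * (hs ! j) z)" for z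
      unfolding gs by (simp add: sum.lessThan_Suc_shift c'_def n del: sum.lessThan_Suc)
    have onB: "(\<Sum>j<length gs. c' j * (gs ! j) z) = 0" if z: "z \<in> B" for z
    proof -
      have "(\<Sum>j<n. c j * (hs ! j) z) = g z * (\<Sum>j<n. c j * (us ! j) z)"
        using B(5)[OF z] us(2) by (simp add: sum_distrib_left)
      then show ?thesis using sum' C[OF z] by simp
    qed
    have "(\<Sum>j<length gs. c' j * (gs ! j) z) = 0" if z: "z \<in> S" for z
    proof (rule analytic_continuation_open[of B S "\<lambda>z. \<Sum>j<length gs. c' j * (gs ! j) z" "\<lambda>_. 0"])
      show "(\<lambda>z. \<Sum>j<length gs. c' j * (gs ! j) z) holomorphic_on S"
        using Suc.prems(4) by (intro holomorphic_intros) auto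
    qed (use B Suc.prems z onB in auto)
    moreover have "\<exists>j<length gs. c' j \<noteq> 0"
    proof -
      obtain j where "j < n" "c j \<noteq> 0" using c by blast
      then show ?thesis using gs n by (intro exI[of _ "Suc j"]) (auto simp: c'_def)
    qed
    ultimately show ?thesis by blast
  qed
qed

text \<open>The exponent \<open>o1 - i\<close> is truncated subtraction: once the zero is used up,
  differentiation acts on \<open>H\<close> alone, which is the case \<open>m = 0\<close> in the
  definition of \<open>H'\<close>.\<close>

lemma higher_deriv_factor:
  assumes S: "open S" and h: "h holomorphic_on S"
  shows "\<exists>H. H holomorphic_on S \<and> (\<forall>w\<in>S. (deriv ^^ i) (\<lambda>w. (w - a) ^ o1 * h w) w = (w - a) ^ (o1 - i) * H w)"
proof (induction i)
  case 0
  then show ?case using h by auto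
next
  case (Suc i)
  then obtain H where H: "H holomorphic_on S"
    "\<And>w. w\<in>S \<Longrightarrow> (deriv ^^ i) (\<lambda>w. (w - a) ^ o1 * h w) w = (w - a) ^ (o1 - i) * H w" by blast
  define m where "m = o1 - i"
  define H' where "H' w = (if m = 0 then deriv H w else of_nat m * H w + (w - a) * deriv H w)" for w
  have H'h: "H' holomorphic_on S"
    unfolding H'_def using H(1) S by (cases "m = 0") (auto intro!: holomorphic_intros holomorphic_deriv)
  have "(deriv ^^ Suc i) (\<lambda>w. (w - a) ^ o1 * h w) w = (w - a) ^ (o1 - Suc i) * H' w" if w: "w \<in> S" for w
  proof -
    have "(deriv ^^ Suc i) (\<lambda>w. (w - a) ^ o1 * h w) w = deriv ((deriv ^^ i) (\<lambda>w. (w - a) ^ o1 * h w)) w" by simp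
    also have "\<dots> = deriv (\<lambda>w. (w - a) ^ m * H w) w"
    proof (rule complex_derivative_transform_within_open[OF _ _ S w])
      show "(deriv ^^ i) (\<lambda>w. (w - a) ^ o1 * h w) holomorphic_on S"
        using S h by (intro holomorphic_higher_deriv holomorphic_intros) auto
      show "(\<lambda>w. (w - a) ^ m * H w) holomorphic_on S" using H(1) by (intro holomorphic_intros)
    qed (use H(2) m_def in auto)
    also have "\<dots> = (w - a) ^ (o1 - Suc i) * H' w"
    proof (rule DERIV_imp_deriv)
      have "(H has_field_derivative deriv H w) (at w)" using H(1) S w by (meson holomorphic_derivI)
      then have "((\<lambda>w. (w - a) ^ m * H w) has_field_derivative
           (of_nat m * (w - a) ^ (m - 1)) * H w + deriv H w * (w - a) ^ m) (at w)"
        by (auto intro!: derivative_eq_intros)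
      moreover have "(of_nat m * (w - a) ^ (m - 1)) * H w + deriv H w * (w - a) ^ m = (w - a) ^ (o1 - Suc i) * H' w"
      proof (cases m)
        case 0
        then show ?thesis by (simp add: H'_def m_def)
      next
        case (Suc l)
        then have "o1 - Suc i = l" by (simp add: m_def)
        then show ?thesis using Suc by (simp add: H'_def algebra_simps)
      qed
      ultimately show "((\<lambda>w. (w - a) ^ m * H w) has_field_derivative (w - a) ^ (o1 - Suc i) * H' w) (at w)" by simp
    qed
    finally show ?thesis .
  qed
  then show ?case using H'h by blast
qed

text \<open>Differentiation lowers the order of a zero by at most one; hence \<open>g\<^sub>j\<close> contributes
  at least its order truncated by the highest order of differentiation.\<close>

lemma wronskian_order:
  assumes S: "open S" and n: "length gs = Suc k"
    and hol: "\<And>j. j < length gs \<Longrightarrow> h j holomorphic_on S"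
    and eq: "\<And>j w. j < length gs \<Longrightarrow> w \<in> S \<Longrightarrow> (gs ! j) w = (w - a) ^ e j * h j w"
  shows "\<exists>H. H holomorphic_on S \<and> (\<forall>w\<in>S. wronskian gs w = (w - a) ^ (\<Sum>j<length gs. e j - k) * H w)"
proof -
  let ?n = "length gs"
  define P where "P i j H \<longleftrightarrow> H holomorphic_on S \<and> (\<forall>w\<in>S. (deriv ^^ i) (gs ! j) w = (w - a) ^ (e j - i) * H w)"
    for i j and H :: "complex \<Rightarrow> complex"
  have P: "\<exists>H. P i j H" if j: "j < ?n" for i j
  proof -
    obtain H where H: "H holomorphic_on S"
      "\<And>w. w\<in>S \<Longrightarrow> (deriv ^^ i) (\<lambda>w. (w - a) ^ e j * h j w) w = (w - a) ^ (e j - i) * H w"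
      using higher_deriv_factor[OF S hol[OF j]] by blast
    have 1: "(\<lambda>w. (w - a) ^ e j * h j w) holomorphic_on S" by (intro holomorphic_intros hol[OF j])
    have 2: "(gs ! j) holomorphic_on S" using holomorphic_transform[OF 1] eq[OF j] by metis
    have "(deriv ^^ i) (gs ! j) w = (w - a) ^ (e j - i) * H w" if "w \<in> S" for w
      using higher_deriv_transform_within_open[OF 2 1 S that eq[OF j], of i] H(2)[OF that] by simp
    then show ?thesis using H unfolding P_def by blast
  qed
  define H where "H i j = (SOME H. P i j H)" for i j
  have "P i j (H i j)" if "j < ?n" for i j unfolding H_def by (rule someI_ex[OF P[OF that]])
  then have H: "\<And>i j. j < ?n \<Longrightarrow> H i j holomorphic_on S"
    "\<And>i j w. j < ?n \<Longrightarrow> w \<in> S \<Longrightarrow> (deriv ^^ i) (gs ! j) w = (w - a) ^ (e j - i) * H i j w"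
    unfolding P_def by auto
  \<comment> \<open>Row i lowers an exponent by i, which is at most \<open>k\<close>, so every
    factor of the Leibniz sum contains the power truncated by \<open>k\<close>. Over a permutation
    these powers multiply to the same total, and \<open>F\<close> collects what is left.\<close>
  define F where "F w = (\<Sum>p\<in>{p. p permutes {0..<?n}}. of_int (sign p) *
     (\<Prod>i = 0..<?n. (w - a) ^ ((e (p i) - i) - (e (p i) - k)) * H i (p i) w))" for w
  have pin: "p i < ?n" if "p permutes {0..<?n}" "i \<in> {0..<?n}" for p i
    using permutes_in_image[OF that(1), of i] that by auto
  have "F holomorphic_on S" unfolding F_def
    by (intro holomorphic_on_sum holomorphic_on_mult holomorphic_on_const holomorphic_on_prod
        holomorphic_on_power holomorphic_on_diff holomorphic_on_ident H(1)) (use pin in auto)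
  moreover have "wronskian gs w = (w - a) ^ (\<Sum>j<?n. e j - k) * F w" if w: "w \<in> S" for w
  proof -
    have "of_int (sign p) * (\<Prod>i = 0..<?n. (deriv ^^ i) (gs ! p i) w) =
      (w - a) ^ (\<Sum>j<?n. e j - k) * (of_int (sign p) *
       (\<Prod>i = 0..<?n. (w - a) ^ ((e (p i) - i) - (e (p i) - k)) * H i (p i) w))"
      if p: "p permutes {0..<?n}" for p
    proof -
      have "(\<Prod>i = 0..<?n. (deriv ^^ i) (gs ! p i) w) =
         (\<Prod>i = 0..<?n. (w - a) ^ (e (p i) - k) * ((w - a) ^ ((e (p i) - i) - (e (p i) - k)) * H i (p i) w))"
      proof (rule prod.cong)
        fix i assume i: "i \<in> {0..<?n}"
        then have "(e (p i) - k) + ((e (p i) - i) - (e (p i) - k)) = e (p i) - i" using n by auto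
        then have "(w - a) ^ (e (p i) - k) * (w - a) ^ ((e (p i) - i) - (e (p i) - k)) = (w - a) ^ (e (p i) - i)"
          by (metis power_add)
        then show "(deriv ^^ i) (gs ! p i) w = (w - a) ^ (e (p i) - k) * ((w - a) ^ ((e (p i) - i) - (e (p i) - k)) * H i (p i) w)"
          using H(2)[OF pin[OF p i] w, of i] by (simp only: mult.assoc[symmetric])
      qed simp
      also have "\<dots> = (\<Prod>i = 0..<?n. (w - a) ^ (e (p i) - k)) *
          (\<Prod>i = 0..<?n. (w - a) ^ ((e (p i) - i) - (e (p i) - k)) * H i (p i) w)"
        by (rule prod.distrib)
      also have "(\<Prod>i = 0..<?n. (w - a) ^ (e (p i) - k)) = (\<Prod>j = 0..<?n. (w - a) ^ (e j - k))"
        by (rule prod.permute[OF p, symmetric, unfolded o_def])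
      also have "\<dots> = (w - a) ^ (\<Sum>j<?n. e j - k)"
        by (simp add: power_sum atLeast0LessThan)
      finally show ?thesis by (simp only: mult.left_commute mult.assoc)
    qed
    then show ?thesis
      unfolding wronskian_leibniz F_def sum_distrib_left by (intro sum.cong) auto
  qed
  ultimately show ?thesis by blast
qed

no_notation Matrix.vec_index (infixl "$" 100)
no_notation fps_nth (infixl "$" 75)

subsection \<open>Harmonic majorants and growth\<close>

text \<open>These are the boundary functions whose harmonic extension is visibly the real part of a
  polynomial. They form an algebra because \<open>z * cnj z\<close> is constant on the circle, so
  Stone-Weierstrass solves the Dirichlet problem up to any error.\<close>

definition re_poly_on :: "real \<Rightarrow> (complex \<Rightarrow> real) \<Rightarrow> bool" where
  "re_poly_on R g \<longleftrightarrow> (\<exists>p. \<forall>z\<in>sphere 0 R. g z = Re (poly p z))"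

lemma re_poly_on_add: "re_poly_on R g \<Longrightarrow> re_poly_on R h \<Longrightarrow> re_poly_on R (\<lambda>z. g z + h z)"
  unfolding re_poly_on_def by (metis poly_add plus_complex.simps(1))

lemma re_poly_on_cmult:
  assumes "re_poly_on R g" shows "re_poly_on R (\<lambda>z. c * g z)"
proof -
  obtain p where "\<forall>z\<in>sphere 0 R. g z = Re (poly p z)" using assms re_poly_on_def by blast
  then show ?thesis unfolding re_poly_on_def
    by (intro exI[of _ "Polynomial.smult (of_real c) p"]) auto
qed

lemma re_poly_on_poly: "re_poly_on R (\<lambda>z. Re (poly p z))"
  unfolding re_poly_on_def by blast

lemma re_poly_on_cong:
  assumes "re_poly_on R g" "\<And>z. z \<in> sphere 0 R \<Longrightarrow> g z = h z" shows "re_poly_on R h"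
  using assms unfolding re_poly_on_def by metis

text \<open>On the circle a factor \<open>z * cnj z\<close> is the constant
  \<open>R\<^sup>2\<close>, which lowers both degrees; a pure power of \<open>cnj z\<close> has the
  same real part as its conjugate.\<close>

lemma re_poly_on_cnj_power: "re_poly_on R (\<lambda>z. Re (poly p z * cnj z ^ m))"
proof (induction p arbitrary: m)
  case 0
  then show ?case using re_poly_on_poly[of R 0] by simp
next
  case (pCons a p)
  have 1: "re_poly_on R (\<lambda>z. Re (a * cnj z ^ m))"
  proof (rule re_poly_on_cong[OF re_poly_on_poly[of R "Polynomial.monom (cnj a) m"]])
    fix z :: complex
    have "poly (Polynomial.monom (cnj a) m) z = cnj (a * cnj z ^ m)" by (simp add: poly_monom)
    then show "Re (poly (Polynomial.monom (cnj a) m) z) = Re (a * cnj z ^ m)" by (metis cnj.sel(1))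
  qed
  show ?case
  proof (cases m)
    case 0
    then show ?thesis using re_poly_on_poly[of R "pCons a p"] by simp
  next
    case (Suc l)
    have "re_poly_on R (\<lambda>z. R\<^sup>2 * Re (poly p z * cnj z ^ l))" by (intro re_poly_on_cmult pCons.IH)
    from re_poly_on_add[OF 1 this] show ?thesis
    proof (rule re_poly_on_cong)
      fix z :: complex assume "z \<in> sphere 0 R"
      then have "z * cnj z = of_real (R\<^sup>2)" using complex_norm_square[of z] by simp
      then have "poly (pCons a p) z * cnj z ^ m = a * cnj z ^ m + of_real (R\<^sup>2) * (poly p z * cnj z ^ l)"
        unfolding Suc by (simp add: algebra_simps)
      then show "Re (a * cnj z ^ m) + R\<^sup>2 * Re (poly p z * cnj z ^ l) = Re (poly (pCons a p) z * cnj z ^ m)"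
        by (simp only: plus_complex.simps Re_complex_of_real times_complex.simps Im_complex_of_real)
    qed
  qed
qed

lemma re_poly_on_cnj_poly: "re_poly_on R (\<lambda>z. Re (poly p z * cnj z ^ m * cnj (poly q z)))"
proof (induction q arbitrary: m)
  case 0
  then show ?case using re_poly_on_poly[of R 0] by simp
next
  case (pCons b q)
  have "re_poly_on R (\<lambda>z. Re (poly (Polynomial.smult (cnj b) p) z * cnj z ^ m) + Re (poly p z * cnj z ^ Suc m * cnj (poly q z)))"
    by (intro re_poly_on_add re_poly_on_cnj_power pCons.IH)
  then show ?case
    by (rule re_poly_on_cong) (simp only: plus_complex.simps(1)[symmetric], simp add: algebra_simps)
qed

text \<open>Re a * Re b is half the sum of Re (a * b) and Re (a * cnj b).\<close>

lemma re_poly_on_mult: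
  assumes "re_poly_on R g" "re_poly_on R h" shows "re_poly_on R (\<lambda>z. g z * h z)"
proof -
  obtain p q where pq: "\<And>z. z\<in>sphere 0 R \<Longrightarrow> g z = Re (poly p z)" "\<And>z. z\<in>sphere 0 R \<Longrightarrow> h z = Re (poly q z)"
    using assms unfolding re_poly_on_def by blast
  have "re_poly_on R (\<lambda>z. (1/2) * Re (poly (p * q) z) + (1/2) * Re (poly p z * cnj z ^ 0 * cnj (poly q z)))"
    by (intro re_poly_on_add re_poly_on_cmult re_poly_on_poly re_poly_on_cnj_poly)
  then show ?thesis
    by (rule re_poly_on_cong) (simp add: pq algebra_simps)
qed

lemma real_polynomial_re_poly_on:
  fixes g :: "complex \<Rightarrow> real"
  assumes "real_polynomial_function g" shows "re_poly_on R g"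
  using assms
proof (induction rule: real_polynomial_function.induct)
  case (linear f)
  define c where "c = Complex (f 1) (- f \<i>)"
  have "f z = Re (poly [:0, c:] z)" for z
  proof -
    have "z = Re z *\<^sub>R 1 + Im z *\<^sub>R \<i>" by (simp add: complex_eq_iff)
    then have "f z = f (Re z *\<^sub>R 1 + Im z *\<^sub>R \<i>)" by (rule arg_cong)
    also have "\<dots> = Re z * f 1 + Im z * f \<i>"
      using linear by (simp add: linear_simps bounded_linear.linear linear_add linear_scale)
    finally show ?thesis by (simp add: c_def algebra_simps)
  qed
  then show ?case unfolding re_poly_on_def by blast
next
  case (const c)
  have "c = Re (poly [:of_real c:] z)" for z :: complex by simp
  then show ?case unfolding re_poly_on_def by blast
qed (auto intro: re_poly_on_add re_poly_on_mult)

lemma re_poly_approx: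
  assumes "continuous_on (sphere 0 R) u" "e > 0"
  obtains p where "p holomorphic_on (UNIV :: complex set)" "\<And>z. z \<in> sphere 0 R \<Longrightarrow> \<bar>u z - Re (p z)\<bar> < e"
proof -
  obtain g where g: "real_polynomial_function g" "\<And>z. z \<in> sphere 0 R \<Longrightarrow> \<bar>u z - g z\<bar> < e"
    using Stone_Weierstrass_real_polynomial_function[OF compact_sphere assms] by blast
  obtain p where p: "\<forall>z\<in>sphere 0 R. g z = Re (poly p z)"
    using real_polynomial_re_poly_on[OF g(1)] unfolding re_poly_on_def by blast
  have "poly p holomorphic_on UNIV"
    unfolding holomorphic_on_def field_differentiable_def using poly_DERIV by blast
  then show ?thesis using that[of "poly p"] g p by auto
qed

section \<open>The Hermitian product and the characteristic of a curve\<close>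

definition herm :: "complex ^ 'n \<Rightarrow> complex ^ 'n \<Rightarrow> complex" where
  "herm u v = (\<Sum>j\<in>UNIV. u $ j * cnj (v $ j))"

lemma herm_self: "herm v v = of_real ((norm v)\<^sup>2)"
proof -
  have "(norm v)\<^sup>2 = (\<Sum>j\<in>UNIV. (norm (v $ j))\<^sup>2)"
    unfolding norm_vec_def L2_set_def by (simp add: sum_nonneg)
  then show ?thesis unfolding herm_def by (simp add: complex_norm_square del: of_real_power)
qed

lemma norm_herm_le: "norm (herm u v) \<le> norm u * norm v"
proof -
  have "norm (herm u v) \<le> (\<Sum>j\<in>UNIV. norm (u $ j) * norm (v $ j))"
    unfolding herm_def by (rule order_trans[OF norm_sum]) (simp add: norm_mult)
  also have "\<dots> = (\<Sum>j\<in>UNIV. \<bar>norm (u $ j)\<bar> * \<bar>norm (v $ j)\<bar>)" by simp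
  also have "\<dots> \<le> norm u * norm v" unfolding norm_vec_def by (rule L2_set_mult_ineq)
  finally show ?thesis .
qed

lemma holomorphic_herm:
  assumes "\<And>j. (\<lambda>z. f z $ j) holomorphic_on S"
  shows "(\<lambda>z. herm (f z) v) holomorphic_on S"
  unfolding herm_def by (intro holomorphic_intros assms)

lemma continuous_on_vec:
  fixes f :: "complex \<Rightarrow> complex ^ 'n"
  assumes "\<And>j. (\<lambda>z. f z $ j) holomorphic_on S"
  shows "continuous_on S f"
proof -
  have "continuous_on S (\<lambda>z. \<chi> j. f z $ j)"
    by (intro continuous_on_vec_lambda holomorphic_on_imp_continuous_on assms)
  then show ?thesis by simp
qed

text \<open>Cartan's form of the characteristic, for a representation without common zeros;
  multiplying \<open>f\<close> by a zero-free holomorphic function does not change it.\<close>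

definition charT :: "(complex \<Rightarrow> complex ^ 'n) \<Rightarrow> real \<Rightarrow> real" where
  "charT f r = cmean 0 r (\<lambda>z. ln (norm (f z))) - ln (norm (f 0))"

lemma continuous_on_ln_vec:
  fixes f :: "complex \<Rightarrow> complex ^ 'n"
  assumes "\<And>j. (\<lambda>z. f z $ j) holomorphic_on S" "A \<subseteq> S" "\<And>z. z \<in> A \<Longrightarrow> f z \<noteq> 0"
  shows "continuous_on A (\<lambda>z. ln (norm (f z)))"
  by (rule continuous_on_ln_norm[OF continuous_on_subset[OF continuous_on_vec[OF assms(1)] assms(2)] assms(3)])

text \<open>\<open>Re p\<close> stands for the harmonic extension of \<open>ln (norm f)\<close> from
  the circle, up to \<eta>. Vector-valued subharmonicity is reduced to the maximum principle for the
  scalar function \<open>herm (f w) (f z) * exp (- p w)\<close> of w, evaluated at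
  \<open>w = z\<close>. Multiplication by \<open>exp (- p)\<close> will normalise \<open>f\<close>
  to norm at most 1.\<close>

lemma majorant:
  fixes f :: "complex \<Rightarrow> complex ^ 'n"
  assumes hol: "\<And>j. (\<lambda>z. f z $ j) holomorphic_on ball 0 R0" and R: "0 < R" "R < R0"
    and nz: "\<And>z. z \<in> sphere 0 R \<Longrightarrow> f z \<noteq> 0" and e: "\<eta> > 0"
  obtains p where "p holomorphic_on UNIV" "\<And>z. z \<in> cball 0 R \<Longrightarrow> norm (f z) \<le> exp (Re (p z))"
    "\<And>z. z \<in> sphere 0 R \<Longrightarrow> Re (p z) \<le> ln (norm (f z)) + \<eta>"
    "cmean 0 R (\<lambda>z. ln (norm (f z))) \<le> Re (p 0)" "Re (p 0) \<le> cmean 0 R (\<lambda>z. ln (norm (f z))) + \<eta>"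
proof -
  have sub: "sphere 0 R \<subseteq> ball (0::complex) R0" "cball 0 R \<subseteq> ball (0::complex) R0" using R by auto
  have con: "continuous_on (sphere 0 R) (\<lambda>z. ln (norm (f z)))"
    by (rule continuous_on_ln_vec[OF hol sub(1) nz])
  then have "continuous_on (sphere 0 R) (\<lambda>z. ln (norm (f z)) + \<eta> / 2)"
    by (rule continuous_on_add[OF _ continuous_on_const])
  then obtain p where p: "p holomorphic_on UNIV"
    "\<And>z. z \<in> sphere 0 R \<Longrightarrow> \<bar>ln (norm (f z)) + \<eta> / 2 - Re (p z)\<bar> < \<eta> / 2"
    using re_poly_approx[of R _ "\<eta> / 2"] e by (metis half_gt_zero)
  have p1: "ln (norm (f z)) \<le> Re (p z)" "Re (p z) \<le> ln (norm (f z)) + \<eta>" if "z \<in> sphere 0 R" for z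
    using p(2)[OF that] unfolding abs_less_iff by linarith+
  have maj: "norm (f z) \<le> exp (Re (p z))" if z: "z \<in> cball 0 R" for z
  proof (cases "f z = 0")
    case True then show ?thesis by simp
  next
    case False
    define g where "g w = herm (f w) (f z) * exp (- p w)" for w
    have gh: "g holomorphic_on cball 0 R" unfolding g_def
      by (intro holomorphic_intros holomorphic_herm)
         (use hol p(1) sub in \<open>auto intro: holomorphic_on_subset\<close>)
    have "norm (g z) \<le> norm (f z)"
    proof (rule maximum_modulus_frontier[of g "cball 0 R"])
      show "g holomorphic_on interior (cball 0 R)" using gh by (rule holomorphic_on_subset) auto
      show "continuous_on (closure (cball 0 R)) g" using gh by (simp add: holomorphic_on_imp_continuous_on)
      fix w :: complex assume "w \<in> frontier (cball 0 R)"
      then have w: "w \<in> sphere 0 R" using R by simp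
      have "norm (g w) \<le> norm (f w) * norm (f z) * exp (- Re (p w))"
        unfolding g_def norm_mult norm_exp_eq_Re using norm_herm_le[of "f w" "f z"]
        by (simp add: mult_right_mono)
      also have "\<dots> \<le> exp (Re (p w)) * norm (f z) * exp (- Re (p w))"
        using p1(1)[OF w] nz[OF w] by (intro mult_right_mono) (auto simp: ln_le_cancel_iff[symmetric] simp flip: ln_ge_iff)
      also have "\<dots> = norm (f z)" by (simp add: exp_minus)
      finally show "norm (g w) \<le> norm (f z)" .
    qed (use z in auto)
    then have "(norm (f z))\<^sup>2 * exp (- Re (p z)) \<le> norm (f z)"
      by (simp add: g_def herm_self norm_mult norm_power)
    then have "norm (f z) * exp (- Re (p z)) \<le> 1" using False by (simp add: power2_eq_square)
    then show ?thesis by (simp add: exp_minus divide_simps)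
  qed
  have conp: "continuous_on (sphere 0 R) (\<lambda>z. Re (p z))"
    using p(1) by (intro continuous_intros holomorphic_on_imp_continuous_on) (auto intro: holomorphic_on_subset)
  have mp: "cmean 0 R (\<lambda>z. Re (p z)) = Re (p 0)"
    by (rule cmean_Re_holomorphic)
       (use p(1) R in \<open>auto intro!: holomorphic_on_imp_continuous_on intro: holomorphic_on_subset\<close>)
  show ?thesis
  proof (rule that[OF p(1) maj p1(2)])
    show "cmean 0 R (\<lambda>z. ln (norm (f z))) \<le> Re (p 0)"
      unfolding mp[symmetric] by (rule cmean_mono[OF con conp]) (use R p1 in auto)
    have "Re (p 0) \<le> cmean 0 R (\<lambda>z. ln (norm (f z)) + \<eta>)"
      unfolding mp[symmetric] by (rule cmean_mono[OF conp]) (use R p1 con in \<open>auto intro!: continuous_intros\<close>)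
    then show "Re (p 0) \<le> cmean 0 R (\<lambda>z. ln (norm (f z))) + \<eta>"
      using R con by (subst (asm) cmean_add) auto
  qed
qed

lemma charT_mono:
  fixes f :: "complex \<Rightarrow> complex ^ 'n"
  assumes hol: "\<And>j. (\<lambda>z. f z $ j) holomorphic_on ball 0 R0" and R: "0 < r" "r \<le> R" "R < R0"
    and nz: "\<And>z. z \<in> ball 0 R0 \<Longrightarrow> f z \<noteq> 0"
  shows "charT f r \<le> charT f R"
proof -
  have "cmean 0 r (\<lambda>z. ln (norm (f z))) \<le> cmean 0 R (\<lambda>z. ln (norm (f z))) + \<eta>" if e: "\<eta> > 0" for \<eta>
  proof -
    have nzR: "f z \<noteq> 0" if "z \<in> sphere 0 R" for z using nz that R by auto
    obtain p where p: "p holomorphic_on UNIV" "\<And>z. z \<in> cball 0 R \<Longrightarrow> norm (f z) \<le> exp (Re (p z))"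
      "Re (p 0) \<le> cmean 0 R (\<lambda>z. ln (norm (f z))) + \<eta>"
    proof (rule majorant[of f R0 R \<eta>])
      show "0 < R" using R by simp
    qed (use hol R nzR e in auto)
    have "cmean 0 r (\<lambda>z. ln (norm (f z))) \<le> cmean 0 r (\<lambda>z. Re (p z))"
    proof (rule cmean_mono)
      show "continuous_on (sphere 0 r) (\<lambda>z. ln (norm (f z)))"
        by (rule continuous_on_ln_vec[OF hol]) (use nz R in auto)
      show "continuous_on (sphere 0 r) (\<lambda>z. Re (p z))"
        using p(1) by (intro continuous_intros holomorphic_on_imp_continuous_on) (auto intro: holomorphic_on_subset)
      fix z :: complex assume "z \<in> sphere 0 r"
      then have "norm (f z) \<le> exp (Re (p z))" "f z \<noteq> 0" using p(2)[of z] nz[of z] R by auto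
      then show "ln (norm (f z)) \<le> Re (p z)" by (metis ln_exp ln_le_cancel_iff exp_gt_zero zero_less_norm_iff)
    qed (use R in auto)
    also have "\<dots> = Re (p 0)"
      by (rule cmean_Re_holomorphic)
         (use p(1) R in \<open>auto intro!: holomorphic_on_imp_continuous_on intro: holomorphic_on_subset\<close>)
    finally show ?thesis using p(3) by linarith
  qed
  then have "cmean 0 r (\<lambda>z. ln (norm (f z))) \<le> cmean 0 R (\<lambda>z. ln (norm (f z)))" by (rule field_le_epsilon)
  then show ?thesis by (simp add: charT_def)
qed

lemma chordal_herm: "chordal v w = sqrt (1 - (norm (herm v w))\<^sup>2 / ((norm v)\<^sup>2 * (norm w)\<^sup>2))"
  by (simp add: chordal_def herm_def)

text \<open>The function \<open>ln |f| - 2 s\<^sup>2 |z|\<^sup>2\<close> is strictly superharmonic, since near a point \<open>z0\<close>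
  the norm of \<open>f\<close> is, up to second order, the modulus of the holomorphic function \<open>\<langle>f, f z0\<rangle>\<close>.\<close>

lemma majorant_gap:
  fixes f :: "complex \<Rightarrow> complex ^ 'n"
  assumes hol: "\<And>j. (\<lambda>z. f z $ j) holomorphic_on ball 0 R0" and R: "0 < R" "R < R0"
    and nz: "\<And>z. z \<in> ball 0 R0 \<Longrightarrow> f z \<noteq> 0" and s: "s > 0"
    and lip: "\<And>z. z \<in> ball 0 R0 \<Longrightarrow> \<exists>\<delta>>0. \<forall>w. norm (w - z) < \<delta> \<longrightarrow> chordal (f w) (f z) \<le> s * norm (w - z)"
    and p: "p holomorphic_on UNIV" "\<And>z. z \<in> sphere 0 R \<Longrightarrow> Re (p z) \<le> ln (norm (f z)) + \<eta>"
    and z: "z \<in> cball 0 R"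
  shows "Re (p z) \<le> ln (norm (f z)) + 2 * s\<^sup>2 * R\<^sup>2 + \<eta>"
proof -
  have conf: "continuous_on A (\<lambda>z. ln (norm (f z)))" if "A \<subseteq> ball 0 R0" for A
    by (rule continuous_on_ln_vec[OF hol that]) (use nz that in auto)
  have conp: "continuous_on A (\<lambda>z. Re (p z))" for A
    using p(1) by (intro continuous_intros holomorphic_on_imp_continuous_on) (auto intro: holomorphic_on_subset)
  define w where "w z = ln (norm (f z)) - 2 * s\<^sup>2 * (norm z)\<^sup>2 - Re (p z)" for z
  have conw: "continuous_on A w" if "A \<subseteq> ball 0 R0" for A
    unfolding w_def
    by (intro continuous_on_diff conf conp that continuous_on_mult continuous_on_const continuous_on_power
        continuous_on_norm continuous_on_id)
  obtain z0 where z0: "z0 \<in> cball 0 R" "\<And>z. z \<in> cball 0 R \<Longrightarrow> w z0 \<le> w z"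
    using continuous_attains_inf[OF compact_cball _ conw, of 0 R] R by (force simp: subset_iff)
  have "norm z0 = R"
  proof (rule ccontr)
    assume "norm z0 \<noteq> R"
    then have lt: "norm z0 < R" using z0 by auto
    have z0b: "z0 \<in> ball 0 R0" using lt R by auto
    have f0: "f z0 \<noteq> 0" by (rule nz[OF z0b])
    obtain \<delta> where d: "\<delta> > 0" "\<And>w. norm (w - z0) < \<delta> \<Longrightarrow> chordal (f w) (f z0) \<le> s * norm (w - z0)"
      using lip[OF z0b] by blast
    \<comment> \<open>The last term makes \<open>x = (s * \<rho>)\<^sup>2\<close> at most 1/4, so
      that \<open>ln (1 - x) \<ge> - 2 * x\<close> below.\<close>
    define \<rho> where "\<rho> = min (min (\<delta> / 2) ((R - norm z0) / 2)) (1 / (2 * s))"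
    have rho: "\<rho> > 0" "\<rho> < \<delta>" "\<rho> < R - norm z0" "s * \<rho> \<le> 1/2"
    proof -
      have le: "\<rho> \<le> \<delta> / 2" "\<rho> \<le> (R - norm z0) / 2" "\<rho> \<le> 1 / (2 * s)"
        unfolding \<rho>_def
        by (rule order_trans[OF min.cobounded1 min.cobounded1] order_trans[OF min.cobounded1 min.cobounded2] min.cobounded2)+
      show "\<rho> > 0" unfolding \<rho>_def using d(1) lt s by simp
      show "\<rho> < \<delta>" using le(1) d(1) by linarith
      have "(R - norm z0) / 2 < R - norm z0" using lt by simp
      then show "\<rho> < R - norm z0" using le(2) by linarith
      have "s * \<rho> \<le> s * (1 / (2 * s))" using le(3) s by (intro mult_left_mono) auto
      then show "s * \<rho> \<le> 1/2" using s by simp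
    qed
    have cb: "cball z0 \<rho> \<subseteq> cball 0 R"
    proof
      fix z assume "z \<in> cball z0 \<rho>"
      then have "norm (z0 - z) \<le> \<rho>" by (simp add: dist_norm)
      then show "z \<in> cball 0 R" using rho norm_triangle_ineq4[of z0 "z0 - z"] by simp
    qed
    have cb2: "cball z0 \<rho> \<subseteq> ball 0 R0" using cb R by auto
    have sp: "sphere z0 \<rho> \<subseteq> ball 0 R0" using cb2 by auto
    define L where "L z = herm (f z) (f z0)" for z
    define x where "x = (s * \<rho>)\<^sup>2"
    have x: "0 \<le> x" "x \<le> 1/4" using rho s power_mono[of "s * \<rho>" "1/2" 2] by (auto simp: x_def power2_eq_square)
    have key: "(1 - x) * ((norm (f z))\<^sup>2 * (norm (f z0))\<^sup>2) \<le> (norm (L z))\<^sup>2" if z: "z \<in> cball z0 \<rho>" for z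
    proof -
      have fz: "f z \<noteq> 0" using nz z cb2 by auto
      have nzr: "norm (z - z0) \<le> \<rho>" using z by (simp add: dist_norm norm_minus_commute)
      have "chordal (f z) (f z0) \<le> s * norm (z - z0)" using d(2)[of z] nzr rho by auto
      also have "\<dots> \<le> s * \<rho>" using s nzr by simp
      finally have "sqrt (1 - (norm (L z))\<^sup>2 / ((norm (f z))\<^sup>2 * (norm (f z0))\<^sup>2)) \<le> s * \<rho>"
        by (simp add: chordal_herm L_def)
      then have "1 - (norm (L z))\<^sup>2 / ((norm (f z))\<^sup>2 * (norm (f z0))\<^sup>2) \<le> x"
        unfolding x_def using sqrt_le_D by blast
      then have "1 - x \<le> (norm (L z))\<^sup>2 / ((norm (f z))\<^sup>2 * (norm (f z0))\<^sup>2)" by linarith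
      then show ?thesis using fz f0 by (simp add: pos_le_divide_eq)
    qed
    have Lnz: "L z \<noteq> 0" if z: "z \<in> cball z0 \<rho>" for z
    proof
      assume "L z = 0"
      moreover have "f z \<noteq> 0" using nz z cb2 by auto
      then have "0 < (1 - x) * ((norm (f z))\<^sup>2 * (norm (f z0))\<^sup>2)" using f0 x by simp
      ultimately show False using key[OF z] by simp
    qed
    have Lhol: "L holomorphic_on ball 0 R0" unfolding L_def by (rule holomorphic_herm[OF hol])
    have conL: "continuous_on (sphere z0 \<rho>) (\<lambda>z. ln (norm (L z)))"
      by (rule continuous_on_ln_norm)
         (use Lhol sp Lnz in \<open>auto intro!: holomorphic_on_imp_continuous_on intro: holomorphic_on_subset\<close>)
    have pt: "ln (norm (f z)) \<le> ln (norm (L z)) + (x - ln (norm (f z0)))" if z: "z \<in> sphere z0 \<rho>" for z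
    proof -
      have zc: "z \<in> cball z0 \<rho>" using z by auto
      have fz: "f z \<noteq> 0" using nz zc cb2 by auto
      have "ln ((1 - x) * ((norm (f z))\<^sup>2 * (norm (f z0))\<^sup>2)) \<le> ln ((norm (L z))\<^sup>2)"
        using key[OF zc] fz f0 x Lnz[OF zc] by (subst ln_le_cancel_iff) auto
      then have "ln (1 - x) + 2 * ln (norm (f z)) + 2 * ln (norm (f z0)) \<le> 2 * ln (norm (L z))"
        using fz f0 x Lnz[OF zc] by (simp add: ln_mult ln_realpow)
      moreover have "- x - 2 * x\<^sup>2 \<le> ln (1 - x)" by (rule ln_one_minus_pos_lower_bound) (use x in auto)
      moreover have "x\<^sup>2 \<le> x * (1/2)" unfolding power2_eq_square using x by (intro mult_left_mono) auto
      ultimately show ?thesis by linarith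
    qed
    have "cmean z0 \<rho> (\<lambda>z. ln (norm (f z))) \<le> cmean z0 \<rho> (\<lambda>z. ln (norm (L z)) + (x - ln (norm (f z0))))"
      by (rule cmean_mono) (use rho pt conL in \<open>auto intro!: continuous_intros conf[OF sp]\<close>)
    also have "\<dots> = ln (norm (L z0)) + (x - ln (norm (f z0)))"
      using rho conL cmean_ln_nonzero[OF Lhol cb2 rho(1) Lnz] by (subst cmean_add) auto
    also have "\<dots> = ln (norm (f z0)) + x"
      using f0 by (simp add: L_def herm_self norm_power ln_realpow)
    finally have m1: "cmean z0 \<rho> (\<lambda>z. ln (norm (f z))) \<le> ln (norm (f z0)) + x" .
    have m2: "cmean z0 \<rho> (\<lambda>z. (norm z)\<^sup>2) = (norm z0)\<^sup>2 + \<rho>\<^sup>2"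
    proof -
      define h where "h z = of_real ((norm z0)\<^sup>2 + \<rho>\<^sup>2) + 2 * cnj z0 * (z - z0)" for z
      have "cmean z0 \<rho> (\<lambda>z. (norm z)\<^sup>2) = cmean z0 \<rho> (\<lambda>z. Re (h z))"
      proof (rule cmean_cong)
        fix z assume "z \<in> sphere z0 \<rho>"
        then have "norm (z - z0) = \<rho>" by (simp add: dist_norm norm_minus_commute)
        then have "\<rho>\<^sup>2 = (norm (z - z0))\<^sup>2" by simp
        then show "(norm z)\<^sup>2 = Re (h z)"
          unfolding h_def cmod_power2 by (simp add: algebra_simps power2_eq_square)
      qed (use rho in auto)
      also have "\<dots> = Re (h z0)" unfolding h_def
        by (rule cmean_Re_holomorphic) (use rho in \<open>auto intro!: continuous_intros holomorphic_intros\<close>)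
      finally show ?thesis by (simp add: h_def)
    qed
    have m3: "cmean z0 \<rho> (\<lambda>z. Re (p z)) = Re (p z0)"
      by (rule cmean_Re_holomorphic)
         (use p(1) rho in \<open>auto intro!: holomorphic_on_imp_continuous_on intro: holomorphic_on_subset\<close>)
    \<comment> \<open>At a minimum the mean of \<open>w\<close> is at least \<open>w z0\<close>. But
      over this circle \<open>ln (norm f)\<close> gains at most \<open>x\<close>,
      \<open>Re p\<close> nothing, and |z|^2 gains \<open>\<rho>\<^sup>2\<close>, so the subtracted
      term with factor \<open>2 * s\<^sup>2\<close> costs \<open>2 * x\<close>.\<close>
    have "w z0 = cmean z0 \<rho> (\<lambda>_. w z0)" by simp
    also have "\<dots> \<le> cmean z0 \<rho> w"
      by (rule cmean_mono) (use rho conw[OF sp] z0(2) cb in auto)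
    also have "\<dots> = cmean z0 \<rho> (\<lambda>z. ln (norm (f z))) - 2 * s\<^sup>2 * cmean z0 \<rho> (\<lambda>z. (norm z)\<^sup>2) - cmean z0 \<rho> (\<lambda>z. Re (p z))"
      unfolding w_def using rho
      by (subst cmean_diff; (subst cmean_diff)?)
         (auto intro!: continuous_intros conf[OF sp] conp simp: cmean_cmult)
    also have "\<dots> \<le> w z0 - x" using m1 unfolding m2 m3 w_def x_def by (simp add: algebra_simps)
    finally have "x \<le> 0" by simp
    moreover have "x > 0" using s rho by (simp add: x_def)
    ultimately show False by simp
  qed
  then have "- \<eta> - 2 * s\<^sup>2 * R\<^sup>2 \<le> w z0" using p(2)[of z0] by (simp add: w_def)
  also have "\<dots> \<le> w z" by (rule z0(2)[OF z])
  also have "\<dots> \<le> ln (norm (f z)) - Re (p z)" by (simp add: w_def)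
  finally show ?thesis by linarith
qed

text \<open>The majorant at the centre is at least the mean over the circle, so the gap there bounds
  the characteristic.\<close>

lemma charT_growth:
  fixes f :: "complex \<Rightarrow> complex ^ 'n"
  assumes hol: "\<And>j. (\<lambda>z. f z $ j) holomorphic_on ball 0 R0" and R: "0 < R" "R < R0"
    and nz: "\<And>z. z \<in> ball 0 R0 \<Longrightarrow> f z \<noteq> 0" and s: "s > 0"
    and lip: "\<And>z. z \<in> ball 0 R0 \<Longrightarrow> \<exists>\<delta>>0. \<forall>w. norm (w - z) < \<delta> \<longrightarrow> chordal (f w) (f z) \<le> s * norm (w - z)"
  shows "charT f R \<le> 2 * s\<^sup>2 * R\<^sup>2"
proof (rule field_le_epsilon)
  fix \<eta> :: real assume e: "\<eta> > 0"
  have nzR: "f z \<noteq> 0" if "z \<in> sphere 0 R" for z using nz that R by auto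
  obtain p where p: "p holomorphic_on UNIV"
    "\<And>z. z \<in> sphere 0 R \<Longrightarrow> Re (p z) \<le> ln (norm (f z)) + \<eta>"
    "cmean 0 R (\<lambda>z. ln (norm (f z))) \<le> Re (p 0)"
  proof (rule majorant[of f R0 R \<eta>])
    show "(\<lambda>z. f z $ j) holomorphic_on ball 0 R0" for j by (rule hol)
  qed (use R nzR e in auto)
  have "Re (p 0) \<le> ln (norm (f 0)) + 2 * s\<^sup>2 * R\<^sup>2 + \<eta>"
    by (rule majorant_gap[OF hol R nz s lip p(1,2)]) (use R in auto)
  then show "charT f R \<le> 2 * s\<^sup>2 * R\<^sup>2 + \<eta>" using p(3) by (simp add: charT_def)
qed

lemma deriv_mult_exp_at:
  assumes "g holomorphic_on ball 0 R0" "p holomorphic_on UNIV" "z \<in> ball 0 R0"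
  shows "deriv (\<lambda>z. g z * exp (- p z)) z = (deriv g z - g z * deriv p z) * exp (- p z)"
proof -
  have "(g has_field_derivative deriv g z) (at z)"
    using assms by (meson holomorphic_derivI open_ball)
  moreover have "(p has_field_derivative deriv p z) (at z)"
    using assms by (meson holomorphic_derivI open_UNIV UNIV_I)
  ultimately have "((\<lambda>z. g z * exp (- p z)) has_field_derivative (deriv g z - g z * deriv p z) * exp (- p z)) (at z)"
    by (auto intro!: derivative_eq_intros simp: algebra_simps)
  then show ?thesis by (rule DERIV_imp_deriv)
qed

text \<open>The components of \<open>exp (- p) * f\<close> are bounded by 1, so by Cauchy their
  derivatives at 0 are at most 1/R. Their minor is that of \<open>f\<close> times
  \<open>exp (- 2 * p 0)\<close>, the derivative of \<open>p\<close> cancelling, and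
  \<open>Re (p 0)\<close> exceeds \<open>ln (norm (f 0))\<close> by at most the characteristic plus
  1. A minor bounded away from 0 thus forces the characteristic up to about (ln R)/2.\<close>

lemma charT_lower:
  fixes f :: "complex \<Rightarrow> complex ^ 'n"
  assumes hol: "\<And>j. (\<lambda>z. f z $ j) holomorphic_on ball 0 R0" and R: "0 < R" "R < R0"
    and nz: "\<And>z. z \<in> ball 0 R0 \<Longrightarrow> f z \<noteq> 0"
  shows "norm (deriv (\<lambda>z. f z $ i) 0 * f 0 $ j - f 0 $ i * deriv (\<lambda>z. f z $ j) 0) / (norm (f 0))\<^sup>2
    \<le> 2 / R * exp (2 * charT f R + 2)"
proof -
  have nzR: "f z \<noteq> 0" if "z \<in> sphere 0 R" for z using nz that R by auto
  obtain p where p: "p holomorphic_on UNIV" "\<And>z. z \<in> cball 0 R \<Longrightarrow> norm (f z) \<le> exp (Re (p z))"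
    "Re (p 0) \<le> cmean 0 R (\<lambda>z. ln (norm (f z))) + 1"
  proof (rule majorant[of f R0 R 1])
    show "(\<lambda>z. f z $ j) holomorphic_on ball 0 R0" for j by (rule hol)
  qed (use R nzR in auto)
  define G where "G i z = f z $ i * exp (- p z)" for i z
  have G1: "norm (G i z) \<le> 1" if "z \<in> cball 0 R" for i z
  proof -
    have "norm (G i z) = norm (f z $ i) * exp (- Re (p z))" by (simp add: G_def norm_mult norm_exp_eq_Re)
    also have "\<dots> \<le> exp (Re (p z)) * exp (- Re (p z))"
      using p(2)[OF that] Finite_Cartesian_Product.norm_nth_le[of "f z" i] by (intro mult_right_mono) auto
    finally show ?thesis by (simp add: exp_minus)
  qed
  have b0: "0 \<in> ball (0::complex) R0" using R by simp
  have dG: "norm (deriv (G i) 0) \<le> 1 / R" for i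
  proof -
    have hG: "G i holomorphic_on cball 0 R"
      unfolding G_def using R p(1)
      by (intro holomorphic_intros holomorphic_on_subset[OF hol]) (auto intro: holomorphic_on_subset)
    have "norm ((deriv ^^ 1) (G i) 0) \<le> fact 1 * 1 / R ^ 1"
      by (rule Cauchy_inequality)
         (use hG R G1 in \<open>auto intro: holomorphic_on_subset holomorphic_on_imp_continuous_on\<close>)
    then show ?thesis by simp
  qed
  have G': "deriv (G i) 0 = (deriv (\<lambda>z. f z $ i) 0 - f 0 $ i * deriv p 0) * exp (- p 0)" for i
    unfolding G_def by (rule deriv_mult_exp_at[OF hol p(1) b0])
  have "(deriv (\<lambda>z. f z $ i) 0 * f 0 $ j - f 0 $ i * deriv (\<lambda>z. f z $ j) 0) * exp (- p 0) * exp (- p 0)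
     = deriv (G i) 0 * G j 0 - G i 0 * deriv (G j) 0"
    unfolding G' by (simp add: G_def algebra_simps)
  also have "norm \<dots> \<le> 1 / R * 1 + 1 * (1 / R)"
  proof (rule order_trans[OF norm_triangle_ineq4])
    show "norm (deriv (G i) 0 * G j 0) + norm (G i 0 * deriv (G j) 0) \<le> 1 / R * 1 + 1 * (1 / R)"
      unfolding norm_mult using dG G1[of 0] R by (intro add_mono mult_mono) auto
  qed
  finally have A: "norm (deriv (\<lambda>z. f z $ i) 0 * f 0 $ j - f 0 $ i * deriv (\<lambda>z. f z $ j) 0) * (exp (- Re (p 0)))\<^sup>2 \<le> 2 / R"
    by (simp add: norm_mult norm_exp_eq_Re power2_eq_square mult.assoc)
  have f0: "f 0 \<noteq> 0" using nz b0 by blast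
  have "exp (Re (p 0)) \<le> exp (charT f R + 1 + ln (norm (f 0)))" using p(3) by (simp add: charT_def)
  also have "\<dots> = exp (charT f R + 1) * norm (f 0)" using f0 by (simp add: exp_add)
  finally have "(exp (Re (p 0)))\<^sup>2 \<le> (exp (charT f R + 1) * norm (f 0))\<^sup>2" by (intro power_mono) auto
  also have "\<dots> = exp (2 * charT f R + 2) * (norm (f 0))\<^sup>2"
    by (simp add: power_mult_distrib exp_double[symmetric])
  finally have B: "(exp (Re (p 0)))\<^sup>2 \<le> exp (2 * charT f R + 2) * (norm (f 0))\<^sup>2" .
  define D where "D = norm (deriv (\<lambda>z. f z $ i) 0 * f 0 $ j - f 0 $ i * deriv (\<lambda>z. f z $ j) 0)"
  have "D \<le> 2 / R * (exp (Re (p 0)))\<^sup>2"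
  proof -
    have "D * (exp (- Re (p 0)))\<^sup>2 * (exp (Re (p 0)))\<^sup>2 \<le> 2 / R * (exp (Re (p 0)))\<^sup>2"
      using A unfolding D_def[symmetric] by (rule mult_right_mono) simp
    moreover have "(exp (- Re (p 0)))\<^sup>2 * (exp (Re (p 0)))\<^sup>2 = 1"
      by (simp add: power_mult_distrib[symmetric] exp_minus)
    ultimately show ?thesis by (simp add: mult.assoc)
  qed
  also have "\<dots> \<le> 2 / R * (exp (2 * charT f R + 2) * (norm (f 0))\<^sup>2)"
    using B R by (intro mult_left_mono) auto
  finally show ?thesis using f0 unfolding D_def[symmetric] by (simp add: divide_simps mult_ac)
qed

subsection \<open>Linear forms modulo a subspace\<close>

lemma lform_add_left: "lform (a + b) v = lform a v + lform b v"
  by (simp add: lform_def sum.distrib algebra_simps)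

lemma lform_diff_left: "lform (a - b) v = lform a v - lform b v"
  by (simp add: lform_def sum_subtractf algebra_simps)

lemma lform_scale_left: "lform (c *s a) v = c * lform a v"
  by (simp add: lform_def sum_distrib_left algebra_simps)

lemma lform_scale_right: "lform a (c *s v) = c * lform a v"
  by (simp add: lform_def sum_distrib_left algebra_simps)

lemma lform_sum_left: "finite B \<Longrightarrow> lform (\<Sum>b\<in>B. f b) v = (\<Sum>b\<in>B. lform (f b) v)"
  by (induction B rule: finite_induct) (auto simp: lform_add_left, simp add: lform_def)

lemma lform_zero_right [simp]: "lform a 0 = 0"
  by (simp add: lform_def)

lemma lform_zero_left [simp]: "lform 0 v = 0"
  by (simp add: lform_def)

lemma lform_axis: "lform (axis j 1) v = v $ j"
proof -
  have "lform (axis j 1) v = (\<Sum>i\<in>UNIV. if i = j then v $ j else 0)"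
    unfolding lform_def by (intro sum.cong) (auto simp: axis_def)
  then show ?thesis by simp
qed

lemma norm_lform_le: "norm (lform a v) \<le> norm a * norm v"
proof -
  have "norm (lform a v) \<le> (\<Sum>j\<in>UNIV. norm (a $ j) * norm (v $ j))"
    unfolding lform_def by (rule order_trans[OF norm_sum]) (simp add: norm_mult)
  also have "\<dots> = (\<Sum>j\<in>UNIV. \<bar>norm (a $ j)\<bar> * \<bar>norm (v $ j)\<bar>)" by simp
  also have "\<dots> \<le> norm a * norm v" unfolding norm_vec_def by (rule L2_set_mult_ineq)
  finally show ?thesis .
qed

lemma holomorphic_lform:
  assumes "\<And>j. (\<lambda>z. f z $ j) holomorphic_on S"
  shows "(\<lambda>z. lform a (f z)) holomorphic_on S"
  unfolding lform_def by (intro holomorphic_intros assms)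

text \<open>With \<open>K\<close> the annihilator of a curve this is the rank of the forms
  restricted to the linear span of the curve; forms in \<open>K\<close> are the loops of the
  matroid.\<close>

definition form_rank :: "(complex ^ 'n) set \<Rightarrow> (nat \<Rightarrow> complex ^ 'n) \<Rightarrow> nat set \<Rightarrow> nat" where
  "form_rank K L R = vec.dim (K \<union> L ` R) - vec.dim K"

lemma dim_form_rank: "vec.dim (K \<union> L ` R) = vec.dim K + form_rank K L R"
proof -
  have "vec.dim K \<le> vec.dim (K \<union> L ` R)" by (rule vec.dim_subset) auto
  then show ?thesis by (simp add: form_rank_def)
qed

text \<open>Submodularity is the dimension formula for sum and intersection of two spans; the span
  belonging to \<open>A \<inter> B\<close> may be smaller than the intersection, whence only an
  inequality.\<close>

lemma rank_function_form_rank: "rank_function {..<q} (form_rank K L)"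
proof
  show "finite {..<q}" by simp
  show "form_rank K L {} = 0" by (simp add: form_rank_def)
  show "form_rank K L (insert x A) \<le> form_rank K L A + 1" for A x
  proof -
    have "vec.dim (K \<union> L ` insert x A) \<le> vec.dim (K \<union> L ` A) + 1"
      using vec.dim_insert[of "L x" "K \<union> L ` A"] by simp
    then show ?thesis unfolding dim_form_rank by simp
  qed
  show "form_rank K L A \<le> form_rank K L B" if "A \<subseteq> B" for A B
  proof -
    have "vec.dim (K \<union> L ` A) \<le> vec.dim (K \<union> L ` B)" by (rule vec.dim_subset) (use that in auto)
    then show ?thesis unfolding dim_form_rank by simp
  qed
  show "form_rank K L (A \<union> B) + form_rank K L (A \<inter> B) \<le> form_rank K L A + form_rank K L B" for A B
  proof -
    define S T where "S = vec.span (K \<union> L ` A)" and "T = vec.span (K \<union> L ` B)"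
    have sub: "vec.subspace S" "vec.subspace T" by (simp_all add: S_def T_def vec.subspace_span)
    have eq: "{x + y |x y. x \<in> S \<and> y \<in> T} = vec.span ((K \<union> L ` A) \<union> (K \<union> L ` B))"
      unfolding S_def T_def by (rule vec.span_Un[symmetric])
    have "(K \<union> L ` A) \<union> (K \<union> L ` B) = K \<union> L ` (A \<union> B)" by auto
    then have 1: "vec.dim {x + y |x y. x \<in> S \<and> y \<in> T} = vec.dim (K \<union> L ` (A \<union> B))"
      unfolding eq by simp
    have "K \<union> L ` (A \<inter> B) \<subseteq> S \<inter> T"
      using vec.span_superset[of "K \<union> L ` A"] vec.span_superset[of "K \<union> L ` B"] unfolding S_def T_def by auto
    then have 2: "vec.dim (K \<union> L ` (A \<inter> B)) \<le> vec.dim (S \<inter> T)" by (rule vec.dim_subset)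
    have "vec.dim {x + y |x y. x \<in> S \<and> y \<in> T} + vec.dim (S \<inter> T) = vec.dim S + vec.dim T"
      by (rule vec.dim_sums_Int[OF sub])
    moreover have "vec.dim S = vec.dim (K \<union> L ` A)" "vec.dim T = vec.dim (K \<union> L ` B)"
      by (simp_all add: S_def T_def)
    ultimately have "vec.dim (K \<union> L ` (A \<union> B)) + vec.dim (K \<union> L ` (A \<inter> B)) \<le> vec.dim (K \<union> L ` A) + vec.dim (K \<union> L ` B)"
      using 1 2 by linarith
    then show ?thesis unfolding dim_form_rank by simp
  qed
qed

lemma dim_full_span:
  fixes S :: "(complex ^ 'n) set"
  assumes "vec.dim S = CARD('n)" shows "vec.span S = UNIV"
proof -
  have "card (cart_basis :: (complex ^ 'n) set) = CARD('n)"
    using vec_dim_card[where 'a=complex and 'n='n] vec.dim_UNIV by metis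
  then have "vec.dim S = finite_dimensional_vector_space.dimension (cart_basis :: (complex ^ 'n) set)"
    using assms vec.dimension_def by metis
  then show ?thesis using vec.dim_eq_full by blast
qed

lemma form_rank_le: "form_rank K L (R :: nat set) \<le> CARD('n) - vec.dim (K :: (complex ^ 'n) set)"
  using dim_subset_UNIV_cart_gen[of "K \<union> L ` R"] dim_form_rank[of K L R] by linarith

lemma form_rank_full_span:
  fixes K :: "(complex ^ 'n) set"
  assumes "form_rank K L R = CARD('n) - vec.dim K" shows "vec.span (K \<union> L ` R) = UNIV"
proof (rule dim_full_span)
  show "vec.dim (K \<union> L ` R) = CARD('n)"
    using dim_form_rank[of K L R] assms dim_subset_UNIV_cart_gen[of K] by linarith
qed

section \<open>Ranks of hyperplanes in general position\<close>

lemma gp_full_subset: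
  fixes L :: "nat \<Rightarrow> complex ^ 'n"
  assumes gp: "general_position L q" and R: "R \<subseteq> {..<q}" "card R = CARD('n)"
  shows "inj_on L R" "vec.independent (L ` R)"
proof -
  have finR: "finite R" using R finite_subset by blast
  obtain \<sigma> where s: "bij_betw \<sigma> (UNIV :: 'n set) R"
    using finite_same_card_bij[of "UNIV :: 'n set" R] finR R by auto
  have injs: "inj \<sigma>" and ran: "range \<sigma> = R" using s by (auto simp: bij_betw_def)
  have dn: "Determinants.det (\<chi> j. L (\<sigma> j)) \<noteq> 0"
    using gp injs ran R unfolding general_position_def by auto
  have row: "Finite_Cartesian_Product.row i (\<chi> j. L (\<sigma> j)) = L (\<sigma> i)" for i
    by (simp add: Finite_Cartesian_Product.row_def vec_eq_iff)
  show "inj_on L R"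
  proof (rule inj_onI)
    fix x y assume xy: "x \<in> R" "y \<in> R" "L x = L y"
    then obtain i j where ij: "x = \<sigma> i" "y = \<sigma> j" using ran by blast
    have "i = j"
    proof (rule ccontr)
      assume "i \<noteq> j"
      then have "Determinants.det (\<chi> j. L (\<sigma> j)) = 0"
        by (rule Determinants.det_identical_rows) (use xy ij row in simp)
      then show False using dn by simp
    qed
    then show "x = y" using ij by simp
  qed
  have "Finite_Cartesian_Product.rows (\<chi> j. L (\<sigma> j)) = L ` R"
    unfolding Finite_Cartesian_Product.rows_def using row ran by auto
  then show "vec.independent (L ` R)" using det_dependent_rows dn by metis
qed

lemma gp_dim:
  fixes L :: "nat \<Rightarrow> complex ^ 'n"
  assumes gp: "general_position L q" and q: "CARD('n) \<le> q" and R: "R \<subseteq> {..<q}" "card R \<le> CARD('n)"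
  shows "vec.dim (L ` R) = card R"
proof -
  have finR: "finite R" using R finite_subset by blast
  have "CARD('n) - card R \<le> card ({..<q} - R)"
    using card_Diff_subset[OF finR R(1)] q by simp
  then obtain T where T: "T \<subseteq> {..<q} - R" "card T = CARD('n) - card R" "finite T"
    by (rule obtain_subset_with_card_n)
  have c: "card (R \<union> T) = CARD('n)" using T R finR by (subst card_Un_disjoint) auto
  have RT: "R \<union> T \<subseteq> {..<q}" using T R by auto
  note ind = gp_full_subset[OF gp RT c]
  have "vec.independent (L ` R)" using ind(2) by (rule vec.independent_mono) auto
  then have "vec.dim (L ` R) = card (L ` R)" by (rule vec.dim_eq_card_independent)
  also have "\<dots> = card R" using ind(1) by (intro card_image) (auto intro: inj_on_subset)
  finally show ?thesis .
qed

lemma gp_form_rank_full: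
  fixes L :: "nat \<Rightarrow> complex ^ 'n"
  assumes gp: "general_position L q" and q: "CARD('n) \<le> q" and R: "R \<subseteq> {..<q}" "card R \<ge> CARD('n)"
  shows "form_rank K L R = CARD('n) - vec.dim K"
proof -
  obtain R' where R': "R' \<subseteq> R" "card R' = CARD('n)" using R by (meson obtain_subset_with_card_n)
  have "CARD('n) = vec.dim (L ` R')" using gp_dim[OF gp q, of R'] R R' by auto
  also have "\<dots> \<le> vec.dim (K \<union> L ` R)" by (rule vec.dim_subset) (use R' in auto)
  finally have "vec.dim (K \<union> L ` R) = CARD('n)" using dim_subset_UNIV_cart_gen[of "K \<union> L ` R"] by simp
  then show ?thesis by (simp add: form_rank_def)
qed

text \<open>Supplies the defect \<open>c = vec.dim K\<close> for Nochka's weights. A set not of full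
  rank has fewer than \<open>CARD('n)\<close> members, hence is independent, and passing modulo
  \<open>K\<close> lowers its rank by at most the dimension of \<open>K\<close>.\<close>

lemma gp_card_le:
  fixes L :: "nat \<Rightarrow> complex ^ 'n"
  assumes gp: "general_position L q" and q: "CARD('n) \<le> q" and R: "R \<subseteq> {..<q}"
    and lt: "form_rank K L R < CARD('n) - vec.dim K"
  shows "card R \<le> form_rank K L R + vec.dim K"
proof -
  have "card R < CARD('n)" using gp_form_rank_full[OF gp q R, of K] lt by fastforce
  then have "card R = vec.dim (L ` R)" using gp_dim[OF gp q R] by simp
  also have "\<dots> \<le> vec.dim (K \<union> L ` R)" by (rule vec.dim_subset) auto
  finally show ?thesis unfolding dim_form_rank by simp
qed

section \<open>Spanning and independence of forms modulo \<open>K\<close>\<close>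

lemma span_forms_coeffs:
  assumes K: "vec.subspace K" and B: "finite B" and x: "x \<in> vec.span (K \<union> L ` B)"
  shows "\<exists>c. x - (\<Sum>b\<in>B. c b *s L b) \<in> K"
proof -
  define S where "S = {x. \<exists>c. x - (\<Sum>b\<in>B. c b *s L b) \<in> K}"
  have "vec.subspace S"
  proof (rule vec.subspaceI)
    show "0 \<in> S" unfolding S_def using vec.subspace_0[OF K] by (auto intro!: exI[of _ "\<lambda>_. 0"])
    fix x y assume "x \<in> S" "y \<in> S"
    then obtain c c' where c: "x - (\<Sum>b\<in>B. c b *s L b) \<in> K" "y - (\<Sum>b\<in>B. c' b *s L b) \<in> K" unfolding S_def by blast
    have "(x + y) - (\<Sum>b\<in>B. (c b + c' b) *s L b) = (x - (\<Sum>b\<in>B. c b *s L b)) + (y - (\<Sum>b\<in>B. c' b *s L b))"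
      by (simp add: vec.scale_left_distrib sum.distrib)
    then have "(x + y) - (\<Sum>b\<in>B. (c b + c' b) *s L b) \<in> K" using vec.subspace_add[OF K c] by metis
    then show "x + y \<in> S" unfolding S_def by (intro CollectI exI)
  next
    fix a x assume "x \<in> S"
    then obtain c where c: "x - (\<Sum>b\<in>B. c b *s L b) \<in> K" unfolding S_def by blast
    have "a *s x - (\<Sum>b\<in>B. (a * c b) *s L b) = a *s (x - (\<Sum>b\<in>B. c b *s L b))"
      by (simp add: vec.scale_right_diff_distrib vec.scale_sum_right)
    then have "a *s x - (\<Sum>b\<in>B. (a * c b) *s L b) \<in> K" using vec.subspace_scale[OF K c] by metis
    then show "a *s x \<in> S" unfolding S_def by (intro CollectI exI)
  qed
  moreover have "K \<union> L ` B \<subseteq> S"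
  proof
    fix x assume "x \<in> K \<union> L ` B"
    then show "x \<in> S"
    proof
      assume "x \<in> K" then show ?thesis unfolding S_def by (auto intro!: exI[of _ "\<lambda>_. 0"])
    next
      assume "x \<in> L ` B"
      then obtain i where i: "i \<in> B" "x = L i" by auto
      have "(\<Sum>b\<in>B. (if b = i then 1 else 0) *s L b) = (\<Sum>b\<in>B. if b = i then L i else 0)"
        by (intro sum.cong) auto
      also have "\<dots> = x" using i B by simp
      finally show ?thesis unfolding S_def using vec.subspace_0[OF K]
        by (auto intro!: exI[of _ "\<lambda>b. if b = i then 1 else 0"])
    qed
  qed
  ultimately have "vec.span (K \<union> L ` B) \<subseteq> S" by (intro vec.span_minimal)
  then show ?thesis using x unfolding S_def by auto
qed

text \<open>A relation with \<open>c i \<noteq> 0\<close> would express \<open>L i\<close> by the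
  other forms modulo \<open>K\<close>, and \<open>card B - 1\<close> forms would already have rank
  \<open>card B\<close>.\<close>

lemma form_basis_independent:
  assumes K: "vec.subspace K" and B: "finite B" and r: "form_rank K L B = card B"
    and rel: "(\<Sum>b\<in>B. c b *s L b) \<in> K" and i: "i \<in> B"
  shows "c i = 0"
proof (rule ccontr)
  assume c: "c i \<noteq> 0"
  define S where "S = vec.span (K \<union> L ` (B - {i}))"
  have sub: "vec.subspace S" by (simp add: S_def vec.subspace_span)
  have sup: "K \<union> L ` (B - {i}) \<subseteq> S" unfolding S_def by (rule vec.span_superset)
  have "c i *s L i = (\<Sum>b\<in>B. c b *s L b) - (\<Sum>b\<in>B - {i}. c b *s L b)"
    using sum.remove[OF B i, of "\<lambda>b. c b *s L b"] by simp
  also have "\<dots> \<in> S"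
  proof (rule vec.subspace_diff[OF sub])
    show "(\<Sum>b\<in>B. c b *s L b) \<in> S" using rel sup by auto
    show "(\<Sum>b\<in>B - {i}. c b *s L b) \<in> S"
      by (intro vec.subspace_sum[OF sub] vec.subspace_scale[OF sub]) (use sup in auto)
  qed
  finally have "inverse (c i) *s (c i *s L i) \<in> S" by (rule vec.subspace_scale[OF sub])
  then have Li: "L i \<in> S" using c by simp
  have "K \<union> L ` B = insert (L i) (K \<union> L ` (B - {i}))" using i by auto
  then have "vec.dim (K \<union> L ` B) = vec.dim (K \<union> L ` (B - {i}))"
    using Li unfolding S_def by (simp add: vec.dim_insert)
  then have "form_rank K L B = form_rank K L (B - {i})" by (simp add: form_rank_def)
  also have "\<dots> \<le> card (B - {i})"
  proof -
    obtain q where "B \<subseteq> {..<q}" using B finite_nat_iff_bounded by blast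
    then show ?thesis using rank_function.rk_le_card[OF rank_function_form_rank[of q K L], of "B - {i}"] by auto
  qed
  also have "\<dots> < card B" using B i by (rule card_Diff1_less)
  finally show False using r by simp
qed

lemma form_basis_no_loop:
  assumes "vec.subspace K" "finite B" "form_rank K L B = card B" "i \<in> B"
  shows "L i \<notin> K"
proof
  assume "L i \<in> K"
  moreover have "(\<Sum>b\<in>B. (if b = i then 1 else 0) *s L b) = (\<Sum>b\<in>B. if b = i then L i else 0)"
    by (intro sum.cong) auto
  ultimately have "(\<Sum>b\<in>B. (if b = i then 1 else 0) *s L b) \<in> K" using assms by simp
  from form_basis_independent[OF assms(1-3) this assms(4)] show False by simp
qed

text \<open>Each coordinate form is a combination of the \<open>L i\<close> modulo \<open>K\<close>,
  and \<open>K\<close> vanishes on \<open>v\<close>; the constant is read off from the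
  coefficients.\<close>

lemma span_forms_bound:
  fixes K :: "(complex ^ 'n) set"
  assumes K: "vec.subspace K" and A: "finite A" and full: "vec.span (K \<union> L ` A) = UNIV"
  shows "\<exists>c>0. \<forall>v. (\<forall>a\<in>K. lform a v = 0) \<longrightarrow> c * norm v \<le> (\<Sum>i\<in>A. norm (lform (L i) v))"
proof -
  have "\<exists>u. axis j 1 - (\<Sum>b\<in>A. u b *s L b) \<in> K" for j :: 'n
    by (rule span_forms_coeffs[OF K A]) (simp add: full)
  then obtain u where u: "\<And>j :: 'n. axis j 1 - (\<Sum>b\<in>A. u j b *s L b) \<in> K" by metis
  define M where "M = 1 + (\<Sum>j\<in>(UNIV :: 'n set). \<Sum>i\<in>A. norm (u j i))"
  have M: "M > 0" unfolding M_def by (simp add: add_pos_nonneg sum_nonneg)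
  have "norm v \<le> M * (\<Sum>i\<in>A. norm (lform (L i) v))" if v: "\<forall>a\<in>K. lform a v = 0" for v
  proof -
    define s where "s = (\<Sum>i\<in>A. norm (lform (L i) v))"
    have s0: "s \<ge> 0" unfolding s_def by (simp add: sum_nonneg)
    have "norm (v $ j) \<le> (\<Sum>i\<in>A. norm (u j i)) * s" for j
    proof -
      have "lform (axis j 1 - (\<Sum>b\<in>A. u j b *s L b)) v = 0" using v u by blast
      then have "v $ j = (\<Sum>b\<in>A. u j b * lform (L b) v)"
        by (simp add: lform_diff_left lform_axis lform_sum_left[OF A] lform_scale_left)
      then have "norm (v $ j) \<le> (\<Sum>b\<in>A. norm (u j b) * norm (lform (L b) v))"
        using norm_sum[of "\<lambda>b. u j b * lform (L b) v" A] by (simp add: norm_mult)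
      also have "\<dots> \<le> (\<Sum>b\<in>A. norm (u j b) * s)"
        unfolding s_def by (intro sum_mono mult_left_mono member_le_sum) (use A in auto)
      finally show ?thesis by (simp add: sum_distrib_right)
    qed
    then have "(\<Sum>j\<in>UNIV. norm (v $ j)) \<le> (\<Sum>j\<in>UNIV. (\<Sum>i\<in>A. norm (u j i)) * s)" by (intro sum_mono)
    also have "\<dots> = (\<Sum>j\<in>UNIV. (\<Sum>i\<in>A. norm (u j i))) * s" by (simp add: sum_distrib_right)
    also have "\<dots> \<le> M * s" unfolding M_def using s0 by (intro mult_right_mono) auto
    finally have "(\<Sum>j\<in>UNIV. norm (v $ j)) \<le> M * s" .
    moreover have "norm v \<le> (\<Sum>j\<in>UNIV. norm (v $ j))"
      unfolding norm_vec_def by (rule L2_set_le_sum) auto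
    ultimately show ?thesis by (simp add: s_def)
  qed
  then show ?thesis using M
    by (intro exI[of _ "1 / M"]) (auto simp: divide_simps mult.commute)
qed

subsection \<open>The second main theorem\<close>

text \<open>The multiplicity clause of \<open>orb_morphism\<close> for a single function. For finite
  \<open>k\<close> the zero function satisfies it; for infinite \<open>k\<close> it means that there
  are no zeros in \<open>S\<close>.\<close>

definition zero_mult :: "enat \<Rightarrow> (complex \<Rightarrow> complex) \<Rightarrow> complex set \<Rightarrow> bool" where
  "zero_mult k g S \<longleftrightarrow> (\<forall>z\<in>S. g z = 0 \<longrightarrow>
     (case k of \<infinity> \<Rightarrow> False | enat k \<Rightarrow> (\<forall>l<k. (deriv ^^ l) g z = 0)))"

definition inv_mult :: "enat \<Rightarrow> real" where
  "inv_mult k = (case k of \<infinity> \<Rightarrow> 0 | enat k \<Rightarrow> 1 / real k)"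

text \<open>At a zero the order N is at least the multiplicity, so n is at most
  \<open>n * inv_mult k * N\<close>, and truncation by \<open>n\<close> keeps at least the fraction
  \<open>1 - n * inv_mult k\<close> of the order. This is where the orbifold condition enters the
  counting.\<close>

lemma zorder_zero_mult:
  assumes hol: "g holomorphic_on ball 0 R" and a: "a \<in> ball 0 R" and z0: "z0 \<in> ball 0 R" "g z0 \<noteq> 0"
    and zm: "zero_mult k g (ball 0 R)" and k: "k \<ge> 1"
  shows "(1 - real n * inv_mult k) * real (nat (zorder g a)) \<le> real (nat (zorder g a) - n)"
proof (cases "g a = 0")
  case False
  have "\<exists>w\<in>ball 0 R. g w \<noteq> 0" using z0 by blast
  then have "zorder g a = 0"
    using zorder_exist_zero[OF hol open_ball connected_ball a] False by auto
  then show ?thesis by simp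
next
  case True
  then obtain m where m: "k = enat m" "\<And>l. l < m \<Longrightarrow> (deriv ^^ l) g a = 0"
    using zm a unfolding zero_mult_def by (cases k) auto
  have m1: "m \<ge> 1" using k m by (simp add: one_enat_def)
  have "\<exists>N. (deriv ^^ N) g a \<noteq> 0"
    using holomorphic_fun_eq_0_on_connected[OF hol open_ball connected_ball _ a z0(1)] z0(2) by blast
  then obtain N where N: "(deriv ^^ N) g a \<noteq> 0" "\<And>l. l < N \<Longrightarrow> (deriv ^^ l) g a = 0"
    using exists_least_iff[of "\<lambda>N. (deriv ^^ N) g a \<noteq> 0"] by blast
  have "zorder g a = int N"
    by (rule zorder_zero_eqI[OF hol open_ball a]) (use N in auto)
  moreover have "m \<le> N" using m N by (meson not_le)
  moreover have "real n \<le> real n * inv_mult k * real N"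
  proof -
    have "1 \<le> inv_mult k * real N" using m1 \<open>m \<le> N\<close> by (simp add: m inv_mult_def divide_simps)
    then show ?thesis using mult_left_mono[of 1 "inv_mult k * real N" "real n"] by (simp add: mult.assoc)
  qed
  ultimately show ?thesis by (simp add: algebra_simps of_nat_diff)
qed

text \<open>Otherwise dividing by \<open>(w - a) ^ p\<close> and letting w tend to \<open>a\<close>
  would give \<open>h a = 0\<close>.\<close>

lemma order_le_of_factor:
  assumes s: "s > 0" and h: "h holomorphic_on ball a s" "h a \<noteq> 0" and H: "H holomorphic_on ball a s"
    and eq: "\<And>w. w \<in> ball a s \<Longrightarrow> (w - a) ^ p * h w = (w - a) ^ e * H w"
  shows "e \<le> (p::nat)"
proof (rule ccontr)
  assume "\<not> e \<le> p"
  then have e: "e = p + (e - p)" "e - p > 0" by auto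
  have ev: "h w = (w - a) ^ (e - p) * H w" if w: "w \<in> ball a s - {a}" for w
  proof -
    have "(w - a) ^ p * h w = (w - a) ^ p * ((w - a) ^ (e - p) * H w)"
      using eq[of w] w e(1) by (metis DiffD1 mult.assoc power_add)
    then show ?thesis using w by auto
  qed
  have "isCont h a" "isCont H a"
    using h(1) H s by (auto intro!: continuous_on_interior[of "ball a s"] holomorphic_on_imp_continuous_on)
  then have L1: "h \<midarrow>a\<rightarrow> h a" and C2: "isCont (\<lambda>w. (w - a) ^ (e - p) * H w) a"
    by (auto intro!: continuous_intros isContD)
  have L2: "(\<lambda>w. (w - a) ^ (e - p) * H w) \<midarrow>a\<rightarrow> (a - a) ^ (e - p) * H a"
    using C2 by (simp only: isCont_def)
  have "(\<lambda>w. (w - a) ^ (e - p) * H w) \<midarrow>a\<rightarrow> h a"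
    by (rule Lim_transform_within_open[OF L1, of "ball a s"]) (use s ev in auto)
  then have "h a = (a - a) ^ (e - p) * H a" using L2 LIM_unique by blast
  then show False using h(2) e(2) by simp
qed

text \<open>Data attached to one possible span: \<open>K\<close> is its annihilator,
  \<open>d\<close> its linear dimension, \<open>w\<close> a family of Nochka weights, and
  \<open>bs\<close> a basis of the forms modulo \<open>K\<close> in which the Wronskian is written.
  No curve occurs, so the constants obtained below are uniform over all curves with that
  span.\<close>

locale weighted_forms =
  fixes L :: "nat \<Rightarrow> complex ^ 'n" and q :: nat and K :: "(complex ^ 'n) set" and w :: "nat \<Rightarrow> real"
    and m :: "nat \<Rightarrow> enat" and d :: nat and bs :: "nat list"
  assumes K: "vec.subspace K" and d_def: "d = CARD('n) - vec.dim K" and d1: "d \<ge> 1"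
    and w0: "\<And>i. i < q \<Longrightarrow> 0 \<le> w i"
    and wr: "\<And>R. R \<subseteq> {..<q} \<Longrightarrow> form_rank K L R < d \<Longrightarrow> sum w R \<le> real (form_rank K L R)"
    and full: "form_rank K L {..<q} = d"
    and bs: "distinct bs" "set bs \<subseteq> {..<q}" "length bs = d" "form_rank K L (set bs) = d"
    and m1: "\<And>i. i < q \<Longrightarrow> m i \<ge> 1"
begin

definition E where "E = {i. i < q \<and> L i \<notin> K}"

text \<open>The factor of the characteristic in the second main theorem: the weights reduced by the
  loss from truncating at \<open>d - 1\<close>, minus the share \<open>d\<close> of the
  Wronskian.\<close>

definition eps where "eps = (\<Sum>i\<in>E. w i * (1 - real (d - 1) * inv_mult (m i))) - real d"

definition Wr :: "(complex \<Rightarrow> complex ^ 'n) \<Rightarrow> complex \<Rightarrow> complex" where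
  "Wr G = wronskian (map (\<lambda>i z. lform (L i) (G z)) bs)"

text \<open>Nondegeneracy is demanded at the centre because Jensen's formula is applied to nonzero
  values at 0. \<open>Wr G 0 \<noteq> 0\<close> makes the curve span the whole common zero space of
  \<open>K\<close>.\<close>

definition admissible :: "real \<Rightarrow> (complex \<Rightarrow> complex ^ 'n) \<Rightarrow> bool" where
  "admissible R G \<longleftrightarrow> (\<forall>j. (\<lambda>z. G z $ j) holomorphic_on ball 0 R) \<and> (\<forall>z\<in>ball 0 R. G z \<noteq> 0) \<and>
     (\<forall>a\<in>K. \<forall>z\<in>ball 0 R. lform a (G z) = 0) \<and>
     (\<forall>i\<in>E. zero_mult (m i) (\<lambda>z. lform (L i) (G z)) (ball 0 R)) \<and>
     (\<forall>i\<in>E. lform (L i) (G 0) \<noteq> 0) \<and> Wr G 0 \<noteq> 0"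

sublocale rf: rank_function "{..<q}" "form_rank K L" by (rule rank_function_form_rank)

lemma finE: "finite E" by (simp add: E_def)
lemma Eq: "E \<subseteq> {..<q}" by (auto simp: E_def)

lemma basis_in_E:
  assumes "B \<subseteq> {..<q}" "form_rank K L B = card B" shows "B \<subseteq> E"
proof
  fix i assume "i \<in> B"
  moreover have "finite B" using assms finite_subset by blast
  ultimately show "i \<in> E" using form_basis_no_loop[OF K _ assms(2)] assms(1) by (auto simp: E_def)
qed

text \<open>The rank bound for \<open>w\<close> is available only on sets of rank below
  \<open>d\<close>. So the greedy argument runs on the indices with positive \<open>a\<close>, and
  its basis \<open>B0\<close> is completed to a basis \<open>B\<close> of all forms modulo
  \<open>K\<close>.\<close>

lemma weighted_basis:
  fixes a :: "nat \<Rightarrow> real"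
  assumes a0: "\<And>i. i \<in> E \<Longrightarrow> 0 \<le> a i" and lt: "form_rank K L {i\<in>E. a i > 0} < d"
  shows "\<exists>B0 B. B0 \<subseteq> {i\<in>E. a i > 0} \<and> B0 \<subseteq> B \<and> B \<subseteq> E \<and> card B = d \<and> form_rank K L B = d \<and>
     (\<Sum>i\<in>E. w i * a i) \<le> (\<Sum>i\<in>B0. a i)"
proof -
  define A where "A = {i\<in>E. a i > 0}"
  have Aq: "A \<subseteq> {..<q}" using Eq by (auto simp: A_def)
  have "\<exists>B0. B0 \<subseteq> A \<and> form_rank K L B0 = card B0 \<and> form_rank K L B0 = form_rank K L A \<and> (\<Sum>x\<in>A. w x * a x) \<le> sum a B0"
  proof (rule rf.greedy_basis[OF Aq])
    show "0 \<le> a x" if "x \<in> A" for x using that by (simp add: A_def)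
    show "sum w R \<le> real (form_rank K L R)" if "R \<subseteq> A" for R
      using rf.rk_mono[OF that Aq] lt that Aq by (intro wr) (auto simp: A_def)
  qed
  then obtain B0 where B0: "B0 \<subseteq> A" "form_rank K L B0 = card B0" "(\<Sum>x\<in>A. w x * a x) \<le> sum a B0" by blast
  have "B0 \<subseteq> {..<q}" using B0 Aq by blast
  from rf.extend_basis[OF this subset_refl B0(2)]
  obtain B where B: "B0 \<subseteq> B" "B \<subseteq> {..<q}" "form_rank K L B = card B" "form_rank K L B = form_rank K L {..<q}"
    by blast
  have "(\<Sum>i\<in>E. w i * a i) = (\<Sum>i\<in>A. w i * a i)"
  proof (rule sum.mono_neutral_right)
    show "\<forall>i\<in>E - A. w i * a i = 0" using a0 by (force simp: A_def)
  qed (use finE in \<open>auto simp: A_def\<close>)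
  then show ?thesis using B0 B full basis_in_E[OF B(2,3)] unfolding A_def by (intro exI[of _ B0] exI[of _ B]) auto
qed

text \<open>One constant serves all full-rank sets because there are finitely many of them. Hence
  the forms that are small at a point, relative to its norm, never have full rank together.\<close>

lemma forms_lower:
  obtains c where "0 < c" "c \<le> 1" "\<And>A v. A \<subseteq> {..<q} \<Longrightarrow> form_rank K L A = d \<Longrightarrow> v \<noteq> 0 \<Longrightarrow> \<forall>a\<in>K. lform a v = 0 \<Longrightarrow>
     \<exists>i\<in>A. c * norm v \<le> norm (lform (L i) v)"
proof -
  have ex: "\<exists>c>0. \<forall>v. (\<forall>a\<in>K. lform a v = 0) \<longrightarrow> c * norm v \<le> (\<Sum>i\<in>A. norm (lform (L i) v))"
    if "A \<subseteq> {..<q}" "form_rank K L A = d" for A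
  proof (rule span_forms_bound[OF K])
    show "finite A" using that finite_subset by blast
    show "vec.span (K \<union> L ` A) = UNIV" by (rule form_rank_full_span) (use that d_def in simp)
  qed
  define FA where "FA = {A. A \<subseteq> {..<q} \<and> form_rank K L A = d}"
  have finF: "finite FA" unfolding FA_def by simp
  have "\<forall>A. \<exists>c>0. A \<in> FA \<longrightarrow> (\<forall>v. (\<forall>a\<in>K. lform a v = 0) \<longrightarrow> c * norm v \<le> (\<Sum>i\<in>A. norm (lform (L i) v)))"
  proof
    fix A show "\<exists>c>0. A \<in> FA \<longrightarrow> (\<forall>v. (\<forall>a\<in>K. lform a v = 0) \<longrightarrow> c * norm v \<le> (\<Sum>i\<in>A. norm (lform (L i) v)))"
      using ex[of A] by (cases "A \<in> FA") (auto simp: FA_def intro: exI[of _ 1])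
  qed
  from choice[OF this] obtain c where c: "\<And>A. c A > 0" "\<And>A v. A \<in> FA \<Longrightarrow> (\<forall>a\<in>K. lform a v = 0) \<Longrightarrow> c A * norm v \<le> (\<Sum>i\<in>A. norm (lform (L i) v))"
    by blast
  define c1 where "c1 = Min (insert 1 (c ` FA))"
  have c1: "c1 > 0" "c1 \<le> 1" "\<And>A. A \<in> FA \<Longrightarrow> c1 \<le> c A"
    unfolding c1_def using finF c(1) by auto
  \<comment> \<open>Passing from a sum over at most \<open>q\<close> forms to a single one costs the
    factor \<open>Suc q\<close>; the 2 makes the contradiction strict.\<close>
  define c2 where "c2 = c1 / (2 * real (Suc q))"
  have c2: "0 < c2" "c2 \<le> 1" using c1 by (auto simp: c2_def divide_simps)
  show ?thesis
  proof (rule that[OF c2])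
    fix A v assume A: "A \<subseteq> {..<q}" "form_rank K L A = d" and v: "v \<noteq> (0 :: complex ^ 'n)" "\<forall>a\<in>K. lform a v = 0"
    show "\<exists>i\<in>A. c2 * norm v \<le> norm (lform (L i) v)"
    proof (rule ccontr)
      assume "\<not> ?thesis"
      then have lt: "norm (lform (L i) v) \<le> c2 * norm v" if "i \<in> A" for i using that by force
      have AF: "A \<in> FA" using A by (simp add: FA_def)
      have "c1 * norm v \<le> c A * norm v" using c1(3)[OF AF] by (intro mult_right_mono) auto
      also have "\<dots> \<le> (\<Sum>i\<in>A. norm (lform (L i) v))" by (rule c(2)[OF AF v(2)])
      also have "\<dots> \<le> (\<Sum>i\<in>A. c2 * norm v)" by (rule sum_mono[OF lt])
      also have "\<dots> = real (card A) * (c2 * norm v)" by simp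
      also have "\<dots> \<le> real (Suc q) * (c2 * norm v)"
        using card_mono[OF _ A(1)] c2 by (intro mult_right_mono) auto
      also have "\<dots> = c1 / 2 * norm v" unfolding c2_def by (simp del: of_nat_Suc)
      finally have "c1 * norm v \<le> c1 / 2 * norm v" .
      then show False using c1(1) v(1) by simp
    qed
  qed
qed

lemma forms_upper:
  obtains \<Lambda> where "1 \<le> \<Lambda>" "\<And>i v. i < q \<Longrightarrow> norm (lform (L i) v) \<le> \<Lambda> * norm v"
proof
  define \<Lambda> where "\<Lambda> = 1 + (\<Sum>i<q. norm (L i))"
  show "1 \<le> \<Lambda>" by (simp add: \<Lambda>_def sum_nonneg)
  fix i and v :: "complex ^ 'n" assume i: "i < q"
  have "norm (L i) \<le> (\<Sum>i<q. norm (L i))" by (rule member_le_sum) (use i in auto)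
  then have "norm (L i) \<le> \<Lambda>" by (simp add: \<Lambda>_def)
  then have "norm (L i) * norm v \<le> \<Lambda> * norm v" by (intro mult_right_mono) auto
  then show "norm (lform (L i) v) \<le> \<Lambda> * norm v" using norm_lform_le[of "L i" v] by linarith
qed

definition annihilated :: "real \<Rightarrow> (complex \<Rightarrow> complex ^ 'n) \<Rightarrow> bool" where
  "annihilated R G \<longleftrightarrow> (\<forall>j. (\<lambda>z. G z $ j) holomorphic_on ball 0 R) \<and> (\<forall>a\<in>K. \<forall>z\<in>ball 0 R. lform a (G z) = 0)"

text \<open>Modulo \<open>K\<close> the forms in \<open>bs\<close> are combinations of those in
  \<open>B\<close>, and \<open>K\<close> vanishes along \<open>G\<close>, so the two Wronskians
  differ by a determinant of constants. Finitely many sets \<open>B\<close> give a common bound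
  \<kappa>.\<close>

lemma Wr_change:
  "\<exists>\<kappa>\<ge>1. \<forall>B G R. B \<subseteq> {..<q} \<longrightarrow> form_rank K L B = d \<longrightarrow> card B = d \<longrightarrow> annihilated R G \<longrightarrow>
      (\<exists>k. norm k \<le> \<kappa> \<and> (\<forall>z\<in>ball 0 R. Wr G z = k * wronskian (map (\<lambda>i z. lform (L i) (G z)) (sorted_list_of_set B)) z))"
proof -
  have ex: "\<exists>k. \<forall>G R z. annihilated R G \<longrightarrow> z \<in> ball 0 R \<longrightarrow> Wr G z = k * wronskian (map (\<lambda>i z. lform (L i) (G z)) (sorted_list_of_set B)) z"
    if B: "B \<subseteq> {..<q}" "form_rank K L B = d" "card B = d" for B
  proof -
    have fB: "finite B" using B finite_subset by blast
    define ls where "ls = sorted_list_of_set B"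
    have ls: "distinct ls" "set ls = B" "length ls = d" using fB B by (auto simp: ls_def)
    have full: "vec.span (K \<union> L ` B) = UNIV" by (rule form_rank_full_span) (use B d_def in simp)
    have "\<exists>c. x - (\<Sum>b\<in>B. c b *s L b) \<in> K" for x
      by (rule span_forms_coeffs[OF K fB]) (simp add: full)
    then obtain c where c: "\<And>x. x - (\<Sum>b\<in>B. c x b *s L b) \<in> K" by metis
    define k where "k = Determinant.det (Matrix.mat d d (\<lambda>(l,j). c (L (bs ! j)) (ls ! l)))"
    show ?thesis
    proof (intro exI[of _ k] allI impI)
      fix G :: "complex \<Rightarrow> complex ^ 'n" and R :: real and z :: complex
      assume "annihilated R G" and z: "z \<in> ball 0 R"
      then have hol: "\<forall>j. (\<lambda>z. G z $ j) holomorphic_on ball 0 R" and ann: "\<forall>a\<in>K. \<forall>z\<in>ball 0 R. lform a (G z) = 0"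
        by (auto simp: annihilated_def)
      have "Wr G z = Determinant.det (Matrix.mat (length (map (\<lambda>i z. lform (L i) (G z)) ls)) (length (map (\<lambda>i z. lform (L i) (G z)) ls)) (\<lambda>(l,j). c (L (bs ! j)) (ls ! l)))
          * wronskian (map (\<lambda>i z. lform (L i) (G z)) ls) z"
        unfolding Wr_def
      proof (rule wronskian_linear_change[OF open_ball z])
        show "(map (\<lambda>i z. lform (L i) (G z)) ls ! j) holomorphic_on ball 0 R" if "j < length (map (\<lambda>i z. lform (L i) (G z)) ls)" for j
          using that hol by (auto intro!: holomorphic_lform)
        fix j and u :: complex assume j: "j < length (map (\<lambda>i z. lform (L i) (G z)) bs)" and u: "u \<in> ball 0 R"
        have "lform (L (bs ! j) - (\<Sum>b\<in>B. c (L (bs ! j)) b *s L b)) (G u) = 0" using c ann u by blast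
        then have "lform (L (bs ! j)) (G u) = (\<Sum>b\<in>B. c (L (bs ! j)) b * lform (L b) (G u))"
          by (simp add: lform_diff_left lform_sum_left[OF fB] lform_scale_left)
        also have "\<dots> = (\<Sum>l<length ls. c (L (bs ! j)) (ls ! l) * lform (L (ls ! l)) (G u))"
          using sum.reindex_bij_betw[OF bij_betw_nth[OF ls(1) refl ls(2)[symmetric]], symmetric] by simp
        finally show "(map (\<lambda>i z. lform (L i) (G z)) bs ! j) u =
           (\<Sum>l<length (map (\<lambda>i z. lform (L i) (G z)) ls). c (L (bs ! j)) (ls ! l) * (map (\<lambda>i z. lform (L i) (G z)) ls ! l) u)"
          using j by simp
      qed (use ls bs in auto)
      then show "Wr G z = k * wronskian (map (\<lambda>i z. lform (L i) (G z)) (sorted_list_of_set B)) z"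
        using ls by (simp add: k_def ls_def)
    qed
  qed
  define FB where "FB = {B. B \<subseteq> {..<q} \<and> form_rank K L B = d \<and> card B = d}"
  define P where "P B k \<longleftrightarrow> (\<forall>G R z. annihilated R G \<longrightarrow> z \<in> ball 0 R \<longrightarrow> Wr G z = k * wronskian (map (\<lambda>i z. lform (L i) (G z)) (sorted_list_of_set B)) z)" for B k
  define k where "k B = (SOME k. P B k)" for B
  have k: "P B (k B)" if "B \<in> FB" for B
    unfolding k_def by (rule someI_ex) (use ex[of B] that in \<open>auto simp: FB_def P_def\<close>)
  have finF: "finite FB" unfolding FB_def by simp
  define \<kappa> where "\<kappa> = Max (insert 1 ((\<lambda>B. norm (k B)) ` FB))"
  show ?thesis
  proof (intro exI[of _ \<kappa>] conjI allI impI)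
    show "1 \<le> \<kappa>" unfolding \<kappa>_def using finF by simp
    fix B and G :: "complex \<Rightarrow> complex ^ 'n" and R :: real
    assume B: "B \<subseteq> {..<q}" "form_rank K L B = d" "card B = d" and ann: "annihilated R G"
    have BF: "B \<in> FB" using B by (simp add: FB_def)
    have "norm (k B) \<le> \<kappa>" unfolding \<kappa>_def using finF BF by (intro Max_ge) auto
    then show "\<exists>k. norm k \<le> \<kappa> \<and> (\<forall>z\<in>ball 0 R. Wr G z = k * wronskian (map (\<lambda>i z. lform (L i) (G z)) (sorted_list_of_set B)) z)"
      using k[OF BF] ann unfolding P_def by (intro exI[of _ "k B"]) auto
  qed
qed

lemma holomorphic_Wr:
  assumes "\<And>j. (\<lambda>z. G z $ j) holomorphic_on ball 0 R"
  shows "Wr G holomorphic_on ball 0 R"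
  unfolding Wr_def by (rule holomorphic_wronskian) (auto intro!: holomorphic_lform assms)

text \<open>The weighted basis bound is applied to the truncated orders \<open>av\<close>. Forms
  with positive entry vanish at \<open>a\<close>, and \<open>G a \<noteq> 0\<close>, so they do not
  have full rank. In the basis obtained the Wronskian vanishes at \<open>a\<close> at least to the
  sum of the truncated orders.\<close>

lemma order_inequality:
  assumes adm: "admissible R G" and R: "R > 0" and a: "a \<in> ball 0 R"
  shows "(\<Sum>i\<in>E. w i * (1 - real (d - 1) * inv_mult (m i)) * real (nat (zorder (\<lambda>z. lform (L i) (G z)) a)))
     \<le> real (nat (zorder (Wr G) a))"
proof -
  define F where "F i z = lform (L i) (G z)" for i z
  define ord where "ord i = nat (zorder (F i) a)" for i
  have hol: "\<And>j. (\<lambda>z. G z $ j) holomorphic_on ball 0 R" and Gnz: "\<And>z. z \<in> ball 0 R \<Longrightarrow> G z \<noteq> 0"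
    and ann: "\<And>a z. a \<in> K \<Longrightarrow> z \<in> ball 0 R \<Longrightarrow> lform a (G z) = 0"
    and zm: "\<And>i. i \<in> E \<Longrightarrow> zero_mult (m i) (F i) (ball 0 R)"
    and F0: "\<And>i. i \<in> E \<Longrightarrow> F i 0 \<noteq> 0" and W0: "Wr G 0 \<noteq> 0"
    using adm unfolding admissible_def F_def by auto
  have b0: "0 \<in> ball (0::complex) R" using R by simp
  have Fh: "F i holomorphic_on ball 0 R" for i unfolding F_def by (rule holomorphic_lform[OF hol])
  define av where "av i = real (ord i - (d - 1))" for i
  have sub: "{i\<in>E. av i > 0} \<subseteq> {i\<in>E. F i a = 0}"
  proof
    fix i assume i: "i \<in> {i\<in>E. av i > 0}"
    then have "ord i > 0" by (simp add: av_def)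
    moreover have "\<exists>w\<in>ball 0 R. F i w \<noteq> 0" using F0 i b0 by blast
    ultimately have "F i a = 0"
      using zorder_exist_zero[OF Fh open_ball connected_ball a, of i] unfolding ord_def
      by (metis nat_0 less_numeral_extra(3))
    then show "i \<in> {i\<in>E. F i a = 0}" using i by simp
  qed
  obtain c where c: "0 < c" "\<And>A v. A \<subseteq> {..<q} \<Longrightarrow> form_rank K L A = d \<Longrightarrow> v \<noteq> 0 \<Longrightarrow> \<forall>a\<in>K. lform a v = 0 \<Longrightarrow>
     \<exists>i\<in>A. c * norm v \<le> norm (lform (L i) v)" using forms_lower by metis
  have rk: "form_rank K L {i\<in>E. av i > 0} < d"
  proof (rule ccontr)
    assume "\<not> ?thesis"
    then have "form_rank K L {i\<in>E. av i > 0} = d"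
      using form_rank_le[of K L "{i\<in>E. av i > 0}"] d_def by linarith
    then obtain i where "i \<in> {i\<in>E. av i > 0}" "c * norm (G a) \<le> norm (F i a)"
      using c(2)[of "{i\<in>E. av i > 0}" "G a"] Eq Gnz[OF a] ann a unfolding F_def by blast
    then have "c * norm (G a) \<le> 0" using sub by auto
    then show False using c(1) Gnz[OF a] by (simp add: mult_le_0_iff)
  qed
  obtain B0 B where B: "B0 \<subseteq> {i\<in>E. av i > 0}" "B0 \<subseteq> B" "B \<subseteq> E" "card B = d" "form_rank K L B = d"
     "(\<Sum>i\<in>E. w i * av i) \<le> (\<Sum>i\<in>B0. av i)"
    using weighted_basis[of av, OF _ rk] by (auto simp: av_def)
  have fB: "finite B" using B(3) finE finite_subset by blast
  have Bq: "B \<subseteq> {..<q}" using B(3) Eq by blast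
  have ann': "annihilated R G" using hol ann by (auto simp: annihilated_def)
  obtain \<kappa> where kap: "\<forall>B G R. B \<subseteq> {..<q} \<longrightarrow> form_rank K L B = d \<longrightarrow> card B = d \<longrightarrow> annihilated R G \<longrightarrow>
      (\<exists>k. norm k \<le> \<kappa> \<and> (\<forall>z\<in>ball 0 R. Wr G z = k * wronskian (map (\<lambda>i z. lform (L i) (G z)) (sorted_list_of_set B)) z))"
    using Wr_change by (elim exE conjE)
  from kap[rule_format, OF Bq B(5,4) ann'] obtain k where
    k0: "\<forall>z\<in>ball 0 R. Wr G z = k * wronskian (map (\<lambda>i z. lform (L i) (G z)) (sorted_list_of_set B)) z"
    by (elim exE conjE)
  then have k: "Wr G z = k * wronskian (map (\<lambda>i z. lform (L i) (G z)) (sorted_list_of_set B)) z"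
    if "z \<in> ball 0 R" for z using that by (rule bspec)
  define ls where "ls = sorted_list_of_set B"
  have ls: "distinct ls" "set ls = B" "length ls = d" using fB B by (auto simp: ls_def)
  have "\<exists>s h. s > 0 \<and> ball a s \<subseteq> ball 0 R \<and> h holomorphic_on ball a s \<and>
      (\<forall>u\<in>ball a s. F i u = (u - a) ^ ord i * h u \<and> h u \<noteq> 0)" if iE: "i \<in> E" for i
  proof -
    obtain s h where "s > 0" "ball a s \<subseteq> ball 0 R" "h holomorphic_on ball a s"
      "\<And>u. u \<in> ball a s \<Longrightarrow> F i u = (u - a) ^ nat (zorder (F i) a) * h u \<and> h u \<noteq> 0"
      using zorder_factor[OF Fh a F0[OF iE] b0] by blast
    then show ?thesis unfolding ord_def by blast
  qed
  then have "\<forall>i. \<exists>s h. i \<in> E \<longrightarrow> (s > 0 \<and> ball a s \<subseteq> ball 0 R \<and> h holomorphic_on ball a s \<and>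
      (\<forall>u\<in>ball a s. F i u = (u - a) ^ ord i * h u \<and> h u \<noteq> 0))" by blast
  from choice[OF this] obtain s where "\<forall>i. \<exists>h. i \<in> E \<longrightarrow> (s i > 0 \<and> ball a (s i) \<subseteq> ball 0 R \<and> h holomorphic_on ball a (s i) \<and>
      (\<forall>u\<in>ball a (s i). F i u = (u - a) ^ ord i * h u \<and> h u \<noteq> 0))" by blast
  from choice[OF this] obtain h where sh: "\<And>i. i \<in> E \<Longrightarrow> s i > 0 \<and> ball a (s i) \<subseteq> ball 0 R \<and> h i holomorphic_on ball a (s i) \<and>
      (\<forall>u\<in>ball a (s i). F i u = (u - a) ^ ord i * h i u \<and> h i u \<noteq> 0)"
    by blast
  obtain s0 h0 where s0: "s0 > 0" "ball a s0 \<subseteq> ball 0 R" "h0 holomorphic_on ball a s0"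
    "\<And>u. u \<in> ball a s0 \<Longrightarrow> Wr G u = (u - a) ^ nat (zorder (Wr G) a) * h0 u \<and> h0 u \<noteq> 0"
    using zorder_factor[OF holomorphic_Wr[OF hol] a W0 b0] by blast
  define t where "t = Min (insert s0 (s ` B))"
  have t: "t > 0" "t \<le> s0" "\<And>i. i \<in> B \<Longrightarrow> t \<le> s i"
    unfolding t_def using fB s0 sh B(3) by auto
  have "\<exists>H. H holomorphic_on ball a t \<and> (\<forall>u\<in>ball a t. wronskian (map F ls) u =
      (u - a) ^ (\<Sum>j<length (map F ls). ord (ls ! j) - (d - 1)) * H u)"
  proof (rule wronskian_order)
    show "length (map F ls) = Suc (d - 1)" using ls d1 by simp
    fix j assume j: "j < length (map F ls)"
    then have lB: "ls ! j \<in> B" using ls nth_mem by force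
    then have lE: "ls ! j \<in> E" using B by auto
    have tb: "ball a t \<subseteq> ball a (s (ls ! j))" using t(3)[OF lB] by auto
    show "h (ls ! j) holomorphic_on ball a t" using sh[OF lE] tb holomorphic_on_subset by blast
    show "(map F ls ! j) u = (u - a) ^ ord (ls ! j) * h (ls ! j) u" if "u \<in> ball a t" for u
      using sh[OF lE] tb that j by auto
  qed auto
  then obtain H where H: "H holomorphic_on ball a t" "\<And>u. u \<in> ball a t \<Longrightarrow> wronskian (map F ls) u =
      (u - a) ^ (\<Sum>j<length (map F ls). ord (ls ! j) - (d - 1)) * H u" by blast
  have sumB: "(\<Sum>j<length (map F ls). ord (ls ! j) - (d - 1)) = (\<Sum>i\<in>B. ord i - (d - 1))"
    using sum.reindex_bij_betw[OF bij_betw_nth[OF ls(1) refl ls(2)[symmetric]], of "\<lambda>i. ord i - (d - 1)"] by simp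
  have le: "(\<Sum>i\<in>B. ord i - (d - 1)) \<le> nat (zorder (Wr G) a)"
  proof (rule order_le_of_factor[OF t(1)])
    have tb: "ball a t \<subseteq> ball a s0" using t(2) by auto
    show "h0 holomorphic_on ball a t" using s0(3) tb holomorphic_on_subset by blast
    show "h0 a \<noteq> 0" using s0 by auto
    show "(\<lambda>u. k * H u) holomorphic_on ball a t" using H(1) by (intro holomorphic_intros)
    fix u assume u: "u \<in> ball a t"
    then have "(u - a) ^ nat (zorder (Wr G) a) * h0 u = Wr G u" using s0(4) tb by auto
    also have "\<dots> = k * wronskian (map F ls) u"
      using k[of u] u tb s0(2) unfolding ls_def F_def by blast
    also have "\<dots> = (u - a) ^ (\<Sum>i\<in>B. ord i - (d - 1)) * (k * H u)"
      unfolding H(2)[OF u] sumB by (rule mult.left_commute)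
    finally show "(u - a) ^ nat (zorder (Wr G) a) * h0 u = (u - a) ^ (\<Sum>i\<in>B. ord i - (d - 1)) * (k * H u)" .
  qed
  have "(\<Sum>i\<in>E. w i * (1 - real (d - 1) * inv_mult (m i)) * real (ord i)) \<le> (\<Sum>i\<in>E. w i * av i)"
  proof (rule sum_mono)
    fix i assume i: "i \<in> E"
    have "(1 - real (d - 1) * inv_mult (m i)) * real (ord i) \<le> av i"
      unfolding ord_def av_def
      by (rule zorder_zero_mult[OF Fh a b0 F0[OF i] zm[OF i]]) (use m1 i in \<open>auto simp: E_def\<close>)
    then have "w i * ((1 - real (d - 1) * inv_mult (m i)) * real (ord i)) \<le> w i * av i"
      using w0 i by (intro mult_left_mono) (auto simp: E_def)
    then show "w i * (1 - real (d - 1) * inv_mult (m i)) * real (ord i) \<le> w i * av i" by (simp add: mult.assoc)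
  qed
  also have "\<dots> \<le> (\<Sum>i\<in>B0. av i)" by (rule B)
  also have "\<dots> \<le> (\<Sum>i\<in>B. av i)" by (rule sum_mono2) (use fB B in \<open>auto simp: av_def\<close>)
  also have "\<dots> = real (\<Sum>i\<in>B. ord i - (d - 1))" by (simp add: av_def)
  also have "\<dots> \<le> real (nat (zorder (Wr G) a))" using le by linarith
  finally show ?thesis unfolding ord_def F_def .
qed

end

text \<open>Allows Jensen's formulas for several functions to be summed over one set
  \<open>Z\<close>; where \<open>g\<close> does not vanish the order is 0.\<close>

lemma jensen_superset:
  assumes "g holomorphic_on ball 0 R" "0 < r" "r < R" "\<And>z. z \<in> sphere 0 r \<Longrightarrow> g z \<noteq> 0" "g 0 \<noteq> 0"
    and Z: "finite Z" "Z \<subseteq> ball 0 r" "{a\<in>ball 0 r. g a = 0} \<subseteq> Z"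
  shows "cmean 0 r (\<lambda>z. ln (norm (g z))) = ln (norm (g 0)) +
           (\<Sum>a\<in>Z. real (nat (zorder g a)) * ln (r / norm a))"
proof -
  have "(\<Sum>a\<in>{a\<in>ball 0 r. g a = 0}. real (nat (zorder g a)) * ln (r / norm a)) =
     (\<Sum>a\<in>Z. real (nat (zorder g a)) * ln (r / norm a))"
  proof (rule sum.mono_neutral_left[OF Z(1) Z(3)])
    show "\<forall>a\<in>Z - {a\<in>ball 0 r. g a = 0}. real (nat (zorder g a)) * ln (r / norm a) = 0"
    proof
      fix a assume a: "a \<in> Z - {a\<in>ball 0 r. g a = 0}"
      then have ga: "g a \<noteq> 0" and aR: "a \<in> ball 0 R" using Z(2) assms(3) by auto
      have "\<exists>w\<in>ball 0 R. g w \<noteq> 0" using ga aR by blast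
      then have "zorder g a = 0"
        using zorder_exist_zero[OF assms(1) open_ball connected_ball aR] ga by auto
      then show "real (nat (zorder g a)) * ln (r / norm a) = 0" by simp
    qed
  qed
  then show ?thesis using jensen_formula[OF assms(1-5)] by simp
qed

context weighted_forms
begin

text \<open>The function \<open>v\<close> is the logarithm of the Wronskian minus the weighted
  logarithms of the forms. By \<open>order_inequality\<close> its zeros outweigh its poles, so
  Jensen's formula bounds \<open>v 0\<close> by the mean of \<open>v\<close>; on the circle
  \<open>v\<close> is at most \<open>- eps * ln (norm (G z))\<close> plus a constant and the
  functions \<open>S i\<close>. The first conjunct lets the same \<open>C\<close> bound the forms in
  later estimates.\<close>

theorem second_main_theorem:
  "\<exists>C>0. (\<forall>i v. i < q \<longrightarrow> norm (lform (L i) v) \<le> exp C * norm v) \<and> (\<forall>R r G. 2 \<le> r \<longrightarrow> 2 * r \<le> R \<longrightarrow> admissible R G \<longrightarrow> (\<forall>z\<in>ball 0 R. norm (G z) \<le> 1) \<longrightarrow>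
     (\<forall>z\<in>sphere 0 r. Wr G z \<noteq> 0 \<and> (\<forall>i\<in>E. lform (L i) (G z) \<noteq> 0)) \<longrightarrow>
     ln (norm (Wr G 0)) - (\<Sum>i\<in>E. w i * (1 - real (d - 1) * inv_mult (m i)) * ln (norm (lform (L i) (G 0))))
     \<le> - eps * cmean 0 r (\<lambda>z. ln (norm (G z))) + C * (1 + (\<Sum>i\<in>E. ln (1 + (C - ln (norm (lform (L i) (G 0))))))))"
proof -
  obtain c where c: "0 < c" "c \<le> 1" "\<And>A v. A \<subseteq> {..<q} \<Longrightarrow> form_rank K L A = d \<Longrightarrow> v \<noteq> 0 \<Longrightarrow> \<forall>a\<in>K. lform a v = 0 \<Longrightarrow>
     \<exists>i\<in>A. c * norm v \<le> norm (lform (L i) v)" using forms_lower by blast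
  obtain \<Lambda> where Lam: "1 \<le> \<Lambda>" "\<And>i v. i < q \<Longrightarrow> norm (lform (L i) v) \<le> \<Lambda> * norm v" using forms_upper by blast
  obtain \<kappa> where kap1: "\<kappa> \<ge> 1" and kap: "\<forall>B G R. B \<subseteq> {..<q} \<longrightarrow> form_rank K L B = d \<longrightarrow> card B = d \<longrightarrow> annihilated R G \<longrightarrow>
      (\<exists>k. norm k \<le> \<kappa> \<and> (\<forall>z\<in>ball 0 R. Wr G z = k * wronskian (map (\<lambda>i z. lform (L i) (G z)) (sorted_list_of_set B)) z))"
    using Wr_change by (elim exE conjE)
  obtain CL where CL: "CL > 0" and ldl: "\<forall>r G. 2 \<le> r \<longrightarrow> G holomorphic_on ball 0 (2 * r) \<longrightarrow> (\<forall>z\<in>ball 0 (2 * r). norm (G z) \<le> 1) \<longrightarrow>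
     G 0 \<noteq> 0 \<longrightarrow> (\<forall>z\<in>sphere 0 r. G z \<noteq> 0) \<longrightarrow>
     (\<exists>S. continuous_on (sphere 0 r) S \<and>
        (\<forall>z\<in>sphere 0 r. 0 \<le> S z \<and> (\<forall>j\<le>d-1. norm ((deriv ^^ j) G z) \<le> exp (S z) * norm (G z))) \<and>
        cmean 0 r S \<le> CL * (1 + ln (1 + - ln (norm (G 0)))))"
    using log_derivative_lemma[of "d - 1"] by (elim exE conjE)
  define lc lL where "lc = ln c" and "lL = ln \<Lambda>"
  have lcL: "lc \<le> 0" "lL \<ge> 0" using c Lam by (auto simp: lc_def lL_def)
  define Ws Ms where "Ws = (\<Sum>i\<in>E. w i)" and "Ms = (\<Sum>i\<in>E. w i * (real (d - 1) * inv_mult (m i)))"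
  have w0E: "w i \<ge> 0" if "i \<in> E" for i using w0 that by (auto simp: E_def)
  have im0: "inv_mult k \<ge> 0" for k by (auto simp: inv_mult_def split: enat.splits)
  have epsW: "eps = Ws - Ms - real d"
    by (simp add: eps_def Ws_def Ms_def algebra_simps sum_subtractf sum.distrib)
  have WM0: "Ws \<ge> 0" "Ms \<ge> 0"
    unfolding Ws_def Ms_def using w0E im0 by (auto intro!: sum_nonneg mult_nonneg_nonneg)
  define C2 where "C2 = ln \<kappa> + ln (fact d) + real d * lL - lc * Ws + lL * Ms"
  have C20: "C2 \<ge> 0"
  proof -
    have "lc * Ws \<le> 0" "0 \<le> lL * Ms" "0 \<le> real d * lL" "0 \<le> ln \<kappa>" "0 \<le> ln (fact d :: real)"
      using kap1 lcL WM0 by (auto simp: mult_nonpos_nonneg)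
    then show ?thesis unfolding C2_def by linarith
  qed
  define C where "C = C2 + CL * real (card E) + CL + lL + 1"
  have C: "C > 0" "C \<ge> CL" "C \<ge> lL" "C \<ge> C2 + CL * real (card E)"
    unfolding C_def using C20 CL lcL by (auto intro: add_nonneg_nonneg add_nonneg_pos)
  show ?thesis
  proof (intro exI[of _ C] conjI C(1) allI impI)
    show "norm (lform (L i) v) \<le> exp C * norm v" if "i < q" for i v
    proof -
      have "exp lL \<le> exp C" using C(3) by simp
      then have "\<Lambda> \<le> exp C" using Lam(1) by (simp add: lL_def)
      then have "\<Lambda> * norm v \<le> exp C * norm v" by (rule mult_right_mono) simp
      then show ?thesis using Lam(2)[OF that, of v] by linarith
    qed
    fix R r :: real and G :: "complex \<Rightarrow> complex ^ 'n"
    assume r: "2 \<le> r" "2 * r \<le> R" and adm: "admissible R G" and le1: "\<forall>z\<in>ball 0 R. norm (G z) \<le> 1"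
      and sph: "\<forall>z\<in>sphere 0 r. Wr G z \<noteq> 0 \<and> (\<forall>i\<in>E. lform (L i) (G z) \<noteq> 0)"
    define F where "F i z = lform (L i) (G z)" for i z
    have hol: "\<And>j. (\<lambda>z. G z $ j) holomorphic_on ball 0 R" and Gnz: "\<And>z. z \<in> ball 0 R \<Longrightarrow> G z \<noteq> 0"
      and ann: "\<And>a z. a \<in> K \<Longrightarrow> z \<in> ball 0 R \<Longrightarrow> lform a (G z) = 0"
      and F0: "\<And>i. i \<in> E \<Longrightarrow> F i 0 \<noteq> 0" and W0: "Wr G 0 \<noteq> 0"
      using adm unfolding admissible_def F_def by auto
    have Fh: "F i holomorphic_on ball 0 R" for i unfolding F_def by (rule holomorphic_lform[OF hol])
    have ann': "annihilated R G" using hol ann by (auto simp: annihilated_def)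
    have Fle: "norm (F i z) \<le> \<Lambda> * norm (G z)" if "i \<in> E" for i z
      using Lam(2) that unfolding F_def E_def by auto
    have r0: "0 < r" "r < R" using r by auto
    have b0: "0 \<in> ball (0::complex) R" using r0 by simp
    have spR: "sphere 0 r \<subseteq> ball (0::complex) R" using r0 by auto
    have Wh: "Wr G holomorphic_on ball 0 R" by (rule holomorphic_Wr[OF hol])
    have Fs: "F i z \<noteq> 0" if "i \<in> E" "z \<in> sphere 0 r" for i z using sph that by (auto simp: F_def)
    have Ws0: "Wr G z \<noteq> 0" if "z \<in> sphere 0 r" for z using sph that by auto
    have "\<forall>i. \<exists>S. i \<in> E \<longrightarrow> continuous_on (sphere 0 r) S \<and>
        (\<forall>z\<in>sphere 0 r. 0 \<le> S z \<and> (\<forall>j\<le>d-1. norm ((deriv ^^ j) (F i) z) \<le> exp (S z) * norm (F i z))) \<and>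
        cmean 0 r S \<le> CL * (1 + ln (1 + (lL - ln (norm (F i 0)))))"
    proof
      fix i
      show "\<exists>S. i \<in> E \<longrightarrow> continuous_on (sphere 0 r) S \<and>
        (\<forall>z\<in>sphere 0 r. 0 \<le> S z \<and> (\<forall>j\<le>d-1. norm ((deriv ^^ j) (F i) z) \<le> exp (S z) * norm (F i z))) \<and>
        cmean 0 r S \<le> CL * (1 + ln (1 + (lL - ln (norm (F i 0)))))"
      proof (cases "i \<in> E")
        case True
        \<comment> \<open>Division by \<Lambda> brings the form to norm at most 1, as the
          logarithmic derivative lemma requires; this is where \<open>lL\<close> comes from.\<close>
        define g where "g z = (1 / of_real \<Lambda>) * F i z" for z
        have sub: "ball 0 (2 * r) \<subseteq> ball (0::complex) R" using r by auto
        have gh: "g holomorphic_on ball 0 (2 * r)"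
          unfolding g_def by (intro holomorphic_intros holomorphic_on_subset[OF Fh sub])
        have gle: "\<forall>z\<in>ball 0 (2 * r). norm (g z) \<le> 1"
        proof
          fix z :: complex assume "z \<in> ball 0 (2 * r)"
          then have "norm (G z) \<le> 1" using le1 sub by blast
          then have "\<Lambda> * norm (G z) \<le> \<Lambda> * 1" using Lam by (intro mult_left_mono) auto
          then have "norm (F i z) \<le> \<Lambda>" using Fle[OF True, of z] by simp
          then show "norm (g z) \<le> 1" using Lam by (simp add: g_def norm_mult norm_divide divide_simps)
        qed
        have g0: "g 0 \<noteq> 0" using F0[OF True] Lam by (simp add: g_def)
        have gs: "\<forall>z\<in>sphere 0 r. g z \<noteq> 0" using Fs[OF True] Lam by (simp add: g_def)
        obtain S where S: "continuous_on (sphere 0 r) S"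
          "\<forall>z\<in>sphere 0 r. 0 \<le> S z \<and> (\<forall>j\<le>d-1. norm ((deriv ^^ j) g z) \<le> exp (S z) * norm (g z))"
          "cmean 0 r S \<le> CL * (1 + ln (1 + - ln (norm (g 0))))"
          using ldl[rule_format, OF r(1) gh gle[rule_format] g0 gs[rule_format]] by blast
        have "norm ((deriv ^^ j) (F i) z) \<le> exp (S z) * norm (F i z)" if z: "z \<in> sphere 0 r" and j: "j \<le> d - 1" for z j
        proof -
          have "(deriv ^^ j) g z = (1 / of_real \<Lambda>) * (deriv ^^ j) (F i) z"
            unfolding g_def by (rule higher_deriv_cmult[OF Fh _ open_ball]) (use z spR in auto)
          then have "norm ((deriv ^^ j) g z) = norm ((deriv ^^ j) (F i) z) / \<Lambda>"
            using Lam by (simp add: norm_mult norm_divide)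
          moreover have "norm ((deriv ^^ j) g z) \<le> exp (S z) * norm (g z)" using S(2) z j by blast
          moreover have "norm (g z) = norm (F i z) / \<Lambda>" using Lam by (simp add: g_def norm_mult norm_divide)
          ultimately show ?thesis using Lam by (simp add: divide_simps)
        qed
        moreover have "- ln (norm (g 0)) = lL - ln (norm (F i 0))"
          using F0[OF True] Lam by (simp add: g_def norm_mult norm_divide ln_div lL_def)
        ultimately show ?thesis using S by (intro exI[of _ S]) auto
      qed auto
    qed
    from choice[OF this] obtain S where Sall: "\<And>i. i \<in> E \<Longrightarrow> continuous_on (sphere 0 r) (S i) \<and>
        (\<forall>z\<in>sphere 0 r. 0 \<le> S i z \<and> (\<forall>j\<le>d-1. norm ((deriv ^^ j) (F i) z) \<le> exp (S i z) * norm (F i z))) \<and>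
        cmean 0 r (S i) \<le> CL * (1 + ln (1 + (lL - ln (norm (F i 0)))))" by blast
    define v where "v z = ln (norm (Wr G z)) - (\<Sum>i\<in>E. w i * (1 - real (d - 1) * inv_mult (m i)) * ln (norm (F i z)))" for z
    have conF: "continuous_on (sphere 0 r) (\<lambda>z. ln (norm (F i z)))" if "i \<in> E" for i
      by (rule continuous_on_ln_norm[OF continuous_on_subset[OF holomorphic_on_imp_continuous_on[OF Fh] spR]])
         (rule Fs[OF that])
    have conW: "continuous_on (sphere 0 r) (\<lambda>z. ln (norm (Wr G z)))"
      by (rule continuous_on_ln_norm[OF continuous_on_subset[OF holomorphic_on_imp_continuous_on[OF Wh] spR]])
         (rule Ws0)
    have conG: "continuous_on (sphere 0 r) (\<lambda>z. ln (norm (G z)))"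
      by (rule continuous_on_ln_vec[OF hol spR]) (use Gnz spR in blast)
    have conS: "continuous_on (sphere 0 r) (S i)" if "i \<in> E" for i using Sall[OF that] by blast
    have conv: "continuous_on (sphere 0 r) v"
      unfolding v_def by (intro continuous_on_diff conW continuous_on_sum continuous_on_mult continuous_on_const conF)
    have pt: "v z \<le> (- eps) * ln (norm (G z)) + (C2 + (\<Sum>i\<in>E. S i z))" if z: "z \<in> sphere 0 r" for z
    proof -
      have zR: "z \<in> ball 0 R" using z spR by blast
      define g where "g = ln (norm (G z))"
      define f where "f i = ln (norm (F i z))" for i
      have Gz: "G z \<noteq> 0" by (rule Gnz[OF zR])
      have fle: "f i \<le> lL + g" if "i \<in> E" for i
      proof -
        have "f i \<le> ln (\<Lambda> * norm (G z))"
          unfolding f_def using Fle[OF that, of z] Fs[OF that z] Lam Gz by (subst ln_le_cancel_iff) auto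
        then show ?thesis using Lam Gz by (simp add: ln_mult lL_def g_def)
      qed
      \<comment> \<open>\<open>a i\<close> measures how far the i-th form lies below
        \<open>c * norm (G z)\<close>. By the choice of \<open>c\<close> the forms with
        \<open>a i > 0\<close> are not of full rank, so \<open>weighted_basis\<close>
        applies.\<close>
      define a where "a i = max 0 (lc + g - f i)" for i
      have apos: "norm (F i z) < c * norm (G z)" if "i \<in> E" "a i > 0" for i
      proof -
        have "f i < lc + g" using that(2) by (simp add: a_def)
        also have "\<dots> = ln (c * norm (G z))" using c Gz by (simp add: ln_mult lc_def g_def)
        finally show ?thesis unfolding f_def using Fs[OF that(1) z] c Gz by (subst (asm) ln_less_cancel_iff) auto
      qed
      have rk: "form_rank K L {i\<in>E. a i > 0} < d"
      proof (rule ccontr)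
        assume "\<not> ?thesis"
        then have eqd: "form_rank K L {i\<in>E. a i > 0} = d"
          using form_rank_le[of K L "{i\<in>E. a i > 0}"] d_def by linarith
        have sq: "{i\<in>E. a i > 0} \<subseteq> {..<q}" using Eq by blast
        have "\<forall>a\<in>K. lform a (G z) = 0" using ann zR by blast
        then obtain i where "i \<in> {i\<in>E. a i > 0}" "c * norm (G z) \<le> norm (F i z)"
          using c(3)[OF sq eqd Gz] unfolding F_def by blast
        then show False using apos by fastforce
      qed
      have a0: "0 \<le> a i" for i by (simp add: a_def)
      obtain B0 B where B: "B0 \<subseteq> {i\<in>E. a i > 0}" "B0 \<subseteq> B" "B \<subseteq> E" "card B = d" "form_rank K L B = d"
        "(\<Sum>i\<in>E. w i * a i) \<le> (\<Sum>i\<in>B0. a i)"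
        using weighted_basis[OF a0 rk] by (elim exE conjE)
      have fB: "finite B" using finite_subset[OF B(3) finE] .
      have Bq: "B \<subseteq> {..<q}" using B(3) Eq by blast
      have i1: "lc * Ws + g * Ws - (\<Sum>i\<in>E. w i * f i) \<le> real d * g - (\<Sum>i\<in>B. f i) + real d * lL"
      proof -
        have "lc * Ws + g * Ws - (\<Sum>i\<in>E. w i * f i) = (\<Sum>i\<in>E. w i * (lc + g - f i))"
          by (simp add: Ws_def algebra_simps sum_subtractf sum.distrib sum_distrib_left)
        also have "\<dots> \<le> (\<Sum>i\<in>E. w i * a i)"
          by (intro sum_mono mult_left_mono w0E) (auto simp: a_def)
        also have "\<dots> \<le> (\<Sum>i\<in>B0. a i)" by (rule B)
        also have "\<dots> \<le> (\<Sum>i\<in>B0. g - f i + lL)"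
        proof (rule sum_mono)
          fix i assume "i \<in> B0"
          then have "a i = lc + g - f i" using B(1) by (auto simp: a_def max_def split: if_splits)
          then show "a i \<le> g - f i + lL" using lcL by simp
        qed
        \<comment> \<open>Each added term is nonnegative because a form is at most
          \<open>\<Lambda> * norm (G z)\<close>.\<close>
        also have "\<dots> \<le> (\<Sum>i\<in>B. g - f i + lL)"
          by (rule sum_mono2[OF fB B(2)]) (use fle B(3) in force)
        also have "\<dots> = real d * g - (\<Sum>i\<in>B. f i) + real d * lL"
          by (simp add: B(4) sum.distrib sum_subtractf)
        finally show ?thesis .
      qed
      have i2: "ln (norm (Wr G z)) \<le> ln \<kappa> + ln (fact d) + (\<Sum>i\<in>E. S i z) + (\<Sum>i\<in>B. f i)"
      proof -
        define ls where "ls = sorted_list_of_set B"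
        have ls: "distinct ls" "set ls = B" "length ls = d" using fB B by (auto simp: ls_def)
        from kap[rule_format, OF Bq B(5,4) ann'] obtain k where k: "norm k \<le> \<kappa>"
          "\<forall>z\<in>ball 0 R. Wr G z = k * wronskian (map (\<lambda>i z. lform (L i) (G z)) ls) z"
          unfolding ls_def by (elim exE conjE)
        have Weq: "Wr G z = k * wronskian (map F ls) z"
          using k(2) zR unfolding F_def by blast
        have bd: "norm (wronskian (map F ls) z) \<le> fact (length (map F ls)) *
            (\<Prod>j<length (map F ls). exp (S (ls ! j) z) * norm (F (ls ! j) z))"
        proof (rule norm_wronskian_le)
          fix i j assume ij: "i < length (map F ls)" "j < length (map F ls)"
          then have jE: "ls ! j \<in> E" using ls(2) B(3) nth_mem[of j ls] by auto
          have "i \<le> d - 1" using ij ls by simp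
          then show "norm ((deriv ^^ i) (map F ls ! j) z) \<le> exp (S (ls ! j) z) * norm (F (ls ! j) z)"
            using Sall[OF jE] z ij by simp
        qed auto
        have prod: "(\<Prod>j<length (map F ls). exp (S (ls ! j) z) * norm (F (ls ! j) z)) = (\<Prod>i\<in>B. exp (S i z) * norm (F i z))"
          using prod.reindex_bij_betw[OF bij_betw_nth[OF ls(1) refl ls(2)[symmetric]], of "\<lambda>i. exp (S i z) * norm (F i z)"] by simp
        define P where "P = (\<Prod>i\<in>B. exp (S i z) * norm (F i z))"
        have Ppos: "P > 0" unfolding P_def using Fs z B(3) by (intro prod_pos) force
        have lnP: "ln P = (\<Sum>i\<in>B. S i z + f i)"
          unfolding P_def using fB Fs z B(3)
          by (subst ln_prod) (force simp: f_def ln_mult intro!: sum.cong)+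
        have "norm (wronskian (map F ls) z) \<le> fact d * P" using bd prod ls by (simp add: P_def)
        then have "norm (Wr G z) \<le> \<kappa> * (fact d * P)"
          unfolding Weq norm_mult using k(1) kap1 by (intro mult_mono) auto
        then have "ln (norm (Wr G z)) \<le> ln (\<kappa> * (fact d * P))"
          using Ws0[OF z] kap1 Ppos by (subst ln_le_cancel_iff) auto
        also have "\<dots> = ln \<kappa> + ln (fact d) + ((\<Sum>i\<in>B. S i z) + (\<Sum>i\<in>B. f i))"
          using kap1 Ppos by (simp add: ln_mult lnP sum.distrib)
        \<comment> \<open>The basis \<open>B\<close> varies with \<open>z\<close>; nonnegativity of
          the \<open>S i\<close> gives a bound that does not, so it can be averaged over the
          circle.\<close>
        also have "(\<Sum>i\<in>B. S i z) \<le> (\<Sum>i\<in>E. S i z)"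
          by (rule sum_mono2[OF finE B(3)]) (use Sall z in blast)
        finally show ?thesis by simp
      qed
      have i3: "(\<Sum>i\<in>E. w i * (real (d - 1) * inv_mult (m i)) * f i) \<le> Ms * (lL + g)"
        unfolding Ms_def sum_distrib_right
        by (intro sum_mono mult_left_mono fle mult_nonneg_nonneg w0E im0) auto
      have "v z = ln (norm (Wr G z)) - (\<Sum>i\<in>E. w i * f i) + (\<Sum>i\<in>E. w i * (real (d - 1) * inv_mult (m i)) * f i)"
        by (simp add: v_def f_def algebra_simps sum_subtractf sum.distrib)
      also have "\<dots> \<le> (ln \<kappa> + ln (fact d) + (\<Sum>i\<in>E. S i z)) + (real d * g + real d * lL - lc * Ws - g * Ws) + Ms * (lL + g)"
        using i1 i2 i3 by linarith
      also have "\<dots> = (- eps) * g + (C2 + (\<Sum>i\<in>E. S i z))"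
        by (simp add: epsW C2_def algebra_simps)
      finally show ?thesis by (simp add: g_def)
    qed
    have v0: "v 0 \<le> cmean 0 r v"
    proof -
      define Z where "Z = {a\<in>ball 0 r. Wr G a = 0} \<union> (\<Union>i\<in>E. {a\<in>ball 0 r. F i a = 0})"
      have fz: "finite {a\<in>ball 0 r. g a = 0}" if "g holomorphic_on ball 0 R" "g 0 \<noteq> 0" for g
        by (rule finite_subset[OF _ finite_zeros_cball[OF that(1) r0(2) that(2) b0]]) auto
      have finZ: "finite Z" unfolding Z_def using fz[OF Wh W0] fz[OF Fh F0] finE by blast
      have Zb: "Z \<subseteq> ball 0 r" unfolding Z_def by blast
      have jW: "cmean 0 r (\<lambda>z. ln (norm (Wr G z))) = ln (norm (Wr G 0)) + (\<Sum>a\<in>Z. real (nat (zorder (Wr G) a)) * ln (r / norm a))"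
        by (rule jensen_superset[OF Wh r0 Ws0 W0 finZ Zb]) (auto simp: Z_def)
      have jF: "cmean 0 r (\<lambda>z. ln (norm (F i z))) = ln (norm (F i 0)) + (\<Sum>a\<in>Z. real (nat (zorder (F i) a)) * ln (r / norm a))"
        if "i \<in> E" for i
        by (rule jensen_superset[OF Fh r0 Fs[OF that] F0[OF that] finZ Zb]) (use that in \<open>auto simp: Z_def\<close>)
      define cf where "cf i = w i * (1 - real (d - 1) * inv_mult (m i))" for i
      have m1: "cmean 0 r v = cmean 0 r (\<lambda>z. ln (norm (Wr G z))) - cmean 0 r (\<lambda>z. \<Sum>i\<in>E. cf i * ln (norm (F i z)))"
        unfolding v_def cf_def[symmetric]
        by (rule cmean_diff[OF conW]) (use r0 conF in \<open>auto intro!: continuous_on_sum continuous_on_mult\<close>)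
      have "cmean 0 r (\<lambda>z. \<Sum>i\<in>E. cf i * ln (norm (F i z))) = (\<Sum>i\<in>E. cf i * cmean 0 r (\<lambda>z. ln (norm (F i z))))"
        using r0 conF by (subst cmean_sum[OF finE]) (auto intro!: continuous_on_mult simp: cmean_cmult)
      also have "\<dots> = (\<Sum>i\<in>E. cf i * ln (norm (F i 0))) + (\<Sum>i\<in>E. cf i * (\<Sum>a\<in>Z. real (nat (zorder (F i) a)) * ln (r / norm a)))"
        by (simp add: jF distrib_left sum.distrib)
      also have "(\<Sum>i\<in>E. cf i * (\<Sum>a\<in>Z. real (nat (zorder (F i) a)) * ln (r / norm a))) =
          (\<Sum>a\<in>Z. (\<Sum>i\<in>E. cf i * real (nat (zorder (F i) a))) * ln (r / norm a))"
        unfolding sum_distrib_left sum_distrib_right by (subst sum.swap) (simp add: mult.assoc)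
      also have "\<dots> \<le> (\<Sum>a\<in>Z. real (nat (zorder (Wr G) a)) * ln (r / norm a))"
      proof (rule sum_mono)
        fix a assume aZ: "a \<in> Z"
        then have ar: "a \<in> ball 0 r" using Zb by blast
        have a0: "a \<noteq> 0" using aZ W0 F0 by (auto simp: Z_def)
        have "(\<Sum>i\<in>E. cf i * real (nat (zorder (F i) a))) \<le> real (nat (zorder (Wr G) a))"
          unfolding cf_def F_def by (rule order_inequality[OF adm]) (use ar r0 in auto)
        moreover have "0 \<le> ln (r / norm a)" using ar a0 by (simp add: divide_simps)
        ultimately show "(\<Sum>i\<in>E. cf i * real (nat (zorder (F i) a))) * ln (r / norm a) \<le> real (nat (zorder (Wr G) a)) * ln (r / norm a)"
          by (rule mult_right_mono)
      qed
      finally have "cmean 0 r (\<lambda>z. \<Sum>i\<in>E. cf i * ln (norm (F i z))) \<le>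
        (\<Sum>i\<in>E. cf i * ln (norm (F i 0))) + (\<Sum>a\<in>Z. real (nat (zorder (Wr G) a)) * ln (r / norm a))" by simp
      moreover have "v 0 = ln (norm (Wr G 0)) - (\<Sum>i\<in>E. cf i * ln (norm (F i 0)))" by (simp add: v_def cf_def)
      ultimately show ?thesis using jW m1 by linarith
    qed
    have v1: "cmean 0 r v \<le> cmean 0 r (\<lambda>z. (- eps) * ln (norm (G z)) + (C2 + (\<Sum>i\<in>E. S i z)))"
    proof (rule cmean_mono[OF conv])
      show "continuous_on (sphere 0 r) (\<lambda>z. (- eps) * ln (norm (G z)) + (C2 + (\<Sum>i\<in>E. S i z)))"
        by (intro continuous_on_add continuous_on_mult continuous_on_const continuous_on_sum conG conS)
    qed (use pt r0 in auto)
    have v2: "cmean 0 r (\<lambda>z. (- eps) * ln (norm (G z)) + (C2 + (\<Sum>i\<in>E. S i z))) =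
        (- eps) * cmean 0 r (\<lambda>z. ln (norm (G z))) + (C2 + (\<Sum>i\<in>E. cmean 0 r (S i)))"
    proof -
      have 1: "continuous_on (sphere 0 r) (\<lambda>z. (- eps) * ln (norm (G z)))" by (intro continuous_on_mult continuous_on_const conG)
      have 2: "continuous_on (sphere 0 r) (\<lambda>z. \<Sum>i\<in>E. S i z)" by (intro continuous_on_sum conS)
      have 3: "continuous_on (sphere 0 r) (\<lambda>z. C2 + (\<Sum>i\<in>E. S i z))" by (intro continuous_on_add continuous_on_const 2)
      have "cmean 0 r (\<lambda>z. (- eps) * ln (norm (G z)) + (C2 + (\<Sum>i\<in>E. S i z))) =
         cmean 0 r (\<lambda>z. (- eps) * ln (norm (G z))) + cmean 0 r (\<lambda>z. C2 + (\<Sum>i\<in>E. S i z))"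
        by (rule cmean_add[OF 1 3]) (use r0 in simp)
      also have "cmean 0 r (\<lambda>z. C2 + (\<Sum>i\<in>E. S i z)) = cmean 0 r (\<lambda>_. C2) + cmean 0 r (\<lambda>z. \<Sum>i\<in>E. S i z)"
        by (rule cmean_add[OF _ 2]) (use r0 in auto)
      also have "cmean 0 r (\<lambda>z. \<Sum>i\<in>E. S i z) = (\<Sum>i\<in>E. cmean 0 r (S i))"
        by (rule cmean_sum[OF finE conS]) (use r0 in auto)
      finally show ?thesis by (simp only: cmean_cmult cmean_const)
    qed
    have v3: "C2 + (\<Sum>i\<in>E. cmean 0 r (S i)) \<le> C * (1 + (\<Sum>i\<in>E. ln (1 + (C - ln (norm (F i 0))))))"
    proof -
      have l0: "0 \<le> ln (1 + (C - ln (norm (F i 0)))) \<and> ln (1 + (lL - ln (norm (F i 0)))) \<le> ln (1 + (C - ln (norm (F i 0))))"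
        if i: "i \<in> E" for i
      proof -
        have "norm (F i 0) \<le> \<Lambda>"
        proof -
          have "norm (G 0) \<le> 1" using le1 b0 by blast
          then have "\<Lambda> * norm (G 0) \<le> \<Lambda> * 1" using Lam(1) by (intro mult_left_mono) auto
          then show ?thesis using Fle[OF i, of 0] by simp
        qed
        then have "ln (norm (F i 0)) \<le> lL" using F0[OF i] Lam(1) unfolding lL_def by (subst ln_le_cancel_iff) auto
        then show ?thesis using C(3) by (auto simp: ln_le_cancel_iff)
      qed
      have "(\<Sum>i\<in>E. cmean 0 r (S i)) \<le> (\<Sum>i\<in>E. CL * (1 + ln (1 + (C - ln (norm (F i 0))))))"
      proof (rule sum_mono)
        fix i assume i: "i \<in> E"
        have "cmean 0 r (S i) \<le> CL * (1 + ln (1 + (lL - ln (norm (F i 0)))))" using Sall[OF i] by blast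
        also have "\<dots> \<le> CL * (1 + ln (1 + (C - ln (norm (F i 0)))))"
          using l0[OF i] CL by (intro mult_left_mono) auto
        finally show "cmean 0 r (S i) \<le> CL * (1 + ln (1 + (C - ln (norm (F i 0)))))" .
      qed
      also have "\<dots> = CL * real (card E) + CL * (\<Sum>i\<in>E. ln (1 + (C - ln (norm (F i 0)))))"
        by (simp add: distrib_left sum.distrib sum_distrib_left)
      finally have "C2 + (\<Sum>i\<in>E. cmean 0 r (S i)) \<le> (C2 + CL * real (card E)) + CL * (\<Sum>i\<in>E. ln (1 + (C - ln (norm (F i 0)))))"
        by simp
      also have "\<dots> \<le> C + C * (\<Sum>i\<in>E. ln (1 + (C - ln (norm (F i 0)))))"
        using C l0 by (intro add_mono mult_right_mono sum_nonneg) auto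
      finally show ?thesis by (simp add: distrib_left)
    qed
    have "v 0 \<le> (- eps) * cmean 0 r (\<lambda>z. ln (norm (G z))) + C * (1 + (\<Sum>i\<in>E. ln (1 + (C - ln (norm (F i 0))))))"
      using v0 v1 v2 v3 by linarith
    then show "ln (norm (Wr G 0)) - (\<Sum>i\<in>E. w i * (1 - real (d - 1) * inv_mult (m i)) * ln (norm (lform (L i) (G 0))))
     \<le> - eps * cmean 0 r (\<lambda>z. ln (norm (G z))) + C * (1 + (\<Sum>i\<in>E. ln (1 + (C - ln (norm (lform (L i) (G 0)))))))"
      by (simp add: v_def F_def)
  qed
qed

end

subsection \<open>Nondegenerate orbifold discs have bounded radius\<close>

text \<open>Lets a representation be renormalised: every summand of Leibniz's rule contains a
  derivative of \<open>g\<close> of order below the multiplicity.\<close>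

lemma zero_mult_unit:
  assumes S: "open S" and g: "g holomorphic_on S" and u: "u holomorphic_on S" and nz: "\<And>z. z \<in> S \<Longrightarrow> u z \<noteq> 0"
    and zm: "zero_mult k g S"
  shows "zero_mult k (\<lambda>z. u z * g z) S"
  unfolding zero_mult_def
proof (intro ballI impI)
  fix z assume z: "z \<in> S" and "u z * g z = 0"
  then have g0: "g z = 0" using nz by auto
  show "case k of \<infinity> \<Rightarrow> False | enat k \<Rightarrow> \<forall>l<k. (deriv ^^ l) (\<lambda>z. u z * g z) z = 0"
  proof (cases k)
    case (enat m)
    have "(deriv ^^ l) (\<lambda>z. u z * g z) z = 0" if l: "l < m" for l
    proof -
      have "(deriv ^^ l) (\<lambda>z. g z * u z) z = (\<Sum>i = 0..l. of_nat (l choose i) * (deriv ^^ i) g z * (deriv ^^ (l - i)) u z)"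
        by (rule higher_deriv_mult[OF g u S z])
      also have "\<dots> = 0"
      proof (rule sum.neutral, rule ballI)
        fix i assume "i \<in> {0..l}"
        then have "(deriv ^^ i) g z = 0" using zm z g0 l enat by (auto simp: zero_mult_def)
        then show "of_nat (l choose i) * (deriv ^^ i) g z * (deriv ^^ (l - i)) u z = 0" by simp
      qed
      finally show ?thesis by (simp add: mult.commute)
    qed
    then show ?thesis using enat by simp
  next
    case infinity
    then show ?thesis using zm z g0 by (auto simp: zero_mult_def)
  qed
qed

lemma norm_vector_scale: "norm (c *s v) = norm c * norm (v :: complex ^ 'n)"
  unfolding norm_vec_def by (simp add: norm_mult L2_set_right_distrib)

context weighted_forms
begin

lemma Wr_scale:
  assumes "\<And>j. (\<lambda>z. G z $ j) holomorphic_on ball 0 R" "u holomorphic_on ball 0 R" "z \<in> ball 0 R"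
  shows "Wr (\<lambda>z. u z *s G z) z = u z ^ d * Wr G z"
proof -
  have "wronskian (map (\<lambda>g w. u w * g w) (map (\<lambda>i z. lform (L i) (G z)) bs)) z =
     u z ^ length (map (\<lambda>i z. lform (L i) (G z)) bs) * wronskian (map (\<lambda>i z. lform (L i) (G z)) bs) z"
    by (rule wronskian_mult[OF open_ball assms(3,2)]) (auto intro!: holomorphic_lform assms(1))
  then show ?thesis unfolding Wr_def by (simp add: lform_scale_right o_def bs)
qed

lemma admissible_scale:
  assumes adm: "admissible R G" and rho: "0 < \<rho>" "\<rho> \<le> R" and u: "u holomorphic_on ball 0 R" "\<And>z. z \<in> ball 0 R \<Longrightarrow> u z \<noteq> 0"
  shows "admissible \<rho> (\<lambda>z. u z *s G z)"
proof -
  have sub: "ball 0 \<rho> \<subseteq> ball (0::complex) R" using rho by auto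
  have hol: "\<And>j. (\<lambda>z. G z $ j) holomorphic_on ball 0 R" using adm by (auto simp: admissible_def)
  have b0: "0 \<in> ball (0::complex) R" using rho by simp
  have zm: "zero_mult (m i) (\<lambda>z. u z * lform (L i) (G z)) (ball 0 R)" if "i \<in> E" for i
    by (rule zero_mult_unit) (use adm u that hol in \<open>auto simp: admissible_def intro!: holomorphic_lform\<close>)
  show ?thesis unfolding admissible_def
  proof (intro conjI ballI allI)
    show "(\<lambda>z. (u z *s G z) $ j) holomorphic_on ball 0 \<rho>" for j
      using holomorphic_on_subset[OF hol sub] holomorphic_on_subset[OF u(1) sub] by (auto intro!: holomorphic_intros)
    show "u z *s G z \<noteq> 0" if "z \<in> ball 0 \<rho>" for z
      using that sub u(2) adm by (auto simp: admissible_def vec_eq_iff)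
    show "lform a (u z *s G z) = 0" if "a \<in> K" "z \<in> ball 0 \<rho>" for a z
      using that sub adm by (auto simp: admissible_def lform_scale_right)
    show "zero_mult (m i) (\<lambda>z. lform (L i) (u z *s G z)) (ball 0 \<rho>)" if "i \<in> E" for i
      using zm[OF that] sub unfolding zero_mult_def lform_scale_right by blast
    show "lform (L i) (u 0 *s G 0) \<noteq> 0" if "i \<in> E" for i
      using that u(2)[OF b0] adm by (auto simp: admissible_def lform_scale_right)
    show "Wr (\<lambda>z. u z *s G z) 0 \<noteq> 0"
      using Wr_scale[OF hol u(1) b0] u(2)[OF b0] adm by (simp add: admissible_def)
  qed
qed

text \<open>Here \<open>G\<close> is \<open>exp (- p) * f\<close>, of norm at most 1 on radius
  \<open>4 * r\<close>. The shift \<tau> lies between 0 and \<open>charT f (4 * r) + 1\<close> and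
  enters both sides of the second main theorem with factor \<open>eps\<close>, so it survives only
  inside logarithms. The lower bounds by \<kappa> make the constants independent of
  \<open>f\<close>, and the first conclusion keeps the logarithm on the right nonnegative.\<close>

lemma characteristic_bound:
  assumes eps: "eps > 0" and k0: "\<kappa> > 0"
  shows "\<exists>a b A. a > 0 \<and> b > 0 \<and> A > 1 \<and> (\<forall>f R r. 2 \<le> r \<longrightarrow> 4 * r < R \<longrightarrow> admissible R f \<longrightarrow>
      \<kappa> * norm (f 0) ^ d \<le> norm (Wr f 0) \<longrightarrow> (\<forall>i\<in>E. \<kappa> * norm (f 0) \<le> norm (lform (L i) (f 0))) \<longrightarrow>
      0 \<le> A + charT f (4 * r) - 1 \<and> eps * charT f r \<le> a + b * ln (A + charT f (4 * r)))"
proof -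
  obtain C where C: "C > 0" and LamC: "\<forall>i v. i < q \<longrightarrow> norm (lform (L i) v) \<le> exp C * norm v" and smt: "\<forall>R r G. 2 \<le> r \<longrightarrow> 2 * r \<le> R \<longrightarrow> admissible R G \<longrightarrow> (\<forall>z\<in>ball 0 R. norm (G z) \<le> 1) \<longrightarrow>
     (\<forall>z\<in>sphere 0 r. Wr G z \<noteq> 0 \<and> (\<forall>i\<in>E. lform (L i) (G z) \<noteq> 0)) \<longrightarrow>
     ln (norm (Wr G 0)) - (\<Sum>i\<in>E. w i * (1 - real (d - 1) * inv_mult (m i)) * ln (norm (lform (L i) (G 0))))
     \<le> - eps * cmean 0 r (\<lambda>z. ln (norm (G z))) + C * (1 + (\<Sum>i\<in>E. ln (1 + (C - ln (norm (lform (L i) (G 0)))))))"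
    using second_main_theorem by (elim exE conjE)
  define \<Lambda> where "\<Lambda> = exp C"
  have Lam: "1 \<le> \<Lambda>" "\<And>i v. i < q \<Longrightarrow> norm (lform (L i) v) \<le> \<Lambda> * norm v"
    using C LamC by (auto simp: \<Lambda>_def)
  define cf where "cf i = w i * (1 - real (d - 1) * inv_mult (m i))" for i
  define M where "M = \<bar>ln \<kappa>\<bar> + ln \<Lambda>"
  define M' where "M' = (\<Sum>i\<in>E. \<bar>cf i\<bar> * M)"
  have M0: "M \<ge> 0" "M' \<ge> 0" using Lam unfolding M_def M'_def by (auto intro!: sum_nonneg)
  define A where "A = 3 + C + \<bar>ln \<kappa>\<bar>"
  define a where "a = \<bar>ln \<kappa>\<bar> + M' + C"
  define b where "b = C * real (card E) + 1"
  have eps_cf: "eps = (\<Sum>i\<in>E. cf i) - real d" by (simp add: eps_def cf_def)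
  show ?thesis
  proof (rule exI[of _ a], rule exI[of _ b], rule exI[of _ A], intro conjI allI impI)
    show "a > 0" "b > 0" "A > 1" using C M0 by (auto simp: a_def b_def A_def intro: add_nonneg_pos)
    fix f :: "complex \<Rightarrow> complex ^ 'n" and R r :: real
    assume r: "2 \<le> r" "4 * r < R" and adm: "admissible R f" and W: "\<kappa> * norm (f 0) ^ d \<le> norm (Wr f 0)"
      and Fk: "\<forall>i\<in>E. \<kappa> * norm (f 0) \<le> norm (lform (L i) (f 0))"
    define \<rho> where "\<rho> = 4 * r"
    have rho: "0 < \<rho>" "\<rho> < R" using r by (auto simp: \<rho>_def)
    have hol: "\<And>j. (\<lambda>z. f z $ j) holomorphic_on ball 0 R" and fnz: "\<And>z. z \<in> ball 0 R \<Longrightarrow> f z \<noteq> 0"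
      and F0: "\<And>i. i \<in> E \<Longrightarrow> lform (L i) (f 0) \<noteq> 0" and W0: "Wr f 0 \<noteq> 0"
      using adm unfolding admissible_def by auto
    have b0: "0 \<in> ball (0::complex) R" using rho by simp
    have f0: "f 0 \<noteq> 0" by (rule fnz[OF b0])
    \<comment> \<open>The circle must avoid all zeros, and \<open>r' < 2 * r\<close> keeps
      \<open>2 * r'\<close> below \<open>4 * r\<close>, the radius on which \<open>G\<close> is
      normalised.\<close>
    obtain r' where r': "r < r'" "r' < 2 * r" "\<And>g z. g \<in> insert (Wr f) ((\<lambda>i z. lform (L i) (f z)) ` E) \<Longrightarrow> z \<in> sphere 0 r' \<Longrightarrow> g z \<noteq> 0"
    proof (rule generic_radius[of "insert (Wr f) ((\<lambda>i z. lform (L i) (f z)) ` E)" R r "2 * r"])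
      show "finite (insert (Wr f) ((\<lambda>i z. lform (L i) (f z)) ` E))" using finE by simp
      fix g assume "g \<in> insert (Wr f) ((\<lambda>i z. lform (L i) (f z)) ` E)"
      then have "g holomorphic_on ball 0 R \<and> g 0 \<noteq> 0"
        using holomorphic_Wr[OF hol] W0 holomorphic_lform[OF hol] F0 by auto
      then show "g holomorphic_on ball 0 R \<and> (\<exists>z\<in>ball 0 R. g z \<noteq> 0)" using b0 by blast
    qed (use r in auto)
    obtain p where p: "p holomorphic_on UNIV" "\<And>z. z \<in> cball 0 \<rho> \<Longrightarrow> norm (f z) \<le> exp (Re (p z))"
      "Re (p 0) \<le> cmean 0 \<rho> (\<lambda>z. ln (norm (f z))) + 1"
    proof (rule majorant[of f R \<rho> 1])
      show "(\<lambda>z. f z $ j) holomorphic_on ball 0 R" for j by (rule hol)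
      show "f z \<noteq> 0" if "z \<in> sphere 0 \<rho>" for z using fnz that rho by auto
    qed (use rho in auto)
    define u where "u z = exp (- p z)" for z
    have uh: "u holomorphic_on ball 0 R" unfolding u_def using p(1) by (intro holomorphic_intros) (auto intro: holomorphic_on_subset)
    have unz: "u z \<noteq> 0" for z by (simp add: u_def)
    have nu: "norm (u z) = exp (- Re (p z))" for z by (simp add: u_def norm_exp_eq_Re)
    define G where "G z = u z *s f z" for z
    have admG: "admissible \<rho> G" unfolding G_def by (rule admissible_scale[OF adm]) (use rho uh unz in auto)
    have Gle: "norm (G z) \<le> 1" if "z \<in> ball 0 \<rho>" for z
    proof -
      have "norm (G z) \<le> exp (- Re (p z)) * exp (Re (p z))"
        unfolding G_def norm_vector_scale nu using p(2)[of z] that by (intro mult_left_mono) auto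
      then show ?thesis by (simp add: exp_minus)
    qed
    have WG: "Wr G z = u z ^ d * Wr f z" if "z \<in> ball 0 R" for z
      unfolding G_def by (rule Wr_scale[OF hol uh that])
    have FG: "lform (L i) (G z) = u z * lform (L i) (f z)" for i z by (simp add: G_def lform_scale_right)
    define \<tau> where "\<tau> = Re (p 0) - ln (norm (f 0))"
    have "norm (f 0) \<le> exp (Re (p 0))" by (rule p(2)) (use rho in auto)
    then have t0: "\<tau> \<ge> 0" 
    proof -
      assume "norm (f 0) \<le> exp (Re (p 0))"
      then have "ln (norm (f 0)) \<le> ln (exp (Re (p 0)))" using f0 by (subst ln_le_cancel_iff) auto
      then show ?thesis by (simp add: \<tau>_def)
    qed
    have tT: "\<tau> \<le> charT f \<rho> + 1" using p(3) by (simp add: \<tau>_def charT_def)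
    have main: "ln (norm (Wr G 0)) - (\<Sum>i\<in>E. cf i * ln (norm (lform (L i) (G 0))))
     \<le> - eps * cmean 0 r' (\<lambda>z. ln (norm (G z))) + C * (1 + (\<Sum>i\<in>E. ln (1 + (C - ln (norm (lform (L i) (G 0)))))))"
      unfolding cf_def
    proof (rule smt[rule_format])
      show "Wr G z \<noteq> 0 \<and> (\<forall>i\<in>E. lform (L i) (G z) \<noteq> 0)" if z: "z \<in> sphere 0 r'" for z
      proof -
        have "Wr f z \<noteq> 0" by (rule r'(3)[OF insertI1 z])
        moreover have "lform (L i) (f z) \<noteq> 0" if "i \<in> E" for i
          using r'(3)[OF insertI2[OF imageI[OF that]] z] by simp
        moreover have "z \<in> ball 0 R" using z r r' by auto
        ultimately show ?thesis using WG FG unz by simp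
      qed
    qed (use r r' admG Gle in \<open>auto simp: \<rho>_def\<close>)
    have lnW: "ln (norm (Wr G 0)) \<ge> ln \<kappa> - real d * \<tau>"
    proof -
      have "ln (norm (Wr G 0)) = - real d * Re (p 0) + ln (norm (Wr f 0))"
        using W0 by (simp add: WG[OF b0] norm_mult norm_power nu ln_mult ln_realpow)
      moreover have "ln (\<kappa> * norm (f 0) ^ d) \<le> ln (norm (Wr f 0))"
        using W W0 k0 f0 by (subst ln_le_cancel_iff) auto
      then have "ln \<kappa> + real d * ln (norm (f 0)) \<le> ln (norm (Wr f 0))"
        using k0 f0 by (simp add: ln_mult ln_realpow)
      ultimately show ?thesis by (simp add: \<tau>_def algebra_simps)
    qed
    define g where "g i = ln (norm (lform (L i) (f 0))) - ln (norm (f 0))" for i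
    have lnF: "ln (norm (lform (L i) (G 0))) = g i - \<tau>" if "i \<in> E" for i
      using F0[OF that] by (simp add: FG norm_mult nu ln_mult g_def \<tau>_def)
    have g1: "ln \<kappa> \<le> g i" "g i \<le> ln \<Lambda>" if i: "i \<in> E" for i
    proof -
      have "ln (\<kappa> * norm (f 0)) \<le> ln (norm (lform (L i) (f 0)))"
        using Fk i F0[OF i] k0 f0 by (subst ln_le_cancel_iff) auto
      then show "ln \<kappa> \<le> g i" using k0 f0 by (simp add: ln_mult g_def)
      have "norm (lform (L i) (f 0)) \<le> \<Lambda> * norm (f 0)" using Lam(2) i by (auto simp: E_def)
      then have "ln (norm (lform (L i) (f 0))) \<le> ln (\<Lambda> * norm (f 0))"
        using F0[OF i] Lam f0 by (subst ln_le_cancel_iff) auto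
      then show "g i \<le> ln \<Lambda>" using Lam f0 by (simp add: ln_mult g_def)
    qed
    have "\<bar>g i\<bar> \<le> M" if "i \<in> E" for i 
    proof -
      have "0 \<le> ln \<Lambda>" using Lam(1) by simp
      then show ?thesis
        using g1[OF that] abs_ge_minus_self[of "ln \<kappa>"] abs_ge_zero[of "ln \<kappa>"]
        unfolding M_def abs_le_iff by linarith
    qed
    then have "cf i * g i \<le> \<bar>cf i\<bar> * M" if "i \<in> E" for i
      using order_trans[OF abs_ge_self[of "cf i * g i"]] mult_left_mono[OF _ abs_ge_zero, of "\<bar>g i\<bar>" M "cf i"] that
      by (simp add: abs_mult)
    then have "(\<Sum>i\<in>E. cf i * g i) \<le> M'" unfolding M'_def by (rule sum_mono)
    moreover have "(\<Sum>i\<in>E. cf i * ln (norm (lform (L i) (G 0)))) = (\<Sum>i\<in>E. cf i * g i) - (\<Sum>i\<in>E. cf i) * \<tau>"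
      by (simp add: lnF algebra_simps sum_subtractf sum_distrib_left)
    ultimately have lhs: "eps * \<tau> + ln \<kappa> - M' \<le> ln (norm (Wr G 0)) - (\<Sum>i\<in>E. cf i * ln (norm (lform (L i) (G 0))))"
      using lnW by (simp add: eps_cf algebra_simps)
    have mG: "cmean 0 r' (\<lambda>z. ln (norm (G z))) = charT f r' - \<tau>"
    proof -
      have sp: "sphere 0 r' \<subseteq> ball (0::complex) R" using r r' by auto
      have con: "continuous_on (sphere 0 r') (\<lambda>z. ln (norm (f z)))"
        by (rule continuous_on_ln_vec[OF hol sp]) (use fnz sp in blast)
      have conp: "continuous_on (sphere 0 r') (\<lambda>z. Re (p z))"
        using p(1) by (intro continuous_intros holomorphic_on_imp_continuous_on) (auto intro: holomorphic_on_subset)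
      have "cmean 0 r' (\<lambda>z. ln (norm (G z))) = cmean 0 r' (\<lambda>z. ln (norm (f z)) - Re (p z))"
      proof (rule cmean_cong)
        fix z :: complex assume "z \<in> sphere 0 r'"
        then have "f z \<noteq> 0" using fnz sp by blast
        then show "ln (norm (G z)) = ln (norm (f z)) - Re (p z)"
          unfolding G_def norm_vector_scale nu by (simp add: ln_mult)
      qed (use r r' in auto)
      also have "\<dots> = cmean 0 r' (\<lambda>z. ln (norm (f z))) - cmean 0 r' (\<lambda>z. Re (p z))"
        by (rule cmean_diff[OF con conp]) (use r r' in auto)
      also have "cmean 0 r' (\<lambda>z. Re (p z)) = Re (p 0)"
        by (rule cmean_Re_holomorphic)
           (use p(1) r r' in \<open>auto intro!: holomorphic_on_imp_continuous_on intro: holomorphic_on_subset\<close>)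
      finally show ?thesis by (simp add: charT_def \<tau>_def)
    qed
    have sumln: "(\<Sum>i\<in>E. ln (1 + (C - ln (norm (lform (L i) (G 0)))))) \<le> real (card E) * ln (A + charT f \<rho>)"
    proof -
      have "(\<Sum>i\<in>E. ln (1 + (C - ln (norm (lform (L i) (G 0)))))) \<le> (\<Sum>i\<in>E. ln (A + charT f \<rho>))"
      proof (rule sum_mono)
        fix i assume i: "i \<in> E"
        have "g i - \<tau> \<le> C" using g1(2)[OF i] t0 by (simp add: \<Lambda>_def)
        then have "1 \<le> 1 + (C - ln (norm (lform (L i) (G 0))))" using lnF[OF i] by simp
        moreover have "1 + (C - ln (norm (lform (L i) (G 0)))) \<le> A + charT f \<rho>"
          using g1(1)[OF i] tT lnF[OF i] unfolding A_def by linarith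
        ultimately show "ln (1 + (C - ln (norm (lform (L i) (G 0))))) \<le> ln (A + charT f \<rho>)"
          by (subst ln_le_cancel_iff) auto
      qed
      then show ?thesis by simp
    qed
    have A1: "0 \<le> A + charT f \<rho> - 1" using tT t0 C unfolding A_def by linarith
    have lnA: "0 \<le> ln (A + charT f \<rho>)" using A1 by simp
    have "C * (\<Sum>i\<in>E. ln (1 + (C - ln (norm (lform (L i) (G 0)))))) \<le> C * (real (card E) * ln (A + charT f \<rho>))"
      using C by (intro mult_left_mono sumln) auto
    then have "eps * \<tau> + ln \<kappa> - M' \<le> - eps * (charT f r' - \<tau>) + (C * 1 + C * (real (card E) * ln (A + charT f \<rho>)))"
      using lhs main[unfolded mG distrib_left[of C]] by linarith
    then have "eps * charT f r' \<le> M' - ln \<kappa> + C + C * real (card E) * ln (A + charT f \<rho>)"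
      by (simp add: algebra_simps)
    then have "eps * charT f r' \<le> a + C * real (card E) * ln (A + charT f \<rho>)"
      using abs_ge_minus_self[of "ln \<kappa>"] unfolding a_def by linarith
    moreover have "C * real (card E) * ln (A + charT f \<rho>) \<le> b * ln (A + charT f \<rho>)"
      using lnA by (intro mult_right_mono) (auto simp: b_def)
    moreover have "charT f r \<le> charT f r'"
      by (rule charT_mono[OF hol]) (use r r' fnz in auto)
    then have "eps * charT f r \<le> eps * charT f r'" using eps by (intro mult_left_mono) auto
    ultimately show "eps * charT f r \<le> a + b * ln (A + charT f (4 * r))" by (simp add: \<rho>_def)
    show "0 \<le> A + charT f (4 * r) - 1" using A1 by (simp add: \<rho>_def)
  qed
qed

text \<open>At radius \<open>16 * r\<close> the growth bound is of order r^2. One use of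
  \<open>characteristic_bound\<close> brings this to order log r at \<open>4 * r\<close>, with a
  factor that is not under control; a second one brings it to order log log r at \<open>r\<close>,
  which is below the (log r)/2 forced by a large minor at 0.\<close>

theorem bounded_radius:
  assumes eps: "eps > 0" and k0: "\<kappa> > 0" and s: "s > 0"
  shows "\<exists>R0>0. \<forall>f R. R0 \<le> R \<longrightarrow> admissible R f \<longrightarrow>
      \<kappa> * norm (f 0) ^ d \<le> norm (Wr f 0) \<longrightarrow> (\<forall>i\<in>E. \<kappa> * norm (f 0) \<le> norm (lform (L i) (f 0))) \<longrightarrow>
      (\<forall>z\<in>ball 0 R. \<exists>\<delta>>0. \<forall>w. norm (w - z) < \<delta> \<longrightarrow> chordal (f w) (f z) \<le> s * norm (w - z)) \<longrightarrow>
      (\<forall>i j. norm (deriv (\<lambda>z. f z $ i) 0 * f 0 $ j - f 0 $ i * deriv (\<lambda>z. f z $ j) 0) < \<kappa> * (norm (f 0))\<^sup>2)"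
proof -
  obtain a b A where ab: "a > 0" "b > 0" "A > 1" and bd: "\<forall>f R r. 2 \<le> r \<longrightarrow> 4 * r < R \<longrightarrow> admissible R f \<longrightarrow>
      \<kappa> * norm (f 0) ^ d \<le> norm (Wr f 0) \<longrightarrow> (\<forall>i\<in>E. \<kappa> * norm (f 0) \<le> norm (lform (L i) (f 0))) \<longrightarrow>
      0 \<le> A + charT f (4 * r) - 1 \<and> eps * charT f r \<le> a + b * ln (A + charT f (4 * r))"
    using characteristic_bound[OF eps k0] by (elim exE conjE)
  define e where "e = eps"
  have e: "e > 0" using eps by (simp add: e_def)
  \<comment> \<open>512 is 2 * 16^2 from the growth bound; the nested logarithms are the two
    applications, and the right side is the lower bound solved for the characteristic.\<close>
  have "eventually (\<lambda>r::real. a + b * ln (A + (a + b * ln (A + 512 * s\<^sup>2 * r\<^sup>2)) / e) < e * (ln (\<kappa> * r / 2) / 2 - 1)) at_top"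
    using ab e k0 s by real_asymp
  then obtain r0 where r0: "\<And>r. r \<ge> r0 \<Longrightarrow> a + b * ln (A + (a + b * ln (A + 512 * s\<^sup>2 * r\<^sup>2)) / e) < e * (ln (\<kappa> * r / 2) / 2 - 1)"
    by (auto simp: eventually_at_top_linorder)
  define r where "r = max 2 r0"
  have r: "r \<ge> 2" "r \<ge> r0" by (auto simp: r_def)
  show ?thesis
  proof (intro exI[of _ "16 * r + 1"] conjI allI impI)
    show "0 < 16 * r + 1" using r by simp
    fix f :: "complex \<Rightarrow> complex ^ 'n" and R i j
    assume R: "16 * r + 1 \<le> R" and adm: "admissible R f"
      and hyp: "\<kappa> * norm (f 0) ^ d \<le> norm (Wr f 0)" "\<forall>i\<in>E. \<kappa> * norm (f 0) \<le> norm (lform (L i) (f 0))"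
      and lip: "\<forall>z\<in>ball 0 R. \<exists>\<delta>>0. \<forall>w. norm (w - z) < \<delta> \<longrightarrow> chordal (f w) (f z) \<le> s * norm (w - z)"
    have hol: "\<And>j. (\<lambda>z. f z $ j) holomorphic_on ball 0 R" and fnz: "\<And>z. z \<in> ball 0 R \<Longrightarrow> f z \<noteq> 0"
      using adm unfolding admissible_def by auto
    have T16: "charT f (16 * r) \<le> 512 * s\<^sup>2 * r\<^sup>2"
    proof -
      have "charT f (16 * r) \<le> 2 * s\<^sup>2 * (16 * r)\<^sup>2"
        by (rule charT_growth[OF hol]) (use R r fnz s lip in auto)
      then show ?thesis by (simp add: power_mult_distrib)
    qed
    have b1: "0 \<le> A + charT f (16 * r) - 1 \<and> eps * charT f (4 * r) \<le> a + b * ln (A + charT f (16 * r))"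
      using bd[rule_format, of "4 * r" R f] R r adm hyp by simp
    have b2: "0 \<le> A + charT f (4 * r) - 1 \<and> eps * charT f r \<le> a + b * ln (A + charT f (4 * r))"
      using bd[rule_format, of r R f] R r adm hyp by simp
    have "ln (A + charT f (16 * r)) \<le> ln (A + 512 * s\<^sup>2 * r\<^sup>2)" using b1 T16 by (subst ln_le_cancel_iff) auto
    then have "b * ln (A + charT f (16 * r)) \<le> b * ln (A + 512 * s\<^sup>2 * r\<^sup>2)" using ab by (intro mult_left_mono) auto
    then have "eps * charT f (4 * r) \<le> a + b * ln (A + 512 * s\<^sup>2 * r\<^sup>2)" using b1 by linarith
    then have T4: "charT f (4 * r) \<le> (a + b * ln (A + 512 * s\<^sup>2 * r\<^sup>2)) / e"
      using e by (simp add: e_def pos_le_divide_eq mult.commute)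
    have "ln (A + charT f (4 * r)) \<le> ln (A + (a + b * ln (A + 512 * s\<^sup>2 * r\<^sup>2)) / e)" using b2 T4 by (subst ln_le_cancel_iff) auto
    then have "b * ln (A + charT f (4 * r)) \<le> b * ln (A + (a + b * ln (A + 512 * s\<^sup>2 * r\<^sup>2)) / e)" using ab by (intro mult_left_mono) auto
    then have "e * charT f r < e * (ln (\<kappa> * r / 2) / 2 - 1)" using b2 r0[OF r(2)] unfolding e_def by linarith
    then have "charT f r < ln (\<kappa> * r / 2) / 2 - 1" using e by simp
    then have "2 * charT f r + 2 < ln (\<kappa> * r / 2)" by simp
    then have "exp (2 * charT f r + 2) < exp (ln (\<kappa> * r / 2))" by simp
    moreover have "\<kappa> * r / 2 > 0" using k0 r by simp
    ultimately have ex: "exp (2 * charT f r + 2) < \<kappa> * r / 2" by simp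
    have f0: "f 0 \<noteq> 0" using fnz[of 0] R r by auto
    have "norm (deriv (\<lambda>z. f z $ i) 0 * f 0 $ j - f 0 $ i * deriv (\<lambda>z. f z $ j) 0) / (norm (f 0))\<^sup>2
       \<le> 2 / r * exp (2 * charT f r + 2)"
      by (rule charT_lower[OF hol]) (use R r fnz in auto)
    also have "\<dots> < 2 / r * (\<kappa> * r / 2)" using ex r by (intro mult_strict_left_mono) auto
    also have "\<dots> = \<kappa>" using r by simp
    finally show "norm (deriv (\<lambda>z. f z $ i) 0 * f 0 $ j - f 0 $ i * deriv (\<lambda>z. f z $ j) 0) < \<kappa> * (norm (f 0))\<^sup>2"
      using f0 by (simp add: pos_divide_less_eq)
  qed
qed

end

subsection \<open>The chordal metric\<close>

lemma herm_add_left: "herm (u + v) x = herm u x + herm v x"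
  by (simp add: herm_def sum.distrib algebra_simps)

lemma herm_scale_left: "herm (c *s u) x = c * herm u x"
  by (simp add: herm_def sum_distrib_left mult.assoc)

lemma herm_scale_right: "herm u (c *s x) = cnj c * herm u x"
  by (simp add: herm_def sum_distrib_left mult_ac)

lemma herm_commute: "herm u v = cnj (herm v u)"
  by (simp add: herm_def mult.commute)

text \<open>For nonzero \<open>v\<close> this is the orthogonal projector onto its line.
  Hilbert-Schmidt distances of projectors are \<open>sqrt 2\<close> times chordal distances, so
  \<open>chordal\<close> inherits the triangle inequality from a norm.\<close>

definition proj_matrix :: "complex ^ 'n \<Rightarrow> complex ^ 'n ^ 'n" where
  "proj_matrix v = (\<chi> i j. v $ i * cnj (v $ j) / of_real ((norm v)\<^sup>2))"

lemma norm_sq_vec: "(norm (v :: complex ^ 'n))\<^sup>2 = (\<Sum>j\<in>UNIV. (norm (v $ j))\<^sup>2)"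
  unfolding norm_vec_def L2_set_def by (simp add: sum_nonneg)

lemma norm_sq_mat: "(norm (A :: complex ^ 'n ^ 'n))\<^sup>2 = (\<Sum>i\<in>UNIV. \<Sum>j\<in>UNIV. (norm (A $ i $ j))\<^sup>2)"
proof -
  have "(norm A)\<^sup>2 = (\<Sum>i\<in>UNIV. (norm (A $ i))\<^sup>2)"
    by (subst norm_vec_def) (simp add: L2_set_def sum_nonneg)
  then show ?thesis by (simp add: norm_sq_vec)
qed

lemma chordal_sq_eq:
  fixes u v :: "complex ^ 'n"
  assumes "u \<noteq> 0" "v \<noteq> 0"
  shows "(norm (proj_matrix u - proj_matrix v))\<^sup>2 =
    2 * (1 - (norm (herm u v))\<^sup>2 / ((norm u)\<^sup>2 * (norm v)\<^sup>2))"
proof -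
  define a b where "a = (norm u)\<^sup>2" and "b = (norm v)\<^sup>2"
  have ab: "a > 0" "b > 0" using assms by (auto simp: a_def b_def)
  define A B where "A i j = u $ i * cnj (u $ j)" and "B i j = v $ i * cnj (v $ j)" for i j
  have ent: "(norm ((proj_matrix u - proj_matrix v) $ i $ j))\<^sup>2 =
     (norm (A i j))\<^sup>2 / a\<^sup>2 + (norm (B i j))\<^sup>2 / b\<^sup>2 - 2 * Re (A i j * cnj (B i j)) / (a * b)" for i j
  proof -
    have e: "(proj_matrix u - proj_matrix v) $ i $ j = A i j / of_real a - B i j / of_real b"
      by (simp add: proj_matrix_def A_def B_def a_def b_def)
    have re: "(norm (x - y))\<^sup>2 = (norm x)\<^sup>2 + (norm y)\<^sup>2 - 2 * Re (x * cnj y)" for x y :: complex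
      unfolding cmod_power2 by (simp add: power2_eq_square algebra_simps)
    have "A i j / of_real a * cnj (B i j / of_real b) = of_real (1 / (a * b)) * (A i j * cnj (B i j))" by simp
    then have "Re (A i j / of_real a * cnj (B i j / of_real b)) = (1 / (a * b)) * Re (A i j * cnj (B i j))"
      by (simp only: Re_complex_of_real Im_complex_of_real times_complex.simps)
    then show ?thesis unfolding e re using ab by (simp add: norm_divide power_divide)
  qed
  have sA: "(\<Sum>i\<in>UNIV. \<Sum>j\<in>UNIV. (norm (A i j))\<^sup>2) = a\<^sup>2"
  proof -
    have "(\<Sum>i\<in>UNIV. \<Sum>j\<in>UNIV. (norm (A i j))\<^sup>2) = (\<Sum>i\<in>UNIV. (norm (u $ i))\<^sup>2) * (\<Sum>j\<in>UNIV. (norm (u $ j))\<^sup>2)"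
      by (simp add: A_def sum_product norm_mult power_mult_distrib)
    then show ?thesis unfolding norm_sq_vec[symmetric] a_def power2_eq_square[of "(norm u)\<^sup>2"] .
  qed
  have sB: "(\<Sum>i\<in>UNIV. \<Sum>j\<in>UNIV. (norm (B i j))\<^sup>2) = b\<^sup>2"
  proof -
    have "(\<Sum>i\<in>UNIV. \<Sum>j\<in>UNIV. (norm (B i j))\<^sup>2) = (\<Sum>i\<in>UNIV. (norm (v $ i))\<^sup>2) * (\<Sum>j\<in>UNIV. (norm (v $ j))\<^sup>2)"
      by (simp add: B_def sum_product norm_mult power_mult_distrib)
    then show ?thesis unfolding norm_sq_vec[symmetric] b_def power2_eq_square[of "(norm v)\<^sup>2"] .
  qed
  have sAB: "(\<Sum>i\<in>UNIV. \<Sum>j\<in>UNIV. Re (A i j * cnj (B i j))) = (norm (herm u v))\<^sup>2"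
  proof -
    have "of_real ((norm (herm u v))\<^sup>2) = herm u v * cnj (herm u v)" by (rule complex_norm_square)
    also have "\<dots> = (\<Sum>i\<in>UNIV. \<Sum>j\<in>UNIV. A i j * cnj (B i j))"
      unfolding herm_def cnj_sum sum_product by (simp add: A_def B_def mult_ac)
    finally have "Re (of_real ((norm (herm u v))\<^sup>2)) = Re (\<Sum>i\<in>UNIV. \<Sum>j\<in>UNIV. A i j * cnj (B i j))" by (rule arg_cong)
    then show ?thesis by (simp add: Re_sum)
  qed
  have "(norm (proj_matrix u - proj_matrix v))\<^sup>2 =
    (\<Sum>i\<in>UNIV. \<Sum>j\<in>UNIV. (norm (A i j))\<^sup>2 / a\<^sup>2 + (norm (B i j))\<^sup>2 / b\<^sup>2 - 2 * Re (A i j * cnj (B i j)) / (a * b))"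
    unfolding norm_sq_mat ent ..
  also have "\<dots> = a\<^sup>2 / a\<^sup>2 + b\<^sup>2 / b\<^sup>2 - 2 * (norm (herm u v))\<^sup>2 / (a * b)"
    by (simp only: sum.distrib sum_subtractf sum_divide_distrib[symmetric] sum_distrib_left[symmetric] sA sB sAB)
  also have "\<dots> = 2 * (1 - (norm (herm u v))\<^sup>2 / (a * b))" using ab by simp
  finally show ?thesis by (simp add: a_def b_def)
qed

lemma chordal_eq_proj:
  assumes "u \<noteq> 0" "v \<noteq> 0"
  shows "chordal u v = norm (proj_matrix u - proj_matrix v) / sqrt 2"
proof -
  have "(norm (proj_matrix u - proj_matrix v) / sqrt 2)\<^sup>2 = 1 - (norm (herm u v))\<^sup>2 / ((norm u)\<^sup>2 * (norm v)\<^sup>2)"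
    unfolding power_divide chordal_sq_eq[OF assms] by simp
  then have "norm (proj_matrix u - proj_matrix v) / sqrt 2 = sqrt (1 - (norm (herm u v))\<^sup>2 / ((norm u)\<^sup>2 * (norm v)\<^sup>2))"
    by (metis divide_nonneg_nonneg norm_ge_zero real_sqrt_ge_0_iff real_sqrt_unique zero_le_numeral)
  then show ?thesis by (simp add: chordal_herm)
qed

lemma chordal_triangle:
  assumes "u \<noteq> 0" "v \<noteq> 0" "x \<noteq> 0"
  shows "chordal u x \<le> chordal u v + chordal v x"
proof -
  have "norm (proj_matrix u - proj_matrix x) \<le> norm (proj_matrix u - proj_matrix v) + norm (proj_matrix v - proj_matrix x)"
    using norm_triangle_ineq[of "proj_matrix u - proj_matrix v" "proj_matrix v - proj_matrix x"] by simp
  then have "norm (proj_matrix u - proj_matrix x) / sqrt 2 \<le>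
     (norm (proj_matrix u - proj_matrix v) + norm (proj_matrix v - proj_matrix x)) / sqrt 2"
    by (rule divide_right_mono) simp
  then show ?thesis using assms by (simp add: chordal_eq_proj add_divide_distrib)
qed

lemma chordal_commute: "chordal u v = chordal v u"
  by (simp add: chordal_herm herm_commute[of u v] mult.commute)

lemma chordal_self: "u \<noteq> 0 \<Longrightarrow> chordal u u = 0"
  by (simp add: chordal_eq_proj)

lemma chordal_nonneg: "u \<noteq> 0 \<Longrightarrow> v \<noteq> 0 \<Longrightarrow> 0 \<le> chordal u v"
  by (simp add: chordal_eq_proj)

lemma chordal_le_1: "u \<noteq> 0 \<Longrightarrow> v \<noteq> 0 \<Longrightarrow> chordal u v \<le> 1"
  by (simp add: chordal_herm)

lemma chordal_scale_left: "c \<noteq> 0 \<Longrightarrow> chordal (c *s u) v = chordal u v"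
  by (simp add: chordal_herm herm_scale_left norm_vector_scale norm_mult power_mult_distrib mult.assoc)

lemma chordal_scale_right: "c \<noteq> 0 \<Longrightarrow> chordal u (c *s v) = chordal u v"
  by (metis chordal_commute chordal_scale_left)

lemma chordal_proj_eq:
  assumes "proj_eq u u'" "proj_eq v v'" shows "chordal u v = chordal u' v'"
  using assms by (auto simp: proj_eq_def chordal_scale_left chordal_scale_right)

text \<open>The Gram determinant: zero exactly for dependent vectors, and unchanged when a multiple
  of \<open>v\<close> is added to \<open>u\<close>.\<close>

definition gram :: "complex ^ 'n \<Rightarrow> complex ^ 'n \<Rightarrow> real" where
  "gram u v = (norm u)\<^sup>2 * (norm v)\<^sup>2 - (norm (herm u v))\<^sup>2"

lemma gram_nonneg: "0 \<le> gram u v"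
  unfolding gram_def using power_mono[OF norm_herm_le[of u v], of 2] by (simp add: power_mult_distrib)

lemma chordal_gram:
  assumes "u \<noteq> 0" "v \<noteq> 0" shows "chordal u v = sqrt (gram u v) / (norm u * norm v)"
proof -
  have "1 - (norm (herm u v))\<^sup>2 / ((norm u)\<^sup>2 * (norm v)\<^sup>2) = gram u v / (norm u * norm v)\<^sup>2"
    using assms by (simp add: gram_def field_simps power_mult_distrib)
  then show ?thesis unfolding chordal_herm by (simp add: real_sqrt_divide)
qed

lemma gram_scale: "gram (c *s u) v = (norm c)\<^sup>2 * gram u v"
  by (simp add: gram_def norm_vector_scale herm_scale_left norm_mult power_mult_distrib algebra_simps)

lemma gram_scale_right: "gram u (c *s v) = (norm c)\<^sup>2 * gram u v"
  by (simp add: gram_def norm_vector_scale herm_scale_right norm_mult power_mult_distrib algebra_simps)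

lemma norm_sq_add_scale: "(norm (u + c *s v))\<^sup>2 = (norm u)\<^sup>2 + (norm c)\<^sup>2 * (norm v)\<^sup>2 + 2 * Re (cnj c * herm u v)"
proof -
  have "of_real ((norm (u + c *s v))\<^sup>2) = herm (u + c *s v) (u + c *s v)" by (rule herm_self[symmetric])
  also have "\<dots> = herm u u + c * cnj c * herm v v + (cnj c * herm u v + cnj (cnj c * herm u v))"
    by (simp add: herm_def sum.distrib sum_distrib_left algebra_simps cnj_sum)
  also have "\<dots> = of_real ((norm u)\<^sup>2 + (norm c)\<^sup>2 * (norm v)\<^sup>2 + 2 * Re (cnj c * herm u v))"
  proof -
    have 1: "c * cnj c * herm v v = of_real ((norm c)\<^sup>2 * (norm v)\<^sup>2)"
      unfolding herm_self complex_norm_square[symmetric] by (rule of_real_mult[symmetric])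
    have 2: "cnj c * herm u v + cnj (cnj c * herm u v) = of_real (2 * Re (cnj c * herm u v))" by (rule complex_add_cnj)
    show ?thesis unfolding 1 2 of_real_add by (simp only: herm_self)
  qed
  finally show ?thesis using of_real_eq_iff by blast
qed

lemma gram_add_scale: "gram (u + c *s v) v = gram u v"
proof -
  have "herm (u + c *s v) v = herm u v + c * of_real ((norm v)\<^sup>2)"
    by (simp add: herm_add_left herm_scale_left herm_self)
  moreover have n: "(norm (herm u v + c * of_real t))\<^sup>2 = (norm (herm u v))\<^sup>2 + (norm c)\<^sup>2 * t\<^sup>2 + 2 * t * Re (cnj c * herm u v)" for t :: real
    unfolding cmod_power2 by (simp add: power2_eq_square algebra_simps)
  ultimately have "(norm (herm (u + c *s v) v))\<^sup>2 =
      (norm (herm u v))\<^sup>2 + (norm c)\<^sup>2 * ((norm v)\<^sup>2)\<^sup>2 + 2 * (norm v)\<^sup>2 * Re (cnj c * herm u v)" by (simp only: n)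
  then show ?thesis unfolding gram_def norm_sq_add_scale by (simp only:) (simp add: power2_eq_square algebra_simps)
qed

text \<open>Equality case of Cauchy-Schwarz: the part of \<open>u\<close> orthogonal to
  \<open>v\<close> has the same Gram determinant with \<open>v\<close>, hence norm 0.\<close>

lemma gram_zero_imp:
  assumes "gram u v = 0" "v \<noteq> 0"
  shows "u = (herm u v / of_real ((norm v)\<^sup>2)) *s v"
proof -
  define c where "c = herm u v / of_real ((norm v)\<^sup>2)"
  have h: "herm (u + (- c) *s v) v = 0"
    using assms(2) by (simp only: herm_add_left herm_scale_left herm_self) (simp add: c_def)
  have "gram (u + (- c) *s v) v = 0" using assms by (simp only: gram_add_scale)
  then have "(norm (u + (- c) *s v))\<^sup>2 * (norm v)\<^sup>2 = 0" using h by (simp add: gram_def)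
  then have "u + (- c) *s v = 0" using assms(2) by simp
  then show ?thesis by (simp add: c_def add_eq_0_iff)
qed

lemma chordal_zero_imp_proj_eq:
  assumes "u \<noteq> 0" "v \<noteq> 0" "chordal u v = 0" shows "proj_eq u v"
proof -
  have "gram v u = 0"
    using assms chordal_gram[of v u] chordal_commute[of u v] gram_nonneg[of v u] by simp
  then have "v = (herm v u / of_real ((norm u)\<^sup>2)) *s u" by (rule gram_zero_imp) fact
  then show ?thesis using assms unfolding proj_eq_def by (metis vector_space_over_itself.scale_zero_left vec.scale_zero_left)
qed

section \<open>The Fubini-Study derivative\<close>

definition vderiv :: "(complex \<Rightarrow> complex ^ 'n) \<Rightarrow> complex \<Rightarrow> complex ^ 'n" where
  "vderiv f z = (\<chi> j. deriv (\<lambda>w. f w $ j) z)"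

text \<open>Up to normalisation this is the Fubini--Study derivative.\<close>

definition sph :: "(complex \<Rightarrow> complex ^ 'n) \<Rightarrow> complex \<Rightarrow> real" where
  "sph f z = sqrt (gram (vderiv f z) (f z)) / (norm (f z))\<^sup>2"

lemma sph_nonneg: "0 \<le> sph f z"
  by (simp add: sph_def gram_nonneg)

lemma continuous_on_sph:
  assumes "open S" "\<And>j. (\<lambda>z. f z $ j) holomorphic_on S" "\<And>z. z \<in> S \<Longrightarrow> f z \<noteq> 0"
  shows "continuous_on S (sph f)"
proof -
  have c1: "continuous_on S f" by (rule continuous_on_vec[OF assms(2)])
  have "(\<lambda>z. vderiv f z $ j) holomorphic_on S" for j
    unfolding vderiv_def using assms(1,2) by (auto intro!: holomorphic_deriv)
  then have c2: "continuous_on S (vderiv f)" by (rule continuous_on_vec)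
  have c3: "continuous_on S (\<lambda>z. herm (vderiv f z) (f z))"
    unfolding herm_def using c1 c2 by (intro continuous_intros)
  show ?thesis unfolding sph_def gram_def
    by (intro continuous_intros c1 c2 c3) (use assms(3) in auto)
qed

text \<open>The derivative of u f is u f' plus a multiple of f, which the Gram determinant ignores;
  so \<open>sph\<close> depends only on the curve in projective space.\<close>

lemma sph_scale:
  assumes S: "open S" "z \<in> S" and hol: "\<And>j. (\<lambda>z. f z $ j) holomorphic_on S" and u: "u holomorphic_on S" "u z \<noteq> 0"
  shows "sph (\<lambda>z. u z *s f z) z = sph f z"
proof -
  have "vderiv (\<lambda>z. u z *s f z) z = u z *s vderiv f z + deriv u z *s f z"
  proof -
    have "deriv (\<lambda>w. u w * f w $ j) z = u z * deriv (\<lambda>w. f w $ j) z + deriv u z * f z $ j" for j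
      using hol u(1) S by (intro complex_derivative_mult_at DERIV_imp_deriv)
        (auto intro!: derivative_eq_intros holomorphic_derivI[of _ S])
    then show ?thesis by (simp add: vderiv_def Finite_Cartesian_Product.vec_eq_iff)
  qed
  then have "gram (vderiv (\<lambda>z. u z *s f z) z) (u z *s f z) = (norm (u z))\<^sup>2 * gram (u z *s vderiv f z + deriv u z *s f z) (f z)"
    by (simp add: gram_scale_right)
  also have "\<dots> = (norm (u z))\<^sup>2 * ((norm (u z))\<^sup>2 * gram (vderiv f z) (f z))"
    by (simp add: gram_add_scale gram_scale)
  also have "\<dots> = ((norm (u z))\<^sup>2)\<^sup>2 * gram (vderiv f z) (f z)" by (simp add: power2_eq_square)
  finally have "sqrt (gram (vderiv (\<lambda>z. u z *s f z) z) (u z *s f z)) = (norm (u z))\<^sup>2 * sqrt (gram (vderiv f z) (f z))"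
    by (simp only: real_sqrt_mult real_sqrt_pow2_iff real_sqrt_abs abs_power2)
  then show ?thesis using u(2) by (simp add: sph_def norm_vector_scale power_mult_distrib)
qed

lemma sph_compose_affine:
  assumes "open S" "\<And>j. (\<lambda>z. f z $ j) holomorphic_on S" "a + b * z \<in> S"
  shows "sph (\<lambda>z. f (a + b * z)) z = norm b * sph f (a + b * z)"
proof -
  have "deriv (\<lambda>w. f (a + b * w) $ j) z = b * deriv (\<lambda>w. f w $ j) (a + b * z)" for j
  proof (rule DERIV_imp_deriv)
    have "((\<lambda>w. f w $ j) has_field_derivative deriv (\<lambda>w. f w $ j) (a + b * z)) (at (a + b * z))"
      using assms by (meson holomorphic_derivI)
    moreover have "((\<lambda>w. a + b * w) has_field_derivative b) (at z)" by (auto intro!: derivative_eq_intros)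
    ultimately have "((\<lambda>w. f (a + b * w) $ j) has_field_derivative deriv (\<lambda>w. f w $ j) (a + b * z) * b) (at z)"
      by (rule DERIV_chain2)
    then show "((\<lambda>w. f (a + b * w) $ j) has_field_derivative b * deriv (\<lambda>w. f w $ j) (a + b * z)) (at z)" by (simp add: mult.commute)
  qed
  then have "vderiv (\<lambda>z. f (a + b * z)) z = b *s vderiv f (a + b * z)" by (simp add: vderiv_def Finite_Cartesian_Product.vec_eq_iff)
  then show ?thesis by (simp add: sph_def gram_scale real_sqrt_mult)
qed

text \<open>With the difference quotient \<open>H\<close> one has f w = (w - z) H w + f z, so the
  Gram determinant of \<open>f w\<close> and \<open>f z\<close> is that of \<open>H w\<close> and
  \<open>f z\<close> times |w - z|^2, and \<open>H w\<close> tends to the derivative.\<close>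

lemma sph_local_lipschitz:
  fixes f :: "complex \<Rightarrow> complex ^ 'n"
  assumes S: "open S" "z \<in> S" and hol: "\<And>j. (\<lambda>z. f z $ j) holomorphic_on S" and nz: "f z \<noteq> 0" and s: "sph f z < s"
  shows "\<exists>\<delta>>0. \<forall>w. norm (w - z) < \<delta> \<longrightarrow> f w \<noteq> 0 \<and> chordal (f w) (f z) \<le> s * norm (w - z)"
proof -
  define H where "H w = (\<chi> j. (f w $ j - f z $ j) / (w - z))" for w
  have "(\<lambda>w. H w $ j) \<midarrow>z\<rightarrow> vderiv f z $ j" for j
  proof -
    have "((\<lambda>w. f w $ j) has_field_derivative deriv (\<lambda>w. f w $ j) z) (at z)"
      using S hol by (meson holomorphic_derivI)
    then show ?thesis by (simp add: H_def vderiv_def has_field_derivative_iff)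
  qed
  then have Ht: "H \<midarrow>z\<rightarrow> vderiv f z" by (intro vec_tendstoI)
  have fc: "f \<midarrow>z\<rightarrow> f z"
    using continuous_on_vec[of f S] hol S by (simp add: continuous_on_eq_continuous_at isContD)
  have ht: "(\<lambda>w. herm (H w) (f z)) \<midarrow>z\<rightarrow> herm (vderiv f z) (f z)"
    unfolding herm_def using Ht by (intro tendsto_intros)
  have "(\<lambda>w. sqrt (gram (H w) (f z)) / (norm (f w) * norm (f z))) \<midarrow>z\<rightarrow> sqrt (gram (vderiv f z) (f z)) / (norm (f z) * norm (f z))"
    unfolding gram_def using Ht ht fc nz by (intro tendsto_intros) auto
  then have "(\<lambda>w. sqrt (gram (H w) (f z)) / (norm (f w) * norm (f z))) \<midarrow>z\<rightarrow> sph f z" by (simp add: sph_def power2_eq_square)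
  then have "eventually (\<lambda>w. sqrt (gram (H w) (f z)) / (norm (f w) * norm (f z)) < s) (at z)"
    using s by (rule order_tendstoD)
  moreover have "eventually (\<lambda>w. f w \<noteq> 0) (at z)" using fc nz by (rule tendsto_imp_eventually_ne)
  ultimately have "eventually (\<lambda>w. f w \<noteq> 0 \<and> sqrt (gram (H w) (f z)) / (norm (f w) * norm (f z)) < s) (at z)"
    by eventually_elim auto
  then obtain \<delta> where d: "\<delta> > 0" "\<And>w. w \<noteq> z \<Longrightarrow> dist w z < \<delta> \<Longrightarrow> f w \<noteq> 0 \<and> sqrt (gram (H w) (f z)) / (norm (f w) * norm (f z)) < s"
    unfolding eventually_at by auto
  show ?thesis
  proof (intro exI[of _ \<delta>] conjI d(1) allI impI)
    fix w assume w: "norm (w - z) < \<delta>"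
    show "f w \<noteq> 0" using d(2)[of w] w nz by (cases "w = z") (auto simp: dist_norm)
    show "chordal (f w) (f z) \<le> s * norm (w - z)"
    proof (cases "w = z")
      case True then show ?thesis using nz by (simp add: chordal_self)
    next
      case False
      then have fw: "f w \<noteq> 0" and lt: "sqrt (gram (H w) (f z)) / (norm (f w) * norm (f z)) < s" using d(2)[of w] w by (auto simp: dist_norm)
      have "f w $ j = (w - z) * ((f w $ j - f z $ j) / (w - z)) + f z $ j" for j using False by simp
      then have "f w = (w - z) *s H w + 1 *s f z"
        unfolding Finite_Cartesian_Product.vec_eq_iff H_def vector_add_component vector_smult_component vec_lambda_beta mult_1 by blast
      then have "gram (f w) (f z) = (norm (w - z))\<^sup>2 * gram (H w) (f z)" by (metis gram_add_scale gram_scale)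
      then have "chordal (f w) (f z) = norm (w - z) * (sqrt (gram (H w) (f z)) / (norm (f w) * norm (f z)))"
        using chordal_gram[OF fw nz] by (simp add: real_sqrt_mult)
      also have "\<dots> \<le> norm (w - z) * s" using lt by (intro mult_left_mono) auto
      finally show ?thesis by (simp add: mult.commute)
    qed
  qed
qed

text \<open>Bisection along the segment from \<open>a\<close> to \<open>b\<close> takes the place of
  integrating a length: the estimate is additive by the triangle inequality and holds locally around
  each parameter.\<close>

lemma sph_lipschitz:
  fixes f :: "complex \<Rightarrow> complex ^ 'n"
  assumes S: "open S" "convex S" and hol: "\<And>j. (\<lambda>z. f z $ j) holomorphic_on S" and nz: "\<And>z. z \<in> S \<Longrightarrow> f z \<noteq> 0"
    and s: "\<And>z. z \<in> S \<Longrightarrow> sph f z < s" and ab: "a \<in> S" "b \<in> S"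
  shows "chordal (f a) (f b) \<le> s * norm (a - b)"
proof -
  define \<gamma> where "\<gamma> t = a + of_real t * (b - a)" for t :: real
  have gS: "\<gamma> t \<in> S" if "0 \<le> t" "t \<le> 1" for t
  proof -
    have "\<gamma> t = (1 - t) *\<^sub>R a + t *\<^sub>R b" by (simp add: \<gamma>_def algebra_simps scaleR_conv_of_real)
    then show ?thesis using convexD_alt[OF S(2) ab that] by simp
  qed
  define l where "l = norm (b - a)"
  have gd: "norm (\<gamma> x - \<gamma> y) = \<bar>x - y\<bar> * l" for x y
  proof -
    have "\<gamma> x - \<gamma> y = of_real (x - y) * (b - a)" by (simp add: \<gamma>_def algebra_simps)
    then show ?thesis by (simp add: norm_mult l_def del: of_real_diff)
  qed
  have l0: "l \<ge> 0" by (simp add: l_def)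
  have "0 \<le> (0::real) \<and> 1 \<le> (1::real) \<longrightarrow> chordal (f (\<gamma> 0)) (f (\<gamma> 1)) \<le> s * l * (1 - 0)"
  proof (rule Bolzano[of 0 1 "\<lambda>x y. 0 \<le> x \<and> y \<le> 1 \<longrightarrow> chordal (f (\<gamma> x)) (f (\<gamma> y)) \<le> s * l * (y - x)"])
    show "(0::real) \<le> 1" by simp
    fix x y z :: real
    assume 1: "0 \<le> x \<and> y \<le> 1 \<longrightarrow> chordal (f (\<gamma> x)) (f (\<gamma> y)) \<le> s * l * (y - x)"
      and 2: "0 \<le> y \<and> z \<le> 1 \<longrightarrow> chordal (f (\<gamma> y)) (f (\<gamma> z)) \<le> s * l * (z - y)" and xyz: "x \<le> y" "y \<le> z"
    show "0 \<le> x \<and> z \<le> 1 \<longrightarrow> chordal (f (\<gamma> x)) (f (\<gamma> z)) \<le> s * l * (z - x)"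
    proof
      assume b: "0 \<le> x \<and> z \<le> 1"
      have "chordal (f (\<gamma> x)) (f (\<gamma> z)) \<le> chordal (f (\<gamma> x)) (f (\<gamma> y)) + chordal (f (\<gamma> y)) (f (\<gamma> z))"
        by (rule chordal_triangle) (use nz gS b xyz in auto)
      also have "\<dots> \<le> s * l * (y - x) + s * l * (z - y)" using 1 2 b xyz by auto
      finally show "chordal (f (\<gamma> x)) (f (\<gamma> z)) \<le> s * l * (z - x)" by (simp add: algebra_simps)
    qed
  next
    fix x :: real assume x: "0 \<le> x" "x \<le> 1"
    obtain \<delta> where d: "\<delta> > 0" "\<And>w. norm (w - \<gamma> x) < \<delta> \<Longrightarrow> chordal (f w) (f (\<gamma> x)) \<le> s * norm (w - \<gamma> x)"
      using sph_local_lipschitz[OF S(1) gS[OF x] hol nz[OF gS[OF x]] s[OF gS[OF x]]] by blast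
    \<comment> \<open>The denominator \<open>l + 1\<close> covers the degenerate segment with
      \<open>l = 0\<close>.\<close>
    have key: "chordal (f (\<gamma> y)) (f (\<gamma> x)) \<le> s * l * \<bar>y - x\<bar>" if "\<bar>y - x\<bar> < \<delta> / (l + 1)" for y
    proof -
      have "\<bar>y - x\<bar> * (l + 1) < \<delta>" using that l0 by (simp add: pos_less_divide_eq)
      moreover have "\<bar>y - x\<bar> * l \<le> \<bar>y - x\<bar> * (l + 1)" by (rule mult_left_mono) auto
      ultimately show ?thesis using d(2)[of "\<gamma> y"] gd[of y x] by (simp add: mult_ac)
    qed
    show "\<exists>d>0. \<forall>a b. a \<le> x \<and> x \<le> b \<and> b - a < d \<longrightarrow> 0 \<le> a \<and> b \<le> 1 \<longrightarrow> chordal (f (\<gamma> a)) (f (\<gamma> b)) \<le> s * l * (b - a)"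
    proof (intro exI[of _ "\<delta> / (l + 1)"] conjI allI impI)
      show "\<delta> / (l + 1) > 0" using d l0 by simp
      fix a b assume ab: "a \<le> x \<and> x \<le> b \<and> b - a < \<delta> / (l + 1)" and r: "0 \<le> a \<and> b \<le> 1"
      have "chordal (f (\<gamma> a)) (f (\<gamma> b)) \<le> chordal (f (\<gamma> a)) (f (\<gamma> x)) + chordal (f (\<gamma> x)) (f (\<gamma> b))"
        by (rule chordal_triangle) (use nz gS r ab x in auto)
      also have "chordal (f (\<gamma> a)) (f (\<gamma> x)) \<le> s * l * \<bar>a - x\<bar>" by (rule key) (use ab in auto)
      also have "chordal (f (\<gamma> x)) (f (\<gamma> b)) \<le> s * l * \<bar>b - x\<bar>"
        unfolding chordal_commute[of "f (\<gamma> x)"] by (rule key) (use ab in auto)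
      finally show "chordal (f (\<gamma> a)) (f (\<gamma> b)) \<le> s * l * (b - a)" using ab by (simp add: algebra_simps)
    qed
  qed
  then show ?thesis by (simp add: \<gamma>_def l_def norm_minus_commute)
qed

subsection \<open>Limits of holomorphic curves\<close>

lemma uniform_limit_setsum:
  fixes f :: "'i \<Rightarrow> nat \<Rightarrow> 'a \<Rightarrow> 'b::real_normed_vector"
  assumes "\<And>i. i \<in> I \<Longrightarrow> uniform_limit X (f i) (g i) F"
  shows "uniform_limit X (\<lambda>k x. \<Sum>i\<in>I. f i k x) (\<lambda>x. \<Sum>i\<in>I. g i x) F"
  using assms by (induction I rule: infinite_finite_induct) (auto intro!: uniform_limit_intros)

text \<open>Montel's theorem one component at a time, each step refining the subsequence found
  before.\<close>

lemma montel_vec: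
  fixes G :: "nat \<Rightarrow> complex \<Rightarrow> complex ^ 'n"
  assumes S: "open S" and hol: "\<And>k j. (\<lambda>z. G k z $ j) holomorphic_on S"
    and le1: "\<And>k z. z \<in> S \<Longrightarrow> norm (G k z) \<le> 1"
  shows "\<exists>\<sigma> f. strict_mono (\<sigma> :: nat \<Rightarrow> nat) \<and> (\<forall>j. (\<lambda>z. f z $ j) holomorphic_on S) \<and>
    (\<forall>j K. compact K \<longrightarrow> K \<subseteq> S \<longrightarrow> uniform_limit K (\<lambda>k z. G (\<sigma> k) z $ j) (\<lambda>z. f z $ j) sequentially)"
proof -
  have "\<exists>\<sigma> h. strict_mono (\<sigma> :: nat \<Rightarrow> nat) \<and> (\<forall>j\<in>J. h j holomorphic_on S \<and>
     (\<forall>K. compact K \<longrightarrow> K \<subseteq> S \<longrightarrow> uniform_limit K (\<lambda>k z. G (\<sigma> k) z $ j) (h j) sequentially))" for J :: "'n set"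
  proof -
    have "finite J" by simp
    then show ?thesis
    proof (induction J rule: finite_induct)
      case empty
      have "strict_mono (\<lambda>k::nat. k)" by (simp add: strict_mono_def)
      then show ?case by blast
    next
      case (insert j0 J)
      then obtain \<sigma> h where \<sigma>: "strict_mono (\<sigma> :: nat \<Rightarrow> nat)" and h: "\<forall>j\<in>J. h j holomorphic_on S \<and>
        (\<forall>K. compact K \<longrightarrow> K \<subseteq> S \<longrightarrow> uniform_limit K (\<lambda>k z. G (\<sigma> k) z $ j) (h j) sequentially)" by blast
      define HH where "HH = {h. h holomorphic_on S \<and> (\<forall>z\<in>S. norm (h z) \<le> 1)}"
      define FF where "FF = (\<lambda>k z. G (\<sigma> k) z $ j0)"
      have r1: "range FF \<subseteq> HH"
      proof
        fix x assume "x \<in> range FF"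
        then obtain k where k: "x = FF k" by blast
        have "norm (FF k z) \<le> 1" if "z \<in> S" for z
          using le1[OF that, of "\<sigma> k"] Finite_Cartesian_Product.norm_nth_le[of "G (\<sigma> k) z" j0] unfolding FF_def by linarith
        then show "x \<in> HH" unfolding k HH_def FF_def using hol by auto
      qed
      obtain g r where g: "g holomorphic_on S" and r: "strict_mono (r :: nat \<Rightarrow> nat)"
          and ul: "\<And>K. \<lbrakk>compact K; K \<subseteq> S\<rbrakk> \<Longrightarrow> uniform_limit K (FF \<circ> r) g sequentially"
      proof (rule Montel[OF S _ _ r1])
        show "h holomorphic_on S" if "h \<in> HH" for h using that by (simp add: HH_def)
        show "\<exists>B. \<forall>h\<in>HH. \<forall>z\<in>K. norm (h z) \<le> B" if "compact K" "K \<subseteq> S" for K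
          using that by (intro exI[of _ 1]) (auto simp: HH_def)
      qed blast
      show ?case
      proof (rule exI[of _ "\<sigma> \<circ> r"], rule exI[of _ "h(j0 := g)"], intro conjI ballI)
        show "strict_mono (\<sigma> \<circ> r)" using \<sigma> r by (simp add: strict_mono_o)
        fix j assume j: "j \<in> insert j0 J"
        show "(h(j0 := g)) j holomorphic_on S" using j g h by auto
        show "\<forall>K. compact K \<longrightarrow> K \<subseteq> S \<longrightarrow> uniform_limit K (\<lambda>k z. G ((\<sigma> \<circ> r) k) z $ j) ((h(j0 := g)) j) sequentially"
        proof (intro allI impI)
          fix K assume K: "compact K" "K \<subseteq> S"
          show "uniform_limit K (\<lambda>k z. G ((\<sigma> \<circ> r) k) z $ j) ((h(j0 := g)) j) sequentially"
          proof (cases "j = j0")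
            case True
            then show ?thesis using ul[OF K] by (simp add: FF_def o_def)
          next
            case False
            then have "uniform_limit K (\<lambda>k z. G (\<sigma> k) z $ j) (h j) sequentially" using h j K by auto
            from filterlim_compose[OF this filterlim_subseq[OF r]] show ?thesis using False by (simp add: o_def)
          qed
        qed
      qed
    qed
  qed
  from this[of UNIV] obtain \<sigma> h where \<sigma>: "strict_mono (\<sigma> :: nat \<Rightarrow> nat)" and h: "\<forall>j. h j holomorphic_on S \<and>
     (\<forall>K. compact K \<longrightarrow> K \<subseteq> S \<longrightarrow> uniform_limit K (\<lambda>k z. G (\<sigma> k) z $ j) (h j) sequentially)" by auto
  show ?thesis
    by (rule exI[of _ \<sigma>], rule exI[of _ "\<lambda>z. \<chi> j. h j z"]) (use \<sigma> h in auto)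
qed

text \<open>Hurwitz with multiplicities. If \<open>g\<close> has a zero at z of too low
  multiplicity, some derivative of order below the multiplicity is nonzero near z, and so is that of
  \<phi> k for large k; hence \<phi> k has no zeros there. Hurwitz's theorem then makes
  \<open>g\<close> constant near z, hence zero. For infinite multiplicity the \<phi> k have no zeros
  at all.\<close>

lemma zero_mult_limit:
  assumes hol: "\<And>k. \<phi> k holomorphic_on ball 0 R" and hol': "g holomorphic_on ball 0 R"
    and ul: "\<And>K. compact K \<Longrightarrow> K \<subseteq> ball 0 R \<Longrightarrow> uniform_limit K \<phi> g sequentially"
    and zm: "\<And>k. zero_mult mm (\<phi> k) (ball 0 R)"
  shows "(\<forall>z\<in>ball 0 R. g z = 0) \<or> zero_mult mm g (ball 0 R)"
proof (rule disjCI)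
  assume "\<not> zero_mult mm g (ball 0 R)"
  then obtain z where z: "z \<in> ball 0 R" "g z = 0"
    and nm: "\<not> (case mm of \<infinity> \<Rightarrow> False | enat k \<Rightarrow> (\<forall>l<k. (deriv ^^ l) g z = 0))"
    unfolding zero_mult_def by blast
  have hurwitz: "g z1 = 0" if s0: "s0 > 0" "ball z s0 \<subseteq> ball 0 R" and N: "\<And>k w. k \<ge> N \<Longrightarrow> w \<in> ball z s0 \<Longrightarrow> \<phi> k w \<noteq> 0"
    and z1: "z1 \<in> ball 0 R" for s0 N z1
  proof -
    have "g constant_on ball z s0"
    proof (rule ccontr)
      assume nc: "\<not> g constant_on ball z s0"
      have "g z \<noteq> 0"
      proof (rule Hurwitz_no_zeros[of "ball z s0" "\<lambda>k. \<phi> (k + N)" g])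
        show "uniform_limit K (\<lambda>k. \<phi> (k + N)) g sequentially" if "compact K" "K \<subseteq> ball z s0" for K
        proof -
          have "uniform_limit K \<phi> g sequentially" by (rule ul) (use that s0 in auto)
          moreover have "strict_mono (\<lambda>k::nat. k + N)" by (simp add: strict_mono_def)
          ultimately show ?thesis using filterlim_compose filterlim_subseq by blast
        qed
        show "\<phi> (k + N) holomorphic_on ball z s0" for k using hol s0 holomorphic_on_subset by blast
        show "g holomorphic_on ball z s0" using hol' s0 holomorphic_on_subset by blast
        show "\<not> g constant_on ball z s0" by (rule nc)
        show "\<phi> (k + N) x \<noteq> 0" if "x \<in> ball z s0" for k x by (rule N) (use that in auto)
        show "z \<in> ball z s0" using s0(1) by simp
      qed auto
      then show False using z by simp
    qed
    then obtain c where "\<And>w. w \<in> ball z s0 \<Longrightarrow> g w = c" unfolding constant_on_def by blast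
    then have "g w = 0" if "w \<in> ball z s0" for w using that z(2) s0(1) by (metis centre_in_ball)
    then show ?thesis
      by (intro analytic_continuation_open[of "ball z s0" "ball 0 R" g "\<lambda>_. 0" z1]) (use s0 z1 hol' in auto)
  qed
  show "\<forall>z\<in>ball 0 R. g z = 0"
  proof
    fix z1 :: complex assume z1: "z1 \<in> ball 0 R"
    obtain e where e: "e > 0" "ball z e \<subseteq> ball 0 R" using z(1) by (meson open_ball openE)
    show "g z1 = 0"
    proof (cases mm)
      case infinity
      show ?thesis
        by (rule hurwitz[OF e _ z1, of 0]) (use zm infinity e in \<open>auto simp: zero_mult_def\<close>)
    next
      case (enat M)
      then obtain l where l: "l < M" "(deriv ^^ l) g z \<noteq> 0" using nm by auto
      define \<eta> where "\<eta> = norm ((deriv ^^ l) g z) / 2"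
      have eta: "\<eta> > 0" using l by (simp add: \<eta>_def)
      have "(deriv ^^ l) g holomorphic_on ball 0 R" by (intro holomorphic_higher_deriv hol' open_ball)
      then have "isCont ((deriv ^^ l) g) z"
        using z(1) by (meson continuous_on_eq_continuous_at holomorphic_on_imp_continuous_on open_ball)
      then have "(\<lambda>w. norm ((deriv ^^ l) g w)) \<midarrow>z\<rightarrow> norm ((deriv ^^ l) g z)" by (intro tendsto_norm isContD)
      then have "eventually (\<lambda>w. \<eta> < norm ((deriv ^^ l) g w)) (at z)"
        by (rule order_tendstoD) (use eta in \<open>simp add: \<eta>_def\<close>)
      then obtain s1 where s1: "s1 > 0" "\<And>w. w \<noteq> z \<Longrightarrow> dist w z < s1 \<Longrightarrow> \<eta> < norm ((deriv ^^ l) g w)"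
        unfolding eventually_at by auto
      \<comment> \<open>Closed discs of radius \<open>s0\<close> about points of
        \<open>ball z s0\<close> stay in \<open>cball z (2 * s0)\<close>, on which convergence is
        uniform.\<close>
      define s0 where "s0 = min s1 (e / 3)"
      have s0: "s0 > 0" "s0 \<le> s1" "2 * s0 < e" using s1 e by (auto simp: s0_def min_def)
      have big: "\<eta> < norm ((deriv ^^ l) g w)" if "w \<in> ball z s0" for w
        using s1(2)[of w] that s0 eta by (cases "w = z") (auto simp: dist_commute \<eta>_def)
      have cb: "cball z (2 * s0) \<subseteq> ball 0 R" 
      proof
        fix x assume "x \<in> cball z (2 * s0)"
        then have "x \<in> ball z e" using s0 by simp
        then show "x \<in> ball 0 R" using e(2) by blast
      qed
      have b0: "ball z s0 \<subseteq> ball 0 R" 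
      proof
        fix x assume "x \<in> ball z s0"
        then have "x \<in> cball z (2 * s0)" using s0 by simp
        then show "x \<in> ball 0 R" using cb by blast
      qed
      \<comment> \<open>Cauchy's inequality on radius \<open>s0\<close> turns a difference of
        \<epsilon> into a difference of \<eta> between the l-th derivatives.\<close>
      define \<epsilon> where "\<epsilon> = \<eta> * s0 ^ l / fact l"
      have eps: "\<epsilon> > 0" using eta s0 by (simp add: \<epsilon>_def)
      have "eventually (\<lambda>k. \<forall>w\<in>cball z (2 * s0). dist (\<phi> k w) (g w) < \<epsilon>) sequentially"
        using uniform_limitD[OF ul[OF compact_cball cb] eps] .
      then obtain N where N: "\<And>k w. k \<ge> N \<Longrightarrow> w \<in> cball z (2 * s0) \<Longrightarrow> norm (\<phi> k w - g w) < \<epsilon>"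
        unfolding eventually_sequentially dist_norm by blast
      have "\<phi> k w \<noteq> 0" if k: "k \<ge> N" and w: "w \<in> ball z s0" for k w
      proof
        assume z0: "\<phi> k w = 0"
        have wR: "w \<in> ball 0 R" using w b0 by blast
        then have d0: "(deriv ^^ l) (\<phi> k) w = 0" using zm[of k] z0 l(1) enat by (auto simp: zero_mult_def)
        have cw: "cball w s0 \<subseteq> cball z (2 * s0)"
        proof
          fix x assume "x \<in> cball w s0"
          then show "x \<in> cball z (2 * s0)" using w dist_triangle[of z x w] by auto
        qed
        have hd: "(\<lambda>x. \<phi> k x - g x) holomorphic_on ball 0 R" by (intro holomorphic_intros hol hol')
        have "norm ((deriv ^^ l) (\<lambda>x. \<phi> k x - g x) w) \<le> fact l * \<epsilon> / s0 ^ l"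
        proof (rule Cauchy_inequality[OF _ _ s0(1)])
          show "(\<lambda>x. \<phi> k x - g x) holomorphic_on ball w s0"
            using hd cw cb by (meson ball_subset_cball holomorphic_on_subset subset_trans)
          show "continuous_on (cball w s0) (\<lambda>x. \<phi> k x - g x)"
            using hd cw cb by (meson holomorphic_on_imp_continuous_on holomorphic_on_subset subset_trans)
          fix x assume "norm (w - x) = s0"
          then have "x \<in> cball w s0" by (simp add: dist_norm)
          then show "norm (\<phi> k x - g x) \<le> \<epsilon>" using N[OF k] cw by (meson less_imp_le subset_iff)
        qed
        also have "fact l * \<epsilon> / s0 ^ l = \<eta>" using s0 by (simp add: \<epsilon>_def)
        also have "(deriv ^^ l) (\<lambda>x. \<phi> k x - g x) w = (deriv ^^ l) (\<phi> k) w - (deriv ^^ l) g w"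
          by (rule higher_deriv_diff[OF hol hol' open_ball wR])
        finally show False using big[OF w] d0 by simp
      qed
      then show ?thesis by (intro hurwitz[OF s0(1) b0 _ z1, of N]) auto
    qed
  qed
qed

text \<open>The conditions of \<open>orb_morphism\<close> on a disc of any radius, except that the
  curve may lie inside a hyperplane with \<open>m i\<close> finite. The class is stable under
  restriction and affine reparametrisation.\<close>

definition orb_curve :: "(nat \<Rightarrow> complex ^ 'n) \<Rightarrow> (nat \<Rightarrow> enat) \<Rightarrow> nat \<Rightarrow> real \<Rightarrow> (complex \<Rightarrow> complex ^ 'n) \<Rightarrow> bool" where
  "orb_curve L m q R g \<longleftrightarrow> (\<forall>j. (\<lambda>z. g z $ j) holomorphic_on ball 0 R) \<and> (\<forall>z\<in>ball 0 R. g z \<noteq> 0) \<and>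
     (\<forall>i<q. zero_mult (m i) (\<lambda>z. lform (L i) (g z)) (ball 0 R))"

lemma zero_mult_subset: "zero_mult k g S \<Longrightarrow> T \<subseteq> S \<Longrightarrow> zero_mult k g T"
  unfolding zero_mult_def by blast

lemma orb_curve_mono:
  assumes "orb_curve L m q R g" "r \<le> R" shows "orb_curve L m q r g"
proof -
  have sub: "ball 0 r \<subseteq> ball (0::complex) R" using assms(2) by auto
  then show ?thesis using assms(1) unfolding orb_curve_def
    by (meson holomorphic_on_subset subsetD zero_mult_subset)
qed

lemma zero_mult_affine:
  assumes "open T" "open S" and g: "g holomorphic_on T" and ST: "\<And>z. z \<in> S \<Longrightarrow> a + b * z \<in> T" and zm: "zero_mult k g T"
  shows "zero_mult k (\<lambda>z. g (a + b * z)) S"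
  unfolding zero_mult_def
proof (intro ballI impI)
  fix z assume z: "z \<in> S" "g (a + b * z) = 0"
  have "(deriv ^^ l) (\<lambda>z. g (a + b * z)) z = b ^ l * (deriv ^^ l) g (a + b * z)" for l
    using higher_deriv_compose_linear'[OF g assms(2,1) z(1), of b a l] ST by (simp add: add.commute)
  then show "case k of \<infinity> \<Rightarrow> False | enat k \<Rightarrow> \<forall>l<k. (deriv ^^ l) (\<lambda>z. g (a + b * z)) z = 0"
    using zm ST[OF z(1)] z(2) unfolding zero_mult_def by (auto split: enat.splits)
qed

lemma holomorphic_affine:
  assumes "g holomorphic_on T" "\<And>z. z \<in> S \<Longrightarrow> a + b * z \<in> T"
  shows "(\<lambda>z. g (a + b * z)) holomorphic_on S"
proof -
  have "(\<lambda>z. a + b * z) holomorphic_on S" by (intro holomorphic_intros)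
  then show ?thesis
    using holomorphic_on_compose_gen[of "\<lambda>z. a + b * z" S g T] assms by (auto simp: o_def)
qed

lemma orb_curve_affine:
  assumes oc: "orb_curve L m q R g" and sub: "\<And>z. z \<in> ball 0 r \<Longrightarrow> a + b * z \<in> ball 0 R"
  shows "orb_curve L m q r (\<lambda>z. g (a + b * z))"
  unfolding orb_curve_def
proof (intro conjI allI impI ballI)
  have hol: "\<And>j. (\<lambda>z. g z $ j) holomorphic_on ball 0 R" using oc by (simp add: orb_curve_def)
  show "(\<lambda>z. g (a + b * z) $ j) holomorphic_on ball 0 r" for j
    by (rule holomorphic_affine[OF hol sub])
  show "g (a + b * z) \<noteq> 0" if "z \<in> ball 0 r" for z using oc sub[OF that] by (auto simp: orb_curve_def)
  show "zero_mult (m i) (\<lambda>z. lform (L i) (g (a + b * z))) (ball 0 r)" if "i < q" for i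
  proof (rule zero_mult_affine[OF open_ball open_ball _ sub])
    show "(\<lambda>z. lform (L i) (g z)) holomorphic_on ball 0 R" by (rule holomorphic_lform[OF hol])
    show "zero_mult (m i) (\<lambda>z. lform (L i) (g z)) (ball 0 R)" using oc that by (simp add: orb_curve_def)
  qed
qed

text \<open>A representative normalised by \<open>ln |g| \<le> Re p\<close> has norm at most \<open>1\<close>, and by the gap estimate
  its norm is bounded below; so a limit of such representatives vanishes nowhere.\<close>

theorem orb_curve_limit:
  fixes g :: "nat \<Rightarrow> complex \<Rightarrow> complex ^ 'n"
  assumes oc: "\<And>k. orb_curve L m q (real k) (g k)" and sph2: "\<And>k z. z \<in> ball 0 (real k) \<Longrightarrow> sph (g k) z \<le> 2"
    and sph1: "\<And>k. sph (g k) 0 = 1" and R: "R > 0"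
  shows "\<exists>\<sigma> \<mu> f. strict_mono (\<sigma> :: nat \<Rightarrow> nat) \<and> (\<forall>k z. \<mu> k z \<noteq> 0) \<and>
     (\<forall>j. (\<lambda>z. f z $ j) holomorphic_on ball 0 R) \<and> (\<forall>z\<in>ball 0 R. f z \<noteq> 0) \<and>
     (\<forall>z\<in>ball 0 R. (\<lambda>k. \<mu> k z *s g (\<sigma> k) z) \<longlonglongrightarrow> f z) \<and>
     (\<forall>i<q. (\<forall>z\<in>ball 0 R. lform (L i) (f z) = 0) \<or> zero_mult (m i) (\<lambda>z. lform (L i) (f z)) (ball 0 R)) \<and>
     (\<forall>z\<in>ball 0 R. sph f z \<le> 2) \<and> sph f 0 = 1"
proof -
  \<comment> \<open>After this shift every \<open>h k\<close> is an orbifold curve with derivative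
    at most 2 on radius \<open>R + 1\<close>.\<close>
  define k0 where "k0 = nat \<lceil>R\<rceil> + 2"
  have k0: "R + 1 < real (k + k0)" for k
    unfolding k0_def using R by (simp add: of_nat_nat) linarith
  define h where "h k = g (k + k0)" for k
  have och: "orb_curve L m q (R + 1) (h k)" for k
    unfolding h_def by (rule orb_curve_mono[OF oc]) (use k0[of k] in linarith)
  have hol: "(\<lambda>z. h k z $ j) holomorphic_on ball 0 (R + 1)" for k j using och by (simp add: orb_curve_def)
  have nz: "h k z \<noteq> 0" if "z \<in> ball 0 (R + 1)" for k z using och that by (simp add: orb_curve_def)
  have zm: "zero_mult (m i) (\<lambda>z. lform (L i) (h k z)) (ball 0 (R + 1))" if "i < q" for i k
    using och that by (simp add: orb_curve_def)
  have sph2h: "sph (h k) z \<le> 2" if "z \<in> ball 0 (R + 1)" for k z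
    unfolding h_def by (rule sph2) (use that k0[of k] in auto)
  have lip: "\<exists>\<delta>>0. \<forall>w. norm (w - z) < \<delta> \<longrightarrow> chordal (h k w) (h k z) \<le> 3 * norm (w - z)"
    if z: "z \<in> ball 0 (R + 1)" for k z
    using sph_local_lipschitz[OF open_ball z hol nz[OF z], of k 3] sph2h[OF z, of k] by fastforce
  \<comment> \<open>This is \<open>2 * 3\<^sup>2 * R\<^sup>2 + 1\<close> from the gap estimate; the
    Lipschitz constant 3 exceeds 2 because the local Lipschitz bound asks for a strict
    inequality.\<close>
  define c where "c = 18 * R\<^sup>2 + 1"
  have "\<forall>k. \<exists>p. p holomorphic_on UNIV \<and> (\<forall>z\<in>cball 0 R. norm (h k z) \<le> exp (Re (p z)) \<and> Re (p z) \<le> ln (norm (h k z)) + c)"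
  proof
    fix k
    obtain p where p: "p holomorphic_on UNIV" "\<And>z. z \<in> cball 0 R \<Longrightarrow> norm (h k z) \<le> exp (Re (p z))"
      "\<And>z. z \<in> sphere 0 R \<Longrightarrow> Re (p z) \<le> ln (norm (h k z)) + 1"
    proof (rule majorant[of "h k" "R + 1" R 1])
      show "(\<lambda>z. h k z $ j) holomorphic_on ball 0 (R + 1)" for j by (rule hol)
      show "h k z \<noteq> 0" if "z \<in> sphere 0 R" for z using nz that R by auto
    qed (use R in auto)
    have gap: "Re (p z) \<le> ln (norm (h k z)) + c" if z: "z \<in> cball 0 R" for z
    proof -
      have "Re (p z) \<le> ln (norm (h k z)) + 2 * 3\<^sup>2 * R\<^sup>2 + 1"
        by (rule majorant_gap[of "h k" "R + 1" R 3 p 1 z]) (use hol R nz lip p z in auto)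
      then show ?thesis by (simp add: c_def)
    qed
    show "\<exists>p. p holomorphic_on UNIV \<and> (\<forall>z\<in>cball 0 R. norm (h k z) \<le> exp (Re (p z)) \<and> Re (p z) \<le> ln (norm (h k z)) + c)"
      using p gap by blast
  qed
  from choice[OF this] obtain p where ph: "\<And>k. p k holomorphic_on UNIV"
    and p1: "\<And>k z. z \<in> cball 0 R \<Longrightarrow> norm (h k z) \<le> exp (Re (p k z))"
    and p2: "\<And>k z. z \<in> cball 0 R \<Longrightarrow> Re (p k z) \<le> ln (norm (h k z)) + c" by blast
  define u where "u k z = exp (- p k z)" for k z
  have uh: "u k holomorphic_on S" for k S
    unfolding u_def using ph by (intro holomorphic_intros) (auto intro: holomorphic_on_subset)
  have nu: "norm (u k z) = exp (- Re (p k z))" for k z by (simp add: u_def norm_exp_eq_Re)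
  have unz: "u k z \<noteq> 0" for k z by (simp add: u_def)
  define G where "G k z = u k z *s h k z" for k z
  have sub: "ball 0 R \<subseteq> ball (0::complex) (R + 1)" by auto
  have Gh: "(\<lambda>z. G k z $ j) holomorphic_on ball 0 R" for k j
    unfolding G_def using holomorphic_on_subset[OF hol sub] uh by (auto intro!: holomorphic_intros)
  have G1: "norm (G k z) \<le> 1" if "z \<in> ball 0 R" for k z
  proof -
    have "norm (G k z) \<le> exp (- Re (p k z)) * exp (Re (p k z))"
      unfolding G_def norm_vector_scale nu using p1[of z k] that by (intro mult_left_mono) auto
    then show ?thesis by (simp add: exp_minus)
  qed
  have Glow: "exp (- c) \<le> norm (G k z)" if z: "z \<in> ball 0 R" for k z
  proof -
    have hz: "norm (h k z) > 0" using nz sub z by auto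
    have "exp (- c) \<le> exp (- Re (p k z) + ln (norm (h k z)))" using p2[of z k] z by auto
    also have "\<dots> = norm (G k z)" using hz unfolding G_def norm_vector_scale nu exp_add by simp
    finally show ?thesis .
  qed
  obtain \<tau> f where tau: "strict_mono (\<tau> :: nat \<Rightarrow> nat)" and fh: "\<And>j. (\<lambda>z. f z $ j) holomorphic_on ball 0 R"
    and ul: "\<And>j K. compact K \<Longrightarrow> K \<subseteq> ball 0 R \<Longrightarrow> uniform_limit K (\<lambda>k z. G (\<tau> k) z $ j) (\<lambda>z. f z $ j) sequentially"
    using montel_vec[of "ball 0 R" G, OF open_ball Gh G1] by auto
  have conv: "(\<lambda>k. G (\<tau> k) z) \<longlonglongrightarrow> f z" if z: "z \<in> ball 0 R" for z
  proof (rule vec_tendstoI)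
    show "(\<lambda>k. G (\<tau> k) z $ j) \<longlonglongrightarrow> f z $ j" for j
      using tendsto_uniform_limitI[OF ul[of "{z}" j], of z] z by auto
  qed
  have fnz: "f z \<noteq> 0" if z: "z \<in> ball 0 R" for z
  proof -
    have "exp (- c) \<le> norm (f z)"
      by (rule Lim_bounded2[OF tendsto_norm[OF conv[OF z]], of 0]) (use Glow z in auto)
    then show ?thesis by (metis exp_gt_zero norm_zero not_le)
  qed
  have zmf: "(\<forall>z\<in>ball 0 R. lform (L i) (f z) = 0) \<or> zero_mult (m i) (\<lambda>z. lform (L i) (f z)) (ball 0 R)" if i: "i < q" for i
  proof (rule zero_mult_limit)
    show "(\<lambda>z. lform (L i) (G (\<tau> k) z)) holomorphic_on ball 0 R" for k by (rule holomorphic_lform[OF Gh])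
    show "(\<lambda>z. lform (L i) (f z)) holomorphic_on ball 0 R" by (rule holomorphic_lform[OF fh])
    show "uniform_limit K (\<lambda>k z. lform (L i) (G (\<tau> k) z)) (\<lambda>z. lform (L i) (f z)) sequentially"
      if K: "compact K" "K \<subseteq> ball 0 R" for K
      unfolding lform_def
      by (intro uniform_limit_setsum bounded_linear.uniform_limit[OF bounded_linear_mult_right] ul K)
    show "zero_mult (m i) (\<lambda>z. lform (L i) (G (\<tau> k) z)) (ball 0 R)" for k
    proof -
      have "zero_mult (m i) (\<lambda>z. u (\<tau> k) z * lform (L i) (h (\<tau> k) z)) (ball 0 (R + 1))"
        by (rule zero_mult_unit[OF open_ball holomorphic_lform[OF hol] uh unz zm[OF i]])
      then show ?thesis unfolding G_def lform_scale_right using sub zero_mult_subset by blast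
    qed
  qed
  have vd: "(\<lambda>k. vderiv (G (\<tau> k)) z) \<longlonglongrightarrow> vderiv f z" if z: "z \<in> ball 0 R" for z
  proof (rule vec_tendstoI)
    fix j
    obtain e where e: "e > 0" "cball z e \<subseteq> ball 0 R" using z by (meson open_ball open_contains_cball)
    have "uniform_limit (ball z e) (\<lambda>k z. G (\<tau> k) z $ j) (\<lambda>z. f z $ j) sequentially"
      by (rule uniform_limit_on_subset[OF ul[OF compact_cball e(2)] ball_subset_cball])
    moreover have "eventually (\<lambda>k. (\<lambda>z. G (\<tau> k) z $ j) holomorphic_on ball z e) sequentially"
      using Gh e ball_subset_cball[of z e] by (intro always_eventually allI) (meson holomorphic_on_subset subset_trans)
    ultimately have "(\<lambda>k. (deriv ^^ 1) (\<lambda>z. G (\<tau> k) z $ j) z) \<longlonglongrightarrow> (deriv ^^ 1) (\<lambda>z. f z $ j) z"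
      by (rule higher_deriv_complex_uniform_limit) (use e in auto)
    then show "(\<lambda>k. vderiv (G (\<tau> k)) z $ j) \<longlonglongrightarrow> vderiv f z $ j" by (simp add: vderiv_def)
  qed
  have sphc: "(\<lambda>k. sph (G (\<tau> k)) z) \<longlonglongrightarrow> sph f z" if z: "z \<in> ball 0 R" for z
  proof -
    have hc: "(\<lambda>k. herm (vderiv (G (\<tau> k)) z) (G (\<tau> k) z)) \<longlonglongrightarrow> herm (vderiv f z) (f z)"
      unfolding herm_def using conv[OF z] vd[OF z] by (intro tendsto_intros)
    show ?thesis unfolding sph_def gram_def
      using conv[OF z] vd[OF z] hc fnz[OF z] by (intro tendsto_intros) auto
  qed
  have sphG: "sph (G k) z = sph (h k) z" if z: "z \<in> ball 0 R" for k z
    unfolding G_def by (rule sph_scale[of "ball 0 R"]) (use z uh unz holomorphic_on_subset[OF hol sub] in auto)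
  have sphf2: "sph f z \<le> 2" if z: "z \<in> ball 0 R" for z
    by (rule Lim_bounded[OF sphc[OF z], of 0]) (use sphG[OF z] sph2h z sub in auto)
  have "(\<lambda>k. sph (G (\<tau> k)) 0) \<longlonglongrightarrow> sph f 0" by (rule sphc) (use R in simp)
  moreover have "sph (G (\<tau> k)) 0 = 1" for k using sphG[of 0] R sph1 by (simp add: h_def)
  ultimately have sphf1: "sph f 0 = 1" by (simp add: LIMSEQ_const_iff)
  have mono: "strict_mono (\<lambda>k. \<tau> k + k0)" using tau by (simp add: strict_mono_def)
  show ?thesis
  proof (rule exI[of _ "\<lambda>k. \<tau> k + k0"], rule exI[of _ "\<lambda>k. u (\<tau> k)"], rule exI[of _ f], intro conjI allI ballI impI)
    show "(\<lambda>k. u (\<tau> k) z *s g (\<tau> k + k0) z) \<longlonglongrightarrow> f z" if "z \<in> ball 0 R" for z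
      using conv[OF that] by (simp add: G_def h_def)
  qed (use mono unz fh fnz zmf sphf2 sphf1 in auto)
qed

text \<open>Let \<Phi> be maximal at \<open>a\<close>, at distance \<open>D\<close> from the circle
  of radius 1/2. The affine map with factor \<open>1 / sph F a\<close> keeps the disc of radius
  \<open>k\<close> within \<open>D / 2\<close> of \<open>a\<close>. There the weight in \<Phi> is
  still at least \<open>D / 2\<close>, so the derivative is at most twice its value at
  \<open>a\<close>.\<close>

theorem brody_sequence:
  fixes L :: "nat \<Rightarrow> complex ^ 'n"
  assumes unb: "\<And>C. \<exists>F. orb_curve L m q 1 F \<and> sph F 0 > C"
  shows "\<exists>g. \<forall>k. orb_curve L m q (real k) (g k) \<and> (\<forall>z\<in>ball 0 (real k). sph (g k) z \<le> 2) \<and> sph (g k) 0 = 1"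
proof (rule choice, rule allI)
  fix k :: nat
  \<comment> \<open>The weight at 0 is 1/2, so the maximum \<open>M\<close> of \<Phi> exceeds
    \<open>2 * k\<close>; this is what makes the rescaled disc small enough.\<close>
  obtain F where F: "orb_curve L m q 1 F" and big: "sph F 0 > 4 * real k + 1" using unb by blast
  have hol: "(\<lambda>z. F z $ j) holomorphic_on ball 0 1" for j using F by (simp add: orb_curve_def)
  have nz: "F z \<noteq> 0" if "z \<in> ball 0 1" for z using F that by (simp add: orb_curve_def)
  have csph: "continuous_on (ball 0 1) (sph F)" by (rule continuous_on_sph[OF open_ball hol nz])
  define \<Phi> where "\<Phi> z = (1/2 - norm z) * sph F z" for z
  have con: "continuous_on (cball 0 (1/2)) \<Phi>"
    unfolding \<Phi>_def by (intro continuous_intros continuous_on_subset[OF csph]) auto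
  obtain a where a: "a \<in> cball 0 (1/2)" "\<And>z. z \<in> cball 0 (1/2) \<Longrightarrow> \<Phi> z \<le> \<Phi> a"
    using continuous_attains_sup[OF compact_cball _ con] by force
  define M where "M = \<Phi> a"
  have M: "M > 2 * real k" "M > 0" using a(2)[of 0] big by (auto simp: M_def \<Phi>_def)
  define D where "D = 1/2 - norm a"
  have D0: "D \<ge> 0" using a by (simp add: D_def)
  have MD: "M = D * sph F a" by (simp add: M_def \<Phi>_def D_def)
  then have "D \<noteq> 0" "sph F a \<noteq> 0" using M(2) by auto
  then have D: "D > 0" and sa: "sph F a > 0" using D0 sph_nonneg[of F a] by auto
  define b where "b = complex_of_real (1 / sph F a)"
  have nb: "norm b = 1 / sph F a" using sa by (simp add: b_def norm_divide)
  have small: "norm (b * z) < D / 2" if "z \<in> ball 0 (real k)" for z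
  proof -
    have "norm (b * z) = norm z / sph F a" by (simp add: norm_mult nb)
    also have "\<dots> < (M / 2) / sph F a" using that M sa by (intro divide_strict_right_mono) auto
    also have "\<dots> = D / 2" using MD sa by simp
    finally show ?thesis .
  qed
  have in12: "norm (a + b * z) < 1/2 - D / 2" if "z \<in> ball 0 (real k)" for z
    using norm_triangle_ineq[of a "b * z"] small[OF that] by (simp add: D_def field_simps)
  have in1: "a + b * z \<in> ball 0 1" if "z \<in> ball 0 (real k)" for z using in12[OF that] D by simp
  define g where "g z = F (a + b * z)" for z
  have "sph g z \<le> 2" if z: "z \<in> ball 0 (real k)" for z
  proof -
    have "sph g z = norm b * sph F (a + b * z)"
      unfolding g_def by (rule sph_compose_affine[OF open_ball hol in1[OF z]])
    moreover have "\<Phi> (a + b * z) \<le> M" unfolding M_def using a(2)[of "a + b * z"] in12[OF z] D by auto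
    moreover have "D / 2 * sph F (a + b * z) \<le> \<Phi> (a + b * z)"
      unfolding \<Phi>_def using in12[OF z] sph_nonneg by (intro mult_right_mono) auto
    ultimately have "D / 2 * sph F (a + b * z) \<le> D * sph F a" using MD by simp
    then have "sph F (a + b * z) \<le> 2 * sph F a" using D by simp
    then have "1 / sph F a * sph F (a + b * z) \<le> 1 / sph F a * (2 * sph F a)" using sa by (intro mult_left_mono) auto
    then show ?thesis using \<open>sph g z = _\<close> sa by (simp add: nb)
  qed
  moreover have "sph g 0 = 1"
  proof -
    have "a + b * 0 \<in> ball 0 1" using a by auto
    then have "sph g 0 = norm b * sph F (a + b * 0)" unfolding g_def by (rule sph_compose_affine[OF open_ball hol])
    then show ?thesis using sa by (simp add: nb)
  qed
  moreover have "orb_curve L m q (real k) g" unfolding g_def by (rule orb_curve_affine[OF F in1])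
  ultimately show "\<exists>g. orb_curve L m q (real k) g \<and> (\<forall>z\<in>ball 0 (real k). sph g z \<le> 2) \<and> sph g 0 = 1" by blast
qed

subsection \<open>Absence of Brody curves\<close>

lemma gram_self: "gram v v = 0"
proof -
  have "gram v v = gram (0 + 1 *s v) v" by simp
  also have "\<dots> = gram 0 v" by (rule gram_add_scale)
  also have "\<dots> = 0" by (simp add: gram_def herm_def)
  finally show ?thesis .
qed

lemma sph_zero_of_proportional:
  assumes "vderiv f z = a *s v" "f z = b *s v" shows "sph f z = 0"
  unfolding sph_def assms by (simp add: gram_scale gram_scale_right gram_self)

lemma subspace_annihilator: "vec.subspace {a. \<forall>z\<in>S. lform a (f z) = 0}"
  by (auto simp: vec.subspace_def lform_add_left lform_scale_left)

text \<open>If the annihilator had codimension at most 1, every component of \<open>f\<close> would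
  be a constant multiple of one of them, so \<open>f\<close> and its derivative at 0 would be
  parallel and \<open>sph f 0 = 0\<close>.\<close>

lemma span_dim_ge_2:
  fixes f :: "complex \<Rightarrow> complex ^ 'n"
  assumes R: "R > 0" and nz: "f 0 \<noteq> 0" and s: "sph f 0 \<noteq> 0" and hol: "\<And>j. (\<lambda>z. f z $ j) holomorphic_on ball 0 R"
  shows "CARD('n) - vec.dim {a. \<forall>z\<in>ball 0 R. lform a (f z) = 0} \<ge> 2"
proof (rule ccontr)
  define K where "K = {a. \<forall>z\<in>ball 0 R. lform a (f z) = 0}"
  have sK: "vec.span K = K" 
    unfolding K_def by (rule vec.span_eq_iff[THEN iffD2, OF subspace_annihilator])
  assume "\<not> ?thesis"
  then have dK: "vec.dim K + 1 \<ge> CARD('n)" by (simp add: K_def)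
  obtain j0 where j0: "f 0 $ j0 \<noteq> 0" using nz by (auto simp: Finite_Cartesian_Product.vec_eq_iff)
  have "axis j0 1 \<notin> vec.span K"
  proof
    assume "axis j0 1 \<in> vec.span K"
    then have "axis j0 1 \<in> K" unfolding sK .
    then have "lform (axis j0 1) (f 0) = 0" using R unfolding K_def by simp
    then show False using j0 by (simp add: lform_axis)
  qed
  then have "vec.dim (insert (axis j0 1) K) = vec.dim K + 1" by (simp add: vec.dim_insert)
  then have "vec.dim (insert (axis j0 1) K) = CARD('n)"
    using dK dim_subset_UNIV_cart_gen[of "insert (axis j0 1) K"] by linarith
  then have full: "vec.span (insert (axis j0 1) K) = UNIV" by (rule dim_full_span)
  have "\<exists>c. axis j 1 - c *s axis j0 1 \<in> K" for j :: 'n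
    using vec.span_breakdown_eq[of "axis j 1" "axis j0 1" K] unfolding full sK by blast
  then obtain c where c: "\<And>j. axis j 1 - c j *s axis j0 1 \<in> K" by metis
  define v where "v = (\<chi> j. c j)"
  have fj: "f z $ j = f z $ j0 * c j" if "z \<in> ball 0 R" for z j
  proof -
    have "lform (axis j 1 - c j *s axis j0 1) (f z) = 0" using c[of j] that unfolding K_def by blast
    then show ?thesis by (simp add: lform_diff_left lform_scale_left lform_axis)
  qed
  have f0: "f 0 = (f 0 $ j0) *s v"
    unfolding v_def Finite_Cartesian_Product.vec_eq_iff vector_smult_component vec_lambda_beta
    by (intro allI fj) (use R in simp)
  have "vderiv f 0 = deriv (\<lambda>w. f w $ j0) 0 *s v"
  proof -
    have "deriv (\<lambda>w. f w $ j) 0 = deriv (\<lambda>w. f w $ j0) 0 * c j" for j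
    proof (rule DERIV_imp_deriv)
      have "((\<lambda>w. f w $ j0 * c j) has_field_derivative deriv (\<lambda>w. f w $ j0) 0 * c j) (at 0)"
        using R by (intro DERIV_cmult_right holomorphic_derivI[OF hol]) auto
      then show "((\<lambda>w. f w $ j) has_field_derivative deriv (\<lambda>w. f w $ j0) 0 * c j) (at 0)"
        by (rule has_field_derivative_transform_within_open[OF _ open_ball[of 0 R]]) (use R in \<open>simp_all add: fj[symmetric]\<close>)
    qed
    then show ?thesis
      unfolding vderiv_def v_def Finite_Cartesian_Product.vec_eq_iff vector_smult_component vec_lambda_beta by blast
  qed
  from sph_zero_of_proportional[OF this f0] have "sph f 0 = 0" .
  then show False using s by simp
qed

text \<open>Turns the metric derivative into a 2 by 2 minor, the quantity bounded in
  \<open>charT_lower\<close>.\<close>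

lemma wedge_nonzero:
  fixes f :: "complex \<Rightarrow> complex ^ 'n"
  assumes nz: "f z \<noteq> 0" and s: "sph f z \<noteq> 0"
  obtains i j where "vderiv f z $ i * f z $ j - f z $ i * vderiv f z $ j \<noteq> 0"
proof (rule ccontr)
  assume "\<not> thesis"
  then have eq: "vderiv f z $ i * f z $ j - f z $ i * vderiv f z $ j = 0" for i j using that by blast
  obtain j0 where j0: "f z $ j0 \<noteq> 0" using nz by (auto simp: Finite_Cartesian_Product.vec_eq_iff)
  define c where "c = vderiv f z $ j0 / f z $ j0"
  have "vderiv f z $ i = c * f z $ i" for i
  proof -
    have "vderiv f z $ i * f z $ j0 = vderiv f z $ j0 * f z $ i" using eq[of i j0] by (simp add: mult.commute)
    then have "vderiv f z $ i = vderiv f z $ j0 * f z $ i / f z $ j0" using j0 by (simp add: eq_divide_eq)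
    then show ?thesis by (simp add: c_def)
  qed
  then have "vderiv f z = c *s f z" by (simp add: Finite_Cartesian_Product.vec_eq_iff)
  moreover have "f z = 1 *s f z" by simp
  ultimately have "sph f z = 0" by (rule sph_zero_of_proportional)
  then show False using s by simp
qed

lemma wronskian_eqI:
  assumes "length gs = length hs" "\<And>i j. i < length hs \<Longrightarrow> j < length hs \<Longrightarrow> (deriv ^^ i) (gs ! j) z = (deriv ^^ i) (hs ! j) w"
  shows "wronskian gs z = wronskian hs w"
  unfolding wronskian_def using assms by (auto intro!: arg_cong[where f = Determinant.det] eq_matI)

context weighted_forms
begin

text \<open>A form in \<open>K\<close> has rank 0, hence weight 0, so the sum over \<open>E\<close>
  may be taken over all indices; the multiplicity terms are estimated by
  \<open>w i \<le> \<theta>\<close>.\<close>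

lemma eps_ge:
  assumes wt: "\<And>i. i < q \<Longrightarrow> w i \<le> \<theta>" and sw: "sum w {..<q} = \<theta> * (real q - real d - 2 * real c) + real d"
  shows "\<theta> * (real q - real d - 2 * real c - real (d - 1) * (\<Sum>i<q. inv_mult (m i))) \<le> eps"
proof -
  have w00: "w i = 0" if i: "i \<in> {..<q} - E" for i
  proof -
    have "insert (L i) K = K" using i by (auto simp: E_def)
    then have "form_rank K L {i} = 0" by (simp add: form_rank_def)
    then have "sum w {i} \<le> real 0" using wr[of "{i}"] i d1 by auto
    then show ?thesis using w0[of i] i by auto
  qed
  have inv0: "inv_mult (m i) \<ge> 0" for i by (cases "m i") (auto simp: inv_mult_def)
  have "(\<Sum>i\<in>E. w i * (1 - real (d - 1) * inv_mult (m i))) = (\<Sum>i<q. w i * (1 - real (d - 1) * inv_mult (m i)))"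
    by (rule sum.mono_neutral_left) (use Eq w00 in auto)
  also have "\<dots> = sum w {..<q} - real (d - 1) * (\<Sum>i<q. w i * inv_mult (m i))"
    by (simp add: algebra_simps sum_subtractf sum_distrib_left)
  also have "\<dots> \<ge> sum w {..<q} - real (d - 1) * (\<theta> * (\<Sum>i<q. inv_mult (m i)))"
  proof -
    have "(\<Sum>i<q. w i * inv_mult (m i)) \<le> (\<Sum>i<q. \<theta> * inv_mult (m i))"
      by (rule sum_mono) (use wt inv0 in \<open>auto intro: mult_right_mono\<close>)
    then show ?thesis by (simp add: sum_distrib_left[symmetric] mult_left_mono)
  qed
  finally show ?thesis unfolding eps_def sw by (simp add: algebra_simps)
qed

text \<open>Since \<open>K\<close> is exactly the annihilator of \<open>f\<close>, a Wronskian
  vanishing identically would give a relation among the basis forms modulo \<open>K\<close>. So none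
  of the functions concerned is identically zero, and a circle free of their zeros supplies
  \<open>z0\<close>.\<close>

lemma generic_point:
  assumes hol: "\<And>j. (\<lambda>z. f z $ j) holomorphic_on ball 0 1" and nz: "\<And>z. z \<in> ball 0 1 \<Longrightarrow> f z \<noteq> 0"
    and K_eq: "K = {a. \<forall>z\<in>ball 0 1. lform a (f z) = 0}" and s: "sph f 0 \<noteq> 0"
  obtains z0 i j where "z0 \<in> ball 0 1" "Wr f z0 \<noteq> 0" "\<And>i. i \<in> E \<Longrightarrow> lform (L i) (f z0) \<noteq> 0"
    "vderiv f z0 $ i * f z0 $ j - f z0 $ i * vderiv f z0 $ j \<noteq> 0"
proof -
  let ?gs = "map (\<lambda>i z. lform (L i) (f z)) bs"
  have "f 0 \<noteq> 0" using nz by simp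
  from wedge_nonzero[OF this s] obtain i j where
    ij: "vderiv f 0 $ i * f 0 $ j - f 0 $ i * vderiv f 0 $ j \<noteq> 0" by blast
  define W where "W z = vderiv f z $ i * f z $ j - f z $ i * vderiv f z $ j" for z
  have vh: "(\<lambda>z. vderiv f z $ j) holomorphic_on ball 0 1" for j
    unfolding vderiv_def using hol by (auto intro!: holomorphic_deriv)
  have Wh: "W holomorphic_on ball 0 1" unfolding W_def by (intro holomorphic_intros vh hol)
  have Wrnz: "\<exists>z\<in>ball 0 1. Wr f z \<noteq> 0"
  proof (rule ccontr)
    assume "\<not> ?thesis"
    then have all0: "\<And>z. z \<in> ball 0 1 \<Longrightarrow> wronskian ?gs z = 0" by (auto simp: Wr_def)
    have gh: "\<And>j. j < length ?gs \<Longrightarrow> (?gs ! j) holomorphic_on ball 0 1"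
      using holomorphic_lform[OF hol] by simp
    have "\<exists>c. (\<exists>j<length ?gs. c j \<noteq> (0::complex)) \<and> (\<forall>z\<in>ball 0 1. (\<Sum>j<length ?gs. c j * (?gs ! j) z) = 0)"
      by (rule wronskian_zero_imp_dependent[OF open_ball connected_ball _ gh all0]) auto
    then obtain c l where l: "l < length bs" "c l \<noteq> (0::complex)"
      and rel: "\<And>z. z \<in> ball 0 1 \<Longrightarrow> (\<Sum>j<length bs. c j * lform (L (bs ! j)) (f z)) = 0" by auto
    have bij: "bij_betw (\<lambda>j. bs ! j) {..<length bs} (set bs)" by (rule bij_betw_nth) (use bs in auto)
    define c' where "c' b = c (inv_into {..<length bs} (\<lambda>j. bs ! j) b)" for b
    have c': "c' (bs ! j) = c j" if "j < length bs" for j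
      unfolding c'_def using bij that by (simp add: bij_betw_def inv_into_f_f)
    have re: "(\<Sum>b\<in>set bs. c' b *s L b) = (\<Sum>j<length bs. c j *s L (bs ! j))"
      using sum.reindex_bij_betw[OF bij, of "\<lambda>b. c' b *s L b"] c' by simp
    have "(\<Sum>b\<in>set bs. c' b *s L b) \<in> K"
      unfolding K_eq re by (simp add: lform_sum_left lform_scale_left rel)
    moreover have "form_rank K L (set bs) = card (set bs)" using bs by (simp add: distinct_card)
    ultimately have "c' (bs ! l) = 0" using l by (intro form_basis_independent[OF K]) auto
    then show False using c' l by simp
  qed
  let ?G = "insert W (insert (Wr f) ((\<lambda>i z. lform (L i) (f z)) ` E))"
  obtain r where r: "1/3 < r" "r < 2/3" "\<And>g z. g \<in> ?G \<Longrightarrow> z \<in> sphere 0 r \<Longrightarrow> g z \<noteq> (0::complex)"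
  proof (rule generic_radius[of ?G 1 "1/3" "2/3"])
    show "finite ?G" using finE by simp
    fix g assume "g \<in> ?G"
    moreover have "W 0 \<noteq> 0" using ij by (simp add: W_def)
    moreover have "Wr f holomorphic_on ball 0 1" by (rule holomorphic_Wr[OF hol])
    moreover have "\<exists>z\<in>ball 0 1. lform (L i) (f z) \<noteq> 0" if "i \<in> E" for i
    proof -
      have "L i \<notin> K" using that by (simp add: E_def)
      then show ?thesis unfolding K_eq by blast
    qed
    moreover have "(\<lambda>z. lform (L i) (f z)) holomorphic_on ball 0 1" for i by (rule holomorphic_lform[OF hol])
    moreover have "(0::complex) \<in> ball 0 1" by simp
    ultimately show "g holomorphic_on ball 0 1 \<and> (\<exists>z\<in>ball 0 1. g z \<noteq> 0)" using Wh Wrnz by blast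
  qed auto
  have z0: "complex_of_real r \<in> sphere 0 r" using r by simp
  show ?thesis
  proof (rule that[of "complex_of_real r" i j])
    show "complex_of_real r \<in> ball 0 1" using r by simp
    show "Wr f (complex_of_real r) \<noteq> 0" using r(3)[OF _ z0] by simp
    show "lform (L i) (f (complex_of_real r)) \<noteq> 0" if "i \<in> E" for i
      using r(3)[OF _ z0, of "\<lambda>z. lform (L i) (f z)"] that by simp
    show "vderiv f (complex_of_real r) $ i * f (complex_of_real r) $ j - f (complex_of_real r) $ i * vderiv f (complex_of_real r) $ j \<noteq> 0"
      using r(3)[OF _ z0, of W] by (simp add: W_def)
  qed
qed

text \<open>The number \<kappa> is read off from \<open>f1\<close> at \<open>z0\<close> through
  ratios unchanged by multiplication with a unit. A curve \<open>f2\<close> on a large disc that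
  agrees with \<open>f1\<close> near \<open>z0\<close> up to a unit therefore meets the hypotheses
  of \<open>bounded_radius\<close>, recentred at \<open>z0\<close>, with the same \<kappa>, while
  its minor at \<open>z0\<close> is too large for the conclusion.\<close>

lemma bounded_extension:
  assumes eps: "eps > 0"
    and f1: "f1 z0 \<noteq> 0" "Wr f1 z0 \<noteq> 0" "\<And>i. i \<in> E \<Longrightarrow> lform (L i) (f1 z0) \<noteq> 0"
      "vderiv f1 z0 $ i0 * f1 z0 $ j0 - f1 z0 $ i0 * vderiv f1 z0 $ j0 \<noteq> 0" and z0: "z0 \<in> ball 0 1"
  obtains R0 where "R0 > 0" "\<And>f2 u S. open S \<Longrightarrow> z0 \<in> S \<Longrightarrow> (\<And>j. (\<lambda>z. f1 z $ j) holomorphic_on S) \<Longrightarrow> u holomorphic_on S \<Longrightarrow> u z0 \<noteq> 0 \<Longrightarrow>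
     (\<And>z. z \<in> S \<Longrightarrow> f2 z = u z *s f1 z) \<Longrightarrow> (\<And>j. (\<lambda>z. f2 z $ j) holomorphic_on ball 0 (R0 + 2)) \<Longrightarrow>
     (\<And>z. z \<in> ball 0 (R0 + 2) \<Longrightarrow> f2 z \<noteq> 0) \<Longrightarrow> (\<And>z. z \<in> ball 0 (R0 + 2) \<Longrightarrow> sph f2 z \<le> 2) \<Longrightarrow>
     (\<And>a z. a \<in> K \<Longrightarrow> z \<in> ball 0 (R0 + 2) \<Longrightarrow> lform a (f2 z) = 0) \<Longrightarrow>
     (\<And>i. i \<in> E \<Longrightarrow> zero_mult (m i) (\<lambda>z. lform (L i) (f2 z)) (ball 0 (R0 + 2))) \<Longrightarrow> False"
proof -
  define W where "W = vderiv f1 z0 $ i0 * f1 z0 $ j0 - f1 z0 $ i0 * vderiv f1 z0 $ j0"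
  define N where "N = norm (f1 z0)"
  have N: "N > 0" using f1 by (simp add: N_def)
  \<comment> \<open>The powers of \<open>N\<close> match homogeneity under a unit: degree 2 for the
    minor, \<open>d\<close> for the Wronskian, 1 for a form.\<close>
  define A where "A = insert (norm W / N\<^sup>2) (insert (norm (Wr f1 z0) / N ^ d) ((\<lambda>i. norm (lform (L i) (f1 z0)) / N) ` E))"
  have finA: "finite A" "A \<noteq> {}" using finE by (auto simp: A_def)
  define \<kappa> where "\<kappa> = Min A"
  have "W \<noteq> 0" using f1 by (simp add: W_def)
  then have "\<forall>x\<in>A. x > 0" using f1 N by (auto simp: A_def)
  then have kp: "\<kappa> > 0" using finA by (simp add: \<kappa>_def)
  have kA: "\<kappa> \<le> x" if "x \<in> A" for x using that finA by (simp add: \<kappa>_def)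
  have k1: "\<kappa> * N\<^sup>2 \<le> norm W" using kA[of "norm W / N\<^sup>2"] N by (simp add: A_def field_simps)
  have k2: "\<kappa> * N ^ d \<le> norm (Wr f1 z0)" using kA[of "norm (Wr f1 z0) / N ^ d"] N by (simp add: A_def field_simps)
  have k3: "\<kappa> * N \<le> norm (lform (L i) (f1 z0))" if "i \<in> E" for i
    using kA[of "norm (lform (L i) (f1 z0)) / N"] that N by (simp add: A_def field_simps)
  obtain R0 where R0: "R0 > 0" and bd: "\<And>f. admissible R0 f \<Longrightarrow>
      \<kappa> * norm (f 0) ^ d \<le> norm (Wr f 0) \<Longrightarrow> (\<forall>i\<in>E. \<kappa> * norm (f 0) \<le> norm (lform (L i) (f 0))) \<Longrightarrow>
      (\<forall>z\<in>ball 0 R0. \<exists>\<delta>>0. \<forall>w. norm (w - z) < \<delta> \<longrightarrow> chordal (f w) (f z) \<le> 3 * norm (w - z)) \<Longrightarrow>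
      (\<forall>i j. norm (deriv (\<lambda>z. f z $ i) 0 * f 0 $ j - f 0 $ i * deriv (\<lambda>z. f z $ j) 0) < \<kappa> * (norm (f 0))\<^sup>2)"
    using bounded_radius[OF eps kp, of 3] by (metis order_refl zero_less_numeral)
  show ?thesis
  proof (rule that[OF R0])
    fix f2 u S
    assume S: "open S" "z0 \<in> S" and f1h: "\<And>j. (\<lambda>z. f1 z $ j) holomorphic_on S" and u: "u holomorphic_on S" "u z0 \<noteq> 0"
      and eq: "\<And>z. z \<in> S \<Longrightarrow> f2 z = u z *s f1 z" and f2h: "\<And>j. (\<lambda>z. f2 z $ j) holomorphic_on ball 0 (R0 + 2)"
      and f2nz: "\<And>z. z \<in> ball 0 (R0 + 2) \<Longrightarrow> f2 z \<noteq> 0" and s2: "\<And>z. z \<in> ball 0 (R0 + 2) \<Longrightarrow> sph f2 z \<le> 2"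
      and Kf2: "\<And>a z. a \<in> K \<Longrightarrow> z \<in> ball 0 (R0 + 2) \<Longrightarrow> lform a (f2 z) = 0"
      and zm: "\<And>i. i \<in> E \<Longrightarrow> zero_mult (m i) (\<lambda>z. lform (L i) (f2 z)) (ball 0 (R0 + 2))"
    \<comment> \<open>The factor 1 puts the translation into the form of the affine lemmas; the disc
      of radius \<open>R0\<close> about \<open>z0\<close> lies inside radius
      \<open>R0 + 2\<close>.\<close>
    define f where "f z = f2 (z0 + 1 * z)" for z
    have sub: "z0 + 1 * z \<in> ball 0 (R0 + 2)" if "z \<in> ball 0 R0" for z
      using norm_triangle_ineq[of z0 "1 * z"] that z0 by simp
    have b0: "0 \<in> ball (0::complex) R0" using R0 by simp
    have fh: "(\<lambda>z. f z $ j) holomorphic_on ball 0 R0" for j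
      unfolding f_def by (rule holomorphic_affine[OF f2h sub])
    have f0: "f 0 = u z0 *s f1 z0" using eq[OF S(2)] by (simp add: f_def)
    have Nf: "norm (f 0) = norm (u z0) * N" by (simp add: f0 norm_vector_scale N_def)
    have Wf: "Wr f 0 = u z0 ^ d * Wr f1 z0"
    proof -
      have "Wr f 0 = Wr f2 z0"
      proof -
        have "(deriv ^^ l) (\<lambda>z. lform a (f z)) 0 = (deriv ^^ l) (\<lambda>z. lform a (f2 z)) z0" for l a
          using higher_deriv_compose_linear'[OF holomorphic_lform[OF f2h] open_ball[of 0 R0] open_ball b0, of 1 z0 l a] sub
          by (simp add: f_def add.commute)
        then show ?thesis unfolding Wr_def by (intro wronskian_eqI) auto
      qed
      also have "\<dots> = wronskian (map (\<lambda>g w. u w * g w) (map (\<lambda>i z. lform (L i) (f1 z)) bs)) z0"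
        unfolding Wr_def
      proof (rule wronskian_cong[of "S \<inter> ball 0 (R0 + 2)"])
        show "open (S \<inter> ball 0 (R0 + 2))" using S by auto
        show "z0 \<in> S \<inter> ball 0 (R0 + 2)" using S z0 R0 by auto
        show "(map (\<lambda>i z. lform (L i) (f2 z)) bs ! j) holomorphic_on S \<inter> ball 0 (R0 + 2)"
          if "j < length (map (\<lambda>i z. lform (L i) (f2 z)) bs)" for j
          using that holomorphic_on_subset[OF holomorphic_lform[OF f2h]] by simp
        show "(map (\<lambda>g w. u w * g w) (map (\<lambda>i z. lform (L i) (f1 z)) bs) ! j) holomorphic_on S \<inter> ball 0 (R0 + 2)"
          if "j < length (map (\<lambda>i z. lform (L i) (f2 z)) bs)" for j
          using that holomorphic_on_subset[OF holomorphic_lform[OF f1h]] holomorphic_on_subset[OF u(1)]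
          by (simp add: holomorphic_on_mult)
      qed (use eq in \<open>auto simp: lform_scale_right\<close>)
      also have "\<dots> = u z0 ^ length (map (\<lambda>i z. lform (L i) (f1 z)) bs) * wronskian (map (\<lambda>i z. lform (L i) (f1 z)) bs) z0"
        by (rule wronskian_mult[OF S u(1)]) (use holomorphic_lform[OF f1h] in auto)
      finally show ?thesis using bs by (simp add: Wr_def)
    qed
    have lf: "lform (L i) (f 0) = u z0 * lform (L i) (f1 z0)" for i by (simp add: f0 lform_scale_right)
    have vf: "deriv (\<lambda>z. f z $ j) 0 = u z0 * vderiv f1 z0 $ j + deriv u z0 * f1 z0 $ j" for j
    proof (rule DERIV_imp_deriv)
      have "((\<lambda>z. u z * f1 z $ j) has_field_derivative deriv u z0 * f1 z0 $ j + deriv (\<lambda>z. f1 z $ j) z0 * u z0) (at z0)"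
        using S u f1h by (intro DERIV_mult holomorphic_derivI[of _ S]) auto
      then have "((\<lambda>z. f2 z $ j) has_field_derivative deriv u z0 * f1 z0 $ j + deriv (\<lambda>z. f1 z $ j) z0 * u z0) (at (z0 + 1 * 0))"
        unfolding mult_zero_right add_0_right
        by (rule has_field_derivative_transform_within_open[OF _ S]) (use eq in auto)
      moreover have "((\<lambda>z. z0 + 1 * z) has_field_derivative 1) (at 0)" by (auto intro!: derivative_eq_intros)
      ultimately have "((\<lambda>z. f2 (z0 + 1 * z) $ j) has_field_derivative (deriv u z0 * f1 z0 $ j + deriv (\<lambda>z. f1 z $ j) z0 * u z0) * 1) (at 0)"
        by (rule DERIV_chain2)
      then show "((\<lambda>z. f z $ j) has_field_derivative u z0 * vderiv f1 z0 $ j + deriv u z0 * f1 z0 $ j) (at 0)"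
        by (simp add: f_def vderiv_def algebra_simps)
    qed
    have "\<forall>i j. norm (deriv (\<lambda>z. f z $ i) 0 * f 0 $ j - f 0 $ i * deriv (\<lambda>z. f z $ j) 0) < \<kappa> * (norm (f 0))\<^sup>2"
    proof (rule bd)
      show "admissible R0 f"
        unfolding admissible_def
      proof (intro conjI allI ballI)
        show "(\<lambda>z. f z $ j) holomorphic_on ball 0 R0" for j by (rule fh)
        show "f z \<noteq> 0" if "z \<in> ball 0 R0" for z unfolding f_def by (rule f2nz[OF sub[OF that]])
        show "lform a (f z) = 0" if "a \<in> K" "z \<in> ball 0 R0" for a z unfolding f_def by (rule Kf2[OF that(1) sub[OF that(2)]])
        show "zero_mult (m i) (\<lambda>z. lform (L i) (f z)) (ball 0 R0)" if "i \<in> E" for i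
          unfolding f_def by (rule zero_mult_affine[OF open_ball open_ball holomorphic_lform[OF f2h] sub zm[OF that]])
        show "lform (L i) (f 0) \<noteq> 0" if "i \<in> E" for i using f1(3)[OF that] u by (simp add: lf)
        show "Wr f 0 \<noteq> 0" using f1 u by (simp add: Wf)
      qed
      show "\<kappa> * norm (f 0) ^ d \<le> norm (Wr f 0)"
        using mult_left_mono[OF k2, of "norm (u z0) ^ d"] by (simp add: Nf Wf norm_mult norm_power power_mult_distrib mult_ac)
      show "\<forall>i\<in>E. \<kappa> * norm (f 0) \<le> norm (lform (L i) (f 0))"
        using mult_left_mono[OF k3, of _ "norm (u z0)"] by (simp add: Nf lf norm_mult mult_ac)
      show "\<forall>z\<in>ball 0 R0. \<exists>\<delta>>0. \<forall>w. norm (w - z) < \<delta> \<longrightarrow> chordal (f w) (f z) \<le> 3 * norm (w - z)"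
      proof
        fix z :: complex assume z: "z \<in> ball 0 R0"
        have "sph f z = norm (1::complex) * sph f2 (z0 + 1 * z)"
          unfolding f_def by (rule sph_compose_affine[OF open_ball f2h sub[OF z]])
        then have "sph f z < 3" using s2[OF sub[OF z]] by simp
        moreover have "f z \<noteq> 0" unfolding f_def by (rule f2nz[OF sub[OF z]])
        ultimately show "\<exists>\<delta>>0. \<forall>w. norm (w - z) < \<delta> \<longrightarrow> chordal (f w) (f z) \<le> 3 * norm (w - z)"
          using sph_local_lipschitz[OF open_ball z fh, of 3] by blast
      qed
    qed
    moreover have "deriv (\<lambda>z. f z $ i0) 0 * f 0 $ j0 - f 0 $ i0 * deriv (\<lambda>z. f z $ j0) 0 = (u z0)\<^sup>2 * W"
      unfolding vf f0 W_def by (simp add: power2_eq_square algebra_simps)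
    ultimately have "norm ((u z0)\<^sup>2 * W) < \<kappa> * (norm (f 0))\<^sup>2" by metis
    then have "(norm (u z0))\<^sup>2 * norm W < (norm (u z0))\<^sup>2 * (\<kappa> * N\<^sup>2)"
      by (simp add: Nf norm_mult norm_power power_mult_distrib mult_ac)
    then show False using mult_left_mono[OF k1, of "(norm (u z0))\<^sup>2"] by simp
  qed
qed

end

text \<open>For positivity of \<open>eps\<close> it suffices that
  \<open>(d - 1) * \<sigma> < q - d - 2 * c\<close>, and this has to be checked for every dimension
  of the span. For \<open>c = 0\<close> it is \<open>sig\<close>; smaller spans are no worse because
  of the lower bound on \<open>q\<close>.\<close>

lemma weighted_forms_exist:
  fixes L :: "nat \<Rightarrow> complex ^ 'n" and K :: "(complex ^ 'n) set"
  assumes gp: "general_position L q" and q: "q > 2 * (CARD('n) - 1)" and m1: "\<And>i. i < q \<Longrightarrow> m i \<ge> 1"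
    and sig: "(\<Sum>i<q. inv_mult (m i)) < (real q - real CARD('n)) / (real CARD('n) - 1)"
    and K: "vec.subspace K" and d2: "CARD('n) - vec.dim K \<ge> 2"
  shows "\<exists>w bs. weighted_forms L q K w m (CARD('n) - vec.dim K) bs \<and>
    weighted_forms.eps L q K w m (CARD('n) - vec.dim K) > 0"
proof -
  define d where "d = CARD('n) - vec.dim K"
  define c where "c = vec.dim K"
  have dc: "d + c = CARD('n)" using dim_subset_UNIV_cart_gen[of K] by (simp add: d_def c_def)
  have d2': "d \<ge> 2" using d2 by (simp add: d_def)
  have Nq: "CARD('n) \<le> q" using q dc d2' by linarith
  interpret rf: rank_function "{..<q}" "form_rank K L" by (rule rank_function_form_rank)
  have full: "form_rank K L {..<q} = d" unfolding d_def by (rule gp_form_rank_full[OF gp Nq]) (use Nq in auto)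
  have "\<exists>w \<theta>. \<theta> > (0::real) \<and> (\<forall>e\<in>{..<q}. 0 \<le> w e \<and> w e \<le> \<theta>) \<and>
     sum w {..<q} = \<theta> * (real (card {..<q}) - real d - 2 * real c) + real d \<and>
     (\<forall>R\<subseteq>{..<q}. form_rank K L R < d \<longrightarrow> sum w R \<le> real (form_rank K L R))"
  proof (rule rf.nochka_weights[of c, unfolded full])
    show "1 \<le> d" using d2' by simp
    show "card R \<le> form_rank K L R + c" if "R \<subseteq> {..<q}" "form_rank K L R < d" for R
      unfolding c_def by (rule gp_card_le[OF gp Nq that(1)]) (use that(2) in \<open>simp add: d_def\<close>)
  qed
  then obtain w \<theta> where th: "\<theta> > (0::real)" and w: "\<And>i. i < q \<Longrightarrow> 0 \<le> w i" "\<And>i. i < q \<Longrightarrow> w i \<le> \<theta>"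
    and sw: "sum w {..<q} = \<theta> * (real q - real d - 2 * real c) + real d"
    and wr: "\<And>R. R \<subseteq> {..<q} \<Longrightarrow> form_rank K L R < d \<Longrightarrow> sum w R \<le> real (form_rank K L R)"
    by auto
  obtain B where B: "B \<subseteq> {..<q}" "form_rank K L B = card B" "form_rank K L B = d"
    using rf.extend_basis[of "{}" "{..<q}"] rf.rk_empty full by auto
  have finB: "finite B" using B finite_subset by blast
  define bs where "bs = sorted_list_of_set B"
  interpret wf: weighted_forms L q K w m d bs
    by unfold_locales (use K d_def d2' w wr full B finB m1 in \<open>auto simp: bs_def\<close>)
  define N where "N = real CARD('n)"
  define \<sigma> where "\<sigma> = (\<Sum>i<q. inv_mult (m i))"
  have N: "N = real d + real c" using dc by (simp add: N_def flip: of_nat_add)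
  have "2 * (d + c) \<le> q + 1" using q d2' unfolding dc[symmetric] by arith
  then have "real (2 * (d + c)) \<le> real (q + 1)" by (rule of_nat_mono)
  then have Nq2: "real q \<ge> 2 * N - 1" by (simp add: N)
  have N1: "N - 1 > 0" using d2' unfolding N by simp
  have k: "real (d - 1) = real d - 1" using d2' by (simp add: of_nat_diff)
  have "(N - 1) * \<sigma> < real q - N" using sig N1 unfolding N_def[symmetric] \<sigma>_def[symmetric] by (simp add: field_simps)
  then have "(real d - 1) * ((N - 1) * \<sigma>) < (real d - 1) * (real q - N)" using d2' by (intro mult_strict_left_mono) auto
  \<comment> \<open>Compares the goal multiplied by \<open>N - 1\<close> with the hypothesis
    multiplied by \<open>d - 1\<close>, using \<open>N = d + c\<close>.\<close>
  moreover have "(N - 1) * (real q - real d - 2 * real c) - (real d - 1) * (real q - N) = real c * (real q - 2 * N + 1)"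
    unfolding N by (simp add: algebra_simps)
  moreover have "real c * (real q - 2 * N + 1) \<ge> 0" using Nq2 by simp
  ultimately have "0 < (N - 1) * (real q - real d - 2 * real c - (real d - 1) * \<sigma>)" by (simp add: algebra_simps)
  then have "0 < \<theta> * (real q - real d - 2 * real c - real (d - 1) * \<sigma>)"
    using N1 th unfolding k by (simp add: zero_less_mult_iff)
  also have "\<dots> \<le> wf.eps" unfolding \<sigma>_def by (rule wf.eps_ge) (use w sw in auto)
  finally show ?thesis using wf.weighted_forms_axioms unfolding d_def by blast
qed

text \<open>The two sequences of scalars may be unrelated; the 2 by 2 minors of two multiples of one
  vector vanish, and this passes to the limit.\<close>

lemma limits_proportional:
  fixes a b :: "complex ^ 'n"
  assumes "(\<lambda>k. \<mu> k *s x k) \<longlonglongrightarrow> a" "(\<lambda>k. \<nu> k *s x k) \<longlonglongrightarrow> b"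
  shows "b $ i * a $ j = b $ j * a $ i"
proof -
  have "(\<lambda>k. (\<nu> k *s x k) $ i * (\<mu> k *s x k) $ j) \<longlonglongrightarrow> b $ i * a $ j"
    by (intro tendsto_intros assms)
  moreover have "(\<lambda>k. (\<nu> k *s x k) $ j * (\<mu> k *s x k) $ i) \<longlonglongrightarrow> b $ j * a $ i"
    by (intro tendsto_intros assms)
  moreover have "(\<nu> k *s x k) $ i * (\<mu> k *s x k) $ j = (\<nu> k *s x k) $ j * (\<mu> k *s x k) $ i" for k
    by (simp add: mult_ac)
  ultimately show ?thesis by (simp only: LIMSEQ_unique)
qed

text \<open>A first limit on the unit disc determines the forms that vanish along the curve, hence the radius \<open>R0\<close>
  beyond which no such curve exists; a second limit on a larger disc then contradicts the bound.\<close>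

theorem no_brody_sequence:
  fixes L :: "nat \<Rightarrow> complex ^ 'n"
  assumes gp: "general_position L q" and q: "q > 2 * (CARD('n) - 1)" and m1: "\<And>i. i < q \<Longrightarrow> m i \<ge> 1"
    and sig: "(\<Sum>i<q. inv_mult (m i)) < (real q - real CARD('n)) / (real CARD('n) - 1)"
    and oc: "\<And>k. orb_curve L m q (real k) (g k)" and sph2: "\<And>k z. z \<in> ball 0 (real k) \<Longrightarrow> sph (g k) z \<le> 2"
    and sph1: "\<And>k. sph (g k) 0 = 1"
  shows False
proof -
  have "\<exists>\<sigma> \<mu> f. strict_mono (\<sigma> :: nat \<Rightarrow> nat) \<and> (\<forall>k z. \<mu> k z \<noteq> 0) \<and>
     (\<forall>j. (\<lambda>z. f z $ j) holomorphic_on ball 0 1) \<and> (\<forall>z\<in>ball 0 1. f z \<noteq> 0) \<and>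
     (\<forall>z\<in>ball 0 1. (\<lambda>k. \<mu> k z *s g (\<sigma> k) z) \<longlonglongrightarrow> f z) \<and>
     (\<forall>i<q. (\<forall>z\<in>ball 0 1. lform (L i) (f z) = 0) \<or> zero_mult (m i) (\<lambda>z. lform (L i) (f z)) (ball 0 1)) \<and>
     (\<forall>z\<in>ball 0 1. sph f z \<le> 2) \<and> sph f 0 = 1"
    by (rule orb_curve_limit[OF oc sph2 sph1]) auto
  then obtain \<sigma> \<mu> f1 where \<sigma>: "strict_mono (\<sigma> :: nat \<Rightarrow> nat)"
    and f1h: "\<And>j. (\<lambda>z. f1 z $ j) holomorphic_on ball 0 1" and f1nz: "\<And>z. z \<in> ball 0 1 \<Longrightarrow> f1 z \<noteq> 0"
    and lim1: "\<And>z. z \<in> ball 0 1 \<Longrightarrow> (\<lambda>k. \<mu> k z *s g (\<sigma> k) z) \<longlonglongrightarrow> f1 z" and f1s: "sph f1 0 = 1" by blast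
  \<comment> \<open>\<open>K\<close> is fixed by the limit on the unit disc; the identity theorem
    will carry it to the larger disc.\<close>
  define K where "K = {a. \<forall>z\<in>ball 0 1. lform a (f1 z) = 0}"
  have K: "vec.subspace K" unfolding K_def by (rule subspace_annihilator)
  have d2: "CARD('n) - vec.dim K \<ge> 2" unfolding K_def by (rule span_dim_ge_2) (use f1nz[of 0] f1h f1s in auto)
  obtain w bs where wf: "weighted_forms L q K w m (CARD('n) - vec.dim K) bs"
    and eps: "weighted_forms.eps L q K w m (CARD('n) - vec.dim K) > 0"
    using weighted_forms_exist[OF gp q m1 sig K d2] by blast
  interpret weighted_forms L q K w m "CARD('n) - vec.dim K" bs by (rule wf)
  obtain z0 i0 j0 where z0: "z0 \<in> ball 0 1" and W0: "Wr f1 z0 \<noteq> 0" and L0: "\<And>i. i \<in> E \<Longrightarrow> lform (L i) (f1 z0) \<noteq> 0"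
    and wd0: "vderiv f1 z0 $ i0 * f1 z0 $ j0 - f1 z0 $ i0 * vderiv f1 z0 $ j0 \<noteq> 0"
    using generic_point[OF f1h f1nz K_def] f1s by (metis zero_neq_one)
  obtain R0 where R0: "R0 > 0" and contra: "\<And>f2 u S. open S \<Longrightarrow> z0 \<in> S \<Longrightarrow> (\<And>j. (\<lambda>z. f1 z $ j) holomorphic_on S) \<Longrightarrow> u holomorphic_on S \<Longrightarrow> u z0 \<noteq> 0 \<Longrightarrow>
     (\<And>z. z \<in> S \<Longrightarrow> f2 z = u z *s f1 z) \<Longrightarrow> (\<And>j. (\<lambda>z. f2 z $ j) holomorphic_on ball 0 (R0 + 2)) \<Longrightarrow>
     (\<And>z. z \<in> ball 0 (R0 + 2) \<Longrightarrow> f2 z \<noteq> 0) \<Longrightarrow> (\<And>z. z \<in> ball 0 (R0 + 2) \<Longrightarrow> sph f2 z \<le> 2) \<Longrightarrow>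
     (\<And>a z. a \<in> K \<Longrightarrow> z \<in> ball 0 (R0 + 2) \<Longrightarrow> lform a (f2 z) = 0) \<Longrightarrow>
     (\<And>i. i \<in> E \<Longrightarrow> zero_mult (m i) (\<lambda>z. lform (L i) (f2 z)) (ball 0 (R0 + 2))) \<Longrightarrow> False"
    by (rule bounded_extension[OF eps f1nz[OF z0] W0 L0 wd0 z0]) blast+
  have ge: "real k \<le> real (\<sigma> k)" for k using seq_suble[OF \<sigma>] by simp
  \<comment> \<open>The second limit is taken along the subsequence \<sigma>, so on the unit disc
    both limits arise from the same curves and are proportional.\<close>
  have "\<exists>\<tau> \<nu> f. strict_mono (\<tau> :: nat \<Rightarrow> nat) \<and> (\<forall>k z. \<nu> k z \<noteq> 0) \<and>
     (\<forall>j. (\<lambda>z. f z $ j) holomorphic_on ball 0 (R0 + 2)) \<and> (\<forall>z\<in>ball 0 (R0 + 2). f z \<noteq> 0) \<and>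
     (\<forall>z\<in>ball 0 (R0 + 2). (\<lambda>k. \<nu> k z *s g (\<sigma> (\<tau> k)) z) \<longlonglongrightarrow> f z) \<and>
     (\<forall>i<q. (\<forall>z\<in>ball 0 (R0 + 2). lform (L i) (f z) = 0) \<or> zero_mult (m i) (\<lambda>z. lform (L i) (f z)) (ball 0 (R0 + 2))) \<and>
     (\<forall>z\<in>ball 0 (R0 + 2). sph f z \<le> 2) \<and> sph f 0 = 1"
  proof (rule orb_curve_limit[of L m q "\<lambda>k. g (\<sigma> k)"])
    show "orb_curve L m q (real k) (g (\<sigma> k))" for k by (rule orb_curve_mono[OF oc ge])
    show "sph (g (\<sigma> k)) z \<le> 2" if "z \<in> ball 0 (real k)" for k z by (rule sph2) (use that ge[of k] in auto)
  qed (use sph1 R0 in auto)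
  then obtain \<tau> \<nu> f2 where \<tau>: "strict_mono (\<tau> :: nat \<Rightarrow> nat)"
    and f2h: "\<And>j. (\<lambda>z. f2 z $ j) holomorphic_on ball 0 (R0 + 2)" and f2nz: "\<And>z. z \<in> ball 0 (R0 + 2) \<Longrightarrow> f2 z \<noteq> 0"
    and lim2: "\<And>z. z \<in> ball 0 (R0 + 2) \<Longrightarrow> (\<lambda>k. \<nu> k z *s g (\<sigma> (\<tau> k)) z) \<longlonglongrightarrow> f2 z"
    and f2zm: "\<And>i. i < q \<Longrightarrow> (\<forall>z\<in>ball 0 (R0 + 2). lform (L i) (f2 z) = 0) \<or> zero_mult (m i) (\<lambda>z. lform (L i) (f2 z)) (ball 0 (R0 + 2))"
    and f2s: "\<And>z. z \<in> ball 0 (R0 + 2) \<Longrightarrow> sph f2 z \<le> 2" by blast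
  have sub: "ball 0 1 \<subseteq> ball (0::complex) (R0 + 2)" using R0 by auto
  have cross: "f2 z $ i * f1 z $ j = f2 z $ j * f1 z $ i" if z: "z \<in> ball 0 1" for z i j
  proof (rule limits_proportional)
    show "(\<lambda>k. \<mu> (\<tau> k) z *s g (\<sigma> (\<tau> k)) z) \<longlonglongrightarrow> f1 z"
      using LIMSEQ_subseq_LIMSEQ[OF lim1[OF z] \<tau>] by (simp add: o_def)
    show "(\<lambda>k. \<nu> k z *s g (\<sigma> (\<tau> k)) z) \<longlonglongrightarrow> f2 z" by (rule lim2) (use z sub in blast)
  qed
  have quot: "f2 z = (f2 z $ j / f1 z $ j) *s f1 z" if "z \<in> ball 0 1" "f1 z $ j \<noteq> 0" for z j
    using cross[OF that(1), of _ j] that(2) by (simp add: Finite_Cartesian_Product.vec_eq_iff field_simps)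
  have scalar: "\<exists>c. c \<noteq> 0 \<and> f2 z = c *s f1 z" if z: "z \<in> ball 0 1" for z
  proof -
    obtain j where j: "f1 z $ j \<noteq> 0" using f1nz[OF z] by (auto simp: Finite_Cartesian_Product.vec_eq_iff)
    have "f2 z \<noteq> 0" using f2nz z sub by blast
    then have "f2 z $ j / f1 z $ j \<noteq> 0" using quot[OF z j] by (metis vec.scale_zero_left)
    then show ?thesis using quot[OF z j] by blast
  qed
  obtain j where j: "f1 z0 $ j \<noteq> 0" using f1nz[OF z0] by (auto simp: Finite_Cartesian_Product.vec_eq_iff)
  \<comment> \<open>On \<open>S\<close> the quotient of the j-th components is holomorphic and is
    the unit relating \<open>f2\<close> to \<open>f1\<close>.\<close>
  define S where "S = {z\<in>ball 0 1. f1 z $ j \<noteq> 0}"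
  define u where "u z = f2 z $ j / f1 z $ j" for z
  have S1: "S \<subseteq> ball 0 1" by (auto simp: S_def)
  show False
  proof (rule contra[of S u f2])
    have "open (ball 0 1 \<inter> (\<lambda>z. f1 z $ j) -` (- {0}))"
      by (rule continuous_open_preimage) (use f1h holomorphic_on_imp_continuous_on in auto)
    moreover have "S = ball 0 1 \<inter> (\<lambda>z. f1 z $ j) -` (- {0})" by (auto simp: S_def)
    ultimately show "open S" by simp
    show "z0 \<in> S" using z0 j by (simp add: S_def)
    show "(\<lambda>z. f1 z $ j) holomorphic_on S" for j using f1h S1 holomorphic_on_subset by blast
    show "u holomorphic_on S" unfolding u_def
      using f1h[of j] f2h[of j] S1 sub by (intro holomorphic_on_divide) (auto intro: holomorphic_on_subset simp: S_def)
    show "u z0 \<noteq> 0" using quot[OF z0 j] f2nz[of z0] z0 sub unfolding u_def by (metis subsetD vec.scale_zero_left)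
    show "f2 z = u z *s f1 z" if "z \<in> S" for z using quot that by (simp add: S_def u_def)
    show "lform a (f2 z) = 0" if a: "a \<in> K" and z: "z \<in> ball 0 (R0 + 2)" for a z
    proof (rule analytic_continuation_open[of "ball 0 1" "ball 0 (R0 + 2)" "\<lambda>z. lform a (f2 z)" "\<lambda>_. 0" z])
      show "(\<lambda>z. lform a (f2 z)) holomorphic_on ball 0 (R0 + 2)" by (rule holomorphic_lform[OF f2h])
      show "lform a (f2 z) = 0" if "z \<in> ball 0 1" for z
        using scalar[OF that] a that by (auto simp: K_def lform_scale_right)
    qed (use sub z in auto)
    show "zero_mult (m i) (\<lambda>z. lform (L i) (f2 z)) (ball 0 (R0 + 2))" if i: "i \<in> E" for i
    proof -
      \<comment> \<open>This excludes the alternative in \<open>f2zm\<close> that the form vanishes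
        along the whole curve.\<close>
      have "lform (L i) (f2 z0) \<noteq> 0" using scalar[OF z0] L0[OF i] by (auto simp: lform_scale_right)
      then show ?thesis using f2zm[of i] i z0 sub by (auto simp: E_def)
    qed
  qed (use f2h f2nz f2s in auto)
qed

subsection \<open>Comparison with the Poincare distance\<close>

text \<open>The bound at the centre, applied to the disc of radius \<open>1 - norm z\<close> about
  \<open>z\<close>, gives a derivative bound of the order of the Poincare density.\<close>

lemma sph_disc_bound:
  assumes C: "\<And>F. orb_curve L m q 1 F \<Longrightarrow> sph F 0 \<le> C" and F: "orb_curve L m q 1 F" and z: "z \<in> ball 0 1"
  shows "(1 - norm z) * sph F z \<le> C"
proof -
  define b where "b = complex_of_real (1 - norm z)"
  have nb: "norm b = 1 - norm z" using z unfolding b_def norm_of_real by simp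
  have in1: "z + b * x \<in> ball 0 1" if "x \<in> ball 0 1" for x
  proof -
    have "norm (b * x) < 1 - norm z" using that z unfolding norm_mult nb by simp
    then show ?thesis using norm_triangle_ineq[of z "b * x"] by simp
  qed
  have "orb_curve L m q 1 (\<lambda>x. F (z + b * x))" by (rule orb_curve_affine[OF F in1])
  then have "sph (\<lambda>x. F (z + b * x)) 0 \<le> C" by (rule C)
  moreover have "sph (\<lambda>x. F (z + b * x)) 0 = norm b * sph F (z + b * 0)"
    by (rule sph_compose_affine[OF open_ball[of 0 1]]) (use F in1[of 0] in \<open>auto simp: orb_curve_def\<close>)
  ultimately show ?thesis by (simp add: nb)
qed

lemma poincare_dist_ge:
  assumes "norm z < 1" "norm w < 1"
  shows "norm (z - w) / norm (1 - cnj w * z) \<le> poincare_dist z w"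
proof -
  define r where "r = norm (z - w) / norm (1 - cnj w * z)"
  have r0: "r \<ge> 0" by (simp add: r_def)
  have "norm (Moebius_function 0 w z) < 1" by (rule Moebius_function_norm_lt_1[OF assms(2,1)])
  then have r1: "r < 1" by (simp add: Moebius_function_simple norm_divide r_def)
  have "ln (1 - r) \<le> - r" using ln_le_minus_one[of "1 - r"] r1 by simp
  moreover have "ln ((1 + r) / (1 - r)) = ln (1 + r) - ln (1 - r)" using r0 r1 by (simp add: ln_div)
  moreover have "ln (1 + r) \<ge> 0" using r0 by simp
  ultimately show ?thesis unfolding poincare_dist_def Let_def r_def[symmetric] by linarith
qed

text \<open>Close points lie in a disc about \<open>w\<close> on which \<open>1 - norm x\<close>
  exceeds a third of \<rho>, so the Lipschitz estimate applies, with |1 - cnj w * z| at most 5/2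
  \<rho>. For distant points the pseudo-hyperbolic distance \<open>r\<close> is at least 1/5 while
  \<open>chordal\<close> is at most 1. The factor \<open>8 * C + 8\<close> dominates what both cases
  require.\<close>

lemma chordal_le_poincare:
  assumes C: "\<And>F. orb_curve L m q 1 F \<Longrightarrow> sph F 0 \<le> C" "C \<ge> 0" and F: "orb_curve L m q 1 F"
    and z: "z \<in> ball 0 1" and w: "w \<in> ball 0 1"
  shows "chordal (F z) (F w) \<le> (8 * C + 8) * poincare_dist z w"
proof -
  define \<rho> where "\<rho> = 1 - norm w"
  define r where "r = norm (z - w) / norm (1 - cnj w * z)"
  have rho: "\<rho> > 0" "\<rho> \<le> 1" using w by (auto simp: \<rho>_def)
  have hol: "(\<lambda>z. F z $ j) holomorphic_on ball 0 1" for j using F by (simp add: orb_curve_def)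
  have nz: "F z \<noteq> 0" if "z \<in> ball 0 1" for z using F that by (simp add: orb_curve_def)
  have den: "norm (1 - cnj w * z) \<le> 2 * \<rho> + norm (z - w)"
  proof -
    have "1 - cnj w * z = of_real (1 - (norm w)\<^sup>2) - cnj w * (z - w)"
      using complex_norm_square[of w] by (simp add: algebra_simps)
    then have "norm (1 - cnj w * z) \<le> norm (complex_of_real (1 - (norm w)\<^sup>2)) + norm (cnj w * (z - w))"
      by (simp only: norm_triangle_ineq4)
    then have "norm (1 - cnj w * z) \<le> norm (complex_of_real (1 - (norm w)\<^sup>2)) + norm w * norm (z - w)"
      by (simp only: norm_mult complex_mod_cnj)
    moreover have "norm (complex_of_real (1 - (norm w)\<^sup>2)) = \<rho> * (1 + norm w)"
    proof -
      have "1 - (norm w)\<^sup>2 = \<rho> * (1 + norm w)" by (simp add: \<rho>_def power2_eq_square algebra_simps)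
      moreover have "\<rho> * (1 + norm w) \<ge> 0" using rho by simp
      ultimately show ?thesis unfolding norm_of_real by simp
    qed
    moreover have "\<rho> * (1 + norm w) \<le> \<rho> * 2" using w rho by (intro mult_left_mono) auto
    moreover have "norm w * norm (z - w) \<le> 1 * norm (z - w)" using w by (intro mult_right_mono) auto
    ultimately show ?thesis by linarith
  qed
  have den0: "norm (1 - cnj w * z) > 0"
  proof -
    have "norm (cnj w * z) < 1" using z w using mult_strict_mono[of "norm w" 1 "norm z" 1] by (simp add: norm_mult)
    then have "cnj w * z \<noteq> 1" by auto
    then show ?thesis by simp
  qed
  have r0: "r \<ge> 0" by (simp add: r_def)
  have "chordal (F z) (F w) \<le> (8 * C + 8) * r"
  proof (cases "norm (z - w) \<le> \<rho> / 2")
    case True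
    define S where "S = ball w (2 / 3 * \<rho>)"
    have nx: "\<rho> / 3 < 1 - norm x" if "x \<in> S" for x
      using norm_triangle_ineq[of w "x - w"] that by (simp add: S_def dist_norm norm_minus_commute \<rho>_def)
    have S1: "x \<in> ball 0 1" if "x \<in> S" for x using nx[OF that] rho by simp
    have "chordal (F z) (F w) \<le> (3 * C + 1) / \<rho> * norm (z - w)"
    proof (rule sph_lipschitz[of S])
      show "open S" "convex S" by (auto simp: S_def)
      show "(\<lambda>z. F z $ j) holomorphic_on S" for j using hol S1 holomorphic_on_subset by blast
      show "F x \<noteq> 0" if "x \<in> S" for x by (rule nz[OF S1[OF that]])
      show "z \<in> S" "w \<in> S" using True rho by (auto simp: S_def dist_norm norm_minus_commute)
      fix x assume x: "x \<in> S"
      have "\<rho> / 3 * sph F x \<le> (1 - norm x) * sph F x"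
        using nx[OF x] sph_nonneg by (intro mult_right_mono) auto
      also have "\<dots> \<le> C" by (rule sph_disc_bound[OF C(1) F S1[OF x]])
      finally have "\<rho> * sph F x < 3 * C + 1" by simp
      then show "sph F x < (3 * C + 1) / \<rho>" using rho by (simp add: pos_less_divide_eq mult.commute)
    qed
    also have "norm (z - w) = r * norm (1 - cnj w * z)" using den0 by (simp add: r_def)
    also have "(3 * C + 1) / \<rho> * (r * norm (1 - cnj w * z)) \<le> (3 * C + 1) / \<rho> * (r * (5 / 2 * \<rho>))"
      using True den rho r0 C(2) by (intro mult_left_mono) auto
    also have "\<dots> = (15 / 2 * C + 5 / 2) * r" using rho by (simp add: field_simps)
    also have "\<dots> \<le> (8 * C + 8) * r" using r0 C(2) by (intro mult_right_mono) auto
    finally show ?thesis .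
  next
    case False
    then have "norm (1 - cnj w * z) \<le> 5 * norm (z - w)" using den by linarith
    then have "1 \<le> 5 * r" using den0 by (simp add: r_def pos_le_divide_eq)
    also have "\<dots> \<le> (8 * C + 8) * r" using r0 C(2) by (intro mult_right_mono) auto
    finally show ?thesis using chordal_le_1[OF nz[OF z] nz[OF w]] by linarith
  qed
  also have "\<dots> \<le> (8 * C + 8) * poincare_dist z w"
    using poincare_dist_ge[of z w] z w C(2) by (intro mult_left_mono) (auto simp: r_def)
  finally show ?thesis .
qed

text \<open>The chordal distance divided by \<open>A\<close> is itself a competitor in the supremum
  that defines \<open>orb_kobayashi\<close>.\<close>

lemma orb_kobayashi_ge:
  fixes L :: "nat \<Rightarrow> complex ^ 'n"
  assumes A: "A > 0" and le: "\<And>F z w. orb_morphism L m q F \<Longrightarrow> z \<in> ball 0 1 \<Longrightarrow> w \<in> ball 0 1 \<Longrightarrow>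
     chordal (F z) (F w) \<le> A * poincare_dist z w"
  shows "ereal (chordal x y / A) \<le> orb_kobayashi L m q x y"
proof -
  define \<delta> where "\<delta> x y = ereal (chordal x y / A)" for x y :: "complex ^ 'n"
  have nz: "x \<noteq> 0" if "x \<in> orb_space L m q" for x using that by (simp add: orb_space_def)
  have "proj_pseudo_dist (orb_space L m q) \<delta>"
    unfolding proj_pseudo_dist_def
  proof (intro conjI ballI impI)
    fix x y z assume x: "x \<in> orb_space L m q" and y: "y \<in> orb_space L m q" and z: "z \<in> orb_space L m q"
    show "\<delta> x x = 0" by (simp add: \<delta>_def chordal_self nz x)
    show "0 \<le> \<delta> x y" using A chordal_nonneg[OF nz[OF x] nz[OF y]] by (simp add: \<delta>_def)
    show "\<delta> x y = \<delta> y x" by (simp add: \<delta>_def chordal_commute)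
    have "chordal x z / A \<le> (chordal x y + chordal y z) / A"
      using chordal_triangle[OF nz[OF x] nz[OF y] nz[OF z]] A by (intro divide_right_mono) auto
    then show "\<delta> x z \<le> \<delta> x y + \<delta> y z" by (simp add: \<delta>_def add_divide_distrib)
  next
    fix x y x' y' :: "complex ^ 'n" assume "proj_eq x x' \<and> proj_eq y y'"
    then show "\<delta> x y = \<delta> x' y'" unfolding \<delta>_def using chordal_proj_eq[of x x' y y'] by simp
  qed
  moreover have "\<delta> (F z) (F w) \<le> ereal (poincare_dist z w)" if "orb_morphism L m q F" "z \<in> ball 0 1" "w \<in> ball 0 1" for F z w
    using le[OF that] A by (simp add: \<delta>_def pos_divide_le_eq mult.commute)
  ultimately have "\<delta> x y \<le> orb_kobayashi L m q x y"
    unfolding orb_kobayashi_def by (intro Sup_upper) blast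
  then show ?thesis by (simp add: \<delta>_def)
qed

lemma orb_morphism_orb_curve: "orb_morphism L m q F \<Longrightarrow> orb_curve L m q 1 F"
  by (simp add: orb_morphism_def orb_curve_def zero_mult_def)

text \<open>\<open>chordal\<close> separates points of projective space and controls convergence;
  for the imbedding, the triangle inequality through \<open>P k\<close> and \<open>Q k\<close>
  bounds the distance of the two limits.\<close>

lemma hyperbolic_of_chordal_le:
  fixes L :: "nat \<Rightarrow> complex ^ 'n"
  assumes A: "A > 0" and le: "\<And>x y. ereal (chordal x y / A) \<le> orb_kobayashi L m q x y"
  shows "orb_hyperbolic L m q" "orb_hyperbolically_imbedded L m q"
proof -
  show "orb_hyperbolic L m q"
    unfolding orb_hyperbolic_def
  proof (intro ballI impI)
    fix x y assume x: "x \<in> orb_space L m q" and y: "y \<in> orb_space L m q" and "orb_kobayashi L m q x y = 0"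
    then have "chordal x y / A \<le> 0" using le[of x y] by simp
    then have "chordal x y \<le> 0" using A by (simp add: divide_le_0_iff)
    moreover have nz: "x \<noteq> 0" "y \<noteq> 0" using x y by (auto simp: orb_space_def)
    ultimately show "proj_eq x y" using chordal_nonneg[OF nz] by (intro chordal_zero_imp_proj_eq) auto
  qed
  show "orb_hyperbolically_imbedded L m q"
    unfolding orb_hyperbolically_imbedded_def
  proof (intro allI impI, elim conjE)
    fix P Q :: "nat \<Rightarrow> complex ^ 'n" and p r :: "complex ^ 'n"
    assume PQ: "\<forall>k. P k \<in> orb_space L m q \<and> Q k \<in> orb_space L m q" and p: "p \<noteq> 0" and r: "r \<noteq> 0"
      and lP: "(\<lambda>k. chordal (P k) p) \<longlonglongrightarrow> 0" and lQ: "(\<lambda>k. chordal (Q k) r) \<longlonglongrightarrow> 0"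
      and lk: "(\<lambda>k. orb_kobayashi L m q (P k) (Q k)) \<longlonglongrightarrow> 0"
    have nz: "P k \<noteq> 0" "Q k \<noteq> 0" for k using PQ by (auto simp: orb_space_def)
    have "(\<lambda>k. ereal (chordal (P k) (Q k) / A)) \<longlonglongrightarrow> 0"
    proof (rule tendsto_sandwich[OF _ _ tendsto_const lk])
      show "eventually (\<lambda>k. 0 \<le> ereal (chordal (P k) (Q k) / A)) sequentially"
        using chordal_nonneg[OF nz] A by simp
      show "eventually (\<lambda>k. ereal (chordal (P k) (Q k) / A) \<le> orb_kobayashi L m q (P k) (Q k)) sequentially"
        using le by simp
    qed
    then have "(\<lambda>k. chordal (P k) (Q k) / A) \<longlonglongrightarrow> 0" by (simp add: zero_ereal_def)
    then have "(\<lambda>k. A * (chordal (P k) (Q k) / A)) \<longlonglongrightarrow> A * 0" by (intro tendsto_intros)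
    then have "(\<lambda>k. chordal (P k) (Q k)) \<longlonglongrightarrow> 0" using A by simp
    then have "(\<lambda>k. chordal (P k) p + chordal (P k) (Q k) + chordal (Q k) r) \<longlonglongrightarrow> 0 + 0 + 0"
      by (intro tendsto_add lP lQ)
    moreover have "chordal p r \<le> chordal (P k) p + chordal (P k) (Q k) + chordal (Q k) r" for k
      using chordal_triangle[OF p nz(1)[of k] r] chordal_triangle[OF nz(1)[of k] nz(2)[of k] r] chordal_commute[of p "P k"]
      by linarith
    ultimately have "chordal p r \<le> 0 + 0 + 0" by (intro LIMSEQ_le_const) auto
    then show "proj_eq p r" using chordal_nonneg[OF p r] p r by (intro chordal_zero_imp_proj_eq) auto
  qed
qed

theorem theorem5p1:
  fixes L :: "nat \<Rightarrow> complex ^ 'n" and m :: "nat \<Rightarrow> enat" and q :: nat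
  defines "n \<equiv> CARD('n) - 1"
  assumes "CARD('n) \<ge> 2"
    and "general_position L q"
    and "q > 2 * n"
    and "\<forall>i<q. m i \<ge> 1"
    and "(\<Sum>i<q. orb_coeff (m i)) > real q - real q / real n + 1 + 1 / real n"
  shows "orb_hyperbolic L m q \<and> orb_hyperbolically_imbedded L m q"
proof -
  have n: "real n = real CARD('n) - 1" "real n > 0" using assms(2) by (auto simp: n_def of_nat_diff)
  \<comment> \<open>The degree hypothesis is rewritten for the sum of the 1/m_i: since
    \<open>CARD('n)\<close> is n + 1, the bound q/n - 1 - 1/n equals
    \<open>(q - CARD('n)) / (CARD('n) - 1)\<close>.\<close>
  have "orb_coeff (m i) = 1 - inv_mult (m i)" for i by (cases "m i") (auto simp: orb_coeff_def inv_mult_def)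
  then have "(\<Sum>i<q. orb_coeff (m i)) = real q - (\<Sum>i<q. inv_mult (m i))" by (simp add: sum_subtractf)
  then have "(\<Sum>i<q. inv_mult (m i)) < real q / real n - 1 - 1 / real n" using assms(6) by linarith
  also have "\<dots> = (real q - real n - 1) / real n" using n(2) by (simp add: diff_divide_distrib)
  also have "\<dots> = (real q - real CARD('n)) / (real CARD('n) - 1)" using n(1) by simp
  finally have sig: "(\<Sum>i<q. inv_mult (m i)) < (real q - real CARD('n)) / (real CARD('n) - 1)" .
  have "\<exists>C. \<forall>F. orb_curve L m q 1 F \<longrightarrow> sph F 0 \<le> C"
  proof (rule ccontr)
    assume "\<not> ?thesis"
    then have "\<And>C. \<exists>F. orb_curve L m q 1 F \<and> sph F 0 > C" by (meson not_le)
    from brody_sequence[OF this] obtain g where g: "\<And>k. orb_curve L m q (real k) (g k)"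
      "\<And>k z. z \<in> ball 0 (real k) \<Longrightarrow> sph (g k) z \<le> 2" "\<And>k. sph (g k) 0 = 1" by blast
    show False by (rule no_brody_sequence[OF assms(3) _ _ sig g]) (use assms(4,5) in \<open>auto simp: n_def\<close>)
  qed
  then obtain C0 where C0: "\<And>F. orb_curve L m q 1 F \<Longrightarrow> sph F 0 \<le> C0" by blast
  define C where "C = max C0 0"
  have C: "C \<ge> 0" "\<And>F. orb_curve L m q 1 F \<Longrightarrow> sph F 0 \<le> C" using C0 by (auto simp: C_def intro: max.coboundedI1)
  have A: "8 * C + 8 > 0" using C by simp
  have "ereal (chordal x y / (8 * C + 8)) \<le> orb_kobayashi L m q x y" for x y
    by (rule orb_kobayashi_ge[OF A chordal_le_poincare[OF C(2,1) orb_morphism_orb_curve]])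
  from hyperbolic_of_chordal_le[OF A this] show ?thesis by blast
qed

end
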